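(* Let $\Lambda$ be a character of $L^\times$ with $\Lambda|_{F^\times}\equiv 1$, and let $B(\Lambda,\theta)^{\mathrm I}$ be the space of smooth functions $B:H(F)\to\mathbb C$ that are right $\mathrm I$-invariant, satisfy $B(tuh)=\Lambda(t)\theta(u)B(h)$ for all $t\in T(F)$, $u\in U(F)$, $h\in H(F)$, and satisfy, for all $h\in H(F)$, the three Hecke conditions (H1)–(H3) given in the context. Then $$\dim\big(B(\Lambda,\theta)^{\mathrm I}\big)=\begin{cases}0,&\text{if }\Lambda=\Omega\circ N_{L/F}\text{ and }\left(\frac L{\mathfrak p}\right)\in\{-1,0\};\\1,&\text{otherwise.}\end{cases}$$
   Context: Let $F$ be a non-archimedean local field of characteristic zero with ring of integers $\mathfrak o$, maximal ideal $\mathfrak p$, uniformizer $\varpi$. Fix $a,b\in\mathfrak o$, $c\in\mathfrak o^\times$ with $d=b^2-4ac\neq0$. Put $L=F(\sqrt d)$ if $d\notin F^{\times2}$ and $L=F\oplus F$ (with $F$ diagonally embedded) if $d\in F^{\times2}$. Assume: if $d\notin F^{\times2}$ then $d$ generates the discriminant of $L/F$; if $d\in F^{\times2}$ then $d\in\mathfrak o^\times$. Set $\left(\frac L{\mathfrak p}\right)=-1$ if $d\notin F^{\times2}$, $d\notin\mathfrak p$; $=0$ if $d\notin F^{\times2}$, $d\in\mathfrak p$; $=1$ if $d\in F^{\times2}$. $N_{L/F}(x)=x\bar x$. $H(F)=\mathrm{GSp}_4(F)=\{g\in\mathrm{GL}_4(F):{}^tgJg=\mu_2(g)J\}$, $J=\begin{bmatrix}&1_2\\-1_2&\end{bmatrix}$;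 $\mathrm I$ is the Iwahori subgroup of $g\in\mathrm{GSp}_4(\mathfrak o)$ with $g\equiv\begin{bmatrix}*&0&*&*\\ *&*&*&*\\0&0&*&*\\0&0&0&*\end{bmatrix}\pmod{\mathfrak p}$. Let $\psi$ be an additive character of $F$ with conductor $\mathfrak o$, $S=\begin{bmatrix}a&b/2\\ b/2&c\end{bmatrix}$, $U(F)=\{\begin{bmatrix}1_2&X\\&1_2\end{bmatrix}:{}^tX=X\}$, $\theta(\begin{bmatrix}1_2&X\\&1_2\end{bmatrix})=\psi(\mathrm{tr}(SX))$. Let $T(F)=\{g\in\mathrm{GL}_2(F):{}^tgSg=\det(g)S\}=\left\{\begin{bmatrix}x+\frac b2y&cy\\-ay&x-\frac b2y\end{bmatrix}\right\}$, identified with $L^\times$ by sending this matrix to $x+y\frac{\sqrt d}2$ (resp. $(x+y\frac{\sqrt d}2,x-y\frac{\sqrt d}2)$ if $L=F\oplus F$), and embedded in $H(F)$ by $g\mapsto\begin{bmatrix}g&\\&\det(g)\,{}^tg^{-1}\end{bmatrix}$. Let $\Omega$ be an unramified character of $F^\times$ with $\Omega^2=1$, $\omega=-\Omega(\varpi)$, and $$s_1=\begin{bmatrix}&1&&\\1&&&\\&&&1\\&&1&\end{bmatrix},\quad s_2=\begin{bmatrix}&&1&\\&1&&\\-1&&&\\&&&1\end{bmatrix},\quad \eta_0=\begin{bmatrix}&&&1\\&&1&\\&\varpi&&\\ \varpi&&&\end{bmatrix}.$$ The Hecke conditions are, for all $h\in H(F)$: (H1) $\displaystyle\sum_{w\in\mathfrak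 o/\mathfrak p}B\Big(h\begin{bmatrix}1&w&&\\&1&&\\&&1&\\&&-w&1\end{bmatrix}\Big)+B(hs_1)=0$; (H2) $B(h\eta_0)=\omega B(h)$; (H3) $\displaystyle\sum_{y\in\mathfrak o/\mathfrak p}B\Big(h\begin{bmatrix}1&&&\\&1&&\\ y&&1&\\&&&1\end{bmatrix}\Big)+B(hs_2)=0$. *)

theory Defs
  imports "HOL-Analysis.Analysis" "HOL-Library.Function_Algebras"
    "HOL-Computational_Algebra.Polynomial"
begin

section \<open>Non-archimedean local fields of characteristic zero\<close>

text \<open>
  The field is a type of class \<open>field_char_0\<close>, and its structure is given by the normalised
  valuation \<open>v\<close>. The value \<open>v 0\<close> is unspecified (it stands for infinity), so every use of \<open>v\<close>
  is guarded against \<open>0\<close>. The sets \<open>prime_power v n\<close>, for \<open>n\<close> an arbitrary integer, are the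
  fractional ideals \<open>\<pp>\<^sup>n\<close>; they form a basis of neighbourhoods of \<open>0\<close>, and
  all topological notions below are expressed through them.
\<close>

definition prime_power :: "('f::field_char_0 \<Rightarrow> int) \<Rightarrow> int \<Rightarrow> 'f set" where
  "prime_power v n = {x. x = 0 \<or> n \<le> v x}"

abbreviation integers :: "('f::field_char_0 \<Rightarrow> int) \<Rightarrow> 'f set" where
  "integers v \<equiv> prime_power v 0"

abbreviation max_ideal :: "('f::field_char_0 \<Rightarrow> int) \<Rightarrow> 'f set" where
  "max_ideal v \<equiv> prime_power v 1"

definition int_units :: "('f::field_char_0 \<Rightarrow> int) \<Rightarrow> 'f set" where
  "int_units v = {x \<in> integers v. \<exists>y\<in>integers v. x * y = 1}"

definition residue_classes :: "('f::field_char_0 \<Rightarrow> int) \<Rightarrow> 'f set set" where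
  "residue_classes v =
     integers v // {(x, y). x \<in> integers v \<and> y \<in> integers v \<and> x - y \<in> max_ideal v}"

text \<open>Complete with respect to a discrete valuation (with value group all of the integers)
  and with finite residue field.\<close>

locale nonarch_local_field =
  fixes v :: "'f::field_char_0 \<Rightarrow> int"
  assumes val_mult: "\<And>x y. x \<noteq> 0 \<Longrightarrow> y \<noteq> 0 \<Longrightarrow> v (x * y) = v x + v y"
    and val_add: "\<And>x y. x \<noteq> 0 \<Longrightarrow> y \<noteq> 0 \<Longrightarrow> x + y \<noteq> 0 \<Longrightarrow> min (v x) (v y) \<le> v (x + y)"
    and val_normalised: "\<exists>x. x \<noteq> 0 \<and> v x = 1"
    and finite_residue_field: "finite (residue_classes v)"
    and complete: "\<And>s :: nat \<Rightarrow> 'f.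
      (\<And>n. \<exists>N. \<forall>i\<ge>N. \<forall>j\<ge>N. s i - s j \<in> prime_power v n) \<Longrightarrow>
      \<exists>l. \<forall>n. \<exists>N. \<forall>i\<ge>N. s i - l \<in> prime_power v n"

definition uniformizer :: "('f::field_char_0 \<Rightarrow> int) \<Rightarrow> 'f \<Rightarrow> bool" where
  "uniformizer v \<pi> \<longleftrightarrow> \<pi> \<noteq> 0 \<and> v \<pi> = 1"

text \<open>A sum over \<open>\<oo>/\<pp>\<close> of a function of representatives. It is only applied to functions that
  are constant on residue classes, so that the choice does not matter.\<close>

definition residue_sum :: "('f::field_char_0 \<Rightarrow> int) \<Rightarrow> ('f \<Rightarrow> complex) \<Rightarrow> complex" where
  "residue_sum v f = (\<Sum>C\<in>residue_classes v. f (SOME w. w \<in> C))"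

text \<open>Characters are continuous homomorphisms to the multiplicative group of the complex numbers,
  not necessarily unitary.\<close>

definition add_char :: "('f::field_char_0 \<Rightarrow> int) \<Rightarrow> ('f \<Rightarrow> complex) \<Rightarrow> bool" where
  "add_char v \<psi> \<longleftrightarrow>
     (\<forall>x. \<psi> x \<noteq> 0) \<and> (\<forall>x y. \<psi> (x + y) = \<psi> x * \<psi> y) \<and>
     (\<forall>x. \<forall>e>0. \<exists>n. \<forall>y. y - x \<in> prime_power v n \<longrightarrow> norm (\<psi> y - \<psi> x) < e)"

text \<open>The largest fractional ideal on which \<open>\<psi>\<close> is trivial is the ring of integers.\<close>

definition conductor_integers :: "('f::field_char_0 \<Rightarrow> int) \<Rightarrow> ('f \<Rightarrow> complex) \<Rightarrow> bool" where
  "conductor_integers v \<psi> \<longleftrightarrow>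
     (\<forall>n. (\<forall>x\<in>prime_power v n. \<psi> x = 1) \<longleftrightarrow> 0 \<le> n)"

definition mult_char :: "('f::field_char_0 \<Rightarrow> int) \<Rightarrow> ('f \<Rightarrow> complex) \<Rightarrow> bool" where
  "mult_char v \<Omega> \<longleftrightarrow>
     (\<forall>x. x \<noteq> 0 \<longrightarrow> \<Omega> x \<noteq> 0) \<and>
     (\<forall>x y. x \<noteq> 0 \<longrightarrow> y \<noteq> 0 \<longrightarrow> \<Omega> (x * y) = \<Omega> x * \<Omega> y) \<and>
     (\<forall>x. x \<noteq> 0 \<longrightarrow> (\<forall>e>0. \<exists>n. \<forall>y. y \<noteq> 0 \<longrightarrow> y - x \<in> prime_power v n \<longrightarrow> norm (\<Omega> y - \<Omega> x) < e))"

definition unramified :: "('f::field_char_0 \<Rightarrow> int) \<Rightarrow> ('f \<Rightarrow> complex) \<Rightarrow> bool" where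
  "unramified v \<Omega> \<longleftrightarrow> (\<forall>x\<in>int_units v. \<Omega> x = 1)"

section \<open>The quadratic algebra L\<close>

text \<open>
  Elements of \<open>L\<close> are pairs over \<open>F\<close> with componentwise addition. If \<open>d\<close> is not a square, the pair
  \<open>(x, y)\<close> stands for \<open>x + y\<surd>d\<close> in \<open>F(\<surd>d)\<close>; if \<open>d\<close> is a square, it
  is the element \<open>(x, y)\<close> of the direct sum of two copies of \<open>F\<close>. In both cases the topology of \<open>L\<close>
  is the product topology.
\<close>

definition is_sq :: "'f::field_char_0 \<Rightarrow> bool" where
  "is_sq d \<longleftrightarrow> (\<exists>r. r\<^sup>2 = d)"

definition sq_root :: "'f::field_char_0 \<Rightarrow> 'f" where
  "sq_root d = (SOME r. r\<^sup>2 = d)"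

definition L_mult :: "'f::field_char_0 \<Rightarrow> 'f \<times> 'f \<Rightarrow> 'f \<times> 'f \<Rightarrow> 'f \<times> 'f" where
  "L_mult d z w =
     (if is_sq d then (fst z * fst w, snd z * snd w)
      else (fst z * fst w + d * (snd z * snd w), fst z * snd w + snd z * fst w))"

definition L_of :: "'f::field_char_0 \<Rightarrow> 'f \<Rightarrow> 'f \<times> 'f" where
  "L_of d x = (if is_sq d then (x, x) else (x, 0))"

definition L_conj :: "'f::field_char_0 \<Rightarrow> 'f \<times> 'f \<Rightarrow> 'f \<times> 'f" where
  "L_conj d z = (if is_sq d then (snd z, fst z) else (fst z, - snd z))"

definition L_units :: "'f::field_char_0 \<Rightarrow> ('f \<times> 'f) set" where
  "L_units d = {z. \<exists>w. L_mult d z w = L_of d 1}"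

text \<open>The norm \<open>z z'\<close> and the trace \<open>z + z'\<close>, where \<open>z'\<close> is the conjugate of \<open>z\<close>, lie in
  the image of \<open>L_of d\<close>, of which \<open>fst\<close> is a left inverse.\<close>

definition L_norm :: "'f::field_char_0 \<Rightarrow> 'f \<times> 'f \<Rightarrow> 'f" where
  "L_norm d z = fst (L_mult d z (L_conj d z))"

definition L_trace :: "'f::field_char_0 \<Rightarrow> 'f \<times> 'f \<Rightarrow> 'f" where
  "L_trace d z = fst (z + L_conj d z)"

lemma L_norm: "L_of d (L_norm d z) = L_mult d z (L_conj d z)"
  by (simp add: L_of_def L_norm_def L_mult_def L_conj_def)

lemma L_trace: "L_of d (L_trace d z) = z + L_conj d z"
  by (auto simp: L_of_def L_trace_def L_conj_def prod_eq_iff)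

text \<open>The integral closure of \<open>\<oo>\<close> in \<open>L\<close>.\<close>

definition L_integers :: "('f::field_char_0 \<Rightarrow> int) \<Rightarrow> 'f \<Rightarrow> ('f \<times> 'f) set" where
  "L_integers v d =
     {z. \<exists>p :: 'f poly. lead_coeff p = 1 \<and> (\<forall>i. coeff p i \<in> integers v) \<and>
        (\<Sum>i\<le>degree p. L_mult d (L_of d (coeff p i)) ((L_mult d z ^^ i) (L_of d 1))) = 0}"

text \<open>The discriminant of \<open>L/F\<close> is the ideal of \<open>\<oo>\<close> generated by the \<open>det (Tr (z\<^sub>i z\<^sub>j))\<close> for
  pairs of integral elements (pairs that are not bases of \<open>L\<close> contribute \<open>0\<close>).\<close>

definition L_disc :: "'f::field_char_0 \<Rightarrow> 'f \<times> 'f \<Rightarrow> 'f \<times> 'f \<Rightarrow> 'f" where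
  "L_disc d z w =
     L_trace d (L_mult d z z) * L_trace d (L_mult d w w) - (L_trace d (L_mult d z w))\<^sup>2"

definition discriminant :: "('f::field_char_0 \<Rightarrow> int) \<Rightarrow> 'f \<Rightarrow> 'f set" where
  "discriminant v d =
     {\<Sum>k<n. r k * L_disc d (z k) (w k) | (n :: nat) r z w.
        \<forall>k<n. r k \<in> integers v \<and> z k \<in> L_integers v d \<and> w k \<in> L_integers v d}"

text \<open>The symbol \<open>(L/\<pp>)\<close>.\<close>

definition L_symbol :: "('f::field_char_0 \<Rightarrow> int) \<Rightarrow> 'f \<Rightarrow> int" where
  "L_symbol v d = (if is_sq d then 1 else if d \<in> max_ideal v then 0 else - 1)"

definition L_char :: "('f::field_char_0 \<Rightarrow> int) \<Rightarrow> 'f \<Rightarrow> ('f \<times> 'f \<Rightarrow> complex) \<Rightarrow> bool" where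
  "L_char v d \<Lambda> \<longleftrightarrow>
     (\<forall>z\<in>L_units d. \<Lambda> z \<noteq> 0) \<and>
     (\<forall>z\<in>L_units d. \<forall>w\<in>L_units d. \<Lambda> (L_mult d z w) = \<Lambda> z * \<Lambda> w) \<and>
     (\<forall>z\<in>L_units d. \<forall>e>0. \<exists>n. \<forall>w\<in>L_units d.
        fst w - fst z \<in> prime_power v n \<and> snd w - snd z \<in> prime_power v n \<longrightarrow>
        norm (\<Lambda> w - \<Lambda> z) < e)"

section \<open>The group GSp(4) and its subgroups\<close>

definition block_matrix :: "'f::field_char_0^2^2 \<Rightarrow> 'f^2^2 \<Rightarrow> 'f^2^2 \<Rightarrow> 'f^2^2 \<Rightarrow> 'f^4^4" where
  "block_matrix A B C D = vector [
     vector [A$1$1, A$1$2, B$1$1, B$1$2],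
     vector [A$2$1, A$2$2, B$2$1, B$2$2],
     vector [C$1$1, C$1$2, D$1$1, D$1$2],
     vector [C$2$1, C$2$2, D$2$1, D$2$2]]"

definition J4 :: "'f::field_char_0^4^4" where
  "J4 = block_matrix 0 (mat 1) (- mat 1) 0"

definition GSp4 :: "('f::field_char_0^4^4) set" where
  "GSp4 = {g. invertible g \<and> (\<exists>\<mu>. \<mu> \<noteq> 0 \<and> transpose g ** J4 ** g = mat \<mu> ** J4)}"

definition GSp4_integers :: "('f::field_char_0 \<Rightarrow> int) \<Rightarrow> ('f^4^4) set" where
  "GSp4_integers v = {g \<in> GSp4. (\<forall>i j. g$i$j \<in> integers v) \<and> det g \<in> int_units v}"

definition iwahori :: "('f::field_char_0 \<Rightarrow> int) \<Rightarrow> ('f^4^4) set" where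
  "iwahori v = {g \<in> GSp4_integers v.
     g$1$2 \<in> max_ideal v \<and>
     g$3$1 \<in> max_ideal v \<and> g$3$2 \<in> max_ideal v \<and>
     g$4$1 \<in> max_ideal v \<and> g$4$2 \<in> max_ideal v \<and> g$4$3 \<in> max_ideal v}"

definition S_mat :: "'f::field_char_0 \<Rightarrow> 'f \<Rightarrow> 'f \<Rightarrow> 'f^2^2" where
  "S_mat a b c = vector [vector [a, b / 2], vector [b / 2, c]]"

definition U_elt :: "'f::field_char_0^2^2 \<Rightarrow> 'f^4^4" where
  "U_elt X = block_matrix (mat 1) X 0 (mat 1)"

definition T_group :: "'f::field_char_0 \<Rightarrow> 'f \<Rightarrow> 'f \<Rightarrow> ('f^2^2) set" where
  "T_group a b c =
     {g. invertible g \<and> transpose g ** S_mat a b c ** g = mat (det g) ** S_mat a b c}"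

definition T_embed :: "'f::field_char_0^2^2 \<Rightarrow> 'f^4^4" where
  "T_embed g = block_matrix g 0 0 (mat (det g) ** transpose (matrix_inv g))"

definition T_elt :: "'f::field_char_0 \<Rightarrow> 'f \<Rightarrow> 'f \<Rightarrow> 'f \<Rightarrow> 'f \<Rightarrow> 'f^2^2" where
  "T_elt a b c x y = vector [vector [x + b / 2 * y, c * y], vector [- a * y, x - b / 2 * y]]"

text \<open>The identification of \<open>T(F)\<close> with the units of \<open>L\<close>, where \<open>d = b\<^sup>2 - 4ac\<close>. For \<open>c \<noteq> 0\<close> the
  parameters \<open>x\<close> and \<open>y\<close> are recovered from the entries of the matrix \<open>T_elt a b c x y\<close>.\<close>

definition T_to_L :: "'f::field_char_0 \<Rightarrow> 'f \<Rightarrow> 'f \<Rightarrow> 'f^2^2 \<Rightarrow> 'f \<times> 'f" where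
  "T_to_L a b c g =
     (let d = b\<^sup>2 - 4 * a * c; x = (g$1$1 + g$2$2) / 2; y = g$1$2 / c in
        if is_sq d then (x + y * (sq_root d / 2), x - y * (sq_root d / 2)) else (x, y / 2))"

lemma T_to_L_T_elt:
  assumes "c \<noteq> 0"
  shows "T_to_L a b c (T_elt a b c x y) =
    (if is_sq (b\<^sup>2 - 4 * a * c)
     then (x + y * (sq_root (b\<^sup>2 - 4 * a * c) / 2), x - y * (sq_root (b\<^sup>2 - 4 * a * c) / 2))
     else (x, y / 2))"
  using assms by (simp add: T_to_L_def T_elt_def Let_def)

lemma T_group_eq:
  fixes a b c :: "'f::field_char_0"
  assumes "c \<noteq> 0"
  shows "T_group a b c = {T_elt a b c x y | x y. invertible (T_elt a b c x y)}"
proof -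
  have T_iff: "transpose g ** S_mat a b c ** g = mat (det g) ** S_mat a b c \<longleftrightarrow>
      (\<exists>x y. g = T_elt a b c x y)" if "invertible g" for g :: "'f^2^2"
  proof -
    define p q r s where "p = g$1$1" "q = g$1$2" "r = g$2$1" "s = g$2$2"
    note pqrs = this
    have D: "det g = p * s - q * r" by (simp add: det_2 pqrs)
    have D0: "p * s - q * r \<noteq> 0" using that D by (simp add: invertible_det_nz)
    have lhs: "transpose g ** S_mat a b c ** g = mat (det g) ** S_mat a b c \<longleftrightarrow>
       (a * p + b / 2 * r) * p + (p * (b / 2) + r * c) * r = (p * s - q * r) * a \<and>
       (a * p + b / 2 * r) * q + (p * (b / 2) + r * c) * s = (p * s - q * r) * (b / 2) \<and>
       (q * a + s * (b / 2)) * p + (q * (b / 2) + s * c) * r = (p * s - q * r) * (b / 2) \<and>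
       (q * a + s * (b / 2)) * q + (q * (b / 2) + s * c) * s = (p * s - q * r) * c"
      (is "_ \<longleftrightarrow> ?E11 \<and> ?E12 \<and> ?E21 \<and> ?E22")
      unfolding D
      by (simp add: vec_eq_iff forall_2 matrix_matrix_mult_def sum_2 transpose_def mat_def
          S_mat_def pqrs mult.commute conj_assoc)
    have rhs: "(\<exists>x y. g = T_elt a b c x y) \<longleftrightarrow> c * r = - a * q \<and> c * (p - s) = b * q"
    proof
      assume "\<exists>x y. g = T_elt a b c x y"
      then show "c * r = - a * q \<and> c * (p - s) = b * q"
        by (auto simp: pqrs T_elt_def algebra_simps)
    next
      assume h: "c * r = - a * q \<and> c * (p - s) = b * q"
      have r: "r = - a * (q / c)" and ps: "p - s = b * (q / c)"
        using h assms by (simp_all add: field_simps)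
      have "g = T_elt a b c ((p + s) / 2) (q / c)"
      proof -
        have "p = s + b * (q / c)" using ps by (simp add: algebra_simps)
        then have "(p + s) / 2 + b / 2 * (q / c) = p" "(p + s) / 2 - b / 2 * (q / c) = s"
          by (simp_all add: field_simps)
        then show ?thesis using r assms
          by (simp add: vec_eq_iff forall_2 T_elt_def flip: pqrs)
      qed
      then show "\<exists>x y. g = T_elt a b c x y" by blast
    qed
    have "c * r = - a * q \<and> c * (p - s) = b * q"
      if E: "?E11" "?E12" "?E21" "?E22"
    proof -
      define k where "k = b / 2"
      have b: "b = 2 * k" by (simp add: k_def)
      have "(p * s - q * r) * (c * r + a * q) =
          p * ((a * p + k * r) * q + (p * k + r * c) * s - (p * s - q * r) * k) -
          q * ((a * p + k * r) * p + (p * k + r * c) * r - (p * s - q * r) * a)"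
        by (simp add: algebra_simps)
      then have "(p * s - q * r) * (c * r + a * q) = 0"
        using E(1,2) by (simp add: k_def)
      moreover have "(p * s - q * r) * (c * (p - s) - b * q) =
          q * ((q * a + s * k) * p + (q * k + s * c) * r - (p * s - q * r) * k) -
          p * ((q * a + s * k) * q + (q * k + s * c) * s - (p * s - q * r) * c)"
        unfolding b by (simp add: algebra_simps)
      then have "(p * s - q * r) * (c * (p - s) - b * q) = 0"
        using E(3,4) by (simp add: k_def)
      ultimately have "c * r + a * q = 0" "c * (p - s) - b * q = 0" using D0 by simp_all
      then show ?thesis by (simp add: eq_neg_iff_add_eq_0)
    qed
    moreover have "?E11 \<and> ?E12 \<and> ?E21 \<and> ?E22"
      if h: "c * r = - a * q" "c * (p - s) = b * q"
    proof -
      define y k where "y = q / c" and "k = b / 2"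
      have eqs: "q = c * y" "r = - a * y" "p = s + 2 * k * y" "b / 2 = k"
        using h assms by (simp_all add: y_def k_def field_simps)
      show ?thesis unfolding eqs by (intro conjI; simp add: algebra_simps)
    qed
    ultimately show ?thesis unfolding lhs rhs by blast
  qed
  have "g \<in> T_group a b c \<longleftrightarrow> (\<exists>x y. g = T_elt a b c x y \<and> invertible (T_elt a b c x y))" for g
    using T_iff[of g] by (auto simp: T_group_def simp del: ex_simps)
  then show ?thesis by blast
qed

section \<open>The space of functions\<close>

definition s1_mat :: "'f::field_char_0^4^4" where
  "s1_mat = vector [vector [0, 1, 0, 0], vector [1, 0, 0, 0],
                    vector [0, 0, 0, 1], vector [0, 0, 1, 0]]"

definition s2_mat :: "'f::field_char_0^4^4" where
  "s2_mat = vector [vector [0, 0, 1, 0], vector [0, 1, 0, 0],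
                    vector [-1, 0, 0, 0], vector [0, 0, 0, 1]]"

definition eta0_mat :: "'f::field_char_0 \<Rightarrow> 'f^4^4" where
  "eta0_mat \<pi> = vector [vector [0, 0, 0, 1], vector [0, 0, 1, 0],
                        vector [0, \<pi>, 0, 0], vector [\<pi>, 0, 0, 0]]"

definition H1_mat :: "'f::field_char_0 \<Rightarrow> 'f^4^4" where
  "H1_mat w = vector [vector [1, w, 0, 0], vector [0, 1, 0, 0],
                      vector [0, 0, 1, 0], vector [0, 0, - w, 1]]"

definition H3_mat :: "'f::field_char_0 \<Rightarrow> 'f^4^4" where
  "H3_mat y = vector [vector [1, 0, 0, 0], vector [0, 1, 0, 0],
                      vector [y, 0, 1, 0], vector [0, 0, 0, 1]]"

text \<open>Smooth means locally constant.\<close>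

definition smooth_on_GSp4 ::
    "('f::field_char_0 \<Rightarrow> int) \<Rightarrow> ('f^4^4 \<Rightarrow> complex) \<Rightarrow> bool" where
  "smooth_on_GSp4 v B \<longleftrightarrow>
     (\<forall>h\<in>GSp4. \<exists>n. \<forall>g\<in>GSp4. (\<forall>i j. g$i$j - h$i$j \<in> prime_power v n) \<longrightarrow> B g = B h)"

text \<open>A function on \<open>GSp4\<close> is represented by its extension by \<open>0\<close> to all matrices.\<close>

definition bessel_space ::
    "('f::field_char_0 \<Rightarrow> int) \<Rightarrow> 'f \<Rightarrow> 'f \<Rightarrow> 'f \<Rightarrow> 'f \<Rightarrow> ('f \<Rightarrow> complex) \<Rightarrow> ('f \<Rightarrow> complex)
      \<Rightarrow> ('f \<times> 'f \<Rightarrow> complex) \<Rightarrow> ('f^4^4 \<Rightarrow> complex) set" where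
  "bessel_space v \<pi> a b c \<psi> \<Omega> \<Lambda> = {B.
     (\<forall>g. g \<notin> GSp4 \<longrightarrow> B g = 0) \<and>
     smooth_on_GSp4 v B \<and>
     (\<forall>h\<in>GSp4. \<forall>k\<in>iwahori v. B (h ** k) = B h) \<and>
     (\<forall>t\<in>T_group a b c. \<forall>X. transpose X = X \<longrightarrow> (\<forall>h\<in>GSp4.
        B (T_embed t ** U_elt X ** h) =
          \<Lambda> (T_to_L a b c t) * \<psi> (trace (S_mat a b c ** X)) * B h)) \<and>
     (\<forall>h\<in>GSp4. residue_sum v (\<lambda>w. B (h ** H1_mat w)) + B (h ** s1_mat) = 0) \<and>
     (\<forall>h\<in>GSp4. B (h ** eta0_mat \<pi>) = - \<Omega> \<pi> * B h) \<and>
     (\<forall>h\<in>GSp4. residue_sum v (\<lambda>y. B (h ** H3_mat y)) + B (h ** s2_mat) = 0)}"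

definition fun_scale :: "complex \<Rightarrow> ('x \<Rightarrow> complex) \<Rightarrow> 'x \<Rightarrow> complex" where
  "fun_scale r B = (\<lambda>g. r * B g)"

lemma vector_space_fun_scale:
  "vector_space (fun_scale :: complex \<Rightarrow> ('x \<Rightarrow> complex) \<Rightarrow> 'x \<Rightarrow> complex)"
  by unfold_locales (auto simp: fun_scale_def fun_eq_iff algebra_simps)

text \<open>The library's \<open>dim\<close> is \<open>0\<close> on infinite-dimensional spaces, so finite-dimensionality is
  required separately.\<close>

definition has_dimension :: "('x \<Rightarrow> complex) set \<Rightarrow> nat \<Rightarrow> bool" where
  "has_dimension V n \<longleftrightarrow>
     (\<exists>A. finite A \<and> module.span fun_scale A = V) \<and> vector_space.dim fun_scale V = n"

end

theory Submission
  imports Defs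
begin

text \<open>By the decomposition of \<open>GSp\<^sub>4\<close> into the cells \<open>U M w I\<close>, where \<open>M\<close> is the Levi subgroup
  \<open>GL\<^sub>2 \<times> GL\<^sub>1\<close> and \<open>w\<close> runs through four Weyl elements, \<open>B\<close> consists of four functions on \<open>M\<close>. The
  relations (H1), (H3) express all of them by the one on the open cell, which is supported where the
  conductor of \<open>\<theta>\<close> permits it, and (H2) removes its dependence on the similitude factor. What remains is a
  harmonic function on the oriented edges of the tree of \<open>PGL\<^sub>2\<close> on which \<open>L\<^sup>\<times>\<close> acts by
  \<open>\<xi> = \<Lambda> (\<Omega> \<circ> N)\<close>, that is, a \<open>\<xi>\<close>-equivariant finitely additive measure of total mass zero on the
  projective line of \<open>L\<close>.

  Away from the fixed points of \<open>L\<^sup>\<times>\<close> such a measure is a multiple of \<open>\<xi>\<close> times the Haar measure of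
  \<open>L\<^sup>\<times> / F\<^sup>\<times>\<close>. If \<open>L\<close> is a field, there are no fixed points and the total mass is zero if and only if
  \<open>\<xi> \<noteq> 1\<close>. If \<open>L = F \<oplus> F\<close>, there are two fixed points: for \<open>\<xi> \<noteq> 1\<close> the measure extends to them after
  regularisation, and for \<open>\<xi> = 1\<close> the difference of the two point masses takes its place.\<close>

subsection \<open>Non-archimedean local fields\<close>

text \<open>(H1) and (H3) sum \<open>B\<close> over the cosets of \<open>I\<close> in the two
  parahoric subgroups generated by \<open>I\<close> and one of \<open>s\<^sub>1\<close>,
  \<open>s\<^sub>2\<close>; together with (H2) they are the conditions on the Iwahori-fixed vector
  of the Steinberg representation twisted by \<Omega>. Multiplying by \<Omega> of the similitude
  factor removes \<Omega> from (H2); since the similitude factor of t in \<open>T(F)\<close> is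
  N(t), the torus then acts by \<xi> instead of \<Lambda>, and the exceptional characters become
  \<xi> = 1. Between neighbouring cells the relations contain a sum of an additive character over
  the residue field, equal to q or 0: each step away from the last cell costs a factor -q and one
  more integrality condition. On the first and the last cell (H1) is the relation at a vertex of the
  tree; on the middle cells \<open>\<eta>\<^sub>0\<close> reverses an edge. Measures are additive
  functions on balls, a ball being given by a basis of the plane; compactness is an induction along
  the tree, and Haar measure is a ratio of coset counts. In the split case \<xi> times Haar measure
  need not be finite near the fixed points. The remedy is to integrate an indicator minus its
  translate by some s with \<xi>(s) \<noteq> 1.\<close>

locale uniformized_field = nonarch_local_field v for v :: "'f::field_char_0 \<Rightarrow> int" +
  fixes \<pi> :: 'f
  assumes uniformizer: "uniformizer v \<pi>"
begin

abbreviation \<O> where "\<O> \<equiv> prime_power v 0"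
abbreviation \<P> where "\<P> \<equiv> prime_power v 1"

lemma pi_nonzero [simp]: "\<pi> \<noteq> 0" and val_pi [simp]: "v \<pi> = 1"
  using uniformizer by (auto simp: uniformizer_def)

lemma val_1 [simp]: "v 1 = 0"
  using val_mult[of 1 1] by simp

lemma val_minus_1: "v (-1) = 0"
  using val_mult[of "-1" "-1"] by simp

lemma val_minus [simp]: "v (- x) = v x"
  using val_mult[of "-1" x] val_minus_1 by (cases "x = 0") auto

lemma val_inverse: "x \<noteq> 0 \<Longrightarrow> v (inverse x) = - v x"
  using val_mult[of x "inverse x"] by simp

lemma val_divide: "x \<noteq> 0 \<Longrightarrow> y \<noteq> 0 \<Longrightarrow> v (x / y) = v x - v y"
  by (simp add: divide_inverse val_mult val_inverse)

lemma val_power: "x \<noteq> 0 \<Longrightarrow> v (x ^ n) = int n * v x"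
  by (induction n) (auto simp: val_mult algebra_simps)

lemma prime_power_iff: "x \<in> prime_power v n \<longleftrightarrow> x = 0 \<or> n \<le> v x"
  by (simp add: prime_power_def)

lemma pp_0 [simp, intro]: "0 \<in> prime_power v n"
  by (simp add: prime_power_iff)

lemma pp_minus [simp]: "- x \<in> prime_power v n \<longleftrightarrow> x \<in> prime_power v n"
  by (simp add: prime_power_iff)

lemma pp_add: "x \<in> prime_power v n \<Longrightarrow> y \<in> prime_power v n \<Longrightarrow> x + y \<in> prime_power v n"
  using val_add[of x y] by (fastforce simp: prime_power_iff)

lemma pp_diff: "x \<in> prime_power v n \<Longrightarrow> y \<in> prime_power v n \<Longrightarrow> x - y \<in> prime_power v n"
  using pp_add[of x n "- y"] by simp

lemma pp_mult: "x \<in> prime_power v m \<Longrightarrow> y \<in> prime_power v n \<Longrightarrow> x * y \<in> prime_power v (m + n)"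
  by (cases "x = 0 \<or> y = 0") (auto simp: prime_power_iff val_mult)

lemma pp_mono: "x \<in> prime_power v n \<Longrightarrow> m \<le> n \<Longrightarrow> x \<in> prime_power v m"
  by (auto simp: prime_power_iff)

lemma pp_mult_O: "x \<in> prime_power v n \<Longrightarrow> y \<in> \<O> \<Longrightarrow> x * y \<in> prime_power v n"
  "y \<in> \<O> \<Longrightarrow> x \<in> prime_power v n \<Longrightarrow> y * x \<in> prime_power v n"
  using pp_mult[of x n y 0] pp_mult[of y 0 x n] by auto

lemma pp_sum: "(\<And>i. i \<in> A \<Longrightarrow> f i \<in> prime_power v n) \<Longrightarrow> sum f A \<in> prime_power v n"
  by (induction A rule: infinite_finite_induct) (auto intro: pp_add)

lemma O_1 [simp, intro]: "1 \<in> \<O>"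
  by (simp add: prime_power_iff)

lemma O_mult: "x \<in> \<O> \<Longrightarrow> y \<in> \<O> \<Longrightarrow> x * y \<in> \<O>"
  using pp_mult_O by blast

lemma P_in_O: "x \<in> \<P> \<Longrightarrow> x \<in> \<O>"
  by (rule pp_mono) auto

lemma pi_in_P [simp, intro]: "\<pi> \<in> \<P>" and pi_in_O [simp, intro]: "\<pi> \<in> \<O>"
  by (simp_all add: prime_power_iff)

lemma pp_pi_mult_iff: "\<pi> * x \<in> prime_power v n \<longleftrightarrow> x \<in> prime_power v (n - 1)"
  by (cases "x = 0") (auto simp: prime_power_iff val_mult)

lemma P_iff_pi: "x \<in> \<P> \<longleftrightarrow> (\<exists>y\<in>\<O>. x = \<pi> * y)"
proof
  assume "x \<in> \<P>"
  then show "\<exists>y\<in>\<O>. x = \<pi> * y"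
    using pp_pi_mult_iff[of "x / \<pi>" 1] by (intro bexI[of _ "x / \<pi>"]) auto
qed (auto simp: pp_pi_mult_iff)

lemma pp_pi_power_mult_iff: "\<pi> ^ k * x \<in> prime_power v n \<longleftrightarrow> x \<in> prime_power v (n - int k)"
  by (cases "x = 0") (auto simp: prime_power_iff val_mult val_power)

lemma pp_unit_mult_iff:
  assumes "u \<noteq> 0" "v u = 0"
  shows "u * x \<in> prime_power v n \<longleftrightarrow> x \<in> prime_power v n"
  using assms by (cases "x = 0") (auto simp: prime_power_iff val_mult)

lemma int_units_iff: "u \<in> int_units v \<longleftrightarrow> u \<noteq> 0 \<and> v u = 0"
proof
  assume "u \<in> int_units v"
  then obtain y where "u \<in> \<O>" "y \<in> \<O>" "u * y = 1" by (auto simp: int_units_def)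
  then show "u \<noteq> 0 \<and> v u = 0"
    using val_mult[of u y] by (cases "u = 0 \<or> y = 0") (auto simp: prime_power_iff)
next
  assume u: "u \<noteq> 0 \<and> v u = 0"
  then show "u \<in> int_units v"
    unfolding int_units_def using val_inverse[of u]
    by (auto simp: prime_power_iff intro!: bexI[of _ "inverse u"])
qed

abbreviation unit where "unit u \<equiv> u \<in> int_units v"

lemma unit_nonzero: "unit u \<Longrightarrow> u \<noteq> 0" by (simp add: int_units_iff)
lemma unit_in_O: "unit u \<Longrightarrow> u \<in> \<O>" by (simp add: int_units_iff prime_power_iff)
lemma unit_1 [simp, intro]: "unit 1" by (simp add: int_units_iff)
lemma unit_mult: "unit x \<Longrightarrow> unit y \<Longrightarrow> unit (x * y)" by (simp add: int_units_iff val_mult)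
lemma unit_inverse: "unit x \<Longrightarrow> unit (inverse x)" by (simp add: int_units_iff val_inverse)
lemma unit_divide: "unit x \<Longrightarrow> unit y \<Longrightarrow> unit (x / y)" by (simp add: int_units_iff val_divide)
lemma unit_iff: "unit x \<longleftrightarrow> x \<in> \<O> \<and> x \<notin> \<P>"
  by (auto simp: int_units_iff prime_power_iff)

lemma unit_mult_iff: "x \<in> \<O> \<Longrightarrow> y \<in> \<O> \<Longrightarrow> unit (x * y) \<longleftrightarrow> unit x \<and> unit y"
  by (auto simp: int_units_iff prime_power_iff val_mult)

lemma unit_add: "unit x \<Longrightarrow> y \<in> \<P> \<Longrightarrow> unit (x + y)"
  using pp_diff[of "x + y" 1 y] by (auto simp: unit_iff intro: pp_add P_in_O)

lemma unit_diff: "unit x \<Longrightarrow> y \<in> \<P> \<Longrightarrow> unit (x - y)"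
  using unit_add[of x "- y"] by simp

lemma unit_mult_pp_iff: "unit u \<Longrightarrow> u * x \<in> prime_power v n \<longleftrightarrow> x \<in> prime_power v n"
  "unit u \<Longrightarrow> x * u \<in> prime_power v n \<longleftrightarrow> x \<in> prime_power v n"
  "unit u \<Longrightarrow> x / u \<in> prime_power v n \<longleftrightarrow> x \<in> prime_power v n"
  using pp_unit_mult_iff[of u x n] pp_unit_mult_iff[of "inverse u" x n] unit_inverse[of u]
  by (auto simp: int_units_iff mult.commute divide_inverse)

lemma div_in_O_or: "x \<noteq> 0 \<Longrightarrow> y / x \<in> \<O> \<or> y \<noteq> 0 \<and> x / y \<in> \<P>"
  by (cases "y = 0") (auto simp: prime_power_iff val_divide)

lemma exists_pi_power_pp: "\<exists>k. \<pi> ^ k * x \<in> prime_power v n"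
  by (rule exI[of _ "nat (n - v x)"], unfold pp_pi_power_mult_iff) (auto simp: prime_power_def)

lemma eventually_pi_power_pp: "\<exists>k0. \<forall>k\<ge>k0. \<pi> ^ k * x \<in> prime_power v n"
  by (rule exI[of _ "nat (n - v x)"], unfold pp_pi_power_mult_iff) (auto simp: prime_power_def)

text \<open>The representatives that \<open>residue_sum\<close> selects.\<close>

definition reps :: "'f set" where
  "reps = (\<lambda>C. SOME w. w \<in> C) ` residue_classes v"

abbreviation q :: nat where "q \<equiv> card reps"

abbreviation residue_rel :: "('f \<times> 'f) set" where
  "residue_rel \<equiv> {(x, y). x \<in> \<O> \<and> y \<in> \<O> \<and> x - y \<in> \<P>}"

lemma residue_equiv: "equiv \<O> residue_rel"
proof (rule equivI)
  show "sym residue_rel"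
    using pp_minus[of _ 1] by (auto simp: sym_def) (metis minus_diff_eq pp_minus)
  show "trans residue_rel"
    by (auto simp: trans_def) (metis diff_add_cancel diff_add_eq pp_add add_diff_eq)
qed (auto simp: refl_on_def)

lemma finite_reps: "finite reps"
  using finite_residue_field by (simp add: reps_def)

lemma some_in_residue_class:
  assumes "C \<in> residue_classes v"
  shows "(SOME w. w \<in> C) \<in> C" "C = residue_rel `` {SOME w. w \<in> C}"
proof -
  have C: "C \<in> \<O> // residue_rel" using assms by (simp add: residue_classes_def)
  have "C \<noteq> {}" by (rule in_quotient_imp_non_empty[OF residue_equiv C])
  then show *: "(SOME w. w \<in> C) \<in> C" unfolding some_in_eq .
  from C obtain x where x: "x \<in> \<O>" "C = residue_rel `` {x}" by (rule quotientE)
  with * have "(x, SOME w. w \<in> C) \<in> residue_rel" by blast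
  from equiv_class_eq[OF residue_equiv this] x(2)
  show "C = residue_rel `` {SOME w. w \<in> C}" by argo
qed

lemma inj_on_some_residue: "inj_on (\<lambda>C. SOME w. w \<in> C) (residue_classes v)"
proof (rule inj_onI)
  fix C D
  assume "C \<in> residue_classes v" "D \<in> residue_classes v" "(SOME w. w \<in> C) = (SOME w. w \<in> D)"
  then show "C = D"
    using some_in_residue_class(2)[of C] some_in_residue_class(2)[of D] by argo
qed

lemma residue_sum_eq: "residue_sum v f = sum f reps"
  unfolding residue_sum_def reps_def by (simp add: sum.reindex[OF inj_on_some_residue])

lemma reps_in_O: "r \<in> reps \<Longrightarrow> r \<in> \<O>"
proof -
  assume "r \<in> reps"
  then obtain C where C: "C \<in> residue_classes v" "r = (SOME w. w \<in> C)"
    by (auto simp: reps_def)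
  have "C \<subseteq> \<O>"
    using C(1) by (auto simp: residue_classes_def elim!: quotientE)
  then show ?thesis using some_in_residue_class(1)[OF C(1)] C(2) by auto
qed

lemma exists_rep:
  assumes "x \<in> \<O>" shows "\<exists>r\<in>reps. x - r \<in> \<P>"
proof -
  have C: "residue_rel `` {x} \<in> residue_classes v"
    unfolding residue_classes_def using assms by (rule quotientI)
  have "x - (SOME w. w \<in> residue_rel `` {x}) \<in> \<P>"
    using some_in_residue_class(1)[OF C] by blast
  with C show ?thesis unfolding reps_def by blast
qed

lemma reps_eqI:
  assumes "r \<in> reps" "s \<in> reps" "r - s \<in> \<P>" shows "r = s"
proof -
  obtain C D where C: "C \<in> residue_classes v" "r = (SOME w. w \<in> C)"
    and D: "D \<in> residue_classes v" "s = (SOME w. w \<in> D)"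
    using assms unfolding reps_def by blast
  have "(r, s) \<in> residue_rel" using assms reps_in_O by auto
  from equiv_class_eq[OF residue_equiv this] have "C = D"
    using some_in_residue_class(2)[OF C(1)] some_in_residue_class(2)[OF D(1)] C(2) D(2) by argo
  then show ?thesis using C D by simp
qed

text \<open>\<open>\<sigma>\<close> induces an injection of the finite residue field into itself,
  hence a bijection. It need not preserve the chosen representatives, so \<open>\<rho>\<close>
  rounds its values back into \<open>reps\<close>.\<close>

lemma sum_reps_reindex:
  fixes f :: "'f \<Rightarrow> 'a::comm_monoid_add"
  assumes f: "\<And>x y. x \<in> \<O> \<Longrightarrow> y \<in> \<O> \<Longrightarrow> x - y \<in> \<P> \<Longrightarrow> f x = f y"
    and \<sigma>: "\<And>x. x \<in> \<O> \<Longrightarrow> \<sigma> x \<in> \<O>"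
    and inj: "\<And>x y. x \<in> \<O> \<Longrightarrow> y \<in> \<O> \<Longrightarrow> \<sigma> x - \<sigma> y \<in> \<P> \<Longrightarrow> x - y \<in> \<P>"
  shows "(\<Sum>x\<in>reps. f (\<sigma> x)) = sum f reps"
proof -
  obtain \<rho> where \<rho>: "\<And>x. x \<in> \<O> \<Longrightarrow> \<rho> x \<in> reps \<and> x - \<rho> x \<in> \<P>"
    using exists_rep by metis
  have inj': "inj_on (\<lambda>x. \<rho> (\<sigma> x)) reps"
  proof (rule inj_onI)
    fix x y assume xy: "x \<in> reps" "y \<in> reps" "\<rho> (\<sigma> x) = \<rho> (\<sigma> y)"
    have xyO: "x \<in> \<O>" "y \<in> \<O>" using xy reps_in_O by blast+
    then have "(\<sigma> x - \<rho> (\<sigma> x)) - (\<sigma> y - \<rho> (\<sigma> y)) \<in> \<P>"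
      using \<rho> \<sigma> pp_diff by blast
    then have "\<sigma> x - \<sigma> y \<in> \<P>" using xy(3) by simp
    then show "x = y" using inj xyO xy(1,2) reps_eqI by blast
  qed
  have bij: "bij_betw (\<lambda>x. \<rho> (\<sigma> x)) reps reps"
    unfolding bij_betw_def using inj' endo_inj_surj[OF finite_reps _ inj'] \<rho> \<sigma> reps_in_O
    by blast
  have "(\<Sum>x\<in>reps. f (\<sigma> x)) = (\<Sum>x\<in>reps. f (\<rho> (\<sigma> x)))"
    by (intro sum.cong refl f) (use \<rho> \<sigma> reps_in_O in blast)+
  also have "\<dots> = sum f reps"
    by (rule sum.reindex_bij_betw[OF bij])
  finally show ?thesis .
qed

lemma card_reps_ge_2: "q \<ge> 2"
proof -
  obtain r where r: "r \<in> reps" "0 - r \<in> \<P>" using exists_rep[of 0] by auto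
  obtain s where s: "s \<in> reps" "1 - s \<in> \<P>" using exists_rep[of 1] by auto
  have "r \<noteq> s"
  proof
    assume "r = s"
    then have "(1 - s) - (0 - r) = 1" by simp
    then have "1 \<in> \<P>" using pp_diff[OF s(2) r(2)] by simp
    then show False by (simp add: prime_power_iff)
  qed
  then have "card {r, s} = 2" by simp
  then show ?thesis using card_mono[OF finite_reps, of "{r, s}"] r s by auto
qed

section \<open>Completeness and descent through residue classes\<close>

lemma complete_power_series:
  assumes "\<And>k. z (Suc k) - z k \<in> prime_power v (int k + 1)"
  obtains l where "\<And>k. l - z k \<in> prime_power v (int k + 1)"
proof -
  have step: "z (k + j) - z k \<in> prime_power v (int k + 1)" for k j
  proof (induction j)
    case (Suc j)
    have "z (Suc (k + j)) - z (k + j) \<in> prime_power v (int k + 1)"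
      using assms[of "k + j"] by (rule pp_mono) simp
    from pp_add[OF this Suc] show ?case by simp
  qed auto
  have "\<exists>N. \<forall>i\<ge>N. \<forall>j\<ge>N. z i - z j \<in> prime_power v n" for n
  proof (intro exI allI impI)
    fix i j assume ij: "nat n \<le> i" "nat n \<le> j"
    have "z i - z (nat n) \<in> prime_power v n" "z j - z (nat n) \<in> prime_power v n"
      using pp_mono[OF step[of "nat n" "i - nat n"], of n]
        pp_mono[OF step[of "nat n" "j - nat n"], of n] ij by simp_all
    from pp_diff[OF this] show "z i - z j \<in> prime_power v n" by simp
  qed
  then obtain l where l: "\<forall>n. \<exists>N. \<forall>i\<ge>N. z i - l \<in> prime_power v n"
    using complete[of z] by blast
  have "l - z k \<in> prime_power v (int k + 1)" for k
  proof -
    obtain N where N: "\<forall>i\<ge>N. z i - l \<in> prime_power v (int k + 1)" using l by blast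
    have "z (k + N) - l \<in> prime_power v (int k + 1)" using N by simp
    from pp_diff[OF step[of k N] this] show ?thesis by simp
  qed
  then show ?thesis by (rule that)
qed

text \<open>A counterexample at the root would give a branch of counterexamples, which converges.\<close>

lemma descent:
  fixes Q :: "nat \<Rightarrow> 'f \<Rightarrow> bool"
  assumes cong: "\<And>k x y. x - y \<in> prime_power v (int k + 1) \<Longrightarrow> Q k x \<Longrightarrow> Q k y"
    and step: "\<And>k z. z \<in> \<P> \<Longrightarrow> (\<And>r. r \<in> \<O> \<Longrightarrow> Q (Suc k) (z + \<pi> ^ Suc k * r)) \<Longrightarrow> Q k z"
    and lim: "\<And>z. z \<in> \<P> \<Longrightarrow> \<exists>k. Q k z"
  shows "Q 0 0"
proof (rule ccontr)
  assume "\<not> Q 0 0"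
  define R where "R k z \<longleftrightarrow> z \<in> \<P> \<and> \<not> Q k z" for k z
  have "\<exists>f. \<forall>n. R n (f n) \<and> f (Suc n) - f n \<in> prime_power v (int n + 1)"
  proof (rule dependent_nat_choice)
    show "\<exists>x. R 0 x" unfolding R_def using \<open>\<not> Q 0 0\<close> pp_0 by (intro exI[of _ 0] conjI)
  next
    fix x n assume "R n x"
    then have x: "x \<in> \<P>" "\<not> Q n x" by (simp_all add: R_def)
    have "\<not> (\<forall>r\<in>\<O>. Q (Suc n) (x + \<pi> ^ Suc n * r))"
    proof
      assume *: "\<forall>r\<in>\<O>. Q (Suc n) (x + \<pi> ^ Suc n * r)"
      have "Q n x" by (rule step[OF x(1)]) (rule bspec[OF *])
      then show False using x(2) by contradiction
    qed
    then obtain r where r: "r \<in> \<O>" "\<not> Q (Suc n) (x + \<pi> ^ Suc n * r)"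
      unfolding ball_simps(10) by (elim bexE)
    have "\<pi> ^ Suc n * r \<in> prime_power v (int n + 1)"
      unfolding pp_pi_power_mult_iff using r(1) by simp
    moreover from this have "x + \<pi> ^ Suc n * r \<in> \<P>"
      by (intro pp_add x(1)) (rule pp_mono, auto)
    ultimately show "\<exists>y. R (Suc n) y \<and> y - x \<in> prime_power v (int n + 1)"
      using r(2) unfolding R_def by (intro exI[of _ "x + \<pi> ^ Suc n * r"]) simp
  qed
  then obtain f where f: "\<And>n. R n (f n)" "\<And>n. f (Suc n) - f n \<in> prime_power v (int n + 1)"
    by blast
  obtain l where l: "\<And>k. l - f k \<in> prime_power v (int k + 1)"
    using complete_power_series[OF f(2)] by blast
  have "f 0 \<in> \<P>" "l - f 0 \<in> \<P>" using f(1)[of 0] l[of 0] by (simp_all add: R_def)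
  from pp_add[OF this] have "l \<in> \<P>" by simp
  from lim[OF this] obtain k where "Q k l" ..
  with cong[OF l[of k]] have "Q k (f k)" .
  then show False using f(1)[of k] by (simp add: R_def)
qed

end

subsection \<open>Harmonic functions on the tree\<close>

definition sm :: "'f::field_char_0 \<Rightarrow> 'f \<times> 'f \<Rightarrow> 'f \<times> 'f" where
  "sm z w = (z * fst w, z * snd w)"

definition det2 :: "'f::field_char_0 \<times> 'f \<Rightarrow> 'f \<times> 'f \<Rightarrow> 'f" where
  "det2 x y = fst x * snd y - snd x * fst y"

lemma sm_simps:
  "sm 1 x = x" "sm 0 x = 0" "sm a 0 = 0" "sm a (sm b x) = sm (a * b) x"
  "sm a (x + y) = sm a x + sm a y" "sm a (x - y) = sm a x - sm a y"
  "sm (a + b) x = sm a x + sm b x" "sm (- a) x = - sm a x"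
  by (auto simp: sm_def prod_eq_iff algebra_simps)

lemma det2_simps:
  "det2 (x + y) z = det2 x z + det2 y z" "det2 z (x + y) = det2 z x + det2 z y"
  "det2 (sm a x) y = a * det2 x y" "det2 x (sm a y) = a * det2 x y"
  "det2 x x = 0" "det2 0 x = 0" "det2 x 0 = 0"
  by (auto simp: det2_def sm_def algebra_simps)

lemma det2_swap: "det2 y x = - det2 x y"
  by (simp add: det2_def algebra_simps)

text \<open>Cramer's rule.\<close>

lemma det2_coords:
  assumes "det2 x y \<noteq> 0"
  shows "w = sm (det2 w y / det2 x y) x + sm (det2 x w / det2 x y) y"
proof -
  have "det2 x y * fst w = det2 w y * fst x + det2 x w * fst y"
    "det2 x y * snd w = det2 w y * snd x + det2 x w * snd y"
    by (simp_all add: det2_def algebra_simps)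
  then have "fst w = (det2 w y * fst x + det2 x w * fst y) / det2 x y"
    "snd w = (det2 w y * snd x + det2 x w * snd y) / det2 x y"
    using assms by (simp_all add: field_simps)
  then show ?thesis by (simp add: prod_eq_iff sm_def add_divide_distrib)
qed

lemma det2_lin:
  "det2 (sm a x + sm b y) (sm c x + sm e y) = (a * e - b * c) * det2 x y"
  by (simp add: det2_simps det2_swap[of y x] algebra_simps)

lemma det2_eq_0_imp:
  assumes "det2 x y \<noteq> 0" "w \<noteq> 0"
  shows "det2 x w \<noteq> 0 \<or> det2 y w \<noteq> 0"
proof (rule ccontr)
  assume "\<not> ?thesis"
  then have "det2 x w = 0" "det2 w y = 0" using det2_swap[of w y] by simp_all
  then have "w = 0" using det2_coords[OF assms(1), of w] by (simp add: sm_simps)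
  then show False using assms by simp
qed

lemma sm_eq_0_iff: "sm a x = 0 \<longleftrightarrow> a = 0 \<or> x = 0"
  by (auto simp: sm_def prod_eq_iff)

section \<open>The algebra \<open>L\<close> as a plane with a multiplication\<close>

locale quadratic_algebra = uniformized_field v \<pi> for v :: "'f::field_char_0 \<Rightarrow> int" and \<pi> +
  fixes d :: 'f
  assumes d_nonzero: "d \<noteq> 0" and d_int: "d \<in> \<O>"
begin

abbreviation L_times (infixl "\<odot>" 70) where "z \<odot> w \<equiv> L_mult d z w"
abbreviation nm where "nm \<equiv> L_norm d"
abbreviation one where "one \<equiv> L_of d 1"

lemma L_mult_laws:
  "x \<odot> y = y \<odot> x" "(x \<odot> y) \<odot> z = x \<odot> (y \<odot> z)" "one \<odot> x = x" "x \<odot> one = x"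
  "x \<odot> (y + z) = x \<odot> y + x \<odot> z" "(y + z) \<odot> x = y \<odot> x + z \<odot> x"
  "sm a x \<odot> y = sm a (x \<odot> y)" "x \<odot> sm a y = sm a (x \<odot> y)"
  by (auto simp: L_mult_def L_of_def sm_def prod_eq_iff algebra_simps)

lemma L_of_eq: "L_of d a = sm a one"
  by (simp add: L_of_def sm_def)

lemma nm_mult: "nm (x \<odot> y) = nm x * nm y"
  by (simp add: L_norm_def L_mult_def L_conj_def algebra_simps)

lemma nm_sm: "nm (sm a x) = a\<^sup>2 * nm x"
  by (simp add: L_norm_def L_mult_def L_conj_def sm_def algebra_simps power2_eq_square)

lemma nm_one [simp]: "nm one = 1"
  by (simp add: L_norm_def L_mult_def L_conj_def L_of_def)

definition linv :: "'f \<times> 'f \<Rightarrow> 'f \<times> 'f" where "linv t = sm (1 / nm t) (L_conj d t)"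

lemma mult_linv: "nm t \<noteq> 0 \<Longrightarrow> t \<odot> linv t = one"
  unfolding linv_def L_mult_laws(8) L_norm[symmetric] L_of_eq[of "nm t"]
  by (simp add: sm_simps)

lemma L_units_iff: "t \<in> L_units d \<longleftrightarrow> nm t \<noteq> 0"
proof
  assume "t \<in> L_units d"
  then obtain w where "t \<odot> w = one" by (auto simp: L_units_def)
  from arg_cong[OF this, of nm] show "nm t \<noteq> 0" by (auto simp: nm_mult)
next
  assume "nm t \<noteq> 0"
  from mult_linv[OF this] show "t \<in> L_units d" unfolding L_units_def by blast
qed

lemma nm_linv: "nm t \<noteq> 0 \<Longrightarrow> nm (linv t) \<noteq> 0"
  using arg_cong[OF mult_linv, of t nm] by (auto simp: nm_mult)

lemma linv_cancel: "nm t \<noteq> 0 \<Longrightarrow> linv t \<odot> (t \<odot> x) = x" "nm t \<noteq> 0 \<Longrightarrow> t \<odot> (linv t \<odot> x) = x"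
  using mult_linv[of t] L_mult_laws(2)[of t "linv t" x] L_mult_laws(2)[of "linv t" t x]
  by (simp_all add: L_mult_laws(3) L_mult_laws(1)[of "linv t" t])

lemma det2_mult: "det2 (t \<odot> x) (t \<odot> y) = nm t * det2 x y"
  by (simp add: det2_def L_mult_def L_norm_def L_conj_def algebra_simps)

lemma nm_eq_0_field:
  assumes "\<not> is_sq d" "nm t = 0" shows "t = 0"
proof -
  have *: "fst t * fst t = d * (snd t * snd t)"
    using assms by (simp add: L_norm_def L_mult_def L_conj_def)
  have "snd t = 0"
  proof (rule ccontr)
    assume "snd t \<noteq> 0"
    then have "(fst t / snd t)\<^sup>2 = d" using * by (simp add: power2_eq_square field_simps)
    then show False using assms by (auto simp: is_sq_def)
  qed
  then show ?thesis using * by (simp add: prod_eq_iff)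
qed

lemma nm_split: "is_sq d \<Longrightarrow> nm t = fst t * snd t"
  by (simp add: L_norm_def L_mult_def L_conj_def)

text \<open>A second basis vector next to \<open>one\<close>, unrelated to the character of
  \<open>U(F)\<close>. In the split case it is an idempotent and spans a line fixed by the torus. In
  both cases the points \<open>one + sm z \<theta>\<close> with z \<in> \<pp> are invertible, so the
  ball \<open>nb \<theta> one\<close> avoids all fixed points.\<close>

definition \<theta> :: "'f \<times> 'f" where "\<theta> = (if is_sq d then (1, 0) else (0, 1))"

lemma det2_theta: "det2 \<theta> one \<noteq> 0"
  by (simp add: \<theta>_def det2_def L_of_def)

lemma theta_sq: "\<exists>A\<in>\<O>. \<exists>B\<in>\<O>. \<theta> \<odot> \<theta> = sm A \<theta> + sm B one"
proof (cases "is_sq d")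
  case True
  then show ?thesis
    by (intro bexI[of _ 1] bexI[of _ 0]) (auto simp: \<theta>_def L_mult_def sm_def L_of_def)
next
  case False
  then show ?thesis using d_int
    by (intro bexI[of _ 0] bexI[of _ d]) (auto simp: \<theta>_def L_mult_def sm_def L_of_def)
qed

lemma nm_one_theta:
  assumes "z \<in> \<P>" shows "nm (one + sm z \<theta>) \<noteq> 0"
proof -
  have "nm (one + sm z \<theta>) = (if is_sq d then 1 + z else 1 - d * (z * z))"
    by (simp add: L_norm_def L_mult_def L_conj_def \<theta>_def sm_def L_of_def)
  moreover have "unit (1 + z)" by (rule unit_add[OF unit_1 assms])
  moreover have "unit (1 - d * (z * z))"
    by (rule unit_diff[OF unit_1]) (intro pp_mult_O(2) d_int pp_mult_O(1) assms P_in_O)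
  ultimately show ?thesis using unit_nonzero by auto
qed

text \<open>The nearby points of \<open>y\<close> on the projective line: the lines spanned by \<open>y + z x\<close>, \<open>z \<in> \<pp>\<close>.\<close>

definition nb :: "'f \<times> 'f \<Rightarrow> 'f \<times> 'f \<Rightarrow> ('f \<times> 'f) set" where
  "nb x y = {w. det2 x w \<noteq> 0 \<and> det2 y w / det2 x w \<in> \<P>}"

text \<open>Functions on the oriented edges of the tree of \<open>PGL\<^sub>2\<close>: an edge is given by a basis \<open>x, y\<close>
  of a lattice \<open>X\<close>, up to homothety, and leads from \<open>X\<close> to \<open>\<oo> y + \<pp> x\<close>.\<close>

definition harmonic :: "('f \<times> 'f \<Rightarrow> 'f \<times> 'f \<Rightarrow> complex) \<Rightarrow> bool" where
  "harmonic \<gamma> \<longleftrightarrow>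
     (\<forall>x y \<alpha> \<beta> z \<delta>. det2 x y \<noteq> 0 \<longrightarrow> unit \<alpha> \<longrightarrow> \<beta> \<in> \<O> \<longrightarrow> z \<in> \<P> \<longrightarrow> unit \<delta> \<longrightarrow>
        \<gamma> (sm \<alpha> x + sm \<beta> y) (sm z x + sm \<delta> y) = \<gamma> x y) \<and>
     (\<forall>x y. det2 x y \<noteq> 0 \<longrightarrow> (\<Sum>r\<in>reps. \<gamma> x (y + sm r x)) + \<gamma> y x = 0) \<and>
     (\<forall>x y. det2 x y \<noteq> 0 \<longrightarrow> \<gamma> y (sm \<pi> x) = - \<gamma> x y)"

definition equivariant :: "('f \<times> 'f \<Rightarrow> complex) \<Rightarrow> ('f \<times> 'f \<Rightarrow> 'f \<times> 'f \<Rightarrow> complex) \<Rightarrow> bool" where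
  "equivariant \<xi> \<gamma> \<longleftrightarrow>
     (\<forall>t x y. nm t \<noteq> 0 \<longrightarrow> det2 x y \<noteq> 0 \<longrightarrow> \<gamma> (t \<odot> x) (t \<odot> y) = \<xi> t * \<gamma> x y)"

lemma harmonic_iwahori:
  "harmonic \<gamma> \<Longrightarrow> det2 x y \<noteq> 0 \<Longrightarrow> unit \<alpha> \<Longrightarrow> \<beta> \<in> \<O> \<Longrightarrow> z \<in> \<P> \<Longrightarrow> unit \<delta> \<Longrightarrow>
     \<gamma> (sm \<alpha> x + sm \<beta> y) (sm z x + sm \<delta> y) = \<gamma> x y"
  unfolding harmonic_def by blast

lemma harmonic_star:
  "harmonic \<gamma> \<Longrightarrow> det2 x y \<noteq> 0 \<Longrightarrow> (\<Sum>r\<in>reps. \<gamma> x (y + sm r x)) + \<gamma> y x = 0"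
  unfolding harmonic_def by blast

lemma harmonic_flip: "harmonic \<gamma> \<Longrightarrow> det2 x y \<noteq> 0 \<Longrightarrow> \<gamma> y (sm \<pi> x) = - \<gamma> x y"
  unfolding harmonic_def by blast

lemma equivariantD:
  "equivariant \<xi> \<gamma> \<Longrightarrow> nm t \<noteq> 0 \<Longrightarrow> det2 x y \<noteq> 0 \<Longrightarrow> \<gamma> (t \<odot> x) (t \<odot> y) = \<xi> t * \<gamma> x y"
  unfolding equivariant_def by blast

lemma harmonic_shift:
  "harmonic \<gamma> \<Longrightarrow> det2 x y \<noteq> 0 \<Longrightarrow> z \<in> \<P> \<Longrightarrow> \<gamma> x (y + sm z x) = \<gamma> x y"
  using harmonic_iwahori[of \<gamma> x y 1 0 z 1] by (simp add: sm_simps add.commute)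

text \<open>Finite additivity, with \<gamma> x y read as the mass of \<open>nb x y\<close>: in the
  relation at the vertex spanned by \<open>sm \<pi> x\<close> and \<open>y\<close>, the edge leading
  back is the reverse of \<open>x, y\<close>.\<close>

lemma harmonic_children:
  assumes "harmonic \<gamma>" "det2 x y \<noteq> 0"
  shows "\<gamma> x y = (\<Sum>r\<in>reps. \<gamma> (sm \<pi> x) (y + sm (\<pi> * r) x))"
proof -
  have "det2 (sm \<pi> x) y \<noteq> 0" using assms by (simp add: det2_simps)
  from harmonic_star[OF assms(1) this] harmonic_flip[OF assms]
  have "(\<Sum>r\<in>reps. \<gamma> (sm \<pi> x) (y + sm r (sm \<pi> x))) - \<gamma> x y = 0" by simp
  then show ?thesis by (simp add: sm_simps(4) mult.commute[of _ \<pi>])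
qed

text \<open>Compactness of a ball as an induction principle: a property holds for
  \<open>nb x y\<close> if it passes from the q sub-balls to a ball and if every point of
  \<open>nb x y\<close> has some small ball with it. It is \<open>descent\<close> in the coordinate
  z of the line spanned by \<open>y + sm z x\<close>, the k-th level being the balls of basis vector
  \<open>sm (\<pi> ^ k) x\<close>.\<close>

lemma tree_descent:
  assumes xy: "det2 x y \<noteq> 0"
    and cong: "\<And>x y z. det2 x y \<noteq> 0 \<Longrightarrow> z \<in> \<P> \<Longrightarrow> R x y \<Longrightarrow> R x (y + sm z x)"
    and step: "\<And>x y. det2 x y \<noteq> 0 \<Longrightarrow>
      (\<And>r. r \<in> \<O> \<Longrightarrow> R (sm \<pi> x) (y + sm (\<pi> * r) x)) \<Longrightarrow> R x y"
    and lim: "\<And>w. w \<in> nb x y \<Longrightarrow> det2 x w \<noteq> 0 \<Longrightarrow> w \<noteq> 0 \<Longrightarrow> \<exists>k. R (sm (\<pi> ^ k) x) w"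
  shows "R x y"
proof -
  define Q where "Q k z = R (sm (\<pi> ^ k) x) (y + sm z x)" for k z
  have nz: "det2 (sm (\<pi> ^ k) x) (y + sm z x) \<noteq> 0" for k z
    using xy by (simp add: det2_simps)
  have "Q 0 0"
  proof (rule descent)
    fix k z z' assume "z - z' \<in> prime_power v (int k + 1)" and Q: "Q k z"
    then have "z' - z \<in> prime_power v (int k + 1)"
      using pp_minus[of "z - z'"] by simp
    then have "\<pi> ^ k * ((z' - z) / \<pi> ^ k) \<in> prime_power v (int k + 1)" by simp
    then have *: "(z' - z) / \<pi> ^ k \<in> \<P>" by (subst (asm) pp_pi_power_mult_iff) simp
    have "y + sm z x + sm ((z' - z) / \<pi> ^ k) (sm (\<pi> ^ k) x) = y + sm z' x"
      by (simp add: sm_simps(4) add.assoc flip: sm_simps(7))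
    with cong[OF nz * Q[unfolded Q_def]] show "Q k z'"
      by (simp add: Q_def)
  next
    fix k z assume *: "\<And>r. r \<in> \<O> \<Longrightarrow> Q (Suc k) (z + \<pi> ^ Suc k * r)"
    show "Q k z"
      unfolding Q_def
    proof (rule step[OF nz])
      fix r assume "r \<in> \<O>"
      from *[OF this] show "R (sm \<pi> (sm (\<pi> ^ k) x)) (y + sm z x + sm (\<pi> * r) (sm (\<pi> ^ k) x))"
        by (simp add: Q_def sm_simps algebra_simps)
    qed
  next
    fix z assume "z \<in> \<P>"
    then have "y + sm z x \<in> nb x y"
      using xy by (simp add: nb_def det2_simps det2_swap[of y x])
    moreover have *: "det2 x (y + sm z x) \<noteq> 0" using xy by (simp add: det2_simps)
    moreover have "y + sm z x \<noteq> 0"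
    proof
      assume "y + sm z x = 0"
      with * show False by (simp only: det2_simps(7)) simp
    qed
    ultimately show "\<exists>k. Q k z" unfolding Q_def by (rule lim)
  qed
  then show ?thesis by (simp add: Q_def sm_simps)
qed

end

section \<open>Uniqueness of equivariant harmonic functions\<close>

locale quadratic_character = quadratic_algebra v \<pi> d
  for v :: "'f::field_char_0 \<Rightarrow> int" and \<pi> d +
  fixes \<xi> :: "'f \<times> 'f \<Rightarrow> complex" and cond :: nat
  assumes xi_mult: "nm t \<noteq> 0 \<Longrightarrow> nm s \<noteq> 0 \<Longrightarrow> \<xi> (t \<odot> s) = \<xi> t * \<xi> s"
    and xi_nonzero: "nm t \<noteq> 0 \<Longrightarrow> \<xi> t \<noteq> 0"
    and xi_scalar: "a \<noteq> 0 \<Longrightarrow> \<xi> (L_of d a) = 1"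
    and xi_small: "fst t \<in> prime_power v (int cond + 1) \<Longrightarrow> snd t \<in> prime_power v (int cond + 1)
      \<Longrightarrow> \<xi> (one + t) = 1"
begin

text \<open>The mass of the level-k ball about \<open>one\<close>. The torus moves
  \<open>one\<close> to every invertible point, so these numbers govern all small balls away from
  the fixed points.\<close>

definition ball_val where "ball_val \<gamma> k = (\<gamma> (sm (\<pi> ^ k) \<theta>) one :: complex)"

context
  fixes \<gamma> N
  assumes harm: "harmonic \<gamma>" and equi: "equivariant \<xi> \<gamma>"
    and N: "\<And>z. z \<in> prime_power v (int N + 1) \<Longrightarrow> \<xi> (one + sm z \<theta>) = 1"
begin

text \<open>Beyond the conductor the q sub-balls of a ball about \<open>one\<close> are translates
  of one of them by elements \<open>one + sm z \<theta>\<close> in the kernel of \<xi>, so they have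
  equal mass.\<close>

lemma ball_val_Suc:
  assumes "k \<ge> N" shows "ball_val \<gamma> k = of_nat q * ball_val \<gamma> (Suc k)"
proof -
  have "\<gamma> (sm \<pi> (sm (\<pi> ^ k) \<theta>)) (one + sm (\<pi> * r) (sm (\<pi> ^ k) \<theta>)) = ball_val \<gamma> (Suc k)"
    if "r \<in> reps" for r
  proof -
    have r: "r \<in> \<O>" using that by (rule reps_in_O)
    define z t where "z = \<pi> ^ Suc k * r" and "t = one + sm z \<theta>"
    have z: "z \<in> prime_power v (int k + 1)"
      unfolding z_def pp_pi_power_mult_iff using r by simp
    then have zP: "z \<in> \<P>" and zN: "z \<in> prime_power v (int N + 1)"
      using assms by (auto intro: pp_mono)
    then have chi: "\<xi> t = 1" and nt: "nm t \<noteq> 0"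
      unfolding t_def using N[OF zN] nm_one_theta[OF zP] by blast+
    obtain A B where AB: "A \<in> \<O>" "B \<in> \<O>" "\<theta> \<odot> \<theta> = sm A \<theta> + sm B one"
      using theta_sq by blast
    define x where "x = sm (\<pi> ^ Suc k) \<theta>"
    have xt: "det2 x t \<noteq> 0" unfolding x_def t_def using det2_theta by (simp add: det2_simps)
    \<comment> \<open>Multiplication by \<open>t\<close> carries the edge \<open>x, one\<close> to
      \<open>t \<odot> x, t\<close>. As \<open>\<theta>\<close> is integral, the two coefficients
      found here are a unit and an integer, so this is the edge \<open>x, t\<close>.\<close>
    have eq: "t \<odot> x = sm (1 + z * A - z * z * B) x + sm (\<pi> ^ Suc k * z * B) t"
    proof -
      have "t \<odot> x = x + sm z (\<theta> \<odot> x)" by (simp add: t_def L_mult_laws)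
      also have "\<theta> \<odot> x = sm A x + sm (\<pi> ^ Suc k * B) one"
        by (simp add: x_def L_mult_laws AB sm_simps mult_ac)
      also have "one = t - sm z \<theta>" by (simp add: t_def)
      finally show ?thesis by (simp add: x_def sm_simps prod_eq_iff sm_def algebra_simps)
    qed
    have "z * A - z * z * B \<in> \<P>"
      by (rule pp_diff[OF pp_mult_O(1)[OF zP AB(1)]
            pp_mult_O(1)[OF pp_mult_O(1)[OF zP P_in_O[OF zP]] AB(2)]])
    from unit_add[OF unit_1 this] have u: "unit (1 + z * A - z * z * B)"
      by (simp only: add_diff_eq)
    have "\<pi> ^ Suc k * z \<in> prime_power v 0"
      unfolding pp_pi_power_mult_iff using z by (rule pp_mono) simp
    from O_mult[OF this AB(2)] have pz: "\<pi> ^ Suc k * z * B \<in> \<O>" .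
    from harmonic_iwahori[OF harm xt u pz pp_0 unit_1]
    have "\<gamma> x t = \<gamma> (t \<odot> x) (t \<odot> one)" unfolding eq L_mult_laws(4) by (simp add: sm_simps)
    also have "\<dots> = \<gamma> x one"
      using equivariantD[OF equi nt, of x one] det2_theta by (simp add: x_def det2_simps chi)
    finally show ?thesis by (simp add: x_def t_def z_def ball_val_def sm_simps mult_ac)
  qed
  then have "(\<Sum>r\<in>reps. \<gamma> (sm \<pi> (sm (\<pi> ^ k) \<theta>)) (one + sm (\<pi> * r) (sm (\<pi> ^ k) \<theta>))) =
      of_nat q * ball_val \<gamma> (Suc k)" by simp
  moreover have "det2 (sm (\<pi> ^ k) \<theta>) one \<noteq> 0" using det2_theta by (simp add: det2_simps)
  from harmonic_children[OF harm this] have "ball_val \<gamma> k =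
    (\<Sum>r\<in>reps. \<gamma> (sm \<pi> (sm (\<pi> ^ k) \<theta>)) (one + sm (\<pi> * r) (sm (\<pi> ^ k) \<theta>)))"
    by (simp add: ball_val_def)
  ultimately show ?thesis by simp
qed

lemma ball_val_add: "ball_val \<gamma> N = of_nat q ^ j * ball_val \<gamma> (N + j)"
proof (induction j)
  case (Suc j)
  then show ?case using ball_val_Suc[of "N + j"] by simp
qed simp

text \<open>Division by \<open>w\<close> moves the centre to \<open>one\<close>. There
  \<open>sm (\<pi> ^ k) y\<close> agrees, up to a unit and an integral multiple of
  \<open>one\<close>, with a power of \<pi> times \<open>\<theta>\<close>, so the ball is one of
  those measured by \<open>ball_val\<close>.\<close>

lemma small_ball:
  assumes w: "nm w \<noteq> 0" and xw: "det2 x w \<noteq> 0"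
  shows "\<exists>k j. \<gamma> (sm (\<pi> ^ k) x) w = \<xi> w * ball_val \<gamma> (N + j)"
proof -
  define y where "y = linv w \<odot> x"
  have wy: "w \<odot> y = x" by (simp add: y_def linv_cancel w)
  define \<alpha> \<beta> where "\<alpha> = det2 y one / det2 \<theta> one" and "\<beta> = det2 \<theta> y / det2 \<theta> one"
  have y: "y = sm \<alpha> \<theta> + sm \<beta> one"
    unfolding \<alpha>_def \<beta>_def by (rule det2_coords[OF det2_theta])
  have yo: "det2 y one \<noteq> 0"
    using xw det2_mult[of w y one] by (auto simp: wy L_mult_laws)
  then have \<alpha>: "\<alpha> \<noteq> 0" using det2_theta by (simp add: \<alpha>_def)
  obtain k0 where k0: "\<forall>k\<ge>k0. \<pi> ^ k * \<beta> \<in> \<O>" using eventually_pi_power_pp by blast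
  \<comment> \<open>Large enough for k + v \<alpha> \<ge> N and for \<pi>^k \<beta> to be integral;
    the level reached is N + j = k + v \<alpha>.\<close>
  define k where "k = k0 + nat (\<bar>v \<alpha>\<bar> + int N)"
  define j where "j = nat (int k + v \<alpha> - int N)"
  have j: "int (N + j) = int k + v \<alpha>" by (auto simp: j_def k_def)
  define u where "u = \<pi> ^ k * \<alpha> / \<pi> ^ (N + j)"
  have u: "unit u" using \<alpha> j by (simp add: int_units_iff u_def val_divide val_mult val_power)
  have "sm (\<pi> ^ k) y = sm u (sm (\<pi> ^ (N + j)) \<theta>) + sm (\<pi> ^ k * \<beta>) one"
    by (subst y) (simp add: sm_simps u_def)
  moreover have "\<gamma> (sm u (sm (\<pi> ^ (N + j)) \<theta>) + sm (\<pi> ^ k * \<beta>) one)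
      (sm 0 (sm (\<pi> ^ (N + j)) \<theta>) + sm 1 one) = \<gamma> (sm (\<pi> ^ (N + j)) \<theta>) one"
    by (rule harmonic_iwahori[OF harm]) (use k0 u det2_theta in \<open>auto simp: det2_simps k_def\<close>)
  ultimately have "\<gamma> (sm (\<pi> ^ k) y) one = ball_val \<gamma> (N + j)"
    by (simp add: ball_val_def sm_simps)
  moreover have "\<gamma> (w \<odot> sm (\<pi> ^ k) y) (w \<odot> one) = \<xi> w * \<gamma> (sm (\<pi> ^ k) y) one"
    by (rule equivariantD[OF equi w]) (use yo in \<open>simp add: det2_simps\<close>)
  ultimately have "\<gamma> (sm (\<pi> ^ k) x) w = \<xi> w * ball_val \<gamma> (N + j)"
    by (simp add: L_mult_laws wy)
  then show ?thesis by blast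
qed

text \<open>By additivity it suffices that every point has a small ball of mass 0. For invertible
  points this follows from the single number \<open>ball_val \<gamma> N\<close>, which fixes the
  smaller balls up to powers of q; the points of norm zero are left to the hypothesis
  \<open>sing\<close>.\<close>

lemma vanishing:
  assumes b: "ball_val \<gamma> N = 0" and xy: "det2 x y \<noteq> 0"
    and sing: "\<And>x w. det2 x w \<noteq> 0 \<Longrightarrow> w \<noteq> 0 \<Longrightarrow> nm w = 0 \<Longrightarrow> \<exists>k. \<gamma> (sm (\<pi> ^ k) x) w = 0"
  shows "\<gamma> x y = 0"
proof (rule tree_descent[OF xy, where R = "\<lambda>x y. \<gamma> x y = 0"])
  fix x y z assume "det2 x y \<noteq> 0" "z \<in> \<P>" "\<gamma> x y = 0"
  then show "\<gamma> x (y + sm z x) = 0" using harmonic_shift[OF harm] by simp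
next
  fix x y
  assume xy: "det2 x y \<noteq> 0" and *: "\<And>r. r \<in> \<O> \<Longrightarrow> \<gamma> (sm \<pi> x) (y + sm (\<pi> * r) x) = 0"
  show "\<gamma> x y = 0"
    unfolding harmonic_children[OF harm xy] using * reps_in_O by (intro sum.neutral) blast
next
  fix w assume w: "det2 x w \<noteq> 0" "w \<noteq> 0"
  show "\<exists>k. \<gamma> (sm (\<pi> ^ k) x) w = 0"
  proof (cases "nm w = 0")
    case False
    have "ball_val \<gamma> (N + j) = 0" for j
      using ball_val_add[of j] b card_reps_ge_2 by auto
    then show ?thesis using small_ball[OF False w(1)] by auto
  qed (use sing w in blast)
qed

text \<open>For \<xi> = 1 all balls have masses that are positive multiples of one number. A ball
  and its complement, the ball of the reversed edge, have opposite masses, so this number is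
  0.\<close>

lemma vanishing_field_trivial:
  assumes "\<not> is_sq d" and triv: "\<And>t. nm t \<noteq> 0 \<Longrightarrow> \<xi> t = 1" and xy: "det2 x y \<noteq> 0"
  shows "\<gamma> x y = 0"
proof -
  have pos: "\<exists>r>0. \<gamma> x y = ball_val \<gamma> N * of_real r" if "det2 x y \<noteq> 0" for x y
  proof (rule tree_descent[OF that, where R = "\<lambda>x y. \<exists>r>0. \<gamma> x y = ball_val \<gamma> N * of_real r"])
    fix x y z assume "det2 x y \<noteq> 0" "z \<in> \<P>" "\<exists>r>0. \<gamma> x y = ball_val \<gamma> N * of_real r"
    then show "\<exists>r>0. \<gamma> x (y + sm z x) = ball_val \<gamma> N * of_real r"
      using harmonic_shift[OF harm] by simp
  next
    fix x y assume xy: "det2 x y \<noteq> 0" and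
      *: "\<And>r. r \<in> \<O> \<Longrightarrow> \<exists>s>0. \<gamma> (sm \<pi> x) (y + sm (\<pi> * r) x) = ball_val \<gamma> N * of_real s"
    then obtain s where s: "\<And>r. r \<in> reps \<Longrightarrow>
        s r > (0::real) \<and> \<gamma> (sm \<pi> x) (y + sm (\<pi> * r) x) = ball_val \<gamma> N * of_real (s r)"
      using reps_in_O by metis
    have "\<gamma> x y = ball_val \<gamma> N * of_real (sum s reps)"
      unfolding harmonic_children[OF harm xy] using s by (simp add: sum_distrib_left)
    moreover have "reps \<noteq> {}" using card_reps_ge_2 by auto
    then have "sum s reps > 0" using s finite_reps by (intro sum_pos) auto
    ultimately show "\<exists>r>0. \<gamma> x y = ball_val \<gamma> N * of_real r" by blast
  next
    fix w assume w: "det2 x w \<noteq> 0" "w \<noteq> 0"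
    have nw: "nm w \<noteq> 0" using nm_eq_0_field assms(1) w(2) by blast
    from small_ball[OF nw w(1)] obtain k j
      where "\<gamma> (sm (\<pi> ^ k) x) w = \<xi> w * ball_val \<gamma> (N + j)" by blast
    moreover have "ball_val \<gamma> (N + j) = ball_val \<gamma> N * of_real (1 / real q ^ j)"
      using ball_val_add[of j] card_reps_ge_2 by (simp add: field_simps)
    moreover have "1 / real q ^ j > 0" using card_reps_ge_2 by simp
    ultimately show "\<exists>k. \<exists>r>0. \<gamma> (sm (\<pi> ^ k) x) w = ball_val \<gamma> N * of_real r"
      using triv[OF nw] by (metis mult_1)
  qed
  obtain r where r: "r > 0" "\<gamma> x y = ball_val \<gamma> N * of_real r" using pos[OF xy] by blast
  have "det2 y (sm \<pi> x) \<noteq> 0" using xy by (simp add: det2_simps det2_swap[of y x])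
  from pos[OF this] obtain s where s: "s > 0" "\<gamma> y (sm \<pi> x) = ball_val \<gamma> N * of_real s" by blast
  have "ball_val \<gamma> N * of_real (r + s) = 0"
    using r(2) s(2) harmonic_flip[OF harm xy] by (simp add: distrib_left)
      (metis add.right_inverse)
  then have "ball_val \<gamma> N = 0" using r s by (simp flip: of_real_add)
  then show ?thesis using r by simp
qed

end

lemma xi_small_theta: "z \<in> prime_power v (int cond + 1) \<Longrightarrow> \<xi> (one + sm z \<theta>) = 1"
  by (rule xi_small) (auto simp: sm_def \<theta>_def)

lemma uniqueness_field:
  assumes "\<not> is_sq d"
  obtains x0 y0 where "det2 x0 y0 \<noteq> 0"
    "\<And>\<gamma> x y. harmonic \<gamma> \<Longrightarrow> equivariant \<xi> \<gamma> \<Longrightarrow> \<gamma> x0 y0 = 0 \<Longrightarrow> det2 x y \<noteq> 0 \<Longrightarrow> \<gamma> x y = 0"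
proof
  show "det2 (sm (\<pi> ^ cond) \<theta>) one \<noteq> 0" using det2_theta by (simp add: det2_simps)
  fix \<gamma> :: "'f \<times> 'f \<Rightarrow> 'f \<times> 'f \<Rightarrow> complex" and x y :: "'f \<times> 'f"
  assume *: "harmonic \<gamma>" "equivariant \<xi> \<gamma>" "\<gamma> (sm (\<pi> ^ cond) \<theta>) one = 0" "det2 x y \<noteq> 0"
  show "\<gamma> x y = 0"
  proof (rule vanishing[OF *(1,2) xi_small_theta])
    show "ball_val \<gamma> cond = 0" using * by (simp add: ball_val_def)
  qed (use * nm_eq_0_field assms in auto)
qed

text \<open>The test edge depends on \<xi>. If \<xi> is nontrivial on pairs of units, the edge
  \<open>e1, e2\<close> on the axis between the two fixed points has value 0 anyway, and a small
  ball about \<open>one\<close> is the test edge. Otherwise \<open>e1, e2\<close> is the test edge,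
  and once its value is 0 the relation at its origin kills the balls about
  \<open>one\<close>.\<close>

lemma uniqueness_split:
  assumes sq: "is_sq d"
  obtains x0 y0 where "det2 x0 y0 \<noteq> 0"
    "\<And>\<gamma> x y. harmonic \<gamma> \<Longrightarrow> equivariant \<xi> \<gamma> \<Longrightarrow> \<gamma> x0 y0 = 0 \<Longrightarrow> det2 x y \<noteq> 0 \<Longrightarrow> \<gamma> x y = 0"
proof -
  define e1 e2 :: "'f \<times> 'f" where "e1 = (1, 0)" and "e2 = (0, 1)"
  have e12: "det2 e1 e2 \<noteq> 0" "det2 e2 e1 \<noteq> 0" by (simp_all add: e1_def e2_def det2_def)
  have mult: "t \<odot> e1 = (fst t, 0)" "t \<odot> e2 = (0, snd t)" for t
    using sq by (simp_all add: e1_def e2_def L_mult_def)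
  \<comment> \<open>Small balls about a fixed point come from torus translates of the edges
    \<open>e1, e2\<close> and \<open>e2, e1\<close> of the axis. The second has the value 0 too,
    because \<open>(\<pi>, 1)\<close> moves it to the reverse of the first.\<close>
  have sing: "\<exists>k. \<gamma> (sm (\<pi> ^ k) x) w = 0"
    if harm: "harmonic \<gamma>" and equi: "equivariant \<xi> \<gamma>" and 0: "\<gamma> e1 e2 = 0"
      and xw: "det2 x w \<noteq> 0" and w: "w \<noteq> 0" "nm w = 0" for \<gamma> x w
  proof (cases "fst w = 0")
    case True
    then obtain w2 where w2: "w = (0, w2)" "w2 \<noteq> 0" using w by (cases w) (auto simp: prod_eq_iff)
    then have x: "fst x \<noteq> 0" using xw by (simp add: det2_def)
    obtain k where k: "\<pi> ^ k * (snd x / w2) \<in> \<O>" using exists_pi_power_pp by blast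
    define t where "t = (\<pi> ^ k * fst x, w2)"
    have nt: "nm t \<noteq> 0" using x w2 by (simp add: nm_split sq t_def)
    have "sm (\<pi> ^ k) x = sm 1 (t \<odot> e1) + sm (\<pi> ^ k * (snd x / w2)) (t \<odot> e2)"
      "w = sm 0 (t \<odot> e1) + sm 1 (t \<odot> e2)"
      using w2 by (simp_all add: mult sm_def t_def prod_eq_iff)
    then have "\<gamma> (sm (\<pi> ^ k) x) w = \<gamma> (t \<odot> e1) (t \<odot> e2)"
      using harmonic_iwahori[OF harm _ unit_1 k pp_0 unit_1, of "t \<odot> e1" "t \<odot> e2"] e12 nt
      by (simp add: det2_mult)
    then show ?thesis using equivariantD[OF equi nt e12(1)] 0 by (intro exI[of _ k]) simp
  next
    case False
    then obtain w1 where w1: "w = (w1, 0)" "w1 \<noteq> 0"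
      using w by (cases w) (auto simp: nm_split sq)
    then have x: "snd x \<noteq> 0" using xw by (simp add: det2_def)
    obtain k where k: "\<pi> ^ k * (fst x / w1) \<in> \<O>" using exists_pi_power_pp by blast
    define t where "t = (w1, \<pi> ^ k * snd x)"
    have nt: "nm t \<noteq> 0" using x w1 by (simp add: nm_split sq t_def)
    have "sm (\<pi> ^ k) x = sm 1 (t \<odot> e2) + sm (\<pi> ^ k * (fst x / w1)) (t \<odot> e1)"
      "w = sm 0 (t \<odot> e2) + sm 1 (t \<odot> e1)"
      using w1 by (simp_all add: mult sm_def t_def prod_eq_iff)
    then have *: "\<gamma> (sm (\<pi> ^ k) x) w = \<gamma> (t \<odot> e2) (t \<odot> e1)"
      using harmonic_iwahori[OF harm _ unit_1 k pp_0 unit_1, of "t \<odot> e2" "t \<odot> e1"] e12 nt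
      by (simp add: det2_mult)
    have ns: "nm (\<pi>, 1) \<noteq> 0" by (simp add: nm_split sq)
    have "(\<pi>, 1) \<odot> e2 = e2" "(\<pi>, 1) \<odot> e1 = sm \<pi> e1"
      by (simp_all add: mult sm_def) (simp_all add: e1_def e2_def)
    then have "\<xi> (\<pi>, 1) * \<gamma> e2 e1 = 0"
      using equivariantD[OF equi ns e12(2)] harmonic_flip[OF harm e12(1)] 0 by simp
    then have "\<gamma> e2 e1 = 0" using xi_nonzero[OF ns] by simp
    then show ?thesis using equivariantD[OF equi nt e12(2)] * by (intro exI[of _ k]) simp
  qed
  show ?thesis
  proof (cases "\<exists>u1 u2. unit u1 \<and> unit u2 \<and> \<xi> (u1, u2) \<noteq> 1")
    case True
    then obtain u1 u2 where u: "unit u1" "unit u2" "\<xi> (u1, u2) \<noteq> 1" by blast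
    have nu: "nm (u1, u2) \<noteq> 0" using u by (auto simp: nm_split sq int_units_iff)
    \<comment> \<open>The pair of units fixes this edge and multiplies its value by \<xi> \<noteq>
      1.\<close>
    have e0: "\<gamma> e1 e2 = 0" if harm: "harmonic \<gamma>" and equi: "equivariant \<xi> \<gamma>" for \<gamma>
    proof -
      have "(u1, u2) \<odot> e1 = sm u1 e1 + sm 0 e2" "(u1, u2) \<odot> e2 = sm 0 e1 + sm u2 e2"
        by (simp_all add: mult sm_def) (simp_all add: e1_def e2_def)
      then have "\<xi> (u1, u2) * \<gamma> e1 e2 = \<gamma> e1 e2"
        using equivariantD[OF equi nu e12(1)] harmonic_iwahori[OF harm e12(1) u(1) pp_0 pp_0 u(2)]
        by simp
      then show ?thesis using u(3) by simp
    qed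
    show ?thesis
    proof (rule that)
      show "det2 (sm (\<pi> ^ cond) \<theta>) one \<noteq> 0" using det2_theta by (simp add: det2_simps)
      fix \<gamma> :: "'f \<times> 'f \<Rightarrow> 'f \<times> 'f \<Rightarrow> complex" and x y :: "'f \<times> 'f"
      assume *: "harmonic \<gamma>" "equivariant \<xi> \<gamma>" "\<gamma> (sm (\<pi> ^ cond) \<theta>) one = 0" "det2 x y \<noteq> 0"
      show "\<gamma> x y = 0"
      proof (rule vanishing[OF *(1,2) xi_small_theta _ *(4)])
        show "ball_val \<gamma> cond = 0" using *(3) by (simp add: ball_val_def)
      qed (use sing[OF *(1,2) e0[OF *(1,2)]] in blast)+
    qed
  next
    case False
    then have triv: "\<xi> (u1, u2) = 1" if "unit u1" "unit u2" for u1 u2 using that by blast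
    show ?thesis
    proof (rule that[OF e12(1)])
      fix \<gamma> :: "'f \<times> 'f \<Rightarrow> 'f \<times> 'f \<Rightarrow> complex" and x y :: "'f \<times> 'f"
      assume harm: "harmonic \<gamma>" and equi: "equivariant \<xi> \<gamma>" and 0: "\<gamma> e1 e2 = 0" and xy: "det2 x y \<noteq> 0"
      have triv_theta: "\<xi> (one + sm z \<theta>) = 1" if "z \<in> prime_power v (int 0 + 1)" for z
      proof -
        have "unit (1 + z)" using that by (intro unit_add) auto
        from triv[OF this unit_1] show ?thesis by (simp add: L_of_def sq \<theta>_def sm_def)
      qed
      have theta: "\<theta> = e1" "one = e1 + e2" by (simp_all add: \<theta>_def sq e1_def e2_def L_of_def)
      \<comment> \<open>Of the q + 1 edges at this vertex two lie on the axis and have value 0. The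
        other q - 1 are the images of \<open>e1, one\<close> under the units \<open>(r, 1)\<close>,
        on which \<xi> is trivial; their values are equal with sum 0, and q > 1.\<close>
      have 1: "\<gamma> e1 one = 0"
      proof -
        have ns: "nm (\<pi>, 1) \<noteq> 0" by (simp add: nm_split sq)
        have "(\<pi>, 1) \<odot> e2 = e2" "(\<pi>, 1) \<odot> e1 = sm \<pi> e1"
          by (simp_all add: mult sm_def) (simp_all add: e1_def e2_def)
        then have "\<xi> (\<pi>, 1) * \<gamma> e2 e1 = 0"
          using equivariantD[OF equi ns e12(2)] harmonic_flip[OF harm e12(1)] 0 by simp
        then have e21: "\<gamma> e2 e1 = 0" using xi_nonzero[OF ns] by simp
        obtain r0 where r0: "r0 \<in> reps" "0 - r0 \<in> \<P>" using exists_rep[of 0] by auto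
        have val: "\<gamma> e1 (e2 + sm r e1) = (if r = r0 then 0 else \<gamma> e1 one)" if r: "r \<in> reps" for r
        proof (cases "r = r0")
          case True
          have "r0 \<in> \<P>" using r0(2) by simp
          from harmonic_shift[OF harm e12(1) this] show ?thesis using True 0 by simp
        next
          case False
          have "r \<notin> \<P>"
          proof
            assume "r \<in> \<P>"
            then have "r - r0 \<in> \<P>" using pp_add[OF _ r0(2), of r] by simp
            then show False using reps_eqI[OF r r0(1)] False by simp
          qed
          then have u: "unit r" using reps_in_O[OF r] by (simp add: unit_iff)
          then have nr: "nm (r, 1) \<noteq> 0" by (auto simp: nm_split sq int_units_iff)
          have det: "det2 e1 one \<noteq> 0" by (simp add: theta det2_simps e12)
          have "(r, 1) \<odot> e1 = sm r e1 + sm 0 (e2 + sm r e1)"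
            "(r, 1) \<odot> one = e2 + sm r e1"
            by (simp_all add: theta L_mult_laws(5) mult sm_def) (simp_all add: e1_def e2_def)
          then have "\<gamma> (sm r e1 + sm 0 (e2 + sm r e1)) (e2 + sm r e1) = \<gamma> e1 one"
            using equivariantD[OF equi nr det] triv[OF u unit_1] by simp
          moreover have "\<gamma> (sm r e1 + sm 0 (e2 + sm r e1)) (sm 0 e1 + sm 1 (e2 + sm r e1)) = \<gamma> e1 (e2 + sm r e1)"
            by (rule harmonic_iwahori[OF harm _ u pp_0 pp_0 unit_1]) (use e12 in \<open>simp add: det2_simps\<close>)
          ultimately show ?thesis using False by (simp add: sm_simps)
        qed
        have "0 = (\<Sum>r\<in>reps. \<gamma> e1 (e2 + sm r e1))"
          using harmonic_star[OF harm e12(1)] e21 by simp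
        also have "\<dots> = (\<Sum>r\<in>reps. if r = r0 then 0 else \<gamma> e1 one)"
          by (rule sum.cong[OF refl val])
        also have "\<dots> = of_nat (card (reps - {r0})) * \<gamma> e1 one"
          using r0 finite_reps by (simp add: sum.remove[of reps r0])
        finally show ?thesis using card_reps_ge_2 r0 finite_reps by (auto simp: card_Diff_singleton)
      qed
      show "\<gamma> x y = 0"
      proof (rule vanishing[OF harm equi triv_theta _ xy])
        show "ball_val \<gamma> 0 = 0" using 1 by (simp add: ball_val_def theta sm_simps)
      qed (use sing[OF harm equi 0] in blast)+
    qed
  qed
qed

end

subsection \<open>Haar measure on the torus\<close>

context quadratic_algebra
begin

section \<open>Balls on the projective line\<close>

lemma nb_repr:
  assumes "det2 x y \<noteq> 0" "w \<in> nb x y"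
  obtains b z where "b \<noteq> 0" "z \<in> \<P>" "w = sm b (y + sm z x)"
proof
  let ?D = "det2 x y" and ?X = "det2 x w" and ?Y = "det2 y w"
  show "?X / ?D \<noteq> 0" "- (?Y / ?X) \<in> \<P>" using assms by (auto simp: nb_def)
  have "w = sm (- ?Y / ?D) x + sm (?X / ?D) y"
    using det2_coords[OF assms(1), of w] det2_swap[of w y] by simp
  moreover have "- ?Y / ?D = ?X / ?D * - (?Y / ?X)" using assms by (simp add: nb_def)
  ultimately show "w = sm (?X / ?D) (y + sm (- (?Y / ?X)) x)"
    by (simp only: sm_simps(4,5) add.commute)
qed

lemma nb_memI: "det2 x y \<noteq> 0 \<Longrightarrow> b \<noteq> 0 \<Longrightarrow> z \<in> \<P> \<Longrightarrow> sm b (y + sm z x) \<in> nb x y"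
  by (simp add: nb_def det2_simps det2_swap[of y x])

lemma nb_sm: "c \<noteq> 0 \<Longrightarrow> sm c w \<in> nb x y \<longleftrightarrow> w \<in> nb x y"
  by (simp add: nb_def det2_simps)

lemma nb_mult: "nm t \<noteq> 0 \<Longrightarrow> t \<odot> w \<in> nb (t \<odot> x) (t \<odot> y) \<longleftrightarrow> w \<in> nb x y"
  by (simp add: nb_def det2_mult)

text \<open>Reversing an edge complements its ball: a ratio of two determinants, not both zero,
  either lies in \<pp> or has its inverse in \<oo>, with 0 and infinity included.\<close>

lemma nb_flip:
  assumes "det2 x y \<noteq> 0" "w \<noteq> 0"
  shows "w \<in> nb y (sm \<pi> x) \<longleftrightarrow> w \<notin> nb x y"
proof -
  define X Y where "X = det2 x w" and "Y = det2 y w"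
  have "X \<noteq> 0 \<or> Y \<noteq> 0" using det2_eq_0_imp[OF assms] by (simp add: X_def Y_def)
  moreover have "\<pi> * X / Y \<in> \<P> \<longleftrightarrow> X / Y \<in> \<O>" using pp_pi_mult_iff[of "X / Y" 1] by simp
  ultimately show ?thesis
    unfolding nb_def mem_Collect_eq det2_simps X_def[symmetric] Y_def[symmetric]
    by (cases "X = 0"; cases "Y = 0") (auto simp: prime_power_iff val_divide)
qed

lemma nb_iwahori_aux:
  assumes u: "unit \<alpha>" "unit \<delta>" "\<beta> \<in> \<O>" "z \<in> \<P>"
    and XY: "X \<noteq> 0" "Y / X \<in> \<P>"
  shows "\<alpha> * X + \<beta> * Y \<noteq> 0" "(z * X + \<delta> * Y) / (\<alpha> * X + \<beta> * Y) \<in> \<P>"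
proof -
  define c where "c = Y / X"
  have Y: "Y = c * X" "c \<in> \<P>" using XY by (simp_all add: c_def)
  have "\<beta> * c \<in> \<P>" using pp_mult_O(2)[OF u(3) Y(2)] .
  from unit_add[OF u(1) this] have w: "unit (\<alpha> + \<beta> * c)" .
  have eq: "\<alpha> * X + \<beta> * Y = (\<alpha> + \<beta> * c) * X" "z * X + \<delta> * Y = (z + \<delta> * c) * X"
    by (simp_all add: Y algebra_simps)
  show "\<alpha> * X + \<beta> * Y \<noteq> 0" using unit_nonzero[OF w] XY by (simp add: eq)
  have "z + \<delta> * c \<in> \<P>" by (rule pp_add[OF u(4) pp_mult_O(2)[OF unit_in_O[OF u(2)] Y(2)]])
  then show "(z * X + \<delta> * Y) / (\<alpha> * X + \<beta> * Y) \<in> \<P>"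
    unfolding eq using XY unit_mult_pp_iff(3)[OF w] by simp
qed

text \<open>One inclusion is a computation. The other is the same computation for the complementary
  balls, since passing to \<open>y, sm \<pi> x\<close> turns an Iwahori change of basis into another
  one.\<close>

lemma nb_iwahori:
  assumes xy: "det2 x y \<noteq> 0" and u: "unit \<alpha>" "\<beta> \<in> \<O>" "z \<in> \<P>" "unit \<delta>"
  shows "nb (sm \<alpha> x + sm \<beta> y) (sm z x + sm \<delta> y) = nb x y"
proof -
  let ?x = "sm \<alpha> x + sm \<beta> y" and ?y = "sm z x + sm \<delta> y"
  have sub: "w \<in> nb ?x ?y" if "w \<in> nb x y" for w
    using nb_iwahori_aux[OF u(1,4,2,3), of "det2 x w" "det2 y w"] that by (simp add: nb_def det2_simps)
  have "w \<in> nb x y" if w: "w \<in> nb ?x ?y" for w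
  proof (rule ccontr)
    assume n: "w \<notin> nb x y"
    have w0: "w \<noteq> 0" using w by (auto simp: nb_def det2_simps)
    have "\<alpha> * \<delta> - \<beta> * z \<noteq> 0"
      by (rule unit_nonzero[OF unit_diff[OF unit_mult[OF u(1,4)] pp_mult_O(2)[OF u(2,3)]]])
    then have xy': "det2 ?x ?y \<noteq> 0" unfolding det2_lin using xy by simp
    have "w \<in> nb y (sm \<pi> x)" using nb_flip[OF xy w0] n by simp
    then have "det2 y w \<noteq> 0" "\<pi> * det2 x w / det2 y w \<in> \<P>" by (simp_all add: nb_def det2_simps)
    moreover obtain c where c: "c \<in> \<O>" "z = \<pi> * c" using u(3) P_iff_pi by blast
    ultimately have "\<delta> * det2 y w + c * (\<pi> * det2 x w) \<noteq> 0"
      "(\<pi> * \<beta> * det2 y w + \<alpha> * (\<pi> * det2 x w)) / (\<delta> * det2 y w + c * (\<pi> * det2 x w)) \<in> \<P>"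
      using nb_iwahori_aux[OF u(4,1) c(1), of "\<pi> * \<beta>" "det2 y w" "\<pi> * det2 x w"]
        pp_mult_O(1)[OF pi_in_P u(2)] by simp_all
    then have "w \<in> nb ?y (sm \<pi> ?x)" by (simp add: nb_def det2_simps c algebra_simps)
    then show False using nb_flip[OF xy' w0] w by simp
  qed
  with sub show ?thesis by blast
qed

lemma nb_shift:
  assumes "det2 x y \<noteq> 0" "z \<in> \<P>" shows "nb x (y + sm z x) = nb x y"
  using nb_iwahori[OF assms(1) unit_1 pp_0 assms(2) unit_1] by (simp add: sm_simps add.commute)

text \<open>The q + 1 balls at a vertex partition the projective line: either Y / X is integral, and
  its residue class selects exactly one \<open>r\<close>, or X / Y lies in \<pp>.\<close>

lemma nb_star:
  assumes xy: "det2 x y \<noteq> 0" and w: "w \<noteq> 0"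
  shows "(\<Sum>r\<in>reps. of_bool (w \<in> nb x (y + sm r x))) + of_bool (w \<in> nb y x) = (1::complex)"
proof -
  define X Y where "X = det2 x w" and "Y = det2 y w"
  have nz: "X \<noteq> 0 \<or> Y \<noteq> 0" using det2_eq_0_imp[OF xy w] by (simp add: X_def Y_def)
  have mem: "w \<in> nb x (y + sm r x) \<longleftrightarrow> X \<noteq> 0 \<and> Y / X + r \<in> \<P>" for r
    by (auto simp: nb_def X_def Y_def det2_simps add_divide_distrib)
  have mem': "w \<in> nb y x \<longleftrightarrow> Y \<noteq> 0 \<and> X / Y \<in> \<P>"
    by (simp add: nb_def X_def Y_def)
  show ?thesis
  proof (cases "X \<noteq> 0 \<and> Y / X \<in> \<O>")
    case True
    then have n: "w \<notin> nb y x"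
      unfolding mem' by (cases "Y = 0") (auto simp: prime_power_iff val_divide)
    have "- (Y / X) \<in> \<O>" using True by simp
    from exists_rep[OF this] obtain r0 where r0: "r0 \<in> reps" "- (Y / X) - r0 \<in> \<P>" by blast
    have "- (- (Y / X) - r0) \<in> \<P>" using r0(2) by (simp only: pp_minus)
    then have r0': "Y / X + r0 \<in> \<P>" by (simp add: add.commute)
    have "(w \<in> nb x (y + sm r x)) = (r = r0)" if "r \<in> reps" for r
    proof
      assume "w \<in> nb x (y + sm r x)"
      then have "(Y / X + r) - (Y / X + r0) \<in> \<P>" using r0' unfolding mem by (intro pp_diff) auto
      then show "r = r0" using reps_eqI[OF that r0(1)] by simp
    qed (use True r0' mem in auto)
    then have "(\<Sum>r\<in>reps. of_bool (w \<in> nb x (y + sm r x))) = (\<Sum>r\<in>reps. if r = r0 then 1 else (0::complex))"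
      by (intro sum.cong) auto
    then show ?thesis using n r0 finite_reps by simp
  next
    case False
    then have "w \<in> nb y x"
      unfolding mem' using nz by (cases "X = 0"; cases "Y = 0") (auto simp: prime_power_iff val_divide)
    moreover have "w \<notin> nb x (y + sm r x)" if "r \<in> reps" for r
    proof
      assume "w \<in> nb x (y + sm r x)"
      then have *: "X \<noteq> 0" "Y / X + r \<in> \<P>" unfolding mem by auto
      from pp_diff[OF P_in_O[OF *(2)] reps_in_O[OF that]] have "Y / X \<in> \<O>" by simp
      then show False using False * by simp
    qed
    ultimately show ?thesis by simp
  qed
qed

lemma nb_children:
  assumes xy: "det2 x y \<noteq> 0"
  shows "nb x y \<subseteq> (\<Union>r\<in>reps. nb (sm \<pi> x) (y + sm (\<pi> * r) x))"
proof
  fix w assume "w \<in> nb x y"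
  then obtain b z where w: "b \<noteq> 0" "z \<in> \<P>" "w = sm b (y + sm z x)" using nb_repr[OF xy] by blast
  obtain c where c: "c \<in> \<O>" "z = \<pi> * c" using w(2) P_iff_pi by blast
  from exists_rep[OF c(1)] obtain r where r: "r \<in> reps" "c - r \<in> \<P>" by blast
  have "w = sm b ((y + sm (\<pi> * r) x) + sm (c - r) (sm \<pi> x))"
    by (simp add: w(3) c sm_def prod_eq_iff algebra_simps)
  also have "\<dots> \<in> nb (sm \<pi> x) (y + sm (\<pi> * r) x)"
    by (rule nb_memI[OF _ w(1) r(2)]) (use xy in \<open>simp add: det2_simps\<close>)
  finally show "w \<in> (\<Union>r\<in>reps. nb (sm \<pi> x) (y + sm (\<pi> * r) x))" using r(1) by blast
qed

lemma nb_open: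
  assumes w: "w \<in> nb x y" and x': "det2 x' w \<noteq> 0"
  shows "\<exists>k0. \<forall>k\<ge>k0. nb (sm (\<pi> ^ k) x') w \<subseteq> nb x y"
proof -
  define X Y A B where "X = det2 x w" and "Y = det2 y w" and "A = det2 x x' / X" and "B = det2 y x' / X"
  have XY: "X \<noteq> 0" "Y / X \<in> \<P>" using w by (simp_all add: nb_def X_def Y_def)
  obtain k1 where k1: "\<forall>k\<ge>k1. \<pi> ^ k * A \<in> \<O>" using eventually_pi_power_pp by blast
  obtain k2 where k2: "\<forall>k\<ge>k2. \<pi> ^ k * B \<in> \<O>" using eventually_pi_power_pp by blast
  have "t \<in> nb x y" if k: "k \<ge> max k1 k2" and t: "t \<in> nb (sm (\<pi> ^ k) x') w" for k t
  proof -
    have "det2 (sm (\<pi> ^ k) x') w \<noteq> 0" using x' by (simp add: det2_simps)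
    from nb_repr[OF this t] obtain b z where
      t: "b \<noteq> 0" "z \<in> \<P>" "t = sm b (w + sm z (sm (\<pi> ^ k) x'))" by blast
    have "det2 x t = b * X * (1 + z * (\<pi> ^ k * A))" "det2 y t = b * X * (Y / X + z * (\<pi> ^ k * B))"
      using XY(1) by (simp_all add: t det2_simps A_def B_def flip: X_def Y_def) (simp_all add: field_simps)
    moreover have "unit (1 + z * (\<pi> ^ k * A))"
      by (rule unit_add[OF unit_1 pp_mult_O(1)[OF t(2)]]) (use k k1 in auto)
    moreover have "Y / X + z * (\<pi> ^ k * B) \<in> \<P>"
      by (rule pp_add[OF XY(2) pp_mult_O(1)[OF t(2)]]) (use k k2 in auto)
    ultimately show ?thesis
      using XY(1) t(1) by (simp add: nb_def unit_nonzero unit_mult_pp_iff(3))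
  qed
  then show ?thesis by blast
qed

text \<open>Norm zero forces the split algebra, and the nonzero vectors of norm zero lie on its two
  coordinate axes, which are ideals.\<close>

lemma singular_eigenvector:
  assumes "nm w = 0" "w \<noteq> 0" "nm s \<noteq> 0"
  shows "\<exists>c. c \<noteq> 0 \<and> s \<odot> w = sm c w"
proof -
  have sq: "is_sq d" using nm_eq_0_field assms(1,2) by blast
  show ?thesis
  proof (cases "fst w = 0")
    case True
    then show ?thesis using assms sq
      by (intro exI[of _ "snd s"]) (auto simp: nm_split L_mult_def sm_def prod_eq_iff)
  next
    case False
    then show ?thesis using assms sq
      by (intro exI[of _ "fst s"]) (auto simp: nm_split L_mult_def sm_def prod_eq_iff)
  qed
qed

section \<open>Small open subgroups of the torus\<close>

definition bx :: "nat \<Rightarrow> ('f \<times> 'f) set" where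
  "bx N = {w. fst w \<in> prime_power v (int N) \<and> snd w \<in> prime_power v (int N)}"

text \<open>Scalars are included because only the line through a vector matters. For growing N these
  sets shrink to the scalars. For N = 0 they contain vectors that are not invertible, hence the
  recurring hypothesis N \<ge> 1.\<close>

definition small :: "nat \<Rightarrow> ('f \<times> 'f) set" where
  "small N = {sm z (one + w) | z w. z \<noteq> 0 \<and> w \<in> bx N}"

lemma bx_add: "w \<in> bx N \<Longrightarrow> u \<in> bx N \<Longrightarrow> w + u \<in> bx N"
  by (simp add: bx_def pp_add)

lemma bx_in_O: "w \<in> bx N \<Longrightarrow> fst w \<in> \<O> \<and> snd w \<in> \<O>"
  by (auto simp: bx_def elim: pp_mono)

lemma bx_mult:
  assumes w: "w \<in> bx N" and u: "u \<in> bx M" shows "w \<odot> u \<in> bx N"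
proof -
  have 1: "fst w \<in> prime_power v (int N)" "snd w \<in> prime_power v (int N)" using w by (auto simp: bx_def)
  have 2: "fst u \<in> \<O>" "snd u \<in> \<O>" using bx_in_O[OF u] by auto
  have "fst w * fst u \<in> prime_power v (int N)" "snd w * snd u \<in> prime_power v (int N)"
    "fst w * snd u \<in> prime_power v (int N)" "snd w * fst u \<in> prime_power v (int N)"
    using 1 2 pp_mult_O(1) by blast+
  then show ?thesis by (simp add: bx_def L_mult_def pp_add pp_mult_O(2)[OF d_int])
qed

lemma nm_one_bx:
  assumes w: "w \<in> bx N" and N: "N \<ge> 1" shows "nm (one + w) \<noteq> 0"
proof -
  have P: "fst w \<in> \<P>" "snd w \<in> \<P>" using w N by (auto simp: bx_def elim: pp_mono)
  have u: "unit (1 + fst w)" "unit (1 + snd w)" using P by (simp_all add: unit_add)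
  have "unit ((1 + fst w) * (1 + fst w) - d * (snd w * snd w))"
    by (rule unit_diff[OF unit_mult[OF u(1) u(1)]])
      (rule pp_mult_O(2)[OF d_int pp_mult_O(1)[OF P(2) P_in_O[OF P(2)]]])
  moreover have "unit ((1 + fst w) * (1 + snd w))" by (rule unit_mult[OF u])
  ultimately show ?thesis
    using unit_nonzero by (auto simp: L_norm_def L_mult_def L_conj_def L_of_def)
qed

lemma small_nm: "N \<ge> 1 \<Longrightarrow> k \<in> small N \<Longrightarrow> nm k \<noteq> 0"
  unfolding small_def using nm_one_bx by (auto simp: nm_sm)

lemma small_one: "one \<in> small N"
proof -
  have "one = sm 1 (one + 0)" "(1::'f) \<noteq> 0" "(0 :: 'f \<times> 'f) \<in> bx N"
    by (simp_all add: sm_simps bx_def)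
  then show ?thesis unfolding small_def by blast
qed

lemma small_mult:
  assumes "k \<in> small N" "l \<in> small N" shows "k \<odot> l \<in> small N"
proof -
  obtain z w where k: "k = sm z (one + w)" "z \<noteq> 0" "w \<in> bx N" using assms by (auto simp: small_def)
  obtain y u where l: "l = sm y (one + u)" "y \<noteq> 0" "u \<in> bx N" using assms by (auto simp: small_def)
  have "k \<odot> l = sm (z * y) (one + (w + u + w \<odot> u))"
    by (simp add: k l L_mult_laws(3-8) sm_simps algebra_simps)
  moreover have "w + u + w \<odot> u \<in> bx N" using k l by (intro bx_add bx_mult)
  ultimately show ?thesis unfolding small_def using k l mult_eq_0_iff by blast
qed

lemma small_inverse:
  assumes N: "N \<ge> 1" and k: "k \<in> small N" shows "linv k \<in> small N"
proof -
  obtain z w where k': "k = sm z (one + w)" "z \<noteq> 0" "w \<in> bx N" using k by (auto simp: small_def)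
  have "L_conj d k = sm z (one + L_conj d w)"
    by (simp add: k' L_conj_def sm_def L_of_def)
  then have "linv k = sm (1 / nm k * z) (one + L_conj d w)" by (simp add: linv_def sm_simps)
  moreover have "L_conj d w \<in> bx N" using k'(3) by (auto simp: bx_def L_conj_def)
  moreover have "1 / nm k * z \<noteq> 0" using small_nm[OF N k] k' by simp
  ultimately show ?thesis unfolding small_def by blast
qed

lemma small_mono: "N \<le> M \<Longrightarrow> small M \<subseteq> small N"
  unfolding small_def bx_def by (auto elim: pp_mono) (metis of_nat_mono pp_mono)

lemma pp_bounded_multiplier:
  assumes "finite C" shows "\<exists>n\<ge>1::nat. \<forall>c\<in>C. \<forall>u\<in>prime_power v (int n). u * c \<in> \<P>"
  using assms
proof (induction C)
  case (insert c C)
  then obtain n where n: "n \<ge> 1" "\<forall>c\<in>C. \<forall>u\<in>prime_power v (int n). u * c \<in> \<P>" by blast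
  define m where "m = max n (nat (1 - v c))"
  have "u * c \<in> \<P>" if "u \<in> prime_power v (int m)" for u
    using that by (cases "u = 0 \<or> c = 0") (auto simp: prime_power_iff val_mult m_def)
  moreover have "u \<in> prime_power v (int n)" if "u \<in> prime_power v (int m)" for u
    using that by (rule pp_mono) (simp add: m_def)
  ultimately show ?case using n by (intro exI[of _ m]) (auto simp: m_def)
qed auto

text \<open>In the basis \<open>x, y\<close> multiplication by \<open>one + w\<close> has the
  identity matrix modulo \<pp> once \<open>w\<close> is small. It then lies in the Iwahori subgroup
  and fixes the ball.\<close>

lemma nb_stable:
  assumes xy: "det2 x y \<noteq> 0"
  shows "\<exists>N0\<ge>1. \<forall>N\<ge>N0. \<forall>k\<in>small N. \<forall>t. t \<odot> k \<in> nb x y \<longleftrightarrow> t \<in> nb x y"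
proof -
  define D where "D = det2 x y"
  define a where "a e = det2 (e \<odot> x) y / D" for e
  define b where "b e = det2 x (e \<odot> x) / D" for e
  define c where "c e = det2 (e \<odot> y) y / D" for e
  define g where "g e = det2 x (e \<odot> y) / D" for e
  let ?e1 = "(1, 0) :: 'f \<times> 'f" and ?e2 = "(0, 1) :: 'f \<times> 'f"
  obtain n where n: "n \<ge> 1" "\<forall>h\<in>{a ?e1, a ?e2, b ?e1, b ?e2, c ?e1, c ?e2, g ?e1, g ?e2}.
      \<forall>u\<in>prime_power v (int n). u * h \<in> \<P>"
    using pp_bounded_multiplier[of "{a ?e1, a ?e2, b ?e1, b ?e2, c ?e1, c ?e2, g ?e1, g ?e2}"] by auto
  have "t \<odot> k \<in> nb x y \<longleftrightarrow> t \<in> nb x y" if N: "N \<ge> n" and k: "k \<in> small N" for N k t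
  proof -
    obtain z w where kz: "k = sm z (one + w)" "z \<noteq> 0" "w \<in> bx N" using k by (auto simp: small_def)
    have w: "fst w \<in> prime_power v (int n)" "snd w \<in> prime_power v (int n)"
      using kz(3) N by (auto simp: bx_def elim: pp_mono)
    \<comment> \<open>The four matrix coefficients are linear in \<open>w\<close>, so bounding them
      at the two unit vectors gives a uniform \<open>n\<close>.\<close>
    have lin: "a w = fst w * a ?e1 + snd w * a ?e2" "b w = fst w * b ?e1 + snd w * b ?e2"
      "c w = fst w * c ?e1 + snd w * c ?e2" "g w = fst w * g ?e1 + snd w * g ?e2"
    proof -
      have "w = sm (fst w) ?e1 + sm (snd w) ?e2" by (simp add: sm_def)
      then have "w \<odot> u = sm (fst w) (?e1 \<odot> u) + sm (snd w) (?e2 \<odot> u)" for u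
        by (metis L_mult_laws(6,7))
      then show "a w = fst w * a ?e1 + snd w * a ?e2" "b w = fst w * b ?e1 + snd w * b ?e2"
      "c w = fst w * c ?e1 + snd w * c ?e2" "g w = fst w * g ?e1 + snd w * g ?e2"
        by (simp_all add: a_def b_def c_def g_def det2_simps add_divide_distrib)
    qed
    have P: "a w \<in> \<P>" "b w \<in> \<P>" "c w \<in> \<P>" "g w \<in> \<P>"
      unfolding lin using n(2) w by (auto intro!: pp_add)
    define l where "l = one + w"
    have nl: "nm l \<noteq> 0" unfolding l_def using nm_one_bx[OF kz(3)] n(1) N by simp
    have "w \<odot> x = sm (a w) x + sm (b w) y" "w \<odot> y = sm (c w) x + sm (g w) y"
      unfolding a_def b_def c_def g_def D_def by (rule det2_coords[OF xy])+
    then have "l \<odot> x = sm (1 + a w) x + sm (b w) y" "l \<odot> y = sm (c w) x + sm (1 + g w) y"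
      by (simp_all add: l_def L_mult_laws(3,6) sm_simps algebra_simps)
    then have eq: "nb (l \<odot> x) (l \<odot> y) = nb x y"
      using nb_iwahori[OF xy unit_add[OF unit_1 P(1)] P_in_O[OF P(2)] P(3) unit_add[OF unit_1 P(4)]]
      by simp
    have "t \<odot> k = sm z (l \<odot> t)" by (simp add: kz(1) L_mult_laws(8) L_mult_laws(1)[of t] l_def)
    then have "t \<odot> k \<in> nb x y \<longleftrightarrow> l \<odot> t \<in> nb (l \<odot> x) (l \<odot> y)"
      by (simp add: eq nb_sm kz(2))
    then show ?thesis by (simp add: nb_mult nl)
  qed
  then show ?thesis using n(1) by blast
qed

section \<open>Integration by counting cosets\<close>

definition cl :: "nat \<Rightarrow> 'f \<times> 'f \<Rightarrow> ('f \<times> 'f) set" where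
  "cl N t = (\<lambda>k. t \<odot> k) ` small N"

definition stable :: "nat \<Rightarrow> ('f \<times> 'f \<Rightarrow> complex) \<Rightarrow> bool" where
  "stable N f \<longleftrightarrow> (\<forall>t. \<forall>k\<in>small N. nm t \<noteq> 0 \<longrightarrow> f (t \<odot> k) = f t)"

definition supp :: "('f \<times> 'f \<Rightarrow> complex) \<Rightarrow> ('f \<times> 'f) set" where
  "supp f = {t. nm t \<noteq> 0 \<and> f t \<noteq> 0}"

text \<open>The sum of a function on \<open>L\<^sup>\<times>\<close> over the cosets of \<open>F\<^sup>\<times> (1 + \<pp>\<^sup>N \<oo>\<^sub>L)\<close>.\<close>

definition coset_sum :: "nat \<Rightarrow> ('f \<times> 'f \<Rightarrow> complex) \<Rightarrow> complex" where
  "coset_sum N f = (\<Sum>C\<in>cl N ` supp f. f (SOME t. t \<in> C))"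

lemma cl_self: "t \<in> cl N t"
  unfolding cl_def using small_one[of N] L_mult_laws(4)[of t] by (metis imageI)

lemma cl_eq:
  assumes N: "N \<ge> 1" and s: "s \<in> cl N t"
  shows "cl N s = cl N t"
proof -
  obtain k where k: "k \<in> small N" "s = t \<odot> k" using s by (auto simp: cl_def)
  have nk: "nm k \<noteq> 0" using small_nm[OF N k(1)] .
  have "\<exists>l'\<in>small N. s \<odot> l = t \<odot> l'" if "l \<in> small N" for l
    using small_mult[OF k(1) that] k(2) L_mult_laws(2)[of t k l] by metis
  moreover have "\<exists>l'\<in>small N. t \<odot> l = s \<odot> l'" if "l \<in> small N" for l
  proof
    show "linv k \<odot> l \<in> small N" by (rule small_mult[OF small_inverse[OF N k(1)] that])
    show "t \<odot> l = s \<odot> (linv k \<odot> l)" using linv_cancel(2)[OF nk] by (simp add: k(2) L_mult_laws(2))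
  qed
  ultimately show ?thesis unfolding cl_def by blast
qed

lemma cl_mono: "N \<le> M \<Longrightarrow> cl M t \<subseteq> cl N t"
  unfolding cl_def using small_mono by blast

lemma some_cl: "(SOME s. s \<in> cl N t) \<in> cl N t"
  by (rule someI[of _ t]) (rule cl_self)

lemma stable_cl: "stable N f \<Longrightarrow> nm t \<noteq> 0 \<Longrightarrow> s \<in> cl N t \<Longrightarrow> f s = f t"
  unfolding stable_def cl_def by blast

lemma stable_some: "stable N f \<Longrightarrow> nm t \<noteq> 0 \<Longrightarrow> f (SOME s. s \<in> cl N t) = f t"
  using stable_cl some_cl by blast

lemma cl_nm: "N \<ge> 1 \<Longrightarrow> nm t \<noteq> 0 \<Longrightarrow> s \<in> cl N t \<Longrightarrow> nm s \<noteq> 0"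
  unfolding cl_def using small_nm by (auto simp: nm_mult)

lemma stable_mono: "stable N f \<Longrightarrow> N \<le> M \<Longrightarrow> stable M f"
  unfolding stable_def using small_mono by blast

lemma coset_sum_superset:
  assumes f: "stable N f" and A: "finite (cl N ` A)" "supp f \<subseteq> A" "\<And>t. t \<in> A \<Longrightarrow> nm t \<noteq> 0"
  shows "coset_sum N f = (\<Sum>C\<in>cl N ` A. f (SOME t. t \<in> C))"
  unfolding coset_sum_def
proof (rule sum.mono_neutral_left[OF A(1)])
  show "cl N ` supp f \<subseteq> cl N ` A" using A(2) by blast
  show "\<forall>C\<in>cl N ` A - cl N ` supp f. f (SOME t. t \<in> C) = 0"
  proof
    fix C assume C: "C \<in> cl N ` A - cl N ` supp f"
    then obtain t where t: "t \<in> A" "C = cl N t" by blast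
    then have "t \<notin> supp f" using C by blast
    then show "f (SOME t. t \<in> C) = 0"
      using stable_some[OF f A(3)[OF t(1)]] A(3)[OF t(1)] by (simp add: t supp_def)
  qed
qed

lemma coset_sum_lincomb:
  assumes f: "stable N f" "finite (cl N ` supp f)" and g: "stable N g" "finite (cl N ` supp g)"
  shows "coset_sum N (\<lambda>t. a * f t + b * g t) = a * coset_sum N f + b * coset_sum N g"
proof -
  let ?A = "supp f \<union> supp g"
  have fin: "finite (cl N ` ?A)" using f g by (simp add: image_Un)
  have st: "stable N (\<lambda>t. a * f t + b * g t)" using f g by (simp add: stable_def)
  have A: "supp (\<lambda>t. a * f t + b * g t) \<subseteq> ?A" "supp f \<subseteq> ?A" "supp g \<subseteq> ?A"
    by (auto simp: supp_def)
  have n: "nm t \<noteq> 0" if "t \<in> ?A" for t using that by (auto simp: supp_def)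
  have "coset_sum N (\<lambda>t. a * f t + b * g t) =
      (\<Sum>C\<in>cl N ` ?A. a * f (SOME t. t \<in> C) + b * g (SOME t. t \<in> C))"
    "coset_sum N f = (\<Sum>C\<in>cl N ` ?A. f (SOME t. t \<in> C))"
    "coset_sum N g = (\<Sum>C\<in>cl N ` ?A. g (SOME t. t \<in> C))"
    by (rule coset_sum_superset[OF st fin A(1) n] coset_sum_superset[OF f(1) fin A(2) n]
      coset_sum_superset[OF g(1) fin A(3) n], assumption)+
  then show ?thesis by (simp add: sum.distrib sum_distrib_left)
qed

lemma cl_mult: "(\<lambda>t. s \<odot> t) ` cl N t = cl N (s \<odot> t)"
  by (simp add: cl_def image_image L_mult_laws(2))

lemma inj_mult: "nm s \<noteq> 0 \<Longrightarrow> inj (\<lambda>t. s \<odot> t)"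
  by (rule injI) (metis linv_cancel(1))

lemma coset_sum_translate:
  assumes f: "stable N f" and s: "nm s \<noteq> 0"
  shows "coset_sum N (\<lambda>t. f (s \<odot> t)) = coset_sum N f"
proof -
  let ?g = "\<lambda>t. f (s \<odot> t)" and ?h = "\<lambda>C. (\<lambda>t. s \<odot> t) ` C"
  have st: "stable N ?g"
    unfolding stable_def
  proof (intro allI ballI impI)
    fix t k assume "k \<in> small N" "nm t \<noteq> 0"
    then show "f (s \<odot> (t \<odot> k)) = f (s \<odot> t)"
      using f[unfolded stable_def, rule_format, of k "s \<odot> t"] s
      by (simp add: nm_mult L_mult_laws(2))
  qed
  have inj: "inj_on ?h (cl N ` supp ?g)"
    by (rule inj_onI) (simp add: inj_image_eq_iff[OF inj_mult[OF s]])
  have "supp f = (\<lambda>t. s \<odot> t) ` supp ?g"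
  proof (intro equalityI subsetI)
    fix t assume "t \<in> supp f"
    then have "linv s \<odot> t \<in> supp ?g" using s nm_linv[OF s] by (simp add: supp_def nm_mult linv_cancel)
    then show "t \<in> (\<lambda>t. s \<odot> t) ` supp ?g" using linv_cancel(2)[OF s, of t] by (metis imageI)
  qed (use s in \<open>auto simp: supp_def nm_mult\<close>)
  then have eq: "cl N ` supp f = ?h ` (cl N ` supp ?g)"
    by (simp add: image_image cl_mult)
  have "f (SOME t. t \<in> ?h C) = ?g (SOME t. t \<in> C)" if C: "C \<in> cl N ` supp ?g" for C
  proof -
    obtain t where t: "nm t \<noteq> 0" "C = cl N t" using C by (auto simp: supp_def)
    then show ?thesis using stable_some[OF f, of "s \<odot> t"] stable_some[OF st t(1)] s
      by (simp add: cl_mult nm_mult)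
  qed
  then show ?thesis
    unfolding coset_sum_def eq sum.reindex[OF inj] by (intro sum.cong) auto
qed

text \<open>Every coset of \<open>small N\<close> splits into the same number of cosets of
  \<open>small M\<close>, namely as many as \<open>small N\<close> itself. The map \<open>g\<close>
  sends a fine coset to the coarse one containing it.\<close>

lemma coset_sum_refine:
  assumes f: "stable N f" and NM: "N \<le> M" "N \<ge> 1" and fin: "finite (cl M ` supp f)"
  shows "coset_sum M f = of_nat (card (cl M ` small N)) * coset_sum N f"
proof -
  have fM: "stable M f" by (rule stable_mono[OF f NM(1)])
  define g where "g C = cl N (SOME t. t \<in> C)" for C
  have M: "M \<ge> 1" using NM by simp
  have g: "g (cl M t) = cl N t" if "nm t \<noteq> 0" for t
    unfolding g_def using some_cl[of M t] cl_mono[OF NM(1)] cl_eq[OF NM(2)] by blast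
  have img: "g ` (cl M ` supp f) = cl N ` supp f"
    unfolding image_image by (rule image_cong[OF refl]) (simp add: g supp_def)
  have "(\<Sum>C'\<in>{C' \<in> cl M ` supp f. g C' = C}. f (SOME t. t \<in> C')) =
      of_nat (card (cl M ` small N)) * f (SOME t. t \<in> C)" if C: "C \<in> cl N ` supp f" for C
  proof -
    obtain t where t: "nm t \<noteq> 0" "f t \<noteq> 0" "C = cl N t" using C by (auto simp: supp_def)
    have sub: "s \<in> supp f" "f s = f t" "nm s \<noteq> 0" if "s \<in> cl N t" for s
      using that cl_nm[OF NM(2) t(1)] stable_cl[OF f t(1)] t(2) by (auto simp: supp_def)
    have "{C' \<in> cl M ` supp f. g C' = C} = cl M ` cl N t"
    proof (intro equalityI subsetI)
      fix C' assume "C' \<in> {C' \<in> cl M ` supp f. g C' = C}"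
      then obtain s where s: "s \<in> supp f" "C' = cl M s" "g C' = C" by blast
      then have "cl N s = cl N t" using g t by (simp add: supp_def)
      then have "s \<in> cl N t" using cl_self by blast
      then show "C' \<in> cl M ` cl N t" using s by blast
    next
      fix C' assume "C' \<in> cl M ` cl N t"
      then obtain s where s: "s \<in> cl N t" "C' = cl M s" by blast
      then show "C' \<in> {C' \<in> cl M ` supp f. g C' = C}"
        using sub[OF s(1)] g cl_eq[OF NM(2) s(1)] t(3) by simp
    qed
    also have "\<dots> = (\<lambda>C. (\<lambda>u. t \<odot> u) ` C) ` (cl M ` small N)"
      unfolding cl_def[of N] by (simp add: image_image cl_mult)
    finally have eq: "{C' \<in> cl M ` supp f. g C' = C} = (\<lambda>C. (\<lambda>u. t \<odot> u) ` C) ` (cl M ` small N)"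
      and eq': "{C' \<in> cl M ` supp f. g C' = C} = cl M ` cl N t"
      using \<open>{C' \<in> cl M ` supp f. g C' = C} = cl M ` cl N t\<close> by auto
    have "inj_on (\<lambda>C. (\<lambda>u. t \<odot> u) ` C) (cl M ` small N)"
      by (rule inj_onI) (simp add: inj_image_eq_iff[OF inj_mult[OF t(1)]])
    then have card: "card {C' \<in> cl M ` supp f. g C' = C} = card (cl M ` small N)"
      unfolding eq by (rule card_image)
    have "f (SOME t. t \<in> C') = f t" if C': "C' \<in> {C' \<in> cl M ` supp f. g C' = C}" for C'
    proof -
      obtain s where s: "s \<in> cl N t" "C' = cl M s" using C' unfolding eq' by blast
      then show ?thesis using stable_some[OF fM sub(3)[OF s(1)]] sub[OF s(1)] by simp
    qed
    then have "(\<Sum>C'\<in>{C' \<in> cl M ` supp f. g C' = C}. f (SOME t. t \<in> C')) =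
        (\<Sum>C'\<in>{C' \<in> cl M ` supp f. g C' = C}. f t)" by (rule sum.cong[OF refl])
    then show ?thesis using card stable_some[OF f t(1)] t(3) by simp
  qed
  then have "(\<Sum>C\<in>cl N ` supp f. \<Sum>C'\<in>{C' \<in> cl M ` supp f. g C' = C}. f (SOME t. t \<in> C')) =
      of_nat (card (cl M ` small N)) * coset_sum N f"
    by (simp add: coset_sum_def sum_distrib_left)
  moreover have "finite (cl N ` supp f)" using fin img by (metis finite_imageI)
  ultimately show ?thesis
    using sum.group[OF fin, of "cl N ` supp f" g "\<lambda>C. f (SOME t. t \<in> C)"] img
    by (simp add: coset_sum_def)
qed

text \<open>Compactness: a set of points of the projective line that stays away from the fixed points of
  \<open>L\<^sup>\<times>\<close> meets only finitely many cosets.\<close>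

lemma finite_cosets:
  assumes A: "\<And>t. t \<in> A \<Longrightarrow> nm t \<noteq> 0" and N: "N \<ge> 1"
    and sing: "\<And>x w. w \<noteq> 0 \<Longrightarrow> nm w = 0 \<Longrightarrow> det2 x w \<noteq> 0 \<Longrightarrow> \<exists>k. A \<inter> nb (sm (\<pi> ^ k) x) w = {}"
  shows "finite (cl N ` A)"
proof -
  have fin: "finite (cl N ` (A \<inter> nb x y))" if "det2 x y \<noteq> 0" for x y
  proof (rule tree_descent[OF that, where R = "\<lambda>x y. finite (cl N ` (A \<inter> nb x y))"])
    fix x y z assume "det2 x y \<noteq> 0" "z \<in> \<P>" "finite (cl N ` (A \<inter> nb x y))"
    then show "finite (cl N ` (A \<inter> nb x (y + sm z x)))" by (simp add: nb_shift)
  next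
    fix x y assume xy: "det2 x y \<noteq> 0"
      and *: "\<And>r. r \<in> \<O> \<Longrightarrow> finite (cl N ` (A \<inter> nb (sm \<pi> x) (y + sm (\<pi> * r) x)))"
    have "cl N ` (A \<inter> nb x y) \<subseteq> (\<Union>r\<in>reps. cl N ` (A \<inter> nb (sm \<pi> x) (y + sm (\<pi> * r) x)))"
      using nb_children[OF xy] by blast
    moreover have "finite (\<Union>r\<in>reps. cl N ` (A \<inter> nb (sm \<pi> x) (y + sm (\<pi> * r) x)))"
      by (rule finite_UN_I[OF finite_reps *[OF reps_in_O]])
    ultimately show "finite (cl N ` (A \<inter> nb x y))" by (rule finite_subset)
  next
    fix w assume w: "det2 x w \<noteq> 0" "w \<noteq> 0"
    show "\<exists>k. finite (cl N ` (A \<inter> nb (sm (\<pi> ^ k) x) w))"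
    proof (cases "nm w = 0")
      case True
      from sing[OF w(2) True w(1)] obtain k where "A \<inter> nb (sm (\<pi> ^ k) x) w = {}" ..
      then show ?thesis by (intro exI[of _ k]) simp
    next
      case False
      \<comment> \<open>Near an invertible \<open>w\<close> a point has the form w (1 + z \<pi>^k
        y), up to a scalar. For large k the second factor lies in \<open>small N\<close>, so the
        whole ball meets a single coset.\<close>
      define y where "y = linv w \<odot> x"
      have wy: "w \<odot> y = x" by (simp add: y_def linv_cancel False)
      obtain k1 where k1: "\<forall>k\<ge>k1. \<pi> ^ k * fst y \<in> prime_power v (int N)"
        using eventually_pi_power_pp by blast
      obtain k2 where k2: "\<forall>k\<ge>k2. \<pi> ^ k * snd y \<in> prime_power v (int N)"
        using eventually_pi_power_pp by blast
      define k where "k = max k1 k2"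
      have "cl N t = cl N w" if t: "t \<in> nb (sm (\<pi> ^ k) x) w" for t
      proof -
        have "det2 (sm (\<pi> ^ k) x) w \<noteq> 0" using w by (simp add: det2_simps)
        from nb_repr[OF this t] obtain b z where
          t: "b \<noteq> 0" "z \<in> \<P>" "t = sm b (w + sm z (sm (\<pi> ^ k) x))" by blast
        define u where "u = sm z (sm (\<pi> ^ k) y)"
        have "u \<in> bx N"
          using k1 k2 pp_mult_O(2)[OF P_in_O[OF t(2)]] by (simp add: u_def bx_def sm_def k_def)
        then have "sm b (one + u) \<in> small N" using t(1) unfolding small_def by blast
        moreover have "t = w \<odot> sm b (one + u)"
          by (simp add: t(3) u_def L_mult_laws(4,5,8) wy)
        ultimately have "t \<in> cl N w" unfolding cl_def by blast
        then show ?thesis by (rule cl_eq[OF N])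
      qed
      then have "cl N ` (A \<inter> nb (sm (\<pi> ^ k) x) w) \<subseteq> {cl N w}" by blast
      then show ?thesis using finite_subset by blast
    qed
  qed
  \<comment> \<open>Two complementary balls cover the projective line.\<close>
  have "A \<subseteq> nb \<theta> one \<union> nb one (sm \<pi> \<theta>)"
  proof
    fix t assume "t \<in> A"
    then have "t \<noteq> 0" using A[of t] nm_sm[of 0 0] by (auto simp: sm_simps)
    then show "t \<in> nb \<theta> one \<union> nb one (sm \<pi> \<theta>)" using nb_flip[OF det2_theta] by blast
  qed
  then have "cl N ` A \<subseteq> cl N ` (A \<inter> nb \<theta> one) \<union> cl N ` (A \<inter> nb one (sm \<pi> \<theta>))" by blast
  moreover have "det2 one (sm \<pi> \<theta>) \<noteq> 0"
    using det2_theta by (simp add: det2_simps det2_swap[of one \<theta>])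
  ultimately show ?thesis using fin[OF det2_theta] fin finite_subset by blast
qed

text \<open>The normalising set, which receives volume 1. Its points are all invertible, so it meets
  only finitely many cosets at each level.\<close>

abbreviation nbhd :: "'f \<times> 'f \<Rightarrow> complex" where
  "nbhd t \<equiv> of_bool (t \<in> nb \<theta> one)"

lemma nb_theta_nm: "t \<in> nb \<theta> one \<Longrightarrow> nm t \<noteq> 0"
  using nb_repr[OF det2_theta, of t] nm_one_theta by (metis mult_eq_0_iff nm_sm power_eq_0_iff)

lemma nb_complement_open:
  assumes xy: "det2 x y \<noteq> 0" and w: "w \<noteq> 0" "w \<notin> nb x y" and x': "det2 x' w \<noteq> 0"
  shows "\<exists>k0. \<forall>k\<ge>k0. nb (sm (\<pi> ^ k) x') w \<inter> nb x y = {}"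
proof -
  have "w \<in> nb y (sm \<pi> x)" using nb_flip[OF xy w(1)] w(2) by simp
  from nb_open[OF this x'] obtain k0 where k0: "\<forall>k\<ge>k0. nb (sm (\<pi> ^ k) x') w \<subseteq> nb y (sm \<pi> x)"
    by blast
  have "t \<notin> nb x y" if "t \<in> nb y (sm \<pi> x)" for t
  proof -
    have "t \<noteq> 0" using that by (auto simp: nb_def det2_simps)
    then show ?thesis using nb_flip[OF xy] that by blast
  qed
  then show ?thesis using k0 by blast
qed

lemma nbhd_cosets:
  assumes N: "N \<ge> 1" shows "finite (cl N ` nb \<theta> one)"
proof (rule finite_cosets[OF nb_theta_nm N])
  fix x w :: "'f \<times> 'f" assume w: "w \<noteq> 0" "nm w = 0" "det2 x w \<noteq> 0"
  then have "w \<notin> nb \<theta> one" using nb_theta_nm by blast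
  from nb_complement_open[OF det2_theta w(1) this w(3)]
  show "\<exists>k. nb \<theta> one \<inter> nb (sm (\<pi> ^ k) x) w = {}" by blast
qed

lemma one_in_nb: "one \<in> nb \<theta> one"
  using nb_memI[OF det2_theta one_neq_zero pp_0] by (simp add: sm_simps)

lemma coset_sum_indicator:
  assumes N: "N \<ge> 1" and st: "stable N (\<lambda>t. of_bool (t \<in> A))" and A: "A \<subseteq> nb \<theta> one" "A \<noteq> {}"
  shows "coset_sum N (\<lambda>t. of_bool (t \<in> A)) \<noteq> 0"
proof -
  let ?f = "\<lambda>t. of_bool (t \<in> A) :: complex"
  have supp: "supp ?f = A" using A(1) nb_theta_nm by (auto simp: supp_def)
  have "?f (SOME t. t \<in> C) = 1" if C: "C \<in> cl N ` A" for C
  proof -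
    obtain t where t: "t \<in> A" "C = cl N t" using C by blast
    then have "nm t \<noteq> 0" using A nb_theta_nm by blast
    from stable_some[OF st this] show ?thesis unfolding t(2) using t(1) by simp
  qed
  then have "coset_sum N ?f = of_nat (card (cl N ` A))"
    unfolding coset_sum_def supp by simp
  moreover have "finite (cl N ` A)" using nbhd_cosets[OF N] A(1) by (meson finite_subset image_mono)
  ultimately show ?thesis using A(2) by (simp add: card_eq_0_iff)
qed

text \<open>Invariance of \<open>nbhd\<close> is included so that numerator and denominator of
  \<open>haar\<close> can be taken at the same level.\<close>

definition admissible :: "nat \<Rightarrow> ('f \<times> 'f \<Rightarrow> complex) \<Rightarrow> bool" where
  "admissible N f \<longleftrightarrow> N \<ge> 1 \<and> stable N f \<and> stable N nbhd"

definition test_fun :: "('f \<times> 'f \<Rightarrow> complex) \<Rightarrow> bool" where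
  "test_fun f \<longleftrightarrow> (\<exists>N. admissible N f) \<and> (\<forall>N\<ge>1. finite (cl N ` supp f))"

definition haar :: "('f \<times> 'f \<Rightarrow> complex) \<Rightarrow> complex" where
  "haar f = (let N = SOME N. admissible N f in coset_sum N f / coset_sum N nbhd)"

lemma admissible_mono: "admissible N f \<Longrightarrow> N \<le> M \<Longrightarrow> admissible M f"
  unfolding admissible_def using stable_mono by (meson le_trans)

text \<open>Refinement multiplies both counts by the same index, so the ratio does not depend on the
  level; two levels are compared through their maximum.\<close>

lemma haar_eq:
  assumes f: "test_fun f" and N: "admissible N f"
  shows "haar f = coset_sum N f / coset_sum N nbhd"
proof -
  have ratio: "coset_sum M f / coset_sum M nbhd = coset_sum N f / coset_sum N nbhd"
    if N: "admissible N f" and NM: "N \<le> M" for N M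
  proof -
    have a: "N \<ge> 1" "stable N f" "stable N nbhd" using N by (auto simp: admissible_def)
    have b: "M \<ge> 1" "stable M nbhd" using admissible_mono[OF N NM] by (auto simp: admissible_def)
    have "supp nbhd = nb \<theta> one" using nb_theta_nm by (auto simp: supp_def)
    then have "finite (cl M ` supp nbhd)" "finite (cl M ` supp f)"
      using nbhd_cosets[OF b(1)] f b(1) by (auto simp: test_fun_def)
    then have eq: "coset_sum M nbhd = of_nat (card (cl M ` small N)) * coset_sum N nbhd"
      "coset_sum M f = of_nat (card (cl M ` small N)) * coset_sum N f"
      using coset_sum_refine[OF _ NM a(1)] a by blast+
    have "nb \<theta> one \<noteq> {}" using one_in_nb by blast
    from coset_sum_indicator[OF b(1) b(2) subset_refl this] have "coset_sum M nbhd \<noteq> 0" .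
    then show ?thesis unfolding eq by simp
  qed
  define K where "K = (SOME N. admissible N f)"
  have K: "admissible K f" unfolding K_def by (rule someI[of _ N]) (rule N)
  have "haar f = coset_sum K f / coset_sum K nbhd" by (simp add: haar_def K_def Let_def)
  also have "\<dots> = coset_sum (max K N) f / coset_sum (max K N) nbhd" by (rule ratio[OF K max.cobounded1, symmetric])
  also have "\<dots> = coset_sum N f / coset_sum N nbhd" by (rule ratio[OF N max.cobounded2])
  finally show ?thesis .
qed

lemma lincomb_test_fun:
  assumes "test_fun f" "test_fun g"
  shows "test_fun (\<lambda>t. a * f t + b * g t)"
    "haar (\<lambda>t. a * f t + b * g t) = a * haar f + b * haar g"
proof -
  obtain N M where NM: "admissible N f" "admissible M g" using assms by (auto simp: test_fun_def)
  define K where "K = max N M"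
  have K: "admissible K f" "admissible K g"
    using admissible_mono[OF NM(1), of K] admissible_mono[OF NM(2), of K] by (auto simp: K_def)
  then have adm: "admissible K (\<lambda>t. a * f t + b * g t)" by (auto simp: admissible_def stable_def)
  have "supp (\<lambda>t. a * f t + b * g t) \<subseteq> supp f \<union> supp g" by (auto simp: supp_def)
  then have "cl N ` supp (\<lambda>t. a * f t + b * g t) \<subseteq> cl N ` supp f \<union> cl N ` supp g" for N by blast
  then have "finite (cl N ` supp (\<lambda>t. a * f t + b * g t))" if "N \<ge> 1" for N
    using that assms by (meson finite_Un finite_subset test_fun_def)
  then show T: "test_fun (\<lambda>t. a * f t + b * g t)" using adm by (auto simp: test_fun_def)
  have K1: "K \<ge> 1" using K by (simp add: admissible_def)
  show "haar (\<lambda>t. a * f t + b * g t) = a * haar f + b * haar g"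
    unfolding haar_eq[OF T adm] haar_eq[OF assms(1) K(1)] haar_eq[OF assms(2) K(2)]
    using coset_sum_lincomb[of K f g a b] K assms K1
    by (simp add: admissible_def test_fun_def add_divide_distrib)
qed

lemma haar_zero: "haar (\<lambda>_. 0) = 0"
  by (simp add: haar_def coset_sum_def supp_def)

lemma test_fun_zero: "test_fun (\<lambda>_. 0)"
proof -
  obtain N where N: "N \<ge> 1" "\<forall>M\<ge>N. \<forall>k\<in>small M. \<forall>t. t \<odot> k \<in> nb \<theta> one \<longleftrightarrow> t \<in> nb \<theta> one"
    using nb_stable[OF det2_theta] by blast
  have "nbhd (t \<odot> k) = nbhd t" if "k \<in> small N" for t k
    using N(2)[rule_format, OF order_refl that, of t] by (simp only:)
  then have "stable N nbhd" unfolding stable_def by blast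
  moreover have "stable N (\<lambda>_. 0)" unfolding stable_def by blast
  ultimately have "admissible N (\<lambda>_. 0)" using N(1) unfolding admissible_def by blast
  then show ?thesis by (auto simp: test_fun_def supp_def)
qed

lemma haar_sum:
  assumes "finite I" "\<And>i. i \<in> I \<Longrightarrow> test_fun (f i)"
  shows "test_fun (\<lambda>t. \<Sum>i\<in>I. f i t) \<and> haar (\<lambda>t. \<Sum>i\<in>I. f i t) = (\<Sum>i\<in>I. haar (f i))"
  using assms
proof (induction I)
  case (insert i I)
  then show ?case using lincomb_test_fun[of "f i" "\<lambda>t. \<Sum>i\<in>I. f i t" 1 1] by simp
qed (simp add: haar_zero test_fun_zero)

end

section \<open>Existence of equivariant harmonic functions\<close>

context quadratic_character
begin

lemma xi_sm: "b \<noteq> 0 \<Longrightarrow> nm u \<noteq> 0 \<Longrightarrow> \<xi> (sm b u) = \<xi> u"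
proof -
  assume a: "b \<noteq> 0" "nm u \<noteq> 0"
  have "sm b u = L_of d b \<odot> u" by (simp add: L_of_eq[of b] L_mult_laws(3,7))
  moreover have "nm (L_of d b) \<noteq> 0" using a by (simp add: L_of_eq[of b] nm_sm)
  ultimately show ?thesis using a xi_mult xi_scalar by simp
qed

lemma xi_small_group: "k \<in> small (Suc cond) \<Longrightarrow> \<xi> k = 1"
  unfolding small_def
proof clarify
  fix z w assume "z \<noteq> (0::'f)" and w: "w \<in> bx (Suc cond)"
  moreover have "nm (one + w) \<noteq> 0" using nm_one_bx[OF w] by simp
  moreover have "\<xi> (one + w) = 1" using w by (intro xi_small) (auto simp: bx_def add.commute)
  ultimately show "\<xi> (sm z (one + w)) = 1" using xi_sm by simp
qed

text \<open>The natural candidate is the integral of \<xi> over \<open>nb x y\<close>. Replacing the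
  indicator of the ball by its difference with its translate by \<open>s\<close> formally multiplies
  this integral by 1 - 1/\<xi>(s) \<noteq> 0, makes the support compact modulo scalars, and forces
  total mass zero, since the indicator of the whole line cancels.\<close>

lemma existence_nontrivial:
  assumes s: "nm s \<noteq> 0" "\<xi> s \<noteq> 1"
  shows "\<exists>\<gamma>. harmonic \<gamma> \<and> equivariant \<xi> \<gamma> \<and> (\<exists>x y. det2 x y \<noteq> 0 \<and> \<gamma> x y \<noteq> 0)"
proof -
  define f where "f x y t = (if nm t = 0 then 0 else
    \<xi> t * (of_bool (t \<in> nb x y) - of_bool (s \<odot> t \<in> nb x y)))" for x y t
  define \<gamma> where "\<gamma> x y = haar (f x y)" for x y
  have stable_f: "\<exists>N. admissible N (f x y)" if xy: "det2 x y \<noteq> 0" for x y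
  proof -
    obtain N1 where N1: "N1 \<ge> 1" "\<forall>N\<ge>N1. \<forall>k\<in>small N. \<forall>t. t \<odot> k \<in> nb x y \<longleftrightarrow> t \<in> nb x y"
      using nb_stable[OF xy] by blast
    obtain N2 where N2: "N2 \<ge> 1" "\<forall>N\<ge>N2. \<forall>k\<in>small N. \<forall>t. t \<odot> k \<in> nb \<theta> one \<longleftrightarrow> t \<in> nb \<theta> one"
      using nb_stable[OF det2_theta] by blast
    define N where "N = max (max N1 N2) (Suc cond)"
    have N: "N \<ge> 1" "N \<ge> N1" "N \<ge> N2" "N \<ge> Suc cond" using N1 by (auto simp: N_def)
    have "f x y (t \<odot> k) = f x y t" if k: "k \<in> small N" and t: "nm t \<noteq> 0" for t k
    proof -
      have nk: "nm k \<noteq> 0" using small_nm[OF N(1) k] .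
      have "k \<in> small (Suc cond)" using small_mono[OF N(4)] k by blast
      then have "\<xi> (t \<odot> k) = \<xi> t" using xi_mult[OF t nk] xi_small_group by simp
      moreover have "t \<odot> k \<in> nb x y \<longleftrightarrow> t \<in> nb x y" "(s \<odot> t) \<odot> k \<in> nb x y \<longleftrightarrow> s \<odot> t \<in> nb x y"
        using N1(2) N(2) k by blast+
      ultimately show ?thesis using t nk by (simp add: f_def nm_mult L_mult_laws(2))
    qed
    then have "admissible N (f x y)"
      using N2(2) N(1,3) by (auto simp: admissible_def stable_def)
    then show ?thesis by blast
  qed
  \<comment> \<open>\<open>s\<close> fixes the line through a vector \<open>w\<close> of norm zero.
    So close to \<open>w\<close> both indicators agree: they are both 1 if w \<in>
    \<open>nb x y\<close> and both 0 otherwise, and \<open>f x y\<close> vanishes there.\<close>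
  have finite_f: "finite (cl N ` supp (f x y))" if xy: "det2 x y \<noteq> 0" and N: "N \<ge> 1" for x y N
  proof (rule finite_cosets[OF _ N])
    fix x' w :: "'f \<times> 'f" assume w: "w \<noteq> 0" "nm w = 0" "det2 x' w \<noteq> 0"
    obtain c where c: "c \<noteq> 0" "s \<odot> w = sm c w" using singular_eigenvector[OF w(2,1) s(1)] by blast
    have sw: "s \<odot> w \<noteq> 0" using c w(1) by (simp add: sm_eq_0_iff)
    have sx': "det2 (s \<odot> x') (s \<odot> w) \<noteq> 0" using w(3) s(1) by (simp add: det2_mult)
    have iff: "s \<odot> w \<in> nb x y \<longleftrightarrow> w \<in> nb x y" unfolding c(2) by (rule nb_sm[OF c(1)])
    have *: "s \<odot> t \<in> nb (sm (\<pi> ^ k) (s \<odot> x')) (s \<odot> w)" if "t \<in> nb (sm (\<pi> ^ k) x') w" for t k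
      using that nb_mult[OF s(1), of t "sm (\<pi> ^ k) x'" w] by (simp add: L_mult_laws(8))
    show "\<exists>k. supp (f x y) \<inter> nb (sm (\<pi> ^ k) x') w = {}"
    proof (cases "w \<in> nb x y")
      case True
      obtain k1 where k1: "\<forall>k\<ge>k1. nb (sm (\<pi> ^ k) x') w \<subseteq> nb x y"
        using nb_open[OF True w(3)] by blast
      obtain k2 where k2: "\<forall>k\<ge>k2. nb (sm (\<pi> ^ k) (s \<odot> x')) (s \<odot> w) \<subseteq> nb x y"
        using nb_open[OF iffD2[OF iff True] sx'] by blast
      have "f x y t = 0" if "t \<in> nb (sm (\<pi> ^ max k1 k2) x') w" for t
        using k1[rule_format, of "max k1 k2"] k2[rule_format, of "max k1 k2"] that *[OF that]
        by (auto simp: f_def)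
      then show ?thesis by (intro exI[of _ "max k1 k2"]) (auto simp: supp_def)
    next
      case False
      then have False': "s \<odot> w \<notin> nb x y" using iff by blast
      obtain k1 where k1: "\<forall>k\<ge>k1. nb (sm (\<pi> ^ k) x') w \<inter> nb x y = {}"
        using nb_complement_open[OF xy w(1) False w(3)] by blast
      obtain k2 where k2: "\<forall>k\<ge>k2. nb (sm (\<pi> ^ k) (s \<odot> x')) (s \<odot> w) \<inter> nb x y = {}"
        using nb_complement_open[OF xy sw False' sx'] by blast
      have "f x y t = 0" if "t \<in> nb (sm (\<pi> ^ max k1 k2) x') w" for t
        using k1[rule_format, of "max k1 k2"] k2[rule_format, of "max k1 k2"] that *[OF that]
        by (auto simp: f_def)
      then show ?thesis by (intro exI[of _ "max k1 k2"]) (auto simp: supp_def)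
    qed
  qed (auto simp: supp_def)
  have test: "test_fun (f x y)" if "det2 x y \<noteq> 0" for x y
    using stable_f[OF that] finite_f[OF that] by (auto simp: test_fun_def)
  have nonzero: "t \<noteq> 0" if "nm t \<noteq> 0" for t
    using that nm_sm[of 0 0] by (auto simp: sm_simps)
  have "harmonic \<gamma>"
    unfolding harmonic_def
  proof (intro conjI allI impI)
    fix x y \<alpha> \<beta> z \<delta>
    assume "det2 x y \<noteq> (0::'f)" "unit \<alpha>" "\<beta> \<in> \<O>" "z \<in> \<P>" "unit \<delta>"
    from nb_iwahori[OF this] have "f (sm \<alpha> x + sm \<beta> y) (sm z x + sm \<delta> y) = f x y"
      by (simp add: f_def fun_eq_iff)
    then show "\<gamma> (sm \<alpha> x + sm \<beta> y) (sm z x + sm \<delta> y) = \<gamma> x y" by (simp add: \<gamma>_def)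
  next
    fix x y :: "'f \<times> 'f" assume xy: "det2 x y \<noteq> 0"
    have yx: "det2 y x \<noteq> 0" using xy by (simp add: det2_swap[of y x])
    have r: "test_fun (f x (y + sm r x))" for r
      by (rule test) (use xy in \<open>simp add: det2_simps\<close>)
    \<comment> \<open>The indicators of the balls at a vertex add up to 1, at \<open>t\<close> as
      well as at \<open>s \<odot> t\<close>.\<close>
    have "(\<Sum>r\<in>reps. f x (y + sm r x) t) + f y x t = 0" for t
    proof (cases "nm t = 0")
      case False
      then have st: "nm (s \<odot> t) \<noteq> 0" using s by (simp add: nm_mult)
      have "(\<Sum>r\<in>reps. f x (y + sm r x) t) + f y x t =
        \<xi> t * (((\<Sum>r\<in>reps. of_bool (t \<in> nb x (y + sm r x))) + of_bool (t \<in> nb y x))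
         - ((\<Sum>r\<in>reps. of_bool (s \<odot> t \<in> nb x (y + sm r x))) + of_bool (s \<odot> t \<in> nb y x)))"
        unfolding f_def if_not_P[OF False] sum_distrib_left[symmetric] sum_subtractf
        by (simp only: algebra_simps)
      also have "\<dots> = 0"
        unfolding nb_star[OF xy nonzero[OF False]] nb_star[OF xy nonzero[OF st]] by simp
      finally show ?thesis .
    qed (simp add: f_def)
    then have "(\<lambda>t. 1 * (\<Sum>r\<in>reps. f x (y + sm r x) t) + 1 * f y x t) = (\<lambda>_. 0)"
      by (simp add: fun_eq_iff)
    moreover have "haar (\<lambda>t. 1 * (\<Sum>r\<in>reps. f x (y + sm r x) t) + 1 * f y x t) =
        (\<Sum>r\<in>reps. \<gamma> x (y + sm r x)) + \<gamma> y x"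
    proof -
      have s: "test_fun (\<lambda>t. \<Sum>r\<in>reps. f x (y + sm r x) t)"
        "haar (\<lambda>t. \<Sum>r\<in>reps. f x (y + sm r x) t) = (\<Sum>r\<in>reps. haar (f x (y + sm r x)))"
        using haar_sum[of reps "\<lambda>r. f x (y + sm r x)", OF finite_reps r] by blast+
      show ?thesis
        unfolding lincomb_test_fun(2)[OF s(1) test[OF yx]] s(2) \<gamma>_def by simp
    qed
    ultimately show "(\<Sum>r\<in>reps. \<gamma> x (y + sm r x)) + \<gamma> y x = 0" by (simp add: haar_zero)
  next
    fix x y :: "'f \<times> 'f" assume xy: "det2 x y \<noteq> 0"
    have "f y (sm \<pi> x) t = - f x y t" for t
    proof (cases "nm t = 0")
      case False
      then have st: "nm (s \<odot> t) \<noteq> 0" using s by (simp add: nm_mult)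
      show ?thesis
        using nb_flip[OF xy nonzero[OF False]] nb_flip[OF xy nonzero[OF st]] by (simp add: f_def)
    qed (simp add: f_def)
    then have "f y (sm \<pi> x) = (\<lambda>t. (-1) * f x y t + 0 * f x y t)" by (simp add: fun_eq_iff)
    then show "\<gamma> y (sm \<pi> x) = - \<gamma> x y"
      unfolding \<gamma>_def using lincomb_test_fun(2)[OF test[OF xy] test[OF xy], of "-1" 0] by simp
  qed
  moreover have "equivariant \<xi> \<gamma>"
    unfolding equivariant_def
  proof (intro allI impI)
    fix t x y assume t: "nm t \<noteq> 0" and xy: "det2 x y \<noteq> (0::'f)"
    have xy': "det2 (t \<odot> x) (t \<odot> y) \<noteq> 0" using t xy by (simp add: det2_mult)
    have lt: "nm (linv t) \<noteq> 0" by (rule nm_linv[OF t])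
    \<comment> \<open>Since \<xi>(u) is \<xi>(t) times \<xi> of u divided by t, the integrand for
      the moved edge is \<xi>(t) times a translate of the original one; translation invariance does
      the rest.\<close>
    have eq: "f (t \<odot> x) (t \<odot> y) u = \<xi> t * f x y (linv t \<odot> u)" for u
    proof (cases "nm u = 0")
      case False
      have u: "u = t \<odot> (linv t \<odot> u)" by (simp add: linv_cancel t)
      have nu: "nm (linv t \<odot> u) \<noteq> 0" using False lt by (simp add: nm_mult)
      have "u \<in> nb (t \<odot> x) (t \<odot> y) \<longleftrightarrow> linv t \<odot> u \<in> nb x y"
        by (subst u) (rule nb_mult[OF t])
      moreover have "s \<odot> u = t \<odot> (s \<odot> (linv t \<odot> u))"
        unfolding L_mult_laws(2)[of t s, symmetric] L_mult_laws(1)[of t s] L_mult_laws(2)[of s t]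
        by (simp only: linv_cancel(2)[OF t])
      then have "s \<odot> u \<in> nb (t \<odot> x) (t \<odot> y) \<longleftrightarrow> s \<odot> (linv t \<odot> u) \<in> nb x y"
        using nb_mult[OF t] by simp
      moreover have "\<xi> u = \<xi> t * \<xi> (linv t \<odot> u)"
        using xi_mult[OF t nu] u by simp
      ultimately show ?thesis using False nu by (simp add: f_def)
    qed (simp add: f_def nm_mult)
    obtain N M where NM: "admissible N (f x y)" "admissible M (f (t \<odot> x) (t \<odot> y))"
      using stable_f xy xy' by blast
    define K where "K = max N M"
    have K: "admissible K (f x y)" "admissible K (f (t \<odot> x) (t \<odot> y))"
      using admissible_mono[OF NM(1), of K] admissible_mono[OF NM(2), of K] by (auto simp: K_def)
    have st: "stable K (f x y)" and K1: "K \<ge> 1" using K by (simp_all add: admissible_def)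
    have "coset_sum K (f (t \<odot> x) (t \<odot> y)) = \<xi> t * coset_sum K (\<lambda>u. f x y (linv t \<odot> u))"
    proof -
      have eq': "f (t \<odot> x) (t \<odot> y) = (\<lambda>u. \<xi> t * f x y (linv t \<odot> u))" using eq by blast
      have "supp (\<lambda>u. \<xi> t * f x y (linv t \<odot> u)) = supp (\<lambda>u. f x y (linv t \<odot> u))"
        using xi_nonzero[OF t] by (simp add: supp_def)
      then show ?thesis unfolding eq' coset_sum_def by (simp add: sum_distrib_left)
    qed
    also have "\<dots> = \<xi> t * coset_sum K (f x y)"
      by (simp add: coset_sum_translate[OF st lt])
    finally show "\<gamma> (t \<odot> x) (t \<odot> y) = \<xi> t * \<gamma> x y"
      unfolding \<gamma>_def haar_eq[OF test[OF xy] K(1)] haar_eq[OF test[OF xy'] K(2)] by simp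
  qed
  moreover have "\<exists>x y. det2 x y \<noteq> 0 \<and> \<gamma> x y \<noteq> 0"
  proof (intro exI conjI)
    let ?x = "sm (\<pi> ^ cond) \<theta>"
    show xy: "det2 ?x one \<noteq> 0" using det2_theta by (simp add: det2_simps)
    define A where "A = nb ?x one"
    have rep: "\<exists>b z. b \<noteq> 0 \<and> z \<in> \<P> \<and> t = sm b (one + sm z ?x)" if "t \<in> A" for t
      by (rule nb_repr[OF xy that[unfolded A_def]]) (intro exI conjI)
    have A1: "A \<subseteq> nb \<theta> one"
    proof
      fix t assume "t \<in> A"
      then obtain b z where t: "b \<noteq> 0" "z \<in> \<P>" "t = sm b (one + sm z ?x)" using rep by blast
      have "\<pi> ^ cond \<in> \<O>" by (simp add: prime_power_iff val_power)
      then have "z * \<pi> ^ cond \<in> \<P>" by (rule pp_mult_O(1)[OF t(2)])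
      from nb_memI[OF det2_theta t(1) this] show "t \<in> nb \<theta> one" by (simp add: t(3) sm_simps)
    qed
    have A_xi: "\<xi> t = 1" if tA: "t \<in> A" for t
    proof -
      obtain b z where t: "b \<noteq> 0" "z \<in> \<P>" "t = sm b (one + sm z ?x)" using rep[OF tA] by blast
      have z: "\<pi> ^ cond * z \<in> prime_power v (int cond + 1)"
        unfolding pp_pi_power_mult_iff using t(2) by simp
      then have P: "\<pi> ^ cond * z \<in> \<P>" by (rule pp_mono) simp
      have "t = sm b (one + sm (\<pi> ^ cond * z) \<theta>)" by (simp add: t(3) sm_simps mult.commute)
      then show ?thesis
        using xi_sm[OF t(1) nm_one_theta[OF P]] xi_small_theta[OF z] by simp
    qed
    obtain N where N: "admissible N (f ?x one)" using stable_f[OF xy] by blast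
    obtain N1 where N1: "N1 \<ge> 1" "\<forall>N\<ge>N1. \<forall>k\<in>small N. \<forall>t. t \<odot> k \<in> A \<longleftrightarrow> t \<in> A"
      unfolding A_def using nb_stable[OF xy] by blast
    define K where "K = max N N1"
    have K: "admissible K (f ?x one)" using admissible_mono[OF N] by (simp add: K_def)
    then have K1: "K \<ge> 1" by (simp add: admissible_def)
    let ?I = "\<lambda>t. of_bool (t \<in> A) :: complex"
    have inv: "t \<odot> k \<in> A \<longleftrightarrow> t \<in> A" if "k \<in> small K" for t k
      using N1(2)[rule_format, of K, OF _ that] by (simp add: K_def)
    have "?I (t \<odot> k) = ?I t" "?I (s \<odot> (t \<odot> k)) = ?I (s \<odot> t)" if "k \<in> small K" for t k
      using inv[OF that, of t] inv[OF that, of "s \<odot> t"] by (simp_all only: L_mult_laws(2))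
    then have st: "stable K ?I" and st': "stable K (\<lambda>t. ?I (s \<odot> t))"
      unfolding stable_def by blast+
    have "supp ?I = A" using A1 nb_theta_nm by (auto simp: supp_def)
    then have fin: "finite (cl K ` supp ?I)"
      using nbhd_cosets[OF K1] A1 by (metis finite_subset image_mono)
    have fin': "finite (cl K ` supp (\<lambda>t. ?I (s \<odot> t)))"
    proof -
      have "cl K ` supp (\<lambda>t. ?I (s \<odot> t)) \<subseteq> (\<lambda>C. (\<lambda>t. linv s \<odot> t) ` C) ` (cl K ` supp ?I)"
      proof
        fix C assume "C \<in> cl K ` supp (\<lambda>t. ?I (s \<odot> t))"
        then obtain t where t: "nm t \<noteq> 0" "s \<odot> t \<in> A" "C = cl K t"
          by (auto simp: supp_def split: if_splits)
        have "s \<odot> t \<in> supp ?I" using t s by (simp add: supp_def nm_mult)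
        moreover have "C = (\<lambda>u. linv s \<odot> u) ` cl K (s \<odot> t)"
          by (simp add: t(3) cl_mult linv_cancel s)
        ultimately show "C \<in> (\<lambda>C. (\<lambda>t. linv s \<odot> t) ` C) ` (cl K ` supp ?I)" by blast
      qed
      then show ?thesis using fin finite_subset by blast
    qed
    \<comment> \<open>\<xi> is 1 on \<open>A\<close>, and \<xi>(t) = 1/\<xi>(s) whenever s t \<in>
      \<open>A\<close>. Thus the integrand is a combination of one indicator and its translate,
      which have the same nonzero volume.\<close>
    have fI: "f ?x one t = 1 * ?I t + (- 1 / \<xi> s) * ?I (s \<odot> t)" if t: "nm t \<noteq> 0" for t
    proof -
      have "\<xi> t * ?I t = ?I t" using A_xi by simp
      moreover have "\<xi> t * ?I (s \<odot> t) = 1 / \<xi> s * ?I (s \<odot> t)"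
        using A_xi[of "s \<odot> t"] xi_mult[OF s(1) t] xi_nonzero[OF s(1)] by (auto simp: field_simps)
      ultimately show ?thesis using t by (simp add: f_def right_diff_distrib flip: A_def)
    qed
    \<comment> \<open>Coset sums only see invertible points, which matters because \<open>f\<close>
      was set to 0 at the others.\<close>
    have cong: "coset_sum K g = coset_sum K h"
      if "\<And>t. nm t \<noteq> 0 \<Longrightarrow> g t = h t" for g h :: "'f \<times> 'f \<Rightarrow> complex"
    proof -
      have "supp g = supp h" using that by (auto simp: supp_def)
      moreover have "g (SOME t. t \<in> C) = h (SOME t. t \<in> C)" if C: "C \<in> cl K ` supp h" for C
      proof -
        obtain t where t: "nm t \<noteq> 0" "C = cl K t" using C by (auto simp: supp_def)
        show ?thesis unfolding t(2) by (rule \<open>\<And>t. nm t \<noteq> 0 \<Longrightarrow> g t = h t\<close>) (rule cl_nm[OF K1 t(1) some_cl])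
      qed
      ultimately show ?thesis unfolding coset_sum_def by simp
    qed
    have "coset_sum K (f ?x one) = coset_sum K (\<lambda>t. 1 * ?I t + (- 1 / \<xi> s) * ?I (s \<odot> t))"
      by (rule cong) (rule fI)
    also have "\<dots> = 1 * coset_sum K ?I + (- 1 / \<xi> s) * coset_sum K (\<lambda>t. ?I (s \<odot> t))"
      by (rule coset_sum_lincomb[OF st fin st' fin'])
    also have "\<dots> = (1 - 1 / \<xi> s) * coset_sum K ?I"
      by (simp add: coset_sum_translate[OF st s(1)] algebra_simps)
    finally have eq: "coset_sum K (f ?x one) = (1 - 1 / \<xi> s) * coset_sum K ?I" .
    have "one \<in> A" unfolding A_def using nb_memI[OF xy one_neq_zero pp_0] by (simp add: sm_simps)
    then have "coset_sum K ?I \<noteq> 0" using coset_sum_indicator[OF K1 st A1] by blast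
    moreover have "1 - 1 / \<xi> s \<noteq> 0" using s xi_nonzero[OF s(1)] by simp
    ultimately have "coset_sum K (f ?x one) \<noteq> 0" unfolding eq by simp
    moreover have "coset_sum K nbhd \<noteq> 0"
      using coset_sum_indicator[OF K1 _ subset_refl] K one_in_nb by (auto simp: admissible_def)
    ultimately show "\<gamma> ?x one \<noteq> 0"
      unfolding \<gamma>_def haar_eq[OF test[OF xy] K] by simp
  qed
  ultimately show ?thesis by blast
qed

text \<open>Each point mass is additive by \<open>nb_star\<close> with total mass 1, so the
  difference has total mass 0. Every torus element fixes both lines, and the edge
  \<open>e1, e2\<close> separates them.\<close>

lemma existence_split_trivial:
  assumes sq: "is_sq d" and triv: "\<And>t. nm t \<noteq> 0 \<Longrightarrow> \<xi> t = 1"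
  shows "\<exists>\<gamma>. harmonic \<gamma> \<and> equivariant \<xi> \<gamma> \<and> (\<exists>x y. det2 x y \<noteq> 0 \<and> \<gamma> x y \<noteq> 0)"
proof -
  define e1 e2 :: "'f \<times> 'f" where "e1 = (1, 0)" and "e2 = (0, 1)"
  have e: "e1 \<noteq> 0" "e2 \<noteq> 0" "nm e1 = 0" "nm e2 = 0"
    by (simp_all add: e1_def e2_def prod_eq_iff nm_split[OF sq])
  define \<gamma> where "\<gamma> x y = (of_bool (e2 \<in> nb x y) - of_bool (e1 \<in> nb x y) :: complex)" for x y
  have "harmonic \<gamma>"
    unfolding harmonic_def
  proof (intro conjI allI impI)
    fix x y :: "'f \<times> 'f" assume xy: "det2 x y \<noteq> 0"
    have "(\<Sum>r\<in>reps. \<gamma> x (y + sm r x)) + \<gamma> y x =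
      ((\<Sum>r\<in>reps. of_bool (e2 \<in> nb x (y + sm r x))) + of_bool (e2 \<in> nb y x))
         - ((\<Sum>r\<in>reps. of_bool (e1 \<in> nb x (y + sm r x))) + of_bool (e1 \<in> nb y x))"
      unfolding \<gamma>_def sum_subtractf by (simp only: algebra_simps)
    then show "(\<Sum>r\<in>reps. \<gamma> x (y + sm r x)) + \<gamma> y x = 0"
      unfolding nb_star[OF xy e(1)] nb_star[OF xy e(2)] by simp
  qed (simp_all add: \<gamma>_def nb_iwahori nb_flip e)
  moreover have "equivariant \<xi> \<gamma>"
    unfolding equivariant_def
  proof (intro allI impI)
    fix t x y assume t: "nm t \<noteq> 0" and xy: "det2 x y \<noteq> (0::'f)"
    have "w \<in> nb (t \<odot> x) (t \<odot> y) \<longleftrightarrow> w \<in> nb x y" if w: "w \<noteq> 0" "nm w = 0" for w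
    proof -
      obtain c where c: "c \<noteq> 0" "t \<odot> w = sm c w" using singular_eigenvector[OF w(2,1) t] by blast
      have "w \<in> nb x y \<longleftrightarrow> sm c w \<in> nb (t \<odot> x) (t \<odot> y)"
        using nb_mult[OF t, of w] by (simp add: c(2))
      then show ?thesis by (simp add: nb_sm c(1))
    qed
    then show "\<gamma> (t \<odot> x) (t \<odot> y) = \<xi> t * \<gamma> x y" using e triv[OF t] by (simp add: \<gamma>_def)
  qed
  moreover have "det2 e1 e2 \<noteq> 0 \<and> \<gamma> e1 e2 \<noteq> 0"
    by (simp add: \<gamma>_def nb_def e1_def e2_def det2_def)
  ultimately show ?thesis by blast
qed

end

subsection \<open>The symplectic similitude group\<close>

definition M4 :: "'f::field_char_0 \<Rightarrow> 'f \<Rightarrow> 'f \<Rightarrow> 'f \<Rightarrow> 'f \<Rightarrow> 'f \<Rightarrow> 'f \<Rightarrow> 'f \<Rightarrow>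
    'f \<Rightarrow> 'f \<Rightarrow> 'f \<Rightarrow> 'f \<Rightarrow> 'f \<Rightarrow> 'f \<Rightarrow> 'f \<Rightarrow> 'f \<Rightarrow> 'f^4^4" where
  "M4 a11 a12 a13 a14 a21 a22 a23 a24 a31 a32 a33 a34 a41 a42 a43 a44 =
    vector [vector [a11, a12, a13, a14], vector [a21, a22, a23, a24],
            vector [a31, a32, a33, a34], vector [a41, a42, a43, a44]]"

lemma vector_4 [simp]:
  "(vector [a, b, c, e] :: 'a::zero^4) $ 1 = a" "(vector [a, b, c, e] :: 'a^4) $ 2 = b"
  "(vector [a, b, c, e] :: 'a^4) $ 3 = c" "(vector [a, b, c, e] :: 'a^4) $ 4 = e"
  unfolding vector_def by simp_all

lemma M4_entries [simp]:
  "M4 a11 a12 a13 a14 a21 a22 a23 a24 a31 a32 a33 a34 a41 a42 a43 a44 $ 1 = vector [a11, a12, a13, a14]"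
  "M4 a11 a12 a13 a14 a21 a22 a23 a24 a31 a32 a33 a34 a41 a42 a43 a44 $ 2 = vector [a21, a22, a23, a24]"
  "M4 a11 a12 a13 a14 a21 a22 a23 a24 a31 a32 a33 a34 a41 a42 a43 a44 $ 3 = vector [a31, a32, a33, a34]"
  "M4 a11 a12 a13 a14 a21 a22 a23 a24 a31 a32 a33 a34 a41 a42 a43 a44 $ 4 = vector [a41, a42, a43, a44]"
  by (simp_all add: M4_def)

lemma M4_eta: "M4 (g$1$1) (g$1$2) (g$1$3) (g$1$4) (g$2$1) (g$2$2) (g$2$3) (g$2$4)
    (g$3$1) (g$3$2) (g$3$3) (g$3$4) (g$4$1) (g$4$2) (g$4$3) (g$4$4) = g"
  by (simp add: vec_eq_iff forall_4)

lemma M4_cases: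
  obtains a11 a12 a13 a14 a21 a22 a23 a24 a31 a32 a33 a34 a41 a42 a43 a44
  where "g = M4 a11 a12 a13 a14 a21 a22 a23 a24 a31 a32 a33 a34 a41 a42 a43 a44"
  using M4_eta[of g] by metis

lemma M4_eq_iff:
  "M4 a11 a12 a13 a14 a21 a22 a23 a24 a31 a32 a33 a34 a41 a42 a43 a44 =
   M4 b11 b12 b13 b14 b21 b22 b23 b24 b31 b32 b33 b34 b41 b42 b43 b44 \<longleftrightarrow>
   a11 = b11 \<and> a12 = b12 \<and> a13 = b13 \<and> a14 = b14 \<and> a21 = b21 \<and> a22 = b22 \<and> a23 = b23 \<and> a24 = b24 \<and>
   a31 = b31 \<and> a32 = b32 \<and> a33 = b33 \<and> a34 = b34 \<and> a41 = b41 \<and> a42 = b42 \<and> a43 = b43 \<and> a44 = b44"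
  by (simp add: vec_eq_iff forall_4 conj_assoc)

lemma M4_mult:
  "M4 a11 a12 a13 a14 a21 a22 a23 a24 a31 a32 a33 a34 a41 a42 a43 a44 **
   M4 b11 b12 b13 b14 b21 b22 b23 b24 b31 b32 b33 b34 b41 b42 b43 b44 =
   M4 (a11*b11 + a12*b21 + a13*b31 + a14*b41) (a11*b12 + a12*b22 + a13*b32 + a14*b42)
      (a11*b13 + a12*b23 + a13*b33 + a14*b43) (a11*b14 + a12*b24 + a13*b34 + a14*b44)
      (a21*b11 + a22*b21 + a23*b31 + a24*b41) (a21*b12 + a22*b22 + a23*b32 + a24*b42)
      (a21*b13 + a22*b23 + a23*b33 + a24*b43) (a21*b14 + a22*b24 + a23*b34 + a24*b44)
      (a31*b11 + a32*b21 + a33*b31 + a34*b41) (a31*b12 + a32*b22 + a33*b32 + a34*b42)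
      (a31*b13 + a32*b23 + a33*b33 + a34*b43) (a31*b14 + a32*b24 + a33*b34 + a34*b44)
      (a41*b11 + a42*b21 + a43*b31 + a44*b41) (a41*b12 + a42*b22 + a43*b32 + a44*b42)
      (a41*b13 + a42*b23 + a43*b33 + a44*b43) (a41*b14 + a42*b24 + a43*b34 + a44*b44)"
  by (simp add: vec_eq_iff forall_4 matrix_matrix_mult_def sum_4)

lemma M4_transpose:
  "transpose (M4 a11 a12 a13 a14 a21 a22 a23 a24 a31 a32 a33 a34 a41 a42 a43 a44) =
   M4 a11 a21 a31 a41 a12 a22 a32 a42 a13 a23 a33 a43 a14 a24 a34 a44"
  by (simp add: vec_eq_iff forall_4 transpose_def)

lemma mat_M4: "mat c = M4 c 0 0 0 0 c 0 0 0 0 c 0 0 0 0 c"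
  by (simp add: vec_eq_iff forall_4 mat_def)

lemma J4_M4: "J4 = M4 0 0 1 0 0 0 0 1 (-1) 0 0 0 0 (-1) 0 0"
  by (simp add: J4_def block_matrix_def M4_def mat_def)

lemma weyl_M4:
  "s1_mat = M4 0 1 0 0 1 0 0 0 0 0 0 1 0 0 1 0"
  "s2_mat = M4 0 0 1 0 0 1 0 0 (-1) 0 0 0 0 0 0 1"
  "eta0_mat p = M4 0 0 0 1 0 0 1 0 0 p 0 0 p 0 0 0"
  "H1_mat w = M4 1 w 0 0 0 1 0 0 0 0 1 0 0 0 (-w) 1"
  "H3_mat w = M4 1 0 0 0 0 1 0 0 w 0 1 0 0 0 0 1"
  by (simp_all add: M4_def s1_mat_def s2_mat_def eta0_mat_def H1_mat_def H3_mat_def)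

section \<open>Unipotent radical, Levi subgroup and Weyl elements\<close>

definition uu :: "'f::field_char_0 \<Rightarrow> 'f \<Rightarrow> 'f \<Rightarrow> 'f^4^4" where
  "uu x y z = M4 1 0 x y 0 1 y z 0 0 1 0 0 0 0 1"

definition lower :: "'f::field_char_0 \<Rightarrow> 'f \<Rightarrow> 'f \<Rightarrow> 'f^4^4" where
  "lower x y z = M4 1 0 0 0 0 1 0 0 x y 1 0 y z 0 1"

text \<open>The element of the Levi subgroup with the columns \<open>x, y\<close> in the upper left block and
  similitude factor \<open>e det (x, y)\<close>; the torus \<open>T(F)\<close> has \<open>e = 1\<close>.\<close>

definition levi :: "'f::field_char_0 \<Rightarrow> 'f \<times> 'f \<Rightarrow> 'f \<times> 'f \<Rightarrow> 'f^4^4" where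
  "levi e x y = M4 (fst x) (fst y) 0 0 (snd x) (snd y) 0 0
     0 0 (e * snd y) (- e * snd x) 0 0 (- e * fst y) (e * fst x)"

text \<open>Representatives of the Weyl group modulo that of the Levi subgroup, each one reflection
  longer than its predecessor, so that (H3), (H1), (H3) link consecutive cells. Every index above 3
  repeats the last element.\<close>

definition weyl :: "nat \<Rightarrow> 'f::field_char_0^4^4" where
  "weyl i = (if i = 0 then mat 1 else if i = 1 then s2_mat
     else if i = 2 then s2_mat ** s1_mat else s2_mat ** s1_mat ** s2_mat)"

lemma weyl_eq:
  "weyl 0 = M4 1 0 0 0 0 1 0 0 0 0 1 0 0 0 0 1"
  "weyl (Suc 0) = M4 0 0 1 0 0 1 0 0 (-1) 0 0 0 0 0 0 1"
  "weyl 2 = M4 0 0 0 1 1 0 0 0 0 (-1) 0 0 0 0 1 0"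
  "weyl 3 = M4 0 0 0 1 0 0 1 0 0 (-1) 0 0 (-1) 0 0 0"
  by (simp_all add: weyl_def mat_M4 weyl_M4 M4_mult)

lemma levi_mult:
  "levi e x y ** levi e' x' y' =
   levi (e * e') (sm (fst x') x + sm (snd x') y) (sm (fst y') x + sm (snd y') y)"
  by (simp add: levi_def M4_mult M4_eq_iff sm_def algebra_simps)

lemma uu_mult: "uu x y z ** uu x' y' z' = uu (x + x') (y + y') (z + z')"
  by (simp add: uu_def M4_mult M4_eq_iff algebra_simps)

text \<open>Conjugation of a symmetric matrix by the Levi element: for A with the columns
  \<open>x, y\<close> the new matrix is A X A^t divided by the similitude factor.\<close>

lemma levi_uu:
  assumes "e \<noteq> 0" "det2 x y \<noteq> 0"
  shows "levi e x y ** uu X Y Z = uu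
    ((fst x * fst x * X + 2 * fst x * fst y * Y + fst y * fst y * Z) / (e * det2 x y))
    ((fst x * snd x * X + (fst x * snd y + fst y * snd x) * Y + fst y * snd y * Z) / (e * det2 x y))
    ((snd x * snd x * X + 2 * snd x * snd y * Y + snd y * snd y * Z) / (e * det2 x y)) ** levi e x y"
proof -
  obtain p r q s where xy: "x = (p, r)" "y = (q, s)" by (cases x; cases y) auto
  define D where "D = p * s - r * q"
  have det: "det2 x y = D" by (simp add: xy D_def det2_def)
  then have D: "D \<noteq> 0" using assms by simp
  define A B C where "A = p * p * X + 2 * p * q * Y + q * q * Z"
    and "B = p * r * X + (p * s + q * r) * Y + q * s * Z"
    and "C = r * r * X + 2 * r * s * Y + s * s * Z"
  have comb: "u / (e * D) * (e * w) + u' / (e * D) * (- e * w') = (u * w - u' * w') / D"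
    "u / (e * D) * (- e * w) + u' / (e * D) * (e * w') = (u' * w' - u * w) / D" for u w u' w'
    using assms(1) by (simp_all add: diff_divide_distrib)
  have num: "A * s - B * q = (p * X + q * Y) * D" "B * p - A * r = (p * Y + q * Z) * D"
    "B * s - C * q = (r * X + s * Y) * D" "C * p - B * r = (r * Y + s * Z) * D"
    by (simp_all add: A_def B_def C_def D_def algebra_simps)
  have "levi e x y ** uu X Y Z = uu (A / (e * D)) (B / (e * D)) (C / (e * D)) ** levi e x y"
    unfolding levi_def uu_def M4_mult M4_eq_iff xy fst_conv snd_conv mult_zero_left mult_zero_right
      mult_1_left mult_1_right add_0_left add_0_right comb num
    using D by (simp add: mult.commute)
  then show ?thesis unfolding det unfolding A_def B_def C_def xy fst_conv snd_conv .
qed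

section \<open>Symplectic similitudes\<close>

definition symp :: "'f::field_char_0 \<Rightarrow> 'f^4^4 \<Rightarrow> bool" where
  "symp \<mu> g \<longleftrightarrow> transpose g ** J4 ** g = mat \<mu> ** J4"

text \<open>The matrix g^t J g is alternating, so the six entries above its diagonal
  suffice.\<close>

lemma symp_M4:
  "symp \<mu> (M4 a11 a12 a13 a14 a21 a22 a23 a24 a31 a32 a33 a34 a41 a42 a43 a44) \<longleftrightarrow>
    a11*a32 - a31*a12 + a21*a42 - a41*a22 = 0 \<and>
    a11*a33 - a31*a13 + a21*a43 - a41*a23 = \<mu> \<and>
    a11*a34 - a31*a14 + a21*a44 - a41*a24 = 0 \<and>
    a12*a33 - a32*a13 + a22*a43 - a42*a23 = 0 \<and>
    a12*a34 - a32*a14 + a22*a44 - a42*a24 = \<mu> \<and>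
    a13*a34 - a33*a14 + a23*a44 - a43*a24 = 0"
proof -
  let ?g = "M4 a11 a12 a13 a14 a21 a22 a23 a24 a31 a32 a33 a34 a41 a42 a43 a44"
  define w12 w13 w14 w23 w24 w34
    where "w12 = a11*a32 - a31*a12 + a21*a42 - a41*a22"
      and "w13 = a11*a33 - a31*a13 + a21*a43 - a41*a23"
      and "w14 = a11*a34 - a31*a14 + a21*a44 - a41*a24"
      and "w23 = a12*a33 - a32*a13 + a22*a43 - a42*a23"
      and "w24 = a12*a34 - a32*a14 + a22*a44 - a42*a24"
      and "w34 = a13*a34 - a33*a14 + a23*a44 - a43*a24"
  note w = this
  have "transpose ?g ** J4 ** ?g =
      M4 0 w12 w13 w14 (- w12) 0 w23 w24 (- w13) (- w23) 0 w34 (- w14) (- w24) (- w34) 0"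
    unfolding J4_M4 M4_transpose M4_mult M4_eq_iff w by (simp add: algebra_simps)
  moreover have "mat \<mu> ** J4 = M4 0 0 \<mu> 0 0 0 0 \<mu> (- \<mu>) 0 0 0 0 (- \<mu>) 0 0"
    by (simp add: J4_M4 mat_M4 M4_mult M4_eq_iff)
  ultimately have "symp \<mu> ?g \<longleftrightarrow> w12 = 0 \<and> w13 = \<mu> \<and> w14 = 0 \<and> w23 = 0 \<and> w24 = \<mu> \<and> w34 = 0"
    unfolding symp_def by (simp only: M4_eq_iff) auto
  then show ?thesis unfolding w .
qed

lemma symp_mult: 
  assumes "symp \<mu> g" "symp \<nu> h" shows "symp (\<mu> * \<nu>) (g ** h)"
proof -
  have comm: "transpose h ** mat \<mu> = mat \<mu> ** transpose h"
    by (rule M4_cases[of "transpose h"]) (simp add: mat_M4 M4_mult mult.commute)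
  have "transpose (g ** h) ** J4 ** (g ** h) = transpose h ** (transpose g ** J4 ** g) ** h"
    by (simp add: matrix_transpose_mul matrix_mul_assoc)
  also have "\<dots> = transpose h ** mat \<mu> ** J4 ** h"
    using assms by (simp add: symp_def matrix_mul_assoc)
  also have "\<dots> = mat \<mu> ** (transpose h ** J4 ** h)" by (simp add: comm matrix_mul_assoc)
  also have "\<dots> = (mat \<mu> ** mat \<nu>) ** J4" using assms by (simp add: symp_def matrix_mul_assoc)
  also have "mat \<mu> ** mat \<nu> = (mat (\<mu> * \<nu>) :: 'a^4^4)" by (simp add: mat_M4 M4_mult)
  finally show ?thesis by (simp add: symp_def)
qed

text \<open>The inverse J^-1 g^t J / \<mu> of a similitude, written out in entries.\<close>

definition sinv :: "'f::field_char_0 \<Rightarrow> 'f^4^4 \<Rightarrow> 'f^4^4" where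
  "sinv \<mu> g = M4 (g$3$3 / \<mu>) (g$4$3 / \<mu>) (- g$1$3 / \<mu>) (- g$2$3 / \<mu>)
                 (g$3$4 / \<mu>) (g$4$4 / \<mu>) (- g$1$4 / \<mu>) (- g$2$4 / \<mu>)
                 (- g$3$1 / \<mu>) (- g$4$1 / \<mu>) (g$1$1 / \<mu>) (g$2$1 / \<mu>)
                 (- g$3$2 / \<mu>) (- g$4$2 / \<mu>) (g$1$2 / \<mu>) (g$2$2 / \<mu>)"

lemma sinv_mult:
  assumes "symp \<mu> g" "\<mu> \<noteq> 0" shows "sinv \<mu> g ** g = mat 1" "g ** sinv \<mu> g = mat 1"
proof -
  obtain a11 a12 a13 a14 a21 a22 a23 a24 a31 a32 a33 a34 a41 a42 a43 a44
    where g: "g = M4 a11 a12 a13 a14 a21 a22 a23 a24 a31 a32 a33 a34 a41 a42 a43 a44"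
    by (rule M4_cases)
  have "sinv \<mu> g = mat (1 / \<mu>) ** M4 a33 a43 (- a13) (- a23) a34 a44 (- a14) (- a24)
      (- a31) (- a41) a11 a21 (- a32) (- a42) a12 a22"
    by (simp add: sinv_def g mat_M4 M4_mult M4_eq_iff)
  moreover have "M4 a33 a43 (- a13) (- a23) a34 a44 (- a14) (- a24)
      (- a31) (- a41) a11 a21 (- a32) (- a42) a12 a22 ** g = mat \<mu>"
    using assms(1) unfolding g symp_M4 by (simp add: mat_M4 M4_mult M4_eq_iff) (simp add: algebra_simps)
  moreover have "mat (1 / \<mu>) ** mat \<mu> = (mat 1 :: 'a^4^4)" using assms(2) by (simp add: mat_M4 M4_mult)
  ultimately show *: "sinv \<mu> g ** g = mat 1" by (metis matrix_mul_assoc)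
  then show "g ** sinv \<mu> g = mat 1" using matrix_left_right_inverse by blast
qed

lemma symp_nonzero_invertible: "symp \<mu> g \<Longrightarrow> \<mu> \<noteq> 0 \<Longrightarrow> invertible g"
  using sinv_mult unfolding invertible_def by blast

lemma symp_sinv:
  assumes "symp \<mu> g" "\<mu> \<noteq> 0" shows "symp (1 / \<mu>) (sinv \<mu> g)"
proof -
  have r: "g ** sinv \<mu> g = mat 1" by (rule sinv_mult[OF assms])
  have eq: "transpose g ** J4 ** g = mat \<mu> ** J4" using assms by (simp add: symp_def)
  have t: "transpose (sinv \<mu> g) ** transpose g = mat 1"
    using arg_cong[OF r, of transpose] by (simp add: matrix_transpose_mul)
  have comm: "transpose (sinv \<mu> g) ** mat \<mu> = mat \<mu> ** transpose (sinv \<mu> g)"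
    by (rule M4_cases[of "transpose (sinv \<mu> g)"]) (simp add: mat_M4 M4_mult mult.commute)
  have "J4 = (transpose (sinv \<mu> g) ** transpose g) ** J4 ** (g ** sinv \<mu> g)"
    by (simp add: t r)
  also have "\<dots> = transpose (sinv \<mu> g) ** (transpose g ** J4 ** g) ** sinv \<mu> g"
    by (simp add: matrix_mul_assoc)
  also have "\<dots> = mat \<mu> ** (transpose (sinv \<mu> g) ** J4 ** sinv \<mu> g)"
    by (simp add: eq comm matrix_mul_assoc)
  finally have "mat (1 / \<mu>) ** J4 = (mat (1 / \<mu>) ** mat \<mu>) ** (transpose (sinv \<mu> g) ** J4 ** sinv \<mu> g)"
    by (metis matrix_mul_assoc)
  moreover have "mat (1 / \<mu>) ** mat \<mu> = (mat 1 :: 'a^4^4)"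
    using assms(2) by (simp add: mat_M4 M4_mult)
  ultimately show ?thesis by (simp add: symp_def)
qed

lemma GSp4_iff: "g \<in> GSp4 \<longleftrightarrow> (\<exists>\<mu>. \<mu> \<noteq> 0 \<and> symp \<mu> g)"
  using symp_nonzero_invertible by (auto simp: GSp4_def symp_def)

lemma GSp4I: "symp \<mu> g \<Longrightarrow> \<mu> \<noteq> 0 \<Longrightarrow> g \<in> GSp4"
  using GSp4_iff by blast

lemma GSp4_mult: "g \<in> GSp4 \<Longrightarrow> h \<in> GSp4 \<Longrightarrow> g ** h \<in> GSp4"
  unfolding GSp4_iff using symp_mult by (metis mult_eq_0_iff)

lemma symp_basic:
  "symp 1 (uu x y z)" "symp 1 (lower x y z)" "symp (e * det2 x' y') (levi e x' y')"
  "symp 1 s1_mat" "symp 1 s2_mat" "symp (- p) (eta0_mat p)" "symp 1 (H1_mat w)" "symp 1 (H3_mat w)"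
  "symp 1 (mat 1)"
  by (simp_all add: uu_def lower_def levi_def weyl_M4 mat_M4 symp_M4 det2_def algebra_simps)

lemma symp_weyl: "symp 1 (weyl i :: 'a::field_char_0^4^4)"
  unfolding weyl_def
  using symp_mult[OF symp_basic(5,4), where 'a='a, simplified]
    symp_mult[OF symp_mult[OF symp_basic(5,4)] symp_basic(5), where 'a='a, simplified]
  by (simp add: symp_basic)

lemma GSp4_basic:
  "uu x y z \<in> GSp4" "s1_mat \<in> GSp4" "s2_mat \<in> GSp4" "H1_mat w \<in> GSp4" "H3_mat w \<in> GSp4"
  "weyl i \<in> GSp4" "mat 1 \<in> GSp4"
  using GSp4I[OF symp_basic(1) one_neq_zero] GSp4I[OF symp_basic(4) one_neq_zero]
    GSp4I[OF symp_basic(5) one_neq_zero] GSp4I[OF symp_basic(7) one_neq_zero]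
    GSp4I[OF symp_basic(8) one_neq_zero] GSp4I[OF symp_weyl one_neq_zero]
    GSp4I[OF symp_basic(9) one_neq_zero]
  by blast+

lemma GSp4_levi: "e \<noteq> 0 \<Longrightarrow> det2 x y \<noteq> 0 \<Longrightarrow> levi e x y \<in> GSp4"
  by (rule GSp4I[OF symp_basic(3)]) simp

lemma GSp4_eta0: "p \<noteq> 0 \<Longrightarrow> eta0_mat p \<in> GSp4"
  by (rule GSp4I[OF symp_basic(6)]) simp

text \<open>Taking determinants in the defining relation only yields the square of det g, which is
  enough to know its valuation.\<close>

lemma det_symp:
  assumes "symp \<mu> g" shows "det g * det g = \<mu> ^ 4"
proof -
  have "J4 ** (mat (-1) ** J4) = (mat 1 :: 'a^4^4)"
    by (simp add: J4_M4 mat_M4 M4_mult)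
  from arg_cong[OF this, of det] have J: "det (J4 :: 'a^4^4) \<noteq> 0"
    by (auto simp: det_mul)
  have "prod (\<lambda>i. (mat \<mu> :: 'a^4^4) $ i $ i) UNIV = \<mu> ^ 4"
    by (simp add: mat_def)
  then have "det (mat \<mu> :: 'a^4^4) = \<mu> ^ 4"
    by (subst det_diagonal) (auto simp: mat_def)
  moreover have "det g * det (J4 :: 'a^4^4) * det g = det (mat \<mu> :: 'a^4^4) * det (J4 :: 'a^4^4)"
    using arg_cong[OF assms[unfolded symp_def], of det] by (simp add: det_mul)
  ultimately show ?thesis using J by (simp add: mult.commute mult.left_commute)
qed

text \<open>For the blocks A, B, D of a block upper triangular similitude the relations give D =
  \<mu> A^-t. Hence the unipotent factor is B D^-1 = B A^t / \<mu>, and the last relation, called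
  \<open>sym\<close> below, says that it is symmetric.\<close>

lemma levi_decomposition:
  assumes g: "symp \<mu> g" "\<mu> \<noteq> 0" and 0: "g$3$1 = 0" "g$3$2 = 0" "g$4$1 = 0" "g$4$2 = 0"
  defines "x \<equiv> (g$1$1, g$2$1)" and "y \<equiv> (g$1$2, g$2$2)"
  shows "det2 x y \<noteq> 0"
    "g = uu ((g$1$3 * g$1$1 + g$1$4 * g$1$2) / \<mu>) ((g$1$3 * g$2$1 + g$1$4 * g$2$2) / \<mu>)
           ((g$2$3 * g$2$1 + g$2$4 * g$2$2) / \<mu>) ** levi (\<mu> / det2 x y) x y"
proof -
  obtain p q a13 a14 r s a23 a24 a31 a32 a33 a34 a41 a42 a43 a44
    where g': "g = M4 p q a13 a14 r s a23 a24 a31 a32 a33 a34 a41 a42 a43 a44"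
    by (rule M4_cases)
  have g'': "g = M4 p q a13 a14 r s a23 a24 0 0 a33 a34 0 0 a43 a44"
    using 0 by (simp add: g')
  have E: "p*a33 + r*a43 = \<mu>" "p*a34 + r*a44 = 0" "q*a33 + s*a43 = 0" "q*a34 + s*a44 = \<mu>"
    "a13*a34 - a33*a14 + a23*a44 - a43*a24 = 0"
    using g(1) by (simp_all add: g'' symp_M4)
  define D where "D = p* s - r*q"
  have det: "det2 x y = D" by (simp add: x_def y_def det2_def D_def g'')
  have "D * (a33*a44 - a34*a43) = (p*a33 + r*a43) * (q*a34 + s*a44) - (p*a34 + r*a44) * (q*a33 + s*a43)"
    by (simp add: D_def algebra_simps)
  also have "\<dots> = \<mu> * \<mu>" by (simp add: E)
  finally have D: "D \<noteq> 0" using g(2) by auto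
  then show "det2 x y \<noteq> 0" by (simp add: det)
  have "D * a33 = s * (p*a33 + r*a43) - r * (q*a33 + s*a43)"
    "D * a43 = p * (q*a33 + s*a43) - q * (p*a33 + r*a43)"
    "D * a34 = s * (p*a34 + r*a44) - r * (q*a34 + s*a44)"
    "D * a44 = p * (q*a34 + s*a44) - q * (p*a34 + r*a44)"
    by (simp_all add: D_def algebra_simps)
  then have "D * a33 = s * \<mu>" "D * a43 = - q * \<mu>" "D * a34 = - r * \<mu>" "D * a44 = p * \<mu>"
    by (simp_all add: E)
  then have B: "a33 = \<mu> / D * s" "a43 = - (\<mu> / D) * q" "a34 = - (\<mu> / D) * r" "a44 = \<mu> / D * p"
    using D by (simp_all add: field_simps)
  have "\<mu> / D * (a23 * p + a24 * q - a13 * r - a14 * s) = 0"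
    using E(5) by (simp add: B algebra_simps)
  then have "a23 * p + a24 * q - a13 * r - a14 * s = 0" using D g(2) by simp
  then have sym: "a23 * p + a24 * q = a13 * r + a14 * s" by (simp add: algebra_simps)
  have m: "\<mu> / D * (w / \<mu>) = w / D" for w using g(2) by simp
  have e1: "(a13 * p + a14 * q) / \<mu> * (\<mu> / D * s) + (a13 * r + a14 * s) / \<mu> * (- (\<mu> / D) * q) = a13"
  proof -
    have "(a13 * p + a14 * q) / \<mu> * (\<mu> / D * s) + (a13 * r + a14 * s) / \<mu> * (- (\<mu> / D) * q) =
        ((a13 * p + a14 * q) * s - (a13 * r + a14 * s) * q) / D"
      using g(2) by (simp add: diff_divide_distrib)
    also have "(a13 * p + a14 * q) * s - (a13 * r + a14 * s) * q = a13 * D"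
      by (simp add: D_def algebra_simps)
    finally show ?thesis using D by simp
  qed
  have e2: "(a13 * p + a14 * q) / \<mu> * (- (\<mu> / D) * r) + (a13 * r + a14 * s) / \<mu> * (\<mu> / D * p) = a14"
  proof -
    have "(a13 * p + a14 * q) / \<mu> * (- (\<mu> / D) * r) + (a13 * r + a14 * s) / \<mu> * (\<mu> / D * p) =
        ((a13 * r + a14 * s) * p - (a13 * p + a14 * q) * r) / D"
      using g(2) by (simp add: diff_divide_distrib)
    also have "(a13 * r + a14 * s) * p - (a13 * p + a14 * q) * r = a14 * D"
      by (simp add: D_def algebra_simps)
    finally show ?thesis using D by simp
  qed
  have e3: "(a13 * r + a14 * s) / \<mu> * (\<mu> / D * s) + (a23 * r + a24 * s) / \<mu> * (- (\<mu> / D) * q) = a23"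
  proof -
    have "(a13 * r + a14 * s) / \<mu> * (\<mu> / D * s) + (a23 * r + a24 * s) / \<mu> * (- (\<mu> / D) * q) =
        ((a23 * p + a24 * q) * s - (a23 * r + a24 * s) * q) / D"
      using g(2) by (simp add: sym diff_divide_distrib)
    also have "(a23 * p + a24 * q) * s - (a23 * r + a24 * s) * q = a23 * D"
      by (simp add: D_def algebra_simps)
    finally show ?thesis using D by simp
  qed
  have e4: "(a13 * r + a14 * s) / \<mu> * (- (\<mu> / D) * r) + (a23 * r + a24 * s) / \<mu> * (\<mu> / D * p) = a24"
  proof -
    have "(a13 * r + a14 * s) / \<mu> * (- (\<mu> / D) * r) + (a23 * r + a24 * s) / \<mu> * (\<mu> / D * p) =
        ((a23 * r + a24 * s) * p - (a23 * p + a24 * q) * r) / D"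
      using g(2) by (simp add: sym diff_divide_distrib)
    also have "(a23 * r + a24 * s) * p - (a23 * p + a24 * q) * r = a24 * D"
      by (simp add: D_def algebra_simps)
    finally show ?thesis using D by simp
  qed
  define X Y Z e where "X = (a13 * p + a14 * q) / \<mu>" and "Y = (a13 * r + a14 * s) / \<mu>"
    and "Z = (a23 * r + a24 * s) / \<mu>" and "e = \<mu> / D"
  note def = this
  have "M4 p q a13 a14 r s a23 a24 0 0 a33 a34 0 0 a43 a44 = uu X Y Z ** levi e (p, r) (q, s)"
    unfolding uu_def levi_def M4_mult M4_eq_iff fst_conv snd_conv
    using e1 e2 e3 e4 B unfolding def[symmetric] by simp
  moreover have "(g$1$3 * g$1$1 + g$1$4 * g$1$2) / \<mu> = X" "(g$1$3 * g$2$1 + g$1$4 * g$2$2) / \<mu> = Y"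
    "(g$2$3 * g$2$1 + g$2$4 * g$2$2) / \<mu> = Z" "x = (p, r)" "y = (q, s)"
    by (simp_all add: def g'' x_def y_def)
  ultimately show "g = uu ((g$1$3 * g$1$1 + g$1$4 * g$1$2) / \<mu>) ((g$1$3 * g$2$1 + g$1$4 * g$2$2) / \<mu>)
           ((g$2$3 * g$2$1 + g$2$4 * g$2$2) / \<mu>) ** levi (\<mu> / det2 x y) x y"
    unfolding det e_def by (simp only: g''[symmetric])
qed

lemma uu_levi_inject:
  assumes "uu a b c ** levi e x y = uu a' b' c' ** levi e' x' y'" "e \<noteq> 0" "det2 x y \<noteq> 0"
  shows "a = a'" "b = b'" "c = c'" "e = e'" "x = x'" "y = y'"
proof -
  have E: "fst x = fst x'" "fst y = fst y'" "snd x = snd x'" "snd y = snd y'"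
    "e * snd y = e' * snd y'" "e * snd x = e' * snd x'" "e * fst y = e' * fst y'" "e * fst x = e' * fst x'"
    "a * (e * snd y) + b * (- e * fst y) = a' * (e' * snd y') + b' * (- e' * fst y')"
    "a * (- e * snd x) + b * (e * fst x) = a' * (- e' * snd x') + b' * (e' * fst x')"
    "b * (e * snd y) + c * (- e * fst y) = b' * (e' * snd y') + c' * (- e' * fst y')"
    "b * (- e * snd x) + c * (e * fst x) = b' * (- e' * snd x') + c' * (e' * fst x')"
    using arg_cong[OF assms(1), of "\<lambda>g. g $ 1 $ 1"] arg_cong[OF assms(1), of "\<lambda>g. g $ 1 $ 2"]
      arg_cong[OF assms(1), of "\<lambda>g. g $ 2 $ 1"] arg_cong[OF assms(1), of "\<lambda>g. g $ 2 $ 2"]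
      arg_cong[OF assms(1), of "\<lambda>g. g $ 3 $ 3"] arg_cong[OF assms(1), of "\<lambda>g. g $ 3 $ 4"]
      arg_cong[OF assms(1), of "\<lambda>g. g $ 4 $ 3"] arg_cong[OF assms(1), of "\<lambda>g. g $ 4 $ 4"]
      arg_cong[OF assms(1), of "\<lambda>g. g $ 1 $ 3"] arg_cong[OF assms(1), of "\<lambda>g. g $ 1 $ 4"]
      arg_cong[OF assms(1), of "\<lambda>g. g $ 2 $ 3"] arg_cong[OF assms(1), of "\<lambda>g. g $ 2 $ 4"]
    by (simp_all add: uu_def levi_def M4_mult)
  show xy: "x = x'" "y = y'" using E by (simp_all add: prod_eq_iff)
  have "fst x \<noteq> 0 \<or> fst y \<noteq> 0" using assms(3) by (auto simp: det2_def)
  then show e: "e = e'" using E(1,2,7,8) by (metis mult_right_cancel)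
  have key: "u = u' \<and> w = w'"
    if "u * (e * snd y) + w * (- e * fst y) = u' * (e * snd y) + w' * (- e * fst y)"
      "u * (- e * snd x) + w * (e * fst x) = u' * (- e * snd x) + w' * (e * fst x)" for u w u' w'
  proof -
    have "e * ((u - u') * snd y - (w - w') * fst y) = 0" "e * ((u - u') * snd x - (w - w') * fst x) = 0"
      using that by (simp_all add: algebra_simps)
    then have 1: "(u - u') * snd y = (w - w') * fst y" and 2: "(u - u') * snd x = (w - w') * fst x"
      using assms(2) by simp_all
    have "(u - u') * det2 x y = fst x * ((u - u') * snd y) - fst y * ((u - u') * snd x)"
      by (simp add: det2_def algebra_simps)
    also have "\<dots> = 0" unfolding 1 2 by (simp add: algebra_simps)
    finally have 3: "(u - u') * det2 x y = 0" .
    have "(w - w') * det2 x y = snd y * ((w - w') * fst x) - snd x * ((w - w') * fst y)"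
      by (simp add: det2_def algebra_simps)
    also have "\<dots> = 0" unfolding 1[symmetric] 2[symmetric] by (simp add: algebra_simps)
    finally have "(w - w') * det2 x y = 0" .
    with 3 show ?thesis using assms(3) by simp
  qed
  show "a = a'" "b = b'" using key[OF E(9,10)[folded xy e]] by simp_all
  show "c = c'" using key[OF E(11,12)[folded xy e]] by simp
qed

subsection \<open>Iwahori cells\<close>

context uniformized_field
begin

section \<open>The Iwahori subgroup and two parahoric subgroups\<close>

definition sim_unit :: "'f^4^4 \<Rightarrow> bool" where
  "sim_unit g \<longleftrightarrow> (\<exists>\<mu>. unit \<mu> \<and> symp \<mu> g)"

definition iw :: "'f^4^4 \<Rightarrow> bool" where
  "iw g \<longleftrightarrow> sim_unit g \<and> (\<forall>i j. g$i$j \<in> \<O>) \<and>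
     g$1$2 \<in> \<P> \<and> g$3$1 \<in> \<P> \<and> g$3$2 \<in> \<P> \<and> g$4$1 \<in> \<P> \<and> g$4$2 \<in> \<P> \<and> g$4$3 \<in> \<P>"

text \<open>The parahoric subgroups generated by \<open>I\<close> and \<open>s\<^sub>1\<close>, respectively \<open>s\<^sub>2\<close>.\<close>

definition siegel :: "'f^4^4 \<Rightarrow> bool" where
  "siegel g \<longleftrightarrow> sim_unit g \<and> (\<forall>i j. g$i$j \<in> \<O>) \<and>
     g$3$1 \<in> \<P> \<and> g$3$2 \<in> \<P> \<and> g$4$1 \<in> \<P> \<and> g$4$2 \<in> \<P>"

definition klingen :: "'f^4^4 \<Rightarrow> bool" where
  "klingen g \<longleftrightarrow> sim_unit g \<and> (\<forall>i j. g$i$j \<in> \<O>) \<and>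
     g$1$2 \<in> \<P> \<and> g$3$2 \<in> \<P> \<and> g$4$1 \<in> \<P> \<and> g$4$2 \<in> \<P> \<and> g$4$3 \<in> \<P>"

lemma sim_unit_GSp4: "sim_unit g \<Longrightarrow> g \<in> GSp4"
  unfolding sim_unit_def GSp4_iff using unit_nonzero by blast

lemma sim_unit_mult: "sim_unit g \<Longrightarrow> sim_unit h \<Longrightarrow> sim_unit (g ** h)"
  unfolding sim_unit_def using symp_mult unit_mult by blast

lemma sim_unit_symp1: "symp 1 g \<Longrightarrow> sim_unit g"
  unfolding sim_unit_def using unit_1 by blast

lemma iw_siegel: "iw g \<Longrightarrow> siegel g" and iw_klingen: "iw g \<Longrightarrow> klingen g"
  by (simp_all add: iw_def siegel_def klingen_def)

lemma iw_GSp4: "iw g \<Longrightarrow> g \<in> GSp4"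
  by (simp add: iw_def sim_unit_GSp4)

text \<open>A unit determinant and a unit similitude factor are equivalent because (det g)^2 =
  \<mu>^4. The similitude factor is the handier one for products and inverses.\<close>

lemma iwahori_iff: "g \<in> iwahori v \<longleftrightarrow> iw g"
proof -
  have "unit (det g) \<longleftrightarrow> unit \<mu>" if "symp \<mu> g" "\<mu> \<noteq> 0" for \<mu>
  proof -
    have eq: "det g * det g = \<mu> ^ 4" by (rule det_symp[OF that(1)])
    then have nz: "det g \<noteq> 0" using that(2) by auto
    have "2 * v (det g) = 4 * v \<mu>"
      using arg_cong[OF eq, of v] nz that(2) by (simp add: val_mult val_power)
    then show ?thesis using nz that(2) by (auto simp: int_units_iff)
  qed
  then show ?thesis
    unfolding iwahori_def GSp4_integers_def iw_def sim_unit_def GSp4_iff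
    using unit_nonzero by fast
qed

lemma pp_prod: "x \<in> \<P> \<and> y \<in> \<O> \<or> x \<in> \<O> \<and> y \<in> \<P> \<Longrightarrow> x * y \<in> \<P>"
  using pp_mult_O by blast

lemma entries_mult:
  assumes "\<forall>i j. (g::'f^4^4)$i$j \<in> \<O>" "\<forall>i j. (h::'f^4^4)$i$j \<in> \<O>"
  shows "\<forall>i j. (g ** h)$i$j \<in> \<O>"
  using assms unfolding matrix_matrix_mult_def by (auto intro!: pp_sum O_mult)

lemma entry_mult: "(g ** h)$i$j = g$i$1 * h$1$j + g$i$2 * h$2$j + g$i$3 * h$3$j + g$i$4 * h$4$j"
  for g h :: "'f^4^4"
  by (simp add: matrix_matrix_mult_def sum_4)

lemma iw_mult: "iw g \<Longrightarrow> iw h \<Longrightarrow> iw (g ** h)"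
  using sim_unit_mult entries_mult unfolding iw_def
  by (auto simp only: entry_mult intro!: pp_add pp_prod O_mult)

lemma siegel_mult: "siegel g \<Longrightarrow> siegel h \<Longrightarrow> siegel (g ** h)"
  using sim_unit_mult entries_mult unfolding siegel_def
  by (auto simp only: entry_mult intro!: pp_add pp_prod O_mult)

lemma klingen_mult: "klingen g \<Longrightarrow> klingen h \<Longrightarrow> klingen (g ** h)"
  using sim_unit_mult entries_mult unfolding klingen_def
  by (auto simp only: entry_mult intro!: pp_add pp_prod O_mult)

lemma iw_inverse:
  assumes "iw g" obtains g' where "iw g'" "g ** g' = mat 1" "g' ** g = mat 1"
proof -
  obtain \<mu> where \<mu>: "unit \<mu>" "symp \<mu> g" using assms by (auto simp: iw_def sim_unit_def)
  have nz: "\<mu> \<noteq> 0" using unit_nonzero[OF \<mu>(1)] .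
  have "sim_unit (sinv \<mu> g)"
    unfolding sim_unit_def using symp_sinv[OF \<mu>(2) nz] unit_divide[OF unit_1 \<mu>(1)] by blast
  then have "iw (sinv \<mu> g)"
    using assms \<mu>(1) by (simp add: iw_def sinv_def forall_4 unit_mult_pp_iff(3))
  then show ?thesis using that sinv_mult[OF \<mu>(2) nz] by blast
qed

lemma iw_uu: "x \<in> \<O> \<Longrightarrow> y \<in> \<O> \<Longrightarrow> z \<in> \<O> \<Longrightarrow> iw (uu x y z)"
  using sim_unit_symp1[OF symp_basic(1)] by (simp add: iw_def uu_def forall_4)

lemma iw_lower: "x \<in> \<P> \<Longrightarrow> y \<in> \<P> \<Longrightarrow> z \<in> \<P> \<Longrightarrow> iw (lower x y z)"
  using sim_unit_symp1[OF symp_basic(2)] P_in_O by (simp add: iw_def lower_def forall_4)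

lemma iw_levi:
  assumes "unit e" "unit (fst x)" "snd x \<in> \<O>" "fst y \<in> \<P>" "unit (snd y)"
  shows "iw (levi e x y)"
proof -
  have "unit (fst x * snd y - snd x * fst y)"
    by (rule unit_diff[OF unit_mult[OF assms(2,5)] pp_mult_O(2)[OF assms(3,4)]])
  then have "sim_unit (levi e x y)"
    using symp_basic(3)[of e x y] unit_mult[OF assms(1)] unfolding sim_unit_def det2_def by blast
  then show ?thesis
    using assms unit_in_O P_in_O by (simp add: iw_def levi_def forall_4 O_mult pp_mult_O)
qed

lemma iw_one: "iw (mat 1)"
  using sim_unit_symp1[OF symp_basic(9)] by (simp add: iw_def mat_M4 forall_4)

lemma iw_s2_sq: "iw (s2_mat ** s2_mat)"
  using sim_unit_mult[OF sim_unit_symp1[OF symp_basic(5)] sim_unit_symp1[OF symp_basic(5)]]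
  by (simp add: iw_def weyl_M4 M4_mult forall_4)

lemma s1_sq: "s1_mat ** s1_mat = (mat 1 :: 'f^4^4)"
  by (simp add: mat_M4 weyl_M4 M4_mult)

lemma panel_siegel: "siegel s1_mat" "w \<in> \<O> \<Longrightarrow> siegel (H1_mat w)"
  using sim_unit_symp1[OF symp_basic(4)] sim_unit_symp1[OF symp_basic(7)]
  by (simp_all add: siegel_def weyl_M4 forall_4)

lemma panel_klingen: "klingen s2_mat" "w \<in> \<O> \<Longrightarrow> klingen (H3_mat w)"
  using sim_unit_symp1[OF symp_basic(5)] sim_unit_symp1[OF symp_basic(8)]
  by (simp_all add: klingen_def weyl_M4 forall_4)

text \<open>Modulo \<pp> the similitude relations reduce to a11 a33 = \<mu> and a22 a44 =
  \<mu>.\<close>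

lemma iw_diag:
  assumes "iw g" shows "unit (g$1$1)" "unit (g$2$2)" "unit (g$3$3)" "unit (g$4$4)"
proof -
  obtain a11 a12 a13 a14 a21 a22 a23 a24 a31 a32 a33 a34 a41 a42 a43 a44
    where g: "g = M4 a11 a12 a13 a14 a21 a22 a23 a24 a31 a32 a33 a34 a41 a42 a43 a44"
    by (rule M4_cases)
  obtain \<mu> where \<mu>: "unit \<mu>" "symp \<mu> g" using assms by (auto simp: iw_def sim_unit_def)
  have O: "a11 \<in> \<O>" "a22 \<in> \<O>" "a33 \<in> \<O>" "a44 \<in> \<O>" "a13 \<in> \<O>" "a21 \<in> \<O>" "a23 \<in> \<O>" "a34 \<in> \<O>" "a24 \<in> \<O>"
    and P: "a31 \<in> \<P>" "a43 \<in> \<P>" "a41 \<in> \<P>" "a12 \<in> \<P>" "a32 \<in> \<P>" "a42 \<in> \<P>"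
    using assms by (auto simp: iw_def g forall_4)
  have E: "a11* a33 - a31* a13 + a21* a43 - a41* a23 = \<mu>" "a12* a34 - a32* a14 + a22* a44 - a42* a24 = \<mu>"
    using \<mu>(2) by (simp_all add: g symp_M4)
  have O': "a14 \<in> \<O>" using assms by (simp add: iw_def g forall_4)
  have "a11* a33 = \<mu> + (a31* a13 - a21* a43 + a41* a23)" using E(1) by (simp add: algebra_simps)
  moreover have "a31* a13 - a21* a43 + a41* a23 \<in> \<P>"
    using O P by (auto intro!: pp_add pp_diff pp_prod)
  ultimately have "unit (a11 * a33)" using unit_add[OF \<mu>(1)] by simp
  moreover have "a22* a44 = \<mu> + (a32* a14 - a12* a34 + a42* a24)" using E(2) by (simp add: algebra_simps)
  moreover have "a32* a14 - a12* a34 + a42* a24 \<in> \<P>"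
    using O O' P by (auto intro!: pp_add pp_diff pp_prod)
  ultimately have "unit (a11 * a33)" "unit (a22 * a44)" using unit_add[OF \<mu>(1)] by simp_all
  then show "unit (g$1$1)" "unit (g$2$2)" "unit (g$3$3)" "unit (g$4$4)"
    using O by (simp_all add: g unit_mult_iff)
qed

section \<open>Cosets of the Iwahori subgroup in the parahorics\<close>

fun gam1 :: "'f option \<Rightarrow> 'f^4^4" where
  "gam1 None = s1_mat" | "gam1 (Some w) = H1_mat w"

fun gam2 :: "'f option \<Rightarrow> 'f^4^4" where
  "gam2 None = s2_mat" | "gam2 (Some w) = H3_mat w"

text \<open>The projective line over the residue field, with \<open>None\<close> as the point at
  infinity. It indexes the cosets of \<open>I\<close> in either parahoric, which makes (H1) and (H3)
  sums over all these cosets.\<close>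

definition pts :: "'f option set" where "pts = insert None (Some ` reps)"

lemma finite_pts: "finite pts" by (simp add: pts_def finite_reps)

lemma sum_pts: "(\<Sum>x\<in>pts. F x) = (\<Sum>w\<in>reps. F (Some w)) + F None" for F :: "'f option \<Rightarrow> complex"
  unfolding pts_def using finite_reps by (subst sum.insert) (auto simp: sum.reindex add.commute)

lemma H_sum: "H1_mat x ** H1_mat y = H1_mat (x + y)" "H3_mat x ** H3_mat y = (H3_mat (x + y) :: 'f^4^4)"
  "H1_mat 0 = (mat 1 :: 'f^4^4)" "H3_mat 0 = (mat 1 :: 'f^4^4)"
  by (simp_all add: weyl_M4 mat_M4 M4_mult M4_eq_iff)

text \<open>The coset is read off from the ratio of a12 and a22 modulo \<pp>; by the second relation
  in \<open>E\<close> they are not both in \<pp>. The condition on the lower right block is then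
  forced by the first relation in \<open>E\<close>.\<close>

lemma siegel_cover:
  assumes p: "siegel p" shows "\<exists>x\<in>pts. \<exists>k. iw k \<and> p = gam1 x ** k"
proof -
  obtain a11 a12 a13 a14 a21 a22 a23 a24 a31 a32 a33 a34 a41 a42 a43 a44
    where g: "p = M4 a11 a12 a13 a14 a21 a22 a23 a24 a31 a32 a33 a34 a41 a42 a43 a44"
    by (rule M4_cases)
  obtain \<mu> where \<mu>: "unit \<mu>" "symp \<mu> p" using p by (auto simp: siegel_def sim_unit_def)
  have O: "\<forall>i j. p$i$j \<in> \<O>" and P: "a31 \<in> \<P>" "a32 \<in> \<P>" "a41 \<in> \<P>" "a42 \<in> \<P>"
    using p by (auto simp: siegel_def g)
  have O': "a11 \<in> \<O>" "a12 \<in> \<O>" "a13 \<in> \<O>" "a14 \<in> \<O>" "a21 \<in> \<O>" "a22 \<in> \<O>" "a23 \<in> \<O>" "a24 \<in> \<O>"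
    "a33 \<in> \<O>" "a34 \<in> \<O>" "a43 \<in> \<O>" "a44 \<in> \<O>"
    using O by (simp_all add: g forall_4)
  have E: "a12* a33 + a22* a43 = a32* a13 + a42* a23"
    "a12* a34 + a22* a44 = \<mu> + (a32* a14 + a42* a24)"
    using \<mu>(2) by (simp_all add: g symp_M4 algebra_simps)
  have E1: "a12* a33 + a22* a43 \<in> \<P>" unfolding E using O' P by (auto intro!: pp_add pp_prod O_mult)
  have E2: "unit (a12* a34 + a22* a44)"
    unfolding E by (rule unit_add[OF \<mu>(1)]) (use O' P in \<open>auto intro!: pp_add pp_prod\<close>)
  show ?thesis
  proof (cases "a22 \<in> \<P>")
    case False
    then have u: "unit a22" using O' by (simp add: unit_iff)
    have "a12 / a22 \<in> \<O>" using O' unit_mult_pp_iff(3)[OF u] by simp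
    from exists_rep[OF this] obtain x where x: "x \<in> reps" "a12 / a22 - x \<in> \<P>" by blast
    have xO: "x \<in> \<O>" using x(1) by (rule reps_in_O)
    define k where "k = H1_mat (- x) ** p"
    have k: "k = M4 (a11 - x* a21) (a12 - x* a22) (a13 - x* a23) (a14 - x* a24) a21 a22 a23 a24
        a31 a32 a33 a34 (a41 + x* a31) (a42 + x* a32) (a43 + x* a33) (a44 + x* a34)"
      by (simp add: k_def g weyl_M4 M4_mult M4_eq_iff algebra_simps)
    have "a12 - x* a22 = a22 * (a12 / a22 - x)" using unit_nonzero[OF u] by (simp add: algebra_simps)
    then have k12: "a12 - x* a22 \<in> \<P>" using pp_mult_O(2)[OF O'(6) x(2)] by simp
    have "a22 * (a43 + x* a33) = (a12* a33 + a22* a43) - (a12 - x* a22) * a33" by (simp add: algebra_simps)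
    also have "\<dots> \<in> \<P>" by (rule pp_diff[OF E1 pp_mult_O(1)[OF k12 O'(9)]])
    finally have k43: "a43 + x* a33 \<in> \<P>" using unit_mult_pp_iff(1)[OF u] by simp
    have "sim_unit k" unfolding k_def
      by (rule sim_unit_mult[OF sim_unit_symp1[OF symp_basic(7)]]) (use p in \<open>simp add: siegel_def\<close>)
    moreover have "\<forall>i j. k$i$j \<in> \<O>" unfolding k_def
      by (rule entries_mult[OF _ O]) (use xO in \<open>simp add: weyl_M4 forall_4\<close>)
    ultimately have "iw k" unfolding iw_def using k12 k43 P xO by (simp add: k pp_add pp_mult_O)
    moreover have "p = H1_mat x ** k" by (simp add: k_def matrix_mul_assoc H_sum)
    ultimately show ?thesis using x(1) by (intro bexI[of _ "Some x"]) (auto simp: pts_def)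
  next
    case True
    have "a22* a44 \<in> \<P>" by (rule pp_mult_O(1)[OF True O'(12)])
    from unit_diff[OF E2 this] have "unit (a12 * a34)" by simp
    then have u: "unit a12" using O' by (simp add: unit_mult_iff)
    have "a12 * a33 \<in> \<P>" using pp_diff[OF E1 pp_mult_O(1)[OF True O'(11)]] by simp
    then have a33: "a33 \<in> \<P>" using unit_mult_pp_iff(1)[OF u] by simp
    define k where "k = s1_mat ** p"
    have k: "k = M4 a21 a22 a23 a24 a11 a12 a13 a14 a41 a42 a43 a44 a31 a32 a33 a34"
      by (simp add: k_def g weyl_M4 M4_mult)
    have "sim_unit k" unfolding k_def
      by (rule sim_unit_mult[OF sim_unit_symp1[OF symp_basic(4)]]) (use p in \<open>simp add: siegel_def\<close>)
    moreover have "\<forall>i j. k$i$j \<in> \<O>" unfolding k_def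
      by (rule entries_mult[OF _ O]) (simp add: weyl_M4 forall_4)
    ultimately have "iw k" unfolding iw_def using P True a33 by (simp add: k)
    moreover have "p = s1_mat ** k" by (simp add: k_def matrix_mul_assoc s1_sq)
    ultimately show ?thesis by (intro bexI[of _ None]) (auto simp: pts_def)
  qed
qed

text \<open>The coset is read off from the ratio of a31 and a11 modulo \<pp>.\<close>

lemma klingen_cover:
  assumes p: "klingen p" shows "\<exists>x\<in>pts. \<exists>k. iw k \<and> p = gam2 x ** k"
proof -
  obtain a11 a12 a13 a14 a21 a22 a23 a24 a31 a32 a33 a34 a41 a42 a43 a44
    where g: "p = M4 a11 a12 a13 a14 a21 a22 a23 a24 a31 a32 a33 a34 a41 a42 a43 a44"
    by (rule M4_cases)
  have su: "sim_unit p" and O: "\<forall>i j. p$i$j \<in> \<O>"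
    and P: "a12 \<in> \<P>" "a32 \<in> \<P>" "a41 \<in> \<P>" "a42 \<in> \<P>" "a43 \<in> \<P>"
    using p by (auto simp: klingen_def g)
  have O': "a11 \<in> \<O>" "a31 \<in> \<O>" using O by (simp_all add: g forall_4)
  show ?thesis
  proof (cases "a11 \<in> \<P>")
    case False
    then have u: "unit a11" using O' by (simp add: unit_iff)
    have "a31 / a11 \<in> \<O>" using O' unit_mult_pp_iff(3)[OF u] by simp
    from exists_rep[OF this] obtain x where x: "x \<in> reps" "a31 / a11 - x \<in> \<P>" by blast
    have xO: "x \<in> \<O>" using x(1) by (rule reps_in_O)
    define k where "k = H3_mat (- x) ** p"
    have k: "k = M4 a11 a12 a13 a14 a21 a22 a23 a24
        (a31 - x* a11) (a32 - x* a12) (a33 - x* a13) (a34 - x* a14) a41 a42 a43 a44"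
      by (simp add: k_def g weyl_M4 M4_mult M4_eq_iff algebra_simps)
    have "a31 - x* a11 = a11 * (a31 / a11 - x)" using unit_nonzero[OF u] by (simp add: algebra_simps)
    then have k31: "a31 - x* a11 \<in> \<P>" using pp_mult_O(2)[OF O'(1) x(2)] by simp
    have "sim_unit k" unfolding k_def
      by (rule sim_unit_mult[OF sim_unit_symp1[OF symp_basic(8)] su])
    moreover have "\<forall>i j. k$i$j \<in> \<O>" unfolding k_def
      by (rule entries_mult[OF _ O]) (use xO in \<open>simp add: weyl_M4 forall_4\<close>)
    ultimately have "iw k" unfolding iw_def using k31 P xO by (simp add: k pp_diff pp_mult_O)
    moreover have "p = H3_mat x ** k" by (simp add: k_def matrix_mul_assoc H_sum)
    ultimately show ?thesis using x(1) by (intro bexI[of _ "Some x"]) (auto simp: pts_def)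
  next
    case True
    define k where "k = transpose s2_mat ** p"
    have s: "s2_mat ** transpose s2_mat = (mat 1 :: 'f^4^4)"
      by (simp add: weyl_M4 M4_transpose M4_mult mat_M4)
    have k: "k = M4 (- a31) (- a32) (- a33) (- a34) a21 a22 a23 a24 a11 a12 a13 a14 a41 a42 a43 a44"
      by (simp add: k_def g weyl_M4 M4_mult M4_transpose)
    have "symp 1 (transpose s2_mat :: 'f^4^4)" by (simp add: weyl_M4 M4_transpose symp_M4)
    then have "sim_unit k" unfolding k_def using sim_unit_mult[OF sim_unit_symp1 su] by blast
    moreover have "\<forall>i j. k$i$j \<in> \<O>" unfolding k_def
      by (rule entries_mult[OF _ O]) (simp add: weyl_M4 M4_transpose forall_4)
    ultimately have "iw k" unfolding iw_def using P True by (simp add: k)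
    moreover have "p = s2_mat ** k" by (simp add: k_def matrix_mul_assoc s)
    ultimately show ?thesis by (intro bexI[of _ None]) (auto simp: pts_def)
  qed
qed

lemma gam1_inj:
  assumes "x \<in> pts" "y \<in> pts" "iw k" "gam1 x = gam1 y ** k" shows "x = y"
proof -
  have k12: "k$1$2 \<in> \<P>" using assms(3) by (simp add: iw_def)
  have one: "1 \<notin> \<P>" by (simp add: prime_power_iff)
  show ?thesis
  proof (cases x; cases y)
    fix a b assume xy: "x = Some a" "y = Some b"
    have "H1_mat (- b) ** H1_mat a = k"
      using assms(4) by (simp add: xy matrix_mul_assoc H_sum)
    then have "k = H1_mat (a - b)" by (simp add: H_sum add.commute)
    then have "a - b \<in> \<P>" using k12 by (simp add: weyl_M4)
    then show ?thesis using reps_eqI assms(1,2) xy by (auto simp: pts_def)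
  next
    fix a assume xy: "x = Some a" "y = None"
    have "s1_mat ** H1_mat a = k" using assms(4) by (simp add: xy matrix_mul_assoc s1_sq)
    then have "k$1$2 = 1" by (auto simp: weyl_M4 M4_mult)
    then show ?thesis using k12 one by simp
  next
    fix b assume xy: "x = None" "y = Some b"
    have "s1_mat = H1_mat b ** k" using assms(4) by (simp add: xy)
    then have "H1_mat (- b) ** s1_mat = (H1_mat (- b) ** H1_mat b) ** k"
      by (metis matrix_mul_assoc)
    then have "H1_mat (- b) ** s1_mat = k" by (simp add: H_sum)
    then have "k$1$2 = 1" by (auto simp: weyl_M4 M4_mult)
    then show ?thesis using k12 one by simp
  qed auto
qed

lemma gam2_inj:
  assumes "x \<in> pts" "y \<in> pts" "iw k" "gam2 x = gam2 y ** k" shows "x = y"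
proof -
  have k31: "k$3$1 \<in> \<P>" using assms(3) by (simp add: iw_def)
  have one: "1 \<notin> \<P>" by (simp add: prime_power_iff)
  have s: "transpose s2_mat ** s2_mat = (mat 1 :: 'f^4^4)"
    by (simp add: weyl_M4 M4_transpose M4_mult mat_M4)
  show ?thesis
  proof (cases x; cases y)
    fix a b assume xy: "x = Some a" "y = Some b"
    have "H3_mat (- b) ** H3_mat a = k"
      using assms(4) by (simp add: xy matrix_mul_assoc H_sum)
    then have "k = H3_mat (a - b)" by (simp add: H_sum add.commute)
    then have "a - b \<in> \<P>" using k31 by (simp add: weyl_M4)
    then show ?thesis using reps_eqI assms(1,2) xy by (auto simp: pts_def)
  next
    fix a assume xy: "x = Some a" "y = None"
    have "transpose s2_mat ** H3_mat a = k" using assms(4) by (simp add: xy matrix_mul_assoc s)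
    then have "k$3$1 = 1" by (auto simp: weyl_M4 M4_transpose M4_mult)
    then show ?thesis using k31 one by simp
  next
    fix b assume xy: "x = None" "y = Some b"
    have "s2_mat = H3_mat b ** k" using assms(4) by (simp add: xy)
    then have "H3_mat (- b) ** s2_mat = (H3_mat (- b) ** H3_mat b) ** k"
      by (metis matrix_mul_assoc)
    then have "H3_mat (- b) ** s2_mat = k" by (simp add: H_sum)
    then have "k$3$1 = -1" by (auto simp: weyl_M4 M4_mult)
    then show ?thesis using k31 one by simp
  qed auto
qed

text \<open>Left multiplication by \<open>p\<close> permutes the cosets \<open>gam x ** I\<close>,
  on which \<open>B\<close> is constant. Hence each Hecke relation depends only on the parahoric
  coset of \<open>h\<close> and can be checked at one convenient element.\<close>

lemma panel_sum_invariant: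
  fixes B :: "'f^4^4 \<Rightarrow> complex" and gam :: "'f option \<Rightarrow> 'f^4^4"
  assumes inv: "\<And>h k. h \<in> GSp4 \<Longrightarrow> iw k \<Longrightarrow> B (h ** k) = B h"
    and h: "h \<in> GSp4" and p: "p \<in> GSp4" and gam: "\<And>x. x \<in> pts \<Longrightarrow> gam x \<in> GSp4"
    and cover: "\<And>x. x \<in> pts \<Longrightarrow> \<exists>z\<in>pts. \<exists>k. iw k \<and> p ** gam x = gam z ** k"
    and inj: "\<And>x y k. x \<in> pts \<Longrightarrow> y \<in> pts \<Longrightarrow> iw k \<Longrightarrow> gam x = gam y ** k \<Longrightarrow> x = y"
  shows "(\<Sum>x\<in>pts. B (h ** p ** gam x)) = (\<Sum>x\<in>pts. B (h ** gam x))"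
proof -
  obtain \<phi> \<kappa> where \<phi>: "\<And>x. x \<in> pts \<Longrightarrow> \<phi> x \<in> pts \<and> iw (\<kappa> x) \<and> p ** gam x = gam (\<phi> x) ** \<kappa> x"
    using cover by metis
  obtain p' where p': "p' ** p = mat 1" using p by (auto simp: GSp4_def invertible_def)
  have "inj_on \<phi> pts"
  proof (rule inj_onI)
    fix x y assume xy: "x \<in> pts" "y \<in> pts" "\<phi> x = \<phi> y"
    have ky: "iw (\<kappa> y)" using \<phi>[OF xy(2)] by blast
    obtain k' where k': "iw k'" "\<kappa> y ** k' = mat 1" using iw_inverse[OF ky] by blast
    have "p ** gam y ** k' = gam (\<phi> y) ** (\<kappa> y ** k')"
      using \<phi>[OF xy(2)] by (simp add: matrix_mul_assoc)
    then have "p ** gam x = p ** gam y ** k' ** \<kappa> x"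
      using \<phi>[OF xy(1)] by (simp add: k' xy(3))
    then have "(p' ** p) ** gam x = (p' ** p) ** gam y ** (k' ** \<kappa> x)"
      by (metis matrix_mul_assoc)
    then have "gam x = gam y ** (k' ** \<kappa> x)" by (simp add: p')
    then show "x = y" using inj[OF xy(1,2)] iw_mult[OF k'(1)] \<phi>[OF xy(1)] by blast
  qed
  moreover from this have "\<phi> ` pts = pts"
    using endo_inj_surj[OF finite_pts] \<phi> by (simp add: image_subset_iff)
  ultimately have bij: "bij_betw \<phi> pts pts" by (simp add: bij_betw_def)
  have "(\<Sum>x\<in>pts. B (h ** p ** gam x)) = (\<Sum>x\<in>pts. B (h ** gam (\<phi> x)))"
  proof (rule sum.cong[OF refl])
    fix x assume x: "x \<in> pts"
    have "h ** p ** gam x = (h ** gam (\<phi> x)) ** \<kappa> x"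
      using \<phi>[OF x] by (metis matrix_mul_assoc)
    then show "B (h ** p ** gam x) = B (h ** gam (\<phi> x))"
      using inv[OF GSp4_mult[OF h gam]] \<phi>[OF x] by simp
  qed
  also have "\<dots> = (\<Sum>x\<in>pts. B (h ** gam x))" by (rule sum.reindex_bij_betw[OF bij])
  finally show ?thesis .
qed

definition panel1 :: "('f^4^4 \<Rightarrow> complex) \<Rightarrow> 'f^4^4 \<Rightarrow> complex" where
  "panel1 B h = (\<Sum>w\<in>reps. B (h ** H1_mat w)) + B (h ** s1_mat)"

definition panel2 :: "('f^4^4 \<Rightarrow> complex) \<Rightarrow> 'f^4^4 \<Rightarrow> complex" where
  "panel2 B h = (\<Sum>w\<in>reps. B (h ** H3_mat w)) + B (h ** s2_mat)"

lemma panel1_invariant: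
  assumes inv: "\<And>h k. h \<in> GSp4 \<Longrightarrow> iw k \<Longrightarrow> B (h ** k) = B h" and h: "h \<in> GSp4" and p: "siegel p"
  shows "panel1 B (h ** p) = panel1 B h"
proof -
  have sg: "siegel (gam1 x)" if "x \<in> pts" for x
    using that panel_siegel reps_in_O by (auto simp: pts_def)
  have "(\<Sum>x\<in>pts. B (h ** p ** gam1 x)) = (\<Sum>x\<in>pts. B (h ** gam1 x))"
  proof (rule panel_sum_invariant[OF inv h])
    show "p \<in> GSp4" "\<And>x. x \<in> pts \<Longrightarrow> gam1 x \<in> GSp4"
      using p sg by (auto simp: siegel_def intro: sim_unit_GSp4)
    show "\<exists>z\<in>pts. \<exists>k. iw k \<and> p ** gam1 x = gam1 z ** k" if "x \<in> pts" for x
      by (rule siegel_cover[OF siegel_mult[OF p sg[OF that]]])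
    show "x = y" if "x \<in> pts" "y \<in> pts" "iw k" "gam1 x = gam1 y ** k" for x y k
      using that by (rule gam1_inj)
  qed
  then show ?thesis by (simp add: panel1_def sum_pts)
qed

lemma panel2_invariant:
  assumes inv: "\<And>h k. h \<in> GSp4 \<Longrightarrow> iw k \<Longrightarrow> B (h ** k) = B h" and h: "h \<in> GSp4" and p: "klingen p"
  shows "panel2 B (h ** p) = panel2 B h"
proof -
  have kl: "klingen (gam2 x)" if "x \<in> pts" for x
    using that panel_klingen reps_in_O by (auto simp: pts_def)
  have "(\<Sum>x\<in>pts. B (h ** p ** gam2 x)) = (\<Sum>x\<in>pts. B (h ** gam2 x))"
  proof (rule panel_sum_invariant[OF inv h])
    show "p \<in> GSp4" "\<And>x. x \<in> pts \<Longrightarrow> gam2 x \<in> GSp4"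
      using p kl by (auto simp: klingen_def intro: sim_unit_GSp4)
    show "\<exists>z\<in>pts. \<exists>k. iw k \<and> p ** gam2 x = gam2 z ** k" if "x \<in> pts" for x
      by (rule klingen_cover[OF klingen_mult[OF p kl[OF that]]])
    show "x = y" if "x \<in> pts" "y \<in> pts" "iw k" "gam2 x = gam2 y ** k" for x y k
      using that by (rule gam2_inj)
  qed
  then show ?thesis by (simp add: panel2_def sum_pts)
qed

section \<open>The decomposition into four cells\<close>

lemma row_pivot:
  fixes r :: "'f^4"
  assumes "r \<noteq> 0"
  shows "\<exists>i c k. c \<noteq> 0 \<and> iw k \<and> (\<forall>j. r $ j = c * k $ i $ j)"
proof -
  define a b c e where "a = r$2" and "b = r$1" and "c = r$3" and "e = r$4"
  have nz: "a \<noteq> 0 \<or> b \<noteq> 0 \<or> c \<noteq> 0 \<or> e \<noteq> 0"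
    using assms by (auto simp: a_def b_def c_def e_def vec_eq_iff forall_4)
  \<comment> \<open>Exceeds all valuations of nonzero entries, so it can serve as the valuation of
    0.\<close>
  define M where "M = 1 + \<bar>v a\<bar> + \<bar>v b\<bar> + \<bar>v c\<bar> + \<bar>v e\<bar>"
  define w where "w x = (if x = 0 then M else v x)" for x
  have wO: "y / x \<in> \<O>" if "x \<noteq> 0" "w x \<le> w y" for x y
    using that by (cases "y = 0") (auto simp: w_def prime_power_iff val_divide)
  have wP: "y / x \<in> \<P>" if "x \<noteq> 0" "w x < w y" for x y
    using that by (cases "y = 0") (auto simp: w_def prime_power_iff val_divide)
  have less: "w x < M" if "x \<in> {a, b, c, e}" "x \<noteq> 0" for x
    using that by (auto simp: w_def M_def)
  have le: "w x \<le> M" if "x \<in> {a, b, c, e}" for x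
    using that by (auto simp: w_def M_def)
  have nz': "x \<noteq> 0" if "w x < M" for x using that by (auto simp: w_def)
  have min_less: "w a < M \<or> w b < M \<or> w c < M \<or> w e < M" using nz less by auto
  \<comment> \<open>The pivot has minimal valuation. Among equal valuations the columns are
    preferred in the order 2, 1, 3, 4, because row i of an Iwahori matrix may have off-diagonal
    entries outside \<pp> exactly in the columns after i in this order.\<close>
  consider
      (2) "a \<noteq> 0" "b / a \<in> \<O>" "c / a \<in> \<O>" "e / a \<in> \<O>"
    | (1) "b \<noteq> 0" "a / b \<in> \<P>" "c / b \<in> \<O>" "e / b \<in> \<O>"
    | (3) "c \<noteq> 0" "a / c \<in> \<P>" "b / c \<in> \<P>" "e / c \<in> \<O>"
    | (4) "e \<noteq> 0" "a / e \<in> \<P>" "b / e \<in> \<P>" "c / e \<in> \<P>"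
  proof -
    have "w a < M \<and> w a \<le> w b \<and> w a \<le> w c \<and> w a \<le> w e \<or>
      w b < M \<and> w b < w a \<and> w b \<le> w c \<and> w b \<le> w e \<or>
      w c < M \<and> w c < w a \<and> w c < w b \<and> w c \<le> w e \<or>
      w e < M \<and> w e < w a \<and> w e < w b \<and> w e < w c" using min_less by linarith
    then show thesis using that nz' wO wP by blast
  qed
  then show ?thesis
  proof cases
    case 2
    define x y z where "x = b / a" and "y = c / a" and "z = e / a"
    note defs = this
    note mem = 2(2-4)[folded defs]
    define k where "k = levi 1 (1, x) (0, 1) ** uu 0 y (z - x * y)"
    have "iw k" unfolding k_def
      by (intro iw_mult iw_levi iw_uu) (use mem P_in_O in \<open>auto intro!: pp_diff pp_mult_O\<close>)
    moreover have "r $ j = a * k $ 2 $ j" for j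
      using exhaust_4[of j] 2(1)
      by (auto simp: k_def levi_def uu_def lower_def M4_mult a_def b_def c_def e_def defs)
    ultimately show ?thesis using 2(1) by blast
  next
    case 1
    define x y z where "x = a / b" and "y = c / b" and "z = e / b"
    note defs = this
    note mem = 1(2-4)[folded defs]
    define k where "k = levi 1 (1, 0) (x, 1) ** uu (y - x * z) z 0"
    have "iw k" unfolding k_def
      by (intro iw_mult iw_levi iw_uu) (use mem P_in_O in \<open>auto intro!: pp_diff pp_mult_O\<close>)
    moreover have "r $ j = b * k $ 1 $ j" for j
      using exhaust_4[of j] 1(1)
      by (auto simp: k_def levi_def uu_def lower_def M4_mult a_def b_def c_def e_def defs)
    ultimately show ?thesis using 1(1) by blast
  next
    case 3
    define x y z where "x = a / c" and "y = b / c" and "z = e / c"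
    note defs = this
    note mem = 3(2-4)[folded defs]
    define k where "k = levi 1 (1, - z) (0, 1) ** lower (y - z * x) x 0"
    have "iw k" unfolding k_def
      by (intro iw_mult iw_levi iw_lower) (use mem P_in_O in \<open>auto intro!: pp_diff pp_mult_O\<close>)
    moreover have "r $ j = c * k $ 3 $ j" for j
      using exhaust_4[of j] 3(1)
      by (auto simp: k_def levi_def uu_def lower_def M4_mult a_def b_def c_def e_def defs)
    ultimately show ?thesis using 3(1) by blast
  next
    case 4
    define x y z where "x = a / e" and "y = b / e" and "z = c / e"
    note defs = this
    note mem = 4(2-4)[folded defs]
    define k where "k = levi 1 (1, 0) (- z, 1) ** lower 0 y (x - z * y)"
    have "iw k" unfolding k_def
      by (intro iw_mult iw_levi iw_lower) (use mem P_in_O in \<open>auto intro!: pp_diff pp_mult_O\<close>)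
    moreover have "r $ j = e * k $ 4 $ j" for j
      using exhaust_4[of j] 4(1)
      by (auto simp: k_def levi_def uu_def lower_def M4_mult a_def b_def c_def e_def defs)
    ultimately show ?thesis using 4(1) by blast
  qed
qed

lemma weyl_orthogonal: "transpose (weyl i) ** weyl i = (mat 1 :: 'f^4^4)"
  "weyl i ** transpose (weyl i) = (mat 1 :: 'f^4^4)" "symp 1 (transpose (weyl i) :: 'f^4^4)"
proof -
  consider "i = 0" | "i = Suc 0" | "i = 2" | "weyl i = (weyl 3 :: 'f^4^4)"
    by (cases "i \<in> {0, 1, 2}") (auto simp: weyl_def)
  note cases = this
  show "transpose (weyl i) ** weyl i = (mat 1 :: 'f^4^4)"
    using cases by cases (simp_all add: weyl_eq M4_transpose M4_mult mat_M4)
  show "weyl i ** transpose (weyl i) = (mat 1 :: 'f^4^4)"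
    using cases by cases (simp_all add: weyl_eq M4_transpose M4_mult mat_M4)
  show "symp 1 (transpose (weyl i) :: 'f^4^4)"
    using cases by cases (simp_all add: weyl_eq M4_transpose symp_M4)
qed

definition in_cell :: "'f^4^4 \<Rightarrow> nat \<Rightarrow> bool" where
  "in_cell h i \<longleftrightarrow> (\<exists>a1 a2 a3 e x y k. e \<noteq> 0 \<and> det2 x y \<noteq> 0 \<and> iw k \<and>
     h = uu a1 a2 a3 ** levi e x y ** weyl i ** k)"

lemma in_cell_mult:
  assumes "in_cell h i" "iw k" shows "in_cell (h ** k) i"
proof -
  obtain a1 a2 a3 e x y k' where *: "e \<noteq> 0" "det2 x y \<noteq> 0" "iw k'"
    "h = uu a1 a2 a3 ** levi e x y ** weyl i ** k'"
    using assms(1) unfolding in_cell_def by blast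
  have "h ** k = uu a1 a2 a3 ** levi e x y ** weyl i ** (k' ** k)"
    unfolding *(4) by (simp only: matrix_mul_assoc)
  then show ?thesis unfolding in_cell_def using *(1,2) iw_mult[OF *(3) assms(2)] by blast
qed

lemma in_cellI:
  assumes "symp \<mu> h" "\<mu> \<noteq> 0"
    and "\<And>g. g = h ** transpose (weyl i) \<Longrightarrow> g$3$1 = 0 \<and> g$3$2 = 0 \<and> g$4$1 = 0 \<and> g$4$2 = 0"
  shows "in_cell h i"
proof -
  define g where "g = h ** transpose (weyl i)"
  have g: "symp \<mu> g" unfolding g_def using symp_mult[OF assms(1) weyl_orthogonal(3)] by simp
  have 0: "g$3$1 = 0" "g$3$2 = 0" "g$4$1 = 0" "g$4$2 = 0" using assms(3)[OF g_def] by auto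
  have h: "h = g ** weyl i ** mat 1"
    by (simp add: g_def weyl_orthogonal flip: matrix_mul_assoc)
  have "\<mu> / det2 (g$1$1, g$2$1) (g$1$2, g$2$2) \<noteq> 0"
    using levi_decomposition(1)[OF g assms(2) 0] assms(2) by simp
  with levi_decomposition[OF g assms(2) 0] h iw_one show ?thesis
    unfolding in_cell_def by metis
qed

text \<open>Elimination on the two lower rows by Iwahori matrices on the right. The third row
  becomes a multiple of a unit vector; orthogonality then removes one entry of the fourth row, and
  one more elementary matrix clears an entry against its pivot. The two pivot columns identify the
  Weyl element.\<close>

lemma bruhat_cover:
  assumes h: "h \<in> GSp4" shows "\<exists>i<4. in_cell h i"
proof -
  obtain \<mu> where \<mu>: "\<mu> \<noteq> 0" "symp \<mu> h" using h unfolding GSp4_iff by blast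
  have inv_h: "h ** sinv \<mu> h = mat 1" using sinv_mult[OF \<mu>(2,1)] by blast
  have "h $ 3 \<noteq> 0"
  proof
    assume "h $ 3 = 0"
    then have "(h ** sinv \<mu> h) $ 3 $ 3 = 0" by (simp add: entry_mult)
    then show False by (simp add: inv_h mat_def)
  qed
  from row_pivot[OF this] obtain i c k where k: "c \<noteq> 0" "iw k" "\<And>j. h $ 3 $ j = c * k $ i $ j" by blast
  obtain k' where k': "iw k'" "k ** k' = mat 1" "k' ** k = mat 1" using iw_inverse[OF k(2)] .
  obtain \<nu> where \<nu>: "unit \<nu>" "symp \<nu> k'" using k'(1) by (auto simp: iw_def sim_unit_def)
  define g where "g = h ** k'"
  have g3: "g $ 3 $ j = (if i = j then c else 0)" for j
  proof -
    have "g $ 3 $ j = c * (k ** k') $ i $ j"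
      by (simp add: g_def entry_mult k(3) algebra_simps)
    then show ?thesis by (simp add: k'(2) mat_def)
  qed
  define \<rho> where "\<rho> = \<mu> * \<nu>"
  have sg: "symp \<rho> g" unfolding g_def \<rho>_def by (rule symp_mult[OF \<mu>(2) \<nu>(2)])
  have \<rho>: "\<rho> \<noteq> 0" using \<mu>(1) unit_nonzero[OF \<nu>(1)] by (simp add: \<rho>_def)
  have hg: "h = g ** k" by (simp add: g_def k'(3) flip: matrix_mul_assoc)
  have inv_g: "g ** sinv \<rho> g = mat 1" using sinv_mult[OF sg \<rho>] by blast
  \<comment> \<open>The lower rows of a similitude are orthogonal for the symplectic form; this is
    an entry of g times its inverse.\<close>
  have iso: "g$3$1 * g$4$3 + g$3$2 * g$4$4 - g$3$3 * g$4$1 - g$3$4 * g$4$2 = 0"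
  proof -
    have "(g ** sinv \<rho> g) $ 3 $ 2 = (g$3$1 * g$4$3 + g$3$2 * g$4$4 - g$3$3 * g$4$1 - g$3$4 * g$4$2) / \<rho>"
      by (simp add: entry_mult sinv_def add_divide_distrib diff_divide_distrib)
    then show ?thesis using \<rho> by (simp add: inv_g mat_def)
  qed
  \<comment> \<open>Otherwise the fourth row would be a multiple of the third.\<close>
  have indep: "g$4$j \<noteq> 0 \<or> g$4$j' \<noteq> 0 \<or> g$4$j'' \<noteq> 0" if "{i, j, j', j''} = UNIV" for j j' j''
  proof (rule ccontr)
    assume n: "\<not> ?thesis"
    have z: "g$4$l = 0" if "l \<noteq> i" for l
      using n that \<open>{i, j, j', j''} = UNIV\<close> by (metis UNIV_I empty_iff insert_iff)
    let ?s = "sinv \<rho> g"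
    have "(g ** ?s) $ 3 $ 4 = c * ?s $ i $ 4"
      using exhaust_4[of i] by (auto simp: entry_mult g3)
    moreover have "(g ** ?s) $ 4 $ 4 = g$4$i * ?s $ i $ 4"
      using exhaust_4[of i] z by (auto simp: entry_mult)
    ultimately show False using k(1) by (simp add: inv_g mat_def)
  qed
  have step: "\<exists>m<4. in_cell g m" if "in_cell (g ** l) m" "m < 4" "iw l'" "l ** l' = mat 1" for l l' m
  proof -
    have "g = (g ** l) ** l'" using that(4) by (simp flip: matrix_mul_assoc)
    then show ?thesis using in_cell_mult[OF that(1,3)] that(2) by metis
  qed
  have uu_inv: "uu x y z ** uu (- x) (- y) (- z) = (mat 1 :: 'f^4^4)"
    "lower x y z ** lower (- x) (- y) (- z) = (mat 1 :: 'f^4^4)" for x y z :: 'f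
    by (simp_all add: uu_def lower_def M4_mult mat_M4)
  have su: "symp \<rho> (g ** uu x y z)" "symp \<rho> (g ** lower x y z)" for x y z
    using symp_mult[OF sg symp_basic(1)] symp_mult[OF sg symp_basic(2)] by simp_all
  have lower4: "lower x y z = M4 1 0 0 0 0 1 0 0 x y 1 0 y z 0 1" for x y z :: 'f
    by (simp add: lower_def)
  obtain a11 a12 a13 a14 a21 a22 a23 a24 a31 a32 a33 a34 t1 t2 t3 t4
    where gM: "g = M4 a11 a12 a13 a14 a21 a22 a23 a24 a31 a32 a33 a34 t1 t2 t3 t4"
    by (rule M4_cases)
  have r3: "a31 = (if i = 1 then c else 0)" "a32 = (if i = 2 then c else 0)"
    "a33 = (if i = 3 then c else 0)" "a34 = (if i = 4 then c else 0)"
    using g3[of 1] g3[of 2] g3[of 3] g3[of 4] by (simp_all add: gM)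
  have "\<exists>m<4. in_cell g m"
  proof (cases "i = 1 \<or> i = 3")
    case True
    have star: "i = 1 \<Longrightarrow> t3 = 0" "i = 3 \<Longrightarrow> t1 = 0" using iso k(1) by (auto simp: gM r3)
    have nz: "t2 \<noteq> 0 \<or> t4 \<noteq> 0"
      using True
    proof
      assume "i = 1"
      then have "{i, 2, 3, 4} = UNIV" by (simp add: UNIV_4)
      from indep[OF this] show ?thesis using star(1)[OF \<open>i = 1\<close>] by (simp add: gM)
    next
      assume "i = 3"
      then have "{i, 1, 2, 4} = UNIV" by (auto simp: UNIV_4)
      from indep[OF this] show ?thesis using star(2)[OF \<open>i = 3\<close>] by (simp add: gM)
    qed
    show ?thesis
    proof (cases "t2 \<noteq> 0 \<and> t4 / t2 \<in> \<O>")
      case t: True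
      have "in_cell (g ** uu 0 0 (- (t4 / t2))) (if i = 1 then 3 else 2)"
        by (rule in_cellI[OF su(1) \<rho>])
          (use True star t in \<open>auto simp: gM r3 uu_def weyl_eq M4_transpose M4_mult\<close>)
      then show ?thesis
        by (rule step[OF _ _ iw_uu]) (use t uu_inv(1)[of 0 0 "- (t4 / t2)"] in auto)
    next
      case False
      then have t: "t4 \<noteq> 0" "t2 / t4 \<in> \<P>" using nz div_in_O_or[of t2 t4] by (cases "t2 = 0"; auto)+
      have "in_cell (g ** lower 0 0 (- (t2 / t4))) (if i = 1 then Suc 0 else 0)"
        by (rule in_cellI[OF su(2) \<rho>])
          (use True star t in \<open>auto simp: gM r3 lower_def weyl_eq M4_transpose M4_mult\<close>)
      then show ?thesis
        by (rule step[OF _ _ iw_lower]) (use t uu_inv(2)[of 0 0 "- (t2 / t4)"] in auto)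
    qed
  next
    case False
    then have True: "i = 2 \<or> i = 4" using exhaust_4[of i] by auto
    have star: "i = 2 \<Longrightarrow> t4 = 0" "i = 4 \<Longrightarrow> t2 = 0" using iso k(1) by (auto simp: gM r3)
    have nz: "t1 \<noteq> 0 \<or> t3 \<noteq> 0"
      using True
    proof
      assume "i = 2"
      then have "{i, 1, 3, 4} = UNIV" by (auto simp: UNIV_4)
      from indep[OF this] show ?thesis using star(1)[OF \<open>i = 2\<close>] by (simp add: gM)
    next
      assume "i = 4"
      then have "{i, 1, 2, 3} = UNIV" by (auto simp: UNIV_4)
      from indep[OF this] show ?thesis using star(2)[OF \<open>i = 4\<close>] by (simp add: gM)
    qed
    show ?thesis
    proof (cases "t1 \<noteq> 0 \<and> t3 / t1 \<in> \<O>")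
      case t: True
      have "in_cell (g ** uu (- (t3 / t1)) 0 0) (if i = 2 then 3 else Suc 0)"
        by (rule in_cellI[OF su(1) \<rho>])
          (use True star t in \<open>auto simp: gM r3 uu_def weyl_eq M4_transpose M4_mult\<close>)
      then show ?thesis
        by (rule step[OF _ _ iw_uu]) (use t uu_inv(1)[of "- (t3 / t1)" 0 0] in auto)
    next
      case False
      then have t: "t3 \<noteq> 0" "t1 / t3 \<in> \<P>" using nz div_in_O_or[of t1 t3] by (cases "t1 = 0"; auto)+
      have "in_cell (g ** lower (- (t1 / t3)) 0 0) (if i = 2 then 2 else 0)"
        by (rule in_cellI[OF su(2) \<rho>])
          (use True star t in \<open>auto simp: gM r3 lower_def weyl_eq M4_transpose M4_mult\<close>)
      then show ?thesis
        by (rule step[OF _ _ iw_lower]) (use t uu_inv(2)[of "- (t1 / t3)" 0 0] in auto)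
    qed
  qed
  then show ?thesis unfolding hg using in_cell_mult[OF _ k(2)] by blast
qed

text \<open>The intersection of the unipotent radical with the conjugate of \<open>I\<close> by the \<open>i\<close>-th Weyl element.\<close>

definition pat :: "nat \<Rightarrow> 'f \<Rightarrow> 'f \<Rightarrow> 'f \<Rightarrow> bool" where
  "pat i x y z \<longleftrightarrow> x \<in> prime_power v (of_bool (i > 0)) \<and> y \<in> prime_power v (of_bool (i > 1)) \<and>
     z \<in> prime_power v (of_bool (i > 2))"

text \<open>Determines the part of the Siegel parabolic that a Weyl conjugate of \<open>I\<close>
  contains. For each of the four Weyl elements its Levi part satisfies the same Iwahori conditions;
  only the unipotent part, described by \<open>pat i\<close>, depends on the cell.\<close>

lemma weyl_iwahori_conj:
  assumes m: "symp \<mu> m" "\<mu> \<noteq> 0" and 0: "m$3$1 = 0" "m$3$2 = 0" "m$4$1 = 0" "m$4$2 = 0"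
    and k: "iw k" and eq: "weyl i ** k = m ** weyl j" and ij: "i < 4" "j < 4"
  shows "i = j" "unit (m$1$1)" "unit (m$2$2)" "m$1$2 \<in> \<P>" "m$2$1 \<in> \<O>" "unit \<mu>"
    "pat i ((m$1$3 * m$1$1 + m$1$4 * m$1$2) / \<mu>) ((m$1$3 * m$2$1 + m$1$4 * m$2$2) / \<mu>)
           ((m$2$3 * m$2$1 + m$2$4 * m$2$2) / \<mu>)"
proof -
  obtain a11 a12 a13 a14 a21 a22 a23 a24 a31 a32 a33 a34 a41 a42 a43 a44
    where kM: "k = M4 a11 a12 a13 a14 a21 a22 a23 a24 a31 a32 a33 a34 a41 a42 a43 a44"
    by (rule M4_cases)
  have q_eq: "m = weyl i ** k ** transpose (weyl j)"
    unfolding eq by (simp add: weyl_orthogonal flip: matrix_mul_assoc)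
  have diag: "unit a11" "unit a22" "unit a33" "unit a44" using iw_diag[OF k] by (simp_all add: kM)
  have O: "a11 \<in> \<O>" "a12 \<in> \<O>" "a13 \<in> \<O>" "a14 \<in> \<O>" "a21 \<in> \<O>" "a22 \<in> \<O>" "a23 \<in> \<O>" "a24 \<in> \<O>"
    "a31 \<in> \<O>" "a32 \<in> \<O>" "a33 \<in> \<O>" "a34 \<in> \<O>" "a41 \<in> \<O>" "a42 \<in> \<O>" "a43 \<in> \<O>" "a44 \<in> \<O>"
    and P: "a12 \<in> \<P>" "a31 \<in> \<P>" "a32 \<in> \<P>" "a41 \<in> \<P>" "a42 \<in> \<P>" "a43 \<in> \<P>"
    using k by (auto simp: iw_def kM forall_4)
  have ij': "i = 0 \<or> i = Suc 0 \<or> i = 2 \<or> i = 3" "j = 0 \<or> j = Suc 0 \<or> j = 2 \<or> j = 3"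
    using ij by auto
  have nz: "a11 \<noteq> 0" "a22 \<noteq> 0" "a33 \<noteq> 0" "a44 \<noteq> 0" using diag unit_nonzero by auto
  \<comment> \<open>For different indices a diagonal unit of \<open>k\<close> would land in the zero
    block of \<open>m\<close>.\<close>
  show ij_eq: "i = j"
    using ij' 0 nz unfolding q_eq by (auto simp: kM weyl_eq M4_transpose M4_mult)
  have qi: "m = weyl i ** k ** transpose (weyl i)" using q_eq ij_eq by simp
  have A: "unit (m$1$1) \<and> unit (m$2$2) \<and> m$1$2 \<in> \<P> \<and> m$2$1 \<in> \<O>"
    using ij'(1) diag P O unfolding qi by (auto simp: kM weyl_eq M4_transpose M4_mult)
  then show "unit (m$1$1)" "unit (m$2$2)" "m$1$2 \<in> \<P>" "m$2$1 \<in> \<O>" by auto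
  have "symp \<mu> (weyl i ** k)" using symp_mult[OF m(1) symp_weyl[of j]] eq by simp
  from symp_mult[OF weyl_orthogonal(3)[of i] this]
  have sk: "symp \<mu> k" by (simp add: matrix_mul_assoc weyl_orthogonal)
  have "\<mu> = a11 * a33 + (a21 * a43 - a31 * a13 - a41 * a23)"
    using sk unfolding kM symp_M4 by (auto simp: algebra_simps)
  also have "unit \<dots>"
    by (rule unit_add[OF unit_mult[OF diag(1,3)]]) (intro pp_diff pp_prod, use P O in auto)
  finally show \<mu>: "unit \<mu>" .
  have B: "pat i (m$1$3 * m$1$1 + m$1$4 * m$1$2) (m$1$3 * m$2$1 + m$1$4 * m$2$2) (m$2$3 * m$2$1 + m$2$4 * m$2$2)"
    using ij'(1) P O unfolding qi pat_def
    by (auto simp: kM weyl_eq M4_transpose M4_mult intro!: pp_add pp_diff pp_prod O_mult)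
  then show "pat i ((m$1$3 * m$1$1 + m$1$4 * m$1$2) / \<mu>) ((m$1$3 * m$2$1 + m$1$4 * m$2$2) / \<mu>)
           ((m$2$3 * m$2$1 + m$2$4 * m$2$2) / \<mu>)"
    by (simp add: pat_def unit_mult_pp_iff(3)[OF \<mu>])
qed

text \<open>Two decompositions of one element differ by an element of the parabolic that a Weyl
  element conjugates into \<open>I\<close>. This is all that has to be checked for a function
  defined cell by cell to be well defined.\<close>

lemma cell_representatives:
  assumes nz: "e \<noteq> 0" "det2 x y \<noteq> 0" "e' \<noteq> 0" "det2 x' y' \<noteq> 0" and k: "iw k" "iw k'" and ij: "i < 4" "j < 4"
    and eq: "uu a1 a2 a3 ** levi e x y ** weyl i ** k = uu b1 b2 b3 ** levi e' x' y' ** weyl j ** k'"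
  shows "i = j" "\<exists>Y1 Y2 Y3 e0 x0 y0. pat i Y1 Y2 Y3 \<and> unit e0 \<and> unit (fst x0) \<and> snd x0 \<in> \<O> \<and>
      fst y0 \<in> \<P> \<and> unit (snd y0) \<and>
      uu b1 b2 b3 ** levi e' x' y' = uu a1 a2 a3 ** levi e x y ** (uu Y1 Y2 Y3 ** levi e0 x0 y0)"
proof -
  define p p' where "p = uu a1 a2 a3 ** levi e x y" and "p' = uu b1 b2 b3 ** levi e' x' y'"
  define \<mu> \<mu>' where "\<mu> = e * det2 x y" and "\<mu>' = e' * det2 x' y'"
  have \<mu>: "\<mu> \<noteq> 0" "\<mu>' \<noteq> 0" using nz by (simp_all add: \<mu>_def \<mu>'_def)
  have sp: "symp \<mu> p" "symp \<mu>' p'"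
    using symp_mult[OF symp_basic(1) symp_basic(3)] by (simp_all add: p_def p'_def \<mu>_def \<mu>'_def)
  define m where "m = sinv \<mu> p ** p'"
  define \<rho> where "\<rho> = 1 / \<mu> * \<mu>'"
  have sq: "symp \<rho> m" unfolding m_def \<rho>_def by (rule symp_mult[OF symp_sinv[OF sp(1) \<mu>(1)] sp(2)])
  have \<rho>: "\<rho> \<noteq> 0" using \<mu> by (simp add: \<rho>_def)
  have pq: "p' = p ** m" unfolding m_def by (simp add: sinv_mult[OF sp(1) \<mu>(1)] matrix_mul_assoc)
  have 0: "m$3$1 = 0" "m$3$2 = 0" "m$4$1 = 0" "m$4$2 = 0"
    by (simp_all add: m_def entry_mult sinv_def p_def p'_def uu_def levi_def M4_mult)
  obtain k'' where k'': "iw k''" "k' ** k'' = mat 1" using iw_inverse[OF k(2)] by blast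
  have "p ** (weyl i ** k) = p ** (m ** weyl j ** k')"
    using eq by (simp add: pq matrix_mul_assoc flip: p_def p'_def)
  then have "(sinv \<mu> p ** p) ** (weyl i ** k) = (sinv \<mu> p ** p) ** (m ** weyl j ** k')"
    by (metis matrix_mul_assoc)
  then have "weyl i ** k = m ** weyl j ** k'" by (simp add: sinv_mult[OF sp(1) \<mu>(1)])
  then have "weyl i ** (k ** k'') = m ** weyl j ** (k' ** k'')" by (metis matrix_mul_assoc)
  then have eq': "weyl i ** (k ** k'') = m ** weyl j" by (simp add: k'')
  note conj = weyl_iwahori_conj[OF sq \<rho> 0 iw_mult[OF k(1) k''(1)] eq' ij]
  show "i = j" by (rule conj(1))
  let ?x = "(m$1$1, m$2$1)" and ?y = "(m$1$2, m$2$2)"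
  have "unit (det2 ?x ?y)"
    using unit_diff[OF unit_mult[OF conj(2,3)] pp_mult_O(2)[OF conj(5,4)]] by (simp add: det2_def)
  then have e0: "unit (\<rho> / det2 ?x ?y)" using unit_divide[OF conj(6)] by blast
  show "\<exists>Y1 Y2 Y3 e0 x0 y0. pat i Y1 Y2 Y3 \<and> unit e0 \<and> unit (fst x0) \<and> snd x0 \<in> \<O> \<and>
      fst y0 \<in> \<P> \<and> unit (snd y0) \<and>
      uu b1 b2 b3 ** levi e' x' y' = uu a1 a2 a3 ** levi e x y ** (uu Y1 Y2 Y3 ** levi e0 x0 y0)"
    using levi_decomposition(2)[OF sq \<rho> 0] pq conj(2-5,7) e0
    unfolding p_def[symmetric] p'_def[symmetric]
    by (intro exI[of _ "(m$1$3 * m$1$1 + m$1$4 * m$1$2) / \<rho>"] exI[of _ "(m$1$3 * m$2$1 + m$1$4 * m$2$2) / \<rho>"]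
        exI[of _ "(m$2$3 * m$2$1 + m$2$4 * m$2$2) / \<rho>"] exI[of _ "\<rho> / det2 ?x ?y"] exI[of _ ?x] exI[of _ ?y]) simp
qed

end

subsection \<open>The Bessel model\<close>

lemma matrix_inv_2:
  fixes g :: "'f::field_char_0^2^2"
  assumes "invertible g"
  shows "mat (det g) ** transpose (matrix_inv g) =
    vector [vector [g$2$2, - g$2$1], vector [- g$1$2, g$1$1]]"
proof -
  have D: "det g \<noteq> 0" using assms by (simp add: invertible_det_nz)
  have "\<exists>h. g ** h = mat 1 \<and> h ** g = mat 1" using assms by (simp add: invertible_def)
  then have h: "g ** matrix_inv g = mat 1" "matrix_inv g ** g = mat 1"
    unfolding matrix_inv_def by (metis (mono_tags, lifting) someI_ex)+
  define w where "w = (vector [vector [g$2$2, - g$1$2], vector [- g$2$1, g$1$1]] :: 'f^2^2)"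
  have "w ** g = mat (det g)"
    by (simp add: w_def vec_eq_iff forall_2 matrix_matrix_mult_def sum_2 mat_def det_2 algebra_simps)
  then have "mat (det g) ** matrix_inv g = w ** (g ** matrix_inv g)"
    by (simp add: matrix_mul_assoc)
  then have w: "mat (det g) ** matrix_inv g = w" by (simp add: h)
  have mm: "(mat x ** h) $ i $ j = x * h $ i $ j" for x and h :: "'f^2^2" and i j
    using exhaust_2[of i] by (auto simp: matrix_matrix_mult_def sum_2 mat_def)
  have "det g * matrix_inv g $ i $ j = w $ i $ j" for i j
    unfolding w[symmetric] mm ..
  then show ?thesis
    by (simp add: w_def vec_eq_iff forall_2 mm transpose_def)
qed

lemma U_elt_eq:
  assumes "transpose X = X" shows "U_elt X = uu (X$1$1) (X$1$2) (X$2$2)"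
proof -
  have "X$2$1 = X$1$2" using arg_cong[OF assms, of "\<lambda>Y. Y $ 1 $ 2"] by (simp add: transpose_def)
  then show ?thesis by (simp add: U_elt_def uu_def block_matrix_def M4_def mat_def)
qed

lemma trace_S_mat:
  assumes "transpose X = X"
  shows "trace (S_mat a b c ** X) = a * X$1$1 + b * X$1$2 + c * X$2$2"
proof -
  have "X$2$1 = X$1$2" using arg_cong[OF assms, of "\<lambda>Y. Y $ 1 $ 2"] by (simp add: transpose_def)
  then show ?thesis
    by (simp add: trace_def S_mat_def matrix_matrix_mult_def sum_2 algebra_simps)
qed

section \<open>Additive and multiplicative characters\<close>

locale bessel_data = quadratic_algebra v \<pi> d
  for v :: "'f::field_char_0 \<Rightarrow> int" and \<pi> d +
  fixes a b c :: 'f and \<psi> \<Omega> :: "'f \<Rightarrow> complex" and \<Lambda> :: "'f \<times> 'f \<Rightarrow> complex"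
  assumes a_int: "a \<in> \<O>" and b_int: "b \<in> \<O>" and c_unit: "unit c"
    and d_eq: "d = b\<^sup>2 - 4 * a * c"
    and psi: "add_char v \<psi>" "conductor_integers v \<psi>"
    and Omega: "mult_char v \<Omega>" "unramified v \<Omega>" and Omega_sq: "x \<noteq> 0 \<Longrightarrow> (\<Omega> x)\<^sup>2 = 1"
    and Lambda: "L_char v d \<Lambda>" and Lambda_F: "x \<noteq> 0 \<Longrightarrow> \<Lambda> (L_of d x) = 1"
begin

lemma c_nonzero: "c \<noteq> 0" using c_unit by (rule unit_nonzero)

lemma psi_add: "\<psi> (x + y) = \<psi> x * \<psi> y" and psi_nonzero: "\<psi> x \<noteq> 0"
  using psi by (auto simp: add_char_def)

lemma psi_trivial: "x \<in> \<O> \<Longrightarrow> \<psi> x = 1"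
  using psi(2) unfolding conductor_integers_def by blast

lemma psi_0: "\<psi> 0 = 1" by (rule psi_trivial) simp

lemma psi_nontrivial: "\<not> 0 \<le> n \<Longrightarrow> \<exists>x\<in>prime_power v n. \<psi> x \<noteq> 1"
  using psi(2) unfolding conductor_integers_def by blast

text \<open>Otherwise \<pp>^n A is a fractional ideal larger than \<oo>, and \<psi> is nontrivial on
  it.\<close>

lemma psi_support:
  assumes "\<And>y. y \<in> prime_power v n \<Longrightarrow> \<psi> (y * A) = 1" shows "A \<in> prime_power v (- n)"
proof (rule ccontr)
  assume A: "A \<notin> prime_power v (- n)"
  then have A': "A \<noteq> 0" "v A < - n" by (auto simp: prime_power_iff)
  obtain x where x: "x \<in> prime_power v (n + v A)" "\<psi> x \<noteq> 1" using psi_nontrivial[of "n + v A"] A' by auto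
  have "x / A \<in> prime_power v n"
    using x(1) A' by (cases "x = 0") (auto simp: prime_power_iff val_divide)
  from assms[OF this] show False using x(2) A' by simp
qed

text \<open>Orthogonality: for \<open>A\<close> in \<pp>^-1 the map sending y to \<psi>(-y A) is a
  character of the residue field, trivial exactly when \<open>A\<close> is integral.\<close>

lemma psi_sum:
  assumes A: "A \<in> prime_power v (-1)"
  shows "(\<Sum>y\<in>reps. \<psi> (- y * A)) = (if A \<in> \<O> then of_nat q else 0)"
proof (cases "A \<in> \<O>")
  case True
  have "\<psi> (- y * A) = 1" if "y \<in> reps" for y
    by (rule psi_trivial) (use O_mult[OF reps_in_O[OF that] True] in simp)
  then show ?thesis using True by simp
next
  case False
  have "\<exists>y\<in>\<O>. \<psi> (y * A) \<noteq> 1"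
  proof (rule ccontr)
    assume "\<not> ?thesis"
    then have "A \<in> prime_power v (- 0)" by (intro psi_support) auto
    then show False using False by simp
  qed
  then obtain y0 where y0: "y0 \<in> \<O>" "\<psi> (y0 * A) \<noteq> 1" by blast
  define f where "f y = \<psi> (- y * A)" for y
  have f_cong: "f x = f y" if "x - y \<in> \<P>" for x y
  proof -
    have "(x - y) * A \<in> \<O>" using pp_mult[OF that A] by simp
    then have "- ((x - y) * A) \<in> \<O>" by simp
    then have "\<psi> (- ((x - y) * A)) = 1" by (rule psi_trivial)
    moreover have "- x * A = - ((x - y) * A) + - y * A" by (simp add: algebra_simps)
    then have "f x = \<psi> (- ((x - y) * A)) * f y" unfolding f_def by (simp only: psi_add)
    ultimately show ?thesis by simp
  qed
  have "(\<Sum>y\<in>reps. f (y - y0)) = sum f reps"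
    by (rule sum_reps_reindex) (use f_cong y0 in \<open>auto intro: pp_diff\<close>)
  moreover have "f (y - y0) = \<psi> (y0 * A) * f y" for y
  proof -
    have "- (y - y0) * A = y0 * A + - y * A" by (simp add: algebra_simps)
    then show ?thesis unfolding f_def by (simp only: psi_add)
  qed
  ultimately have "\<psi> (y0 * A) * sum f reps = sum f reps" by (simp add: sum_distrib_left)
  then have "sum f reps = 0" using y0(2) by simp
  then show ?thesis using False by (simp add: f_def)
qed

lemma Omega_mult: "x \<noteq> 0 \<Longrightarrow> y \<noteq> 0 \<Longrightarrow> \<Omega> (x * y) = \<Omega> x * \<Omega> y"
  using Omega(1) unfolding mult_char_def by blast

lemma Omega_nonzero: "x \<noteq> 0 \<Longrightarrow> \<Omega> x \<noteq> 0"
  using Omega(1) unfolding mult_char_def by blast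

lemma Omega_unit: "unit u \<Longrightarrow> \<Omega> u = 1"
  using Omega(2) unfolding unramified_def by blast

lemma Omega_self: "x \<noteq> 0 \<Longrightarrow> \<Omega> x * \<Omega> x = 1"
  using Omega_sq[of x] by (simp add: power2_eq_square)

lemma Lambda_mult: "nm z \<noteq> 0 \<Longrightarrow> nm w \<noteq> 0 \<Longrightarrow> \<Lambda> (z \<odot> w) = \<Lambda> z * \<Lambda> w"
  using Lambda[unfolded L_char_def, THEN conjunct2, THEN conjunct1, rule_format, of z w]
  by (simp add: L_units_iff)

lemma Lambda_nonzero: "nm z \<noteq> 0 \<Longrightarrow> \<Lambda> z \<noteq> 0"
  using Lambda[unfolded L_char_def, THEN conjunct1, rule_format, of z] by (simp add: L_units_iff)

text \<open>If \<open>u\<close> is near 1, then \<open>u - 1\<close> grows under squaring.\<close>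

lemma small_group_trivial:
  fixes u :: complex
  assumes "\<And>k. norm (u ^ (2 ^ k) - 1) < 1 / 2" shows "u = 1"
proof (rule ccontr)
  assume "u \<noteq> 1"
  have grow: "norm (u ^ (2 ^ k) - 1) \<ge> (3 / 2) ^ k * norm (u - 1)" for k
  proof (induction k)
    case (Suc k)
    define w where "w = u ^ (2 ^ k)"
    have "norm (w + 1) \<ge> 2 - norm (w - 1)"
    proof -
      have "norm (2 :: complex) \<le> norm (w + 1) + norm (1 - w)"
        using norm_triangle_ineq[of "w + 1" "1 - w"] by simp
      then show ?thesis by (simp add: norm_minus_commute)
    qed
    then have w: "norm (w + 1) \<ge> 3 / 2" using assms[of k] by (simp add: w_def)
    have "u ^ (2 ^ Suc k) - 1 = (w + 1) * (w - 1)"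
      by (simp add: w_def power_mult power2_eq_square algebra_simps mult_2 power_add)
    then have "norm (u ^ (2 ^ Suc k) - 1) = norm (w + 1) * norm (w - 1)" by (simp add: norm_mult)
    also have "\<dots> \<ge> 3 / 2 * norm (w - 1)" using w by (intro mult_right_mono) auto
    finally show ?case using Suc by (simp add: w_def)
  qed simp
  obtain k where "1 / norm (u - 1) < (3 / 2 :: real) ^ k"
    using real_arch_pow[of "3 / 2"] by auto
  then have "(3 / 2) ^ k * norm (u - 1) > 1" using \<open>u \<noteq> 1\<close> by (simp add: field_simps)
  then show False using grow[of k] assms[of k] by linarith
qed

text \<open>The norm of z is the similitude factor of the embedded torus element, so this is how the
  torus acts after the twist by \<Omega>.\<close>

definition \<xi> :: "'f \<times> 'f \<Rightarrow> complex" where "\<xi> z = \<Lambda> z * \<Omega> (nm z)"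

text \<open>Continuity keeps \<Lambda> within 1/2 of 1 on a neighbourhood of \<open>one\<close> that
  is closed under squaring. All iterated squares of a value of \<Lambda> there stay near 1, so the
  value is 1.\<close>

lemma Lambda_small: "\<exists>N\<ge>1. \<forall>w\<in>bx N. \<Lambda> (one + w) = 1"
proof -
  have "one \<in> L_units d" by (simp add: L_units_iff)
  then have "\<exists>n. \<forall>w\<in>L_units d. fst w - fst one \<in> prime_power v n \<and>
      snd w - snd one \<in> prime_power v n \<longrightarrow> norm (\<Lambda> w - \<Lambda> one) < 1 / 2"
    by (rule Lambda[unfolded L_char_def, THEN conjunct2, THEN conjunct2, rule_format]) simp
  then obtain n where n: "\<And>w. w \<in> L_units d \<Longrightarrow> fst w - fst one \<in> prime_power v n \<Longrightarrow>
      snd w - snd one \<in> prime_power v n \<Longrightarrow> norm (\<Lambda> w - \<Lambda> one) < 1 / 2" by blast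
  define N where "N = nat (max n 1)"
  have N: "N \<ge> 1" "n \<le> int N" by (auto simp: N_def)
  have L1: "\<Lambda> one = 1" using Lambda_F[of 1] by simp
  have near: "norm (\<Lambda> (one + w) - 1) < 1 / 2" if "w \<in> bx N" for w
  proof -
    have w: "fst w \<in> prime_power v n" "snd w \<in> prime_power v n"
      using that N(2) pp_mono[of _ "int N" n] by (auto simp: bx_def)
    have "one + w \<in> L_units d" using nm_one_bx[OF that N(1)] by (simp add: L_units_iff)
    from n[OF this] show ?thesis using w by (simp add: L1)
  qed
  have power: "\<exists>w'\<in>bx N. \<Lambda> (one + w) ^ (2 ^ k) = \<Lambda> (one + w')" if "w \<in> bx N" for w k
  proof (induction k)
    case 0
    then show ?case using that by (intro bexI[of _ w]) auto
  next
    case (Suc k)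
    then obtain w' where w': "w' \<in> bx N" "\<Lambda> (one + w) ^ (2 ^ k) = \<Lambda> (one + w')" by blast
    have nz: "nm (one + w') \<noteq> 0" by (rule nm_one_bx[OF w'(1) N(1)])
    have "\<Lambda> (one + w) ^ (2 ^ Suc k) = \<Lambda> (one + w') * \<Lambda> (one + w')"
      by (simp add: mult_2 power_add w'(2))
    also have "\<dots> = \<Lambda> ((one + w') \<odot> (one + w'))" using Lambda_mult[OF nz nz] by simp
    also have "(one + w') \<odot> (one + w') = one + (w' + w' + w' \<odot> w')"
      by (simp add: L_mult_laws(3-6) algebra_simps)
    finally show ?case using w'(1) by (intro bexI[of _ "w' + w' + w' \<odot> w'"]) (auto intro: bx_add bx_mult)
  qed
  have "\<Lambda> (one + w) = 1" if w: "w \<in> bx N" for w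
  proof (rule small_group_trivial)
    fix k
    obtain w' where "w' \<in> bx N" "\<Lambda> (one + w) ^ (2 ^ k) = \<Lambda> (one + w')" using power[OF w] by blast
    then show "norm (\<Lambda> (one + w) ^ (2 ^ k) - 1) < 1 / 2" using near by simp
  qed
  then show ?thesis using N(1) by blast
qed

lemma nm_one_bx_unit:
  assumes w: "w \<in> bx N" and N: "N \<ge> 1" shows "unit (nm (one + w))"
proof -
  have P: "fst w \<in> \<P>" "snd w \<in> \<P>"
    using w N pp_mono[of _ "int N" 1] by (auto simp: bx_def)
  have u: "unit (1 + fst w)" "unit (1 + snd w)" using P by (simp_all add: unit_add)
  have "unit ((1 + fst w) * (1 + fst w) - d * (snd w * snd w))"
    by (rule unit_diff[OF unit_mult[OF u(1) u(1)]])
      (rule pp_mult_O(2)[OF d_int pp_mult_O(1)[OF P(2) P_in_O[OF P(2)]]])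
  then show ?thesis
    using unit_mult[OF u] by (auto simp: L_norm_def L_mult_def L_conj_def L_of_def)
qed

lemma character: "\<exists>cond. quadratic_character v \<pi> d \<xi> cond"
proof -
  obtain N where N: "N \<ge> 1" "\<forall>w\<in>bx N. \<Lambda> (one + w) = 1" using Lambda_small by blast
  have "quadratic_character v \<pi> d \<xi> N"
  proof
    fix t s assume "nm t \<noteq> 0" "nm s \<noteq> 0"
    then show "\<xi> (t \<odot> s) = \<xi> t * \<xi> s"
      by (simp add: \<xi>_def Lambda_mult nm_mult Omega_mult)
  next
    fix t assume "nm t \<noteq> 0"
    then show "\<xi> t \<noteq> 0" by (simp add: \<xi>_def Lambda_nonzero Omega_nonzero)
  next
    fix x :: 'f assume x: "x \<noteq> 0"
    have "nm (L_of d x) = x * x" by (simp add: L_of_eq[of x] nm_sm power2_eq_square)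
    then show "\<xi> (L_of d x) = 1" using x by (simp add: \<xi>_def Lambda_F Omega_mult Omega_self)
  next
    fix t assume "fst t \<in> prime_power v (int N + 1)" "snd t \<in> prime_power v (int N + 1)"
    then have t: "t \<in> bx N" using pp_mono[of _ "int N + 1" "int N"] by (auto simp: bx_def)
    then show "\<xi> (one + t) = 1"
      using N nm_one_bx_unit[OF t N(1)] by (simp add: \<xi>_def Omega_unit)
  qed
  then show ?thesis by blast
qed

section \<open>The torus acting on the plane through \<open>L\<close>\<close>

text \<open>The identification of \<open>F\<^sup>2\<close> with \<open>L\<close> that sends \<open>t e\<^sub>2\<close> to \<open>t\<close> for \<open>t\<close> in \<open>T(F)\<close>; it exists
  because \<open>c \<noteq> 0\<close>.\<close>

definition iota :: "'f \<times> 'f \<Rightarrow> 'f \<times> 'f" where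
  "iota w = (let y = fst w / c; x = snd w + b / 2 * y in
     if is_sq d then (x + y * (sq_root d / 2), x - y * (sq_root d / 2)) else (x, y / 2))"

lemma sq_root_sq: "is_sq d \<Longrightarrow> sq_root d * sq_root d = d"
  unfolding is_sq_def sq_root_def power2_eq_square by (rule someI_ex)

lemma sq_root_nonzero: "is_sq d \<Longrightarrow> sq_root d \<noteq> 0"
  using sq_root_sq d_nonzero by auto

lemma iota_sm: "iota (sm z w) = sm z (iota w)" and iota_add: "iota (w + w') = iota w + iota w'"
  by (auto simp: iota_def Let_def sm_def prod_eq_iff algebra_simps add_divide_distrib)

lemma det2_iota: "\<exists>k. k \<noteq> 0 \<and> (\<forall>x y. det2 (iota x) (iota y) = k * det2 x y)"
proof (cases "is_sq d")
  case True
  have "det2 (iota x) (iota y) = (sq_root d / c) * det2 x y" for x y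
    using c_nonzero by (simp add: iota_def Let_def True det2_def field_simps)
  then show ?thesis using sq_root_nonzero[OF True] c_nonzero by (intro exI[of _ "sq_root d / c"]) simp
next
  case False
  have "det2 (iota x) (iota y) = (- 1 / (2 * c)) * det2 x y" for x y
    using c_nonzero by (simp add: iota_def Let_def False det2_def field_simps)
  then show ?thesis using c_nonzero by (intro exI[of _ "- 1 / (2 * c)"]) simp
qed

definition jota :: "'f \<times> 'f \<Rightarrow> 'f \<times> 'f" where
  "jota z = (let y = (if is_sq d then (fst z - snd z) / sq_root d else 2 * snd z);
     x = (if is_sq d then (fst z + snd z) / 2 else fst z) in (c * y, x - b / 2 * y))"

lemma iota_jota: "iota (jota z) = z"
proof (cases "is_sq d")
  case True
  then show ?thesis using sq_root_nonzero[OF True] c_nonzero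
    by (simp add: iota_def jota_def Let_def prod_eq_iff) (simp add: field_simps)
next
  case False
  then show ?thesis using c_nonzero by (simp add: iota_def jota_def Let_def prod_eq_iff)
qed

lemma jota_iota: "jota (iota w) = w"
proof (cases "is_sq d")
  case True
  then show ?thesis using sq_root_nonzero[OF True] c_nonzero
    by (simp add: iota_def jota_def Let_def prod_eq_iff) (simp add: add_divide_distrib mult.commute)
next
  case False
  then show ?thesis using c_nonzero by (simp add: iota_def jota_def Let_def prod_eq_iff)
qed

lemma det2_iota_iff: "det2 (iota x) (iota y) \<noteq> 0 \<longleftrightarrow> det2 x y \<noteq> 0"
  using det2_iota by (metis mult_eq_0_iff)

definition act :: "'f \<times> 'f \<Rightarrow> 'f \<times> 'f \<Rightarrow> 'f \<times> 'f" where
  "act z w = jota (z \<odot> iota w)"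

lemma iota_act: "iota (act z w) = z \<odot> iota w"
  by (simp add: act_def iota_jota)

lemma jota_lin: "jota (sm z w) = sm z (jota w)" "jota (w + w') = jota w + jota w'"
  by (metis iota_jota iota_sm jota_iota) (metis iota_jota iota_add jota_iota)

lemma act_lin: "act z (sm x w) = sm x (act z w)" "act z (w + w') = act z w + act z w'"
  by (simp_all add: act_def iota_sm iota_add L_mult_laws(5,8) jota_lin)

lemma det2_act: "det2 (act z x) (act z y) = nm z * det2 x y"
proof -
  obtain k where k: "k \<noteq> 0" "\<And>x y. det2 (iota x) (iota y) = k * det2 x y" using det2_iota by blast
  have "k * det2 (act z x) (act z y) = k * (nm z * det2 x y)"
    using det2_mult[of z "iota x" "iota y"] by (simp add: iota_act k(2) flip: k(2)[of "act z x"])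
  then show ?thesis using k(1) by simp
qed

section \<open>The quadratic form of \<open>S\<close> and its translates\<close>

definition fm :: "'f \<times> 'f \<Rightarrow> 'f" where
  "fm w = a * (fst w * fst w) + b * (fst w * snd w) + c * (snd w * snd w)"

definition bm :: "'f \<times> 'f \<Rightarrow> 'f \<times> 'f \<Rightarrow> 'f" where
  "bm x y = 2 * a * (fst x * fst y) + b * (fst x * snd y + fst y * snd x) + 2 * c * (snd x * snd y)"

lemma bm_eq: "bm x y = fm (x + y) - fm x - fm y"
  by (simp add: bm_def fm_def algebra_simps)

text \<open>Completing the square in the second coordinate, with d / 4 = (b / 2)^2 - a c. It makes
  the quadratic form a multiple of the norm, so the torus scales it by norms.\<close>

lemma fm_iota: "fm w = c * nm (iota w)"
proof -
  define y k where "y = fst w / c" and "k = b / 2"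
  have p: "fst w = c * y" using c_nonzero by (simp add: y_def)
  have "nm (iota w) = (snd w + k * y) * (snd w + k * y) - d / 4 * (y * y)"
  proof (cases "is_sq d")
    case True
    then have "nm (iota w) = (snd w + k * y + y * (sq_root d / 2)) * (snd w + k * y - y * (sq_root d / 2))"
      by (simp add: nm_split iota_def Let_def y_def k_def mult.commute[of c 2])
    also have "\<dots> = (snd w + k * y) * (snd w + k * y) - (sq_root d * sq_root d) / 4 * (y * y)"
      by (simp add: algebra_simps)
    finally show ?thesis by (simp add: sq_root_sq[OF True])
  next
    case False
    then show ?thesis by (simp add: iota_def Let_def L_norm_def L_mult_def L_conj_def y_def k_def mult.commute[of c 2])
  qed
  moreover have "d / 4 = k * k - a * c" by (simp add: d_eq k_def power2_eq_square field_simps)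
  ultimately have n: "nm (iota w) = (snd w + k * y) * (snd w + k * y) - (k * k - a * c) * (y * y)"
    by (simp only:)
  have "fm w = a * (c * y * (c * y)) + 2 * k * (c * y * snd w) + c * (snd w * snd w)"
    unfolding fm_def p by (simp add: k_def)
  then show ?thesis unfolding n by (simp add: algebra_simps)
qed

lemma fm_act: "fm (act z w) = nm z * fm w"
  by (simp add: fm_iota iota_act nm_mult)

lemma bm_act: "bm (act z x) (act z y) = nm z * bm x y"
  unfolding bm_eq act_lin(2)[symmetric] fm_act by (simp add: algebra_simps)

definition tor :: "'f \<times> 'f \<Rightarrow> 'f^4^4" where
  "tor z = levi 1 (act z (1, 0)) (act z (0, 1))"

lemma tor_levi: "tor z ** levi e x y = levi e (act z x) (act z y)"
proof -
  have "w = sm (fst w) (1, 0) + sm (snd w) (0, 1)" for w :: "'f \<times> 'f" by (simp add: sm_def)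
  then have *: "act z w = sm (fst w) (act z (1, 0)) + sm (snd w) (act z (0, 1))" for w
    by (metis act_lin)
  show ?thesis unfolding tor_def levi_mult mult_1 *[of x] *[of y] ..
qed

text \<open>The two vectors are the columns of the torus matrix, so \<open>act z\<close> is
  multiplication by the matrix identified with z.\<close>

lemma T_elt_act:
  assumes "z = T_to_L a b c (T_elt a b c x y)"
  shows "act z (1, 0) = (x + b / 2 * y, - a * y)" "act z (0, 1) = (c * y, x - b / 2 * y)"
proof -
  have z: "z = (if is_sq d then (x + y * (sq_root d / 2), x - y * (sq_root d / 2)) else (x, y / 2))"
    using T_to_L_T_elt[OF c_nonzero, of a b x y] assms by (simp flip: d_eq)
  define k h where "k = b / 2" and "h = sq_root d / 2"
  have b: "b = 2 * k" and d4: "d = 4 * (k * k - a * c)" by (simp_all add: k_def d_eq power2_eq_square)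
  have hh: "h * h = k * k - a * c" if "is_sq d"
    using sq_root_sq[OF that] by (simp add: h_def d4)
  have key: "c * (- a * y + k * ((x + k * y) / c)) = - (a * c) * y + k * (x + k * y)"
  proof -
    define w where "w = (x + k * y) / c"
    have w: "x + k * y = c * w" using c_nonzero by (simp add: w_def)
    show ?thesis unfolding w_def[symmetric] unfolding w by (simp add: algebra_simps)
  qed
  have "iota (x + k * y, - a * y) = z \<odot> iota (1, 0)"
  proof (cases "is_sq d")
    case True
    have "iota (x + k * y, - a * y) =
        (let y' = (x + k * y) / c; x' = - a * y + k * y' in (x' + y' * h, x' - y' * h))"
      by (simp add: iota_def True Let_def k_def h_def)
    moreover have "z \<odot> iota (1, 0) = ((x + y * h) * (k / c + h / c), (x - y * h) * (k / c - h / c))"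
      by (simp add: iota_def True Let_def k_def h_def z L_mult_def mult.commute[of c 2])
    moreover have "c * (- a * y + k * ((x + k * y) / c)) = x * k + y * (h * h)"
      unfolding key hh[OF True] by (simp add: algebra_simps)
    then have "- a * y + k * ((x + k * y) / c) = (x * k + y * (h * h)) / c"
      using c_nonzero by (metis nonzero_mult_div_cancel_left)
    ultimately show ?thesis
      by (simp add: Let_def prod_eq_iff) (simp add: add_divide_distrib diff_divide_distrib algebra_simps)
  next
    case False
    have d': "d * (y / 2) / 2 = (k * k - a * c) * y" by (simp add: d4)
    have "c * (- a * y + k * ((x + k * y) / c)) = x * k + d * (y / 2) / 2"
      unfolding key d' by (simp add: algebra_simps)
    then have "- a * y + k * ((x + k * y) / c) = (x * k + d * (y / 2) / 2) / c"
      using c_nonzero by (metis nonzero_mult_div_cancel_left)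
    then show ?thesis
      by (simp add: iota_def False Let_def z L_mult_def flip: k_def)
        (simp add: add_divide_distrib algebra_simps)
  qed
  then show "act z (1, 0) = (x + b / 2 * y, - a * y)"
    unfolding act_def k_def[symmetric] by (metis jota_iota)
  have "iota (c * y, x - k * y) = z \<odot> iota (0, 1)"
    using c_nonzero by (simp add: iota_def Let_def z L_mult_def k_def)
  then show "act z (0, 1) = (c * y, x - b / 2 * y)"
    unfolding act_def k_def[symmetric] by (metis jota_iota)
qed

lemma T_embed_tor:
  assumes t: "t \<in> T_group a b c"
  shows "T_embed t = tor (T_to_L a b c t)" "nm (T_to_L a b c t) \<noteq> 0"
proof -
  obtain x y where xy: "t = T_elt a b c x y" "invertible t"
    using t unfolding T_group_eq[OF c_nonzero] by blast
  define z where "z = T_to_L a b c t"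
  note act = T_elt_act[of z x y, unfolded xy(1)[symmetric], OF z_def]
  have e: "t$1$1 = x + b / 2 * y" "t$1$2 = c * y" "t$2$1 = - a * y" "t$2$2 = x - b / 2 * y"
    by (simp_all add: xy(1) T_elt_def)
  show "T_embed t = tor (T_to_L a b c t)"
    unfolding z_def[symmetric] tor_def act T_embed_def matrix_inv_2[OF xy(2)]
    by (simp add: block_matrix_def levi_def M4_def e)
  have "det t = det2 (act z (1, 0)) (act z (0, 1))"
    by (simp add: det_2 act det2_def e algebra_simps)
  also have "\<dots> = nm z" unfolding det2_act by (simp add: det2_def)
  finally show "nm (T_to_L a b c t) \<noteq> 0" using xy(2) by (simp add: invertible_det_nz z_def)
qed

lemma T_to_L_surj:
  assumes z: "nm z \<noteq> 0" shows "\<exists>t\<in>T_group a b c. T_to_L a b c t = z"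
proof -
  define x where "x = (if is_sq d then (fst z + snd z) / 2 else fst z)"
  define y where "y = (if is_sq d then (fst z - snd z) / sq_root d else 2 * snd z)"
  have eq: "T_to_L a b c (T_elt a b c x y) = z"
    using T_to_L_T_elt[OF c_nonzero, of a b x y] sq_root_nonzero
    by (simp add: x_def y_def prod_eq_iff flip: d_eq) (simp add: field_simps)
  note act = T_elt_act[OF eq[symmetric]]
  have "det (T_elt a b c x y) = det2 (act z (1, 0)) (act z (0, 1))"
    by (simp add: det_2 act det2_def T_elt_def algebra_simps)
  also have "\<dots> = nm z" unfolding det2_act by (simp add: det2_def)
  finally have "invertible (T_elt a b c x y)" using z by (simp add: invertible_det_nz)
  then show ?thesis using eq unfolding T_group_eq[OF c_nonzero] by blast
qed

text \<open>\<open>fA\<close>, \<open>fB\<close>, \<open>fC\<close> are the coefficients of the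
  symmetric form A^t S A divided by the similitude factor, where A has the columns
  \<open>x, y\<close>. They describe the character obtained from the character of
  \<open>U(F)\<close> by conjugation with \<open>levi e x y\<close>.\<close>

definition fA where "fA e x y = fm x / (e * det2 x y)"
definition fB where "fB e x y = bm x y / (e * det2 x y)"
definition fC where "fC e x y = fm y / (e * det2 x y)"

text \<open>The condition for the translate of \<open>\<theta>\<close> by \<open>levi e x y\<close> to be trivial on the subgroup \<open>pat i\<close>.\<close>

definition ind :: "nat \<Rightarrow> 'f \<Rightarrow> 'f \<times> 'f \<Rightarrow> 'f \<times> 'f \<Rightarrow> bool" where
  "ind i e x y \<longleftrightarrow> fA e x y \<in> prime_power v (- of_bool (i > 0)) \<and>
     fB e x y \<in> prime_power v (- of_bool (i > 1)) \<and> fC e x y \<in> prime_power v (- of_bool (i > 2))"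

lemma two_O: "2 \<in> \<O>"
  using pp_add[of 1 0 1] by simp

lemma fm_lin: "fm (sm \<alpha> x + sm \<beta> y) = \<alpha> * \<alpha> * fm x + \<alpha> * \<beta> * bm x y + \<beta> * \<beta> * fm y"
  by (simp add: fm_def bm_def sm_def algebra_simps)

lemma bm_lin: "bm (sm \<alpha> x + sm \<beta> y) (sm z x + sm \<delta> y) =
    2 * \<alpha> * (z * fm x) + (\<alpha> * \<delta> + \<beta> * z) * bm x y + 2 * \<beta> * \<delta> * fm y"
  by (simp add: fm_def bm_def sm_def algebra_simps)

lemma form_change:
  fixes \<alpha> \<beta> z \<delta> e0 :: 'f
  defines "u \<equiv> e0 * (\<alpha> * \<delta> - \<beta> * z)"
  shows "fA (e * e0) (sm \<alpha> x + sm \<beta> y) (sm z x + sm \<delta> y) =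
      (\<alpha> * \<alpha> * fA e x y + \<alpha> * \<beta> * fB e x y + \<beta> * \<beta> * fC e x y) / u"
    "fB (e * e0) (sm \<alpha> x + sm \<beta> y) (sm z x + sm \<delta> y) =
      (2 * \<alpha> * (z * fA e x y) + (\<alpha> * \<delta> + \<beta> * z) * fB e x y + 2 * \<beta> * \<delta> * fC e x y) / u"
    "fC (e * e0) (sm \<alpha> x + sm \<beta> y) (sm z x + sm \<delta> y) =
      (z * (z * fA e x y) + \<delta> * (z * fB e x y) + \<delta> * \<delta> * fC e x y) / u"
proof -
  have D: "e * e0 * det2 (sm \<alpha> x + sm \<beta> y) (sm z x + sm \<delta> y) = (e * det2 x y) * u"
    by (simp add: det2_lin u_def)
  show "fA (e * e0) (sm \<alpha> x + sm \<beta> y) (sm z x + sm \<delta> y) =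
      (\<alpha> * \<alpha> * fA e x y + \<alpha> * \<beta> * fB e x y + \<beta> * \<beta> * fC e x y) / u"
    unfolding fA_def fB_def fC_def D fm_lin by (simp add: add_divide_distrib)
  show "fB (e * e0) (sm \<alpha> x + sm \<beta> y) (sm z x + sm \<delta> y) =
      (2 * \<alpha> * (z * fA e x y) + (\<alpha> * \<delta> + \<beta> * z) * fB e x y + 2 * \<beta> * \<delta> * fC e x y) / u"
    unfolding fA_def fB_def fC_def D bm_lin by (simp add: add_divide_distrib)
  show "fC (e * e0) (sm \<alpha> x + sm \<beta> y) (sm z x + sm \<delta> y) =
      (z * (z * fA e x y) + \<delta> * (z * fB e x y) + \<delta> * \<delta> * fC e x y) / u"
    unfolding fA_def fB_def fC_def D fm_lin by (simp add: add_divide_distrib mult_ac)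
qed

text \<open>The three exponents increase from \<open>fA\<close> to \<open>fC\<close> by at most 1 in
  all. The entry z \<in> \<pp> makes up for the weaker bounds on \<open>fA\<close> and
  \<open>fB\<close> wherever these enter a form with a stronger bound.\<close>

lemma ind_iwahori_aux:
  assumes "ind i e x y" and e0: "unit e0" and u: "unit \<alpha>" "\<beta> \<in> \<O>" "z \<in> \<P>" "unit \<delta>"
  shows "ind i (e * e0) (sm \<alpha> x + sm \<beta> y) (sm z x + sm \<delta> y)"
proof -
  define k l m :: int where "k = - of_bool (i > 0)" and "l = - of_bool (i > 1)" and "m = - of_bool (i > 2)"
  have klm: "- 1 \<le> k" "k \<le> l" "l \<le> m" "m \<le> 0" by (auto simp: k_def l_def m_def)
  define A B C where "A = fA e x y" and "B = fB e x y" and "C = fC e x y"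
  have A: "A \<in> prime_power v k" and B: "B \<in> prime_power v l" and C: "C \<in> prime_power v m"
    using assms(1) by (simp_all add: ind_def k_def l_def m_def A_def B_def C_def)
  have zA: "z * A \<in> prime_power v m" "z * A \<in> prime_power v l" and zB: "z * B \<in> prime_power v m"
    using pp_mult[OF u(3) A] pp_mult[OF u(3) B] klm by (auto elim: pp_mono)
  have B': "B \<in> prime_power v k" and C': "C \<in> prime_power v k" "C \<in> prime_power v l"
    using pp_mono[OF B] pp_mono[OF C] klm by auto
  have O: "\<alpha> \<in> \<O>" "\<delta> \<in> \<O>" "z \<in> \<O>" using u unit_in_O P_in_O by auto
  have num: "\<alpha> * \<alpha> * A + \<alpha> * \<beta> * B + \<beta> * \<beta> * C \<in> prime_power v k"
    by (intro pp_add pp_mult_O(2)[OF O_mult] A B' C' O u(2))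
  have num': "2 * \<alpha> * (z * A) + (\<alpha> * \<delta> + \<beta> * z) * B + 2 * \<beta> * \<delta> * C \<in> prime_power v l"
    by (rule pp_add[OF pp_add[OF pp_mult_O(2)[OF O_mult[OF two_O O(1)] zA(2)]
          pp_mult_O(2)[OF pp_add[OF O_mult[OF O(1,2)] O_mult[OF u(2) O(3)]] B]]
          pp_mult_O(2)[OF O_mult[OF O_mult[OF two_O u(2)] O(2)] C'(2)]])
  have num'': "z * (z * A) + \<delta> * (z * B) + \<delta> * \<delta> * C \<in> prime_power v m"
    by (rule pp_add[OF pp_add[OF pp_mult_O(2)[OF O(3) zA(1)] pp_mult_O(2)[OF O(2) zB]]
          pp_mult_O(2)[OF O_mult[OF O(2,2)] C]])
  have "unit (e0 * (\<alpha> * \<delta> - \<beta> * z))"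
    by (rule unit_mult[OF e0 unit_diff[OF unit_mult[OF u(1,4)] pp_mult_O(2)[OF u(2,3)]]])
  note unit_mult_pp_iff(3)[OF this]
  then show ?thesis
    unfolding ind_def form_change using num num' num''
    by (simp add: A_def B_def C_def k_def l_def m_def)
qed

lemma ind_iwahori:
  assumes e0: "unit e0" and u: "unit \<alpha>" "\<beta> \<in> \<O>" "z \<in> \<P>" "unit \<delta>"
  shows "ind i (e * e0) (sm \<alpha> x + sm \<beta> y) (sm z x + sm \<delta> y) \<longleftrightarrow> ind i e x y" (is "ind i ?e ?x ?y \<longleftrightarrow> _")
proof
  assume "ind i e x y"
  then show "ind i ?e ?x ?y" by (rule ind_iwahori_aux[OF _ e0 u])
next
  assume *: "ind i ?e ?x ?y"
  define w where "w = \<alpha> * \<delta> - \<beta> * z"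
  have w: "unit w" unfolding w_def
    by (rule unit_diff[OF unit_mult[OF u(1,4)] pp_mult_O(2)[OF u(2,3)]])
  \<comment> \<open>The converse is the same statement for the inverse change of basis.\<close>
  have "ind i (?e * inverse e0) (sm (\<delta> / w) ?x + sm (- \<beta> / w) ?y) (sm (- z / w) ?x + sm (\<alpha> / w) ?y)"
    by (rule ind_iwahori_aux[OF * unit_inverse[OF e0] unit_divide[OF u(4) w] _ _ unit_divide[OF u(1) w]])
      (use u(2,3) unit_mult_pp_iff(3)[OF w] in simp_all)
  moreover have "sm (\<delta> / w) ?x + sm (- \<beta> / w) ?y = x"
  proof -
    have "sm (\<delta> / w) ?x + sm (- \<beta> / w) ?y = sm (1 / w) (sm \<delta> ?x + sm (- \<beta>) ?y)"
      by (simp add: sm_def prod_eq_iff add_divide_distrib diff_divide_distrib)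
    also have "sm \<delta> ?x + sm (- \<beta>) ?y = sm w x"
      by (simp add: sm_def prod_eq_iff w_def algebra_simps)
    finally have "sm (\<delta> / w) ?x + sm (- \<beta> / w) ?y = sm (1 / w * w) x" by (simp only: sm_simps(4))
    then show ?thesis using unit_nonzero[OF w] by (simp add: sm_simps)
  qed
  moreover have "sm (- z / w) ?x + sm (\<alpha> / w) ?y = y"
  proof -
    have "sm (- z / w) ?x + sm (\<alpha> / w) ?y = sm (1 / w) (sm (- z) ?x + sm \<alpha> ?y)"
      by (simp add: sm_def prod_eq_iff add_divide_distrib diff_divide_distrib)
    also have "sm (- z) ?x + sm \<alpha> ?y = sm w y"
      by (simp add: sm_def prod_eq_iff w_def algebra_simps)
    finally have "sm (- z / w) ?x + sm (\<alpha> / w) ?y = sm (1 / w * w) y" by (simp only: sm_simps(4))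
    then show ?thesis using unit_nonzero[OF w] by (simp add: sm_simps)
  qed
  moreover have "?e * inverse e0 = e" using unit_nonzero[OF e0] by simp
  ultimately show "ind i e x y" by simp
qed

text \<open>For i = 0 and i = 3 the three bounds coincide, so the condition is insensitive to all
  integral changes of basis and not just to Iwahori ones. This is why (H1) on these cells becomes a
  relation at a vertex.\<close>

lemma ind_shear_aux:
  assumes "ind i e x y" "w \<in> \<O>" "i = 0 \<or> i = 3"
  shows "ind i e x (y + sm w x)"
proof -
  define k :: int where "k = - of_bool (i > 0)"
  define A B C where "A = fA e x y" and "B = fB e x y" and "C = fC e x y"
  have ABC: "A \<in> prime_power v k" "B \<in> prime_power v k" "C \<in> prime_power v k"
    using assms by (auto simp: ind_def k_def A_def B_def C_def)
  have s: "sm w x + sm 1 y = y + sm w x" "sm 1 x + sm 0 y = x" by (simp_all add: sm_simps add.commute)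
  have eq: "fA e x (y + sm w x) = A" "fB e x (y + sm w x) = 2 * (w * A) + B"
    "fC e x (y + sm w x) = w * (w * A) + w * B + C"
    using form_change[of e 1 1 x 0 y w 1, unfolded s] by (simp_all add: A_def B_def C_def)
  have wA: "w * A \<in> prime_power v k" by (rule pp_mult_O(2)[OF assms(2) ABC(1)])
  have "2 * (w * A) + B \<in> prime_power v k" "w * (w * A) + w * B + C \<in> prime_power v k"
    using pp_add[OF pp_mult_O(2)[OF two_O wA] ABC(2)]
      pp_add[OF pp_add[OF pp_mult_O(2)[OF assms(2) wA] pp_mult_O(2)[OF assms(2) ABC(2)]] ABC(3)] .
  then show ?thesis unfolding ind_def eq using ABC assms(3) by (auto simp: k_def)
qed

lemma ind_shear:
  assumes "w \<in> \<O>" "i = 0 \<or> i = 3"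
  shows "ind i e x (y + sm w x) \<longleftrightarrow> ind i e x y"
proof
  assume "ind i e x (y + sm w x)"
  from ind_shear_aux[OF this _ assms(2), of "- w"] show "ind i e x y"
    using assms(1) by (simp add: sm_simps)
qed (rule ind_shear_aux[OF _ assms])

lemma ind_swap: "i = 0 \<or> i = 3 \<Longrightarrow> ind i (- e) y x \<longleftrightarrow> ind i e x y"
  by (auto simp: ind_def fA_def fB_def fC_def det2_swap[of y x] bm_def algebra_simps)

text \<open>\<open>e\<close> stands in the denominator of all three forms, so every sufficiently
  small valuation of \<open>e\<close> makes them integral.\<close>

lemma ind_exists: "\<exists>e. e \<noteq> 0 \<and> (\<forall>e'. e' \<noteq> 0 \<longrightarrow> v e' \<le> v e \<longrightarrow> (\<forall>i. ind i e' x y))"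
proof -
  obtain n where n: "n \<ge> 1"
    "\<forall>h\<in>{fm x / det2 x y, bm x y / det2 x y, fm y / det2 x y}. \<forall>u\<in>prime_power v (int n). u * h \<in> \<P>"
    using pp_bounded_multiplier[of "{fm x / det2 x y, bm x y / det2 x y, fm y / det2 x y}"] by auto
  have "ind i e' x y" if "e' \<noteq> 0" "v e' \<le> v (inverse (\<pi> ^ n))" for e' i
  proof -
    have "inverse e' \<in> prime_power v (int n)"
      using that by (simp add: prime_power_iff val_inverse val_power)
    then have "inverse e' * (fm x / det2 x y) \<in> \<P>" "inverse e' * (bm x y / det2 x y) \<in> \<P>"
      "inverse e' * (fm y / det2 x y) \<in> \<P>" using n(2) by blast+
    then have "fA e' x y \<in> \<P>" "fB e' x y \<in> \<P>" "fC e' x y \<in> \<P>"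
      by (simp_all add: fA_def fB_def fC_def field_simps)
    then show ?thesis unfolding ind_def by (auto elim!: pp_mono)
  qed
  then show ?thesis by (intro exI[of _ "inverse (\<pi> ^ n)"]) auto
qed

text \<open>Moves the conjugation from the unipotent element to the form: tr(S A Y A^t) = tr(A^t S A
  Y).\<close>

lemma levi_uu_theta:
  assumes "e \<noteq> 0" "det2 x y \<noteq> 0"
  obtains Z1 Z2 Z3 where "levi e x y ** uu Y1 Y2 Y3 = uu Z1 Z2 Z3 ** levi e x y"
    "a * Z1 + b * Z2 + c * Z3 = fA e x y * Y1 + fB e x y * Y2 + fC e x y * Y3"
proof (rule that[OF levi_uu[OF assms]])
  let ?E = "e * det2 x y"
  have "a * (fst x * fst x * Y1 + 2 * fst x * fst y * Y2 + fst y * fst y * Y3) +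
      b * (fst x * snd x * Y1 + (fst x * snd y + fst y * snd x) * Y2 + fst y * snd y * Y3) +
      c * (snd x * snd x * Y1 + 2 * snd x * snd y * Y2 + snd y * snd y * Y3) =
      fm x * Y1 + bm x y * Y2 + fm y * Y3"
    by (simp add: fm_def bm_def algebra_simps)
  then show "a * ((fst x * fst x * Y1 + 2 * fst x * fst y * Y2 + fst y * fst y * Y3) / ?E) +
      b * ((fst x * snd x * Y1 + (fst x * snd y + fst y * snd x) * Y2 + fst y * snd y * Y3) / ?E) +
      c * ((snd x * snd x * Y1 + 2 * snd x * snd y * Y2 + snd y * snd y * Y3) / ?E) =
      fA e x y * Y1 + fB e x y * Y2 + fC e x y * Y3"
    unfolding fA_def fB_def fC_def times_divide_eq_right times_divide_eq_left add_divide_distrib[symmetric]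
    by (simp only:)
qed

section \<open>Hecke matrices moved past the Weyl elements\<close>

lemma weyl_H1:
  "weyl 0 ** H1_mat w = levi 1 (1, 0) (w, 1) ** weyl 0"
  "weyl 3 ** H1_mat w = levi 1 (1, 0) (- w, 1) ** weyl 3"
  "weyl 0 ** s1_mat = levi (- 1) (0, 1) (1, 0) ** weyl 0"
  "weyl 3 ** s1_mat = levi (- 1) (0, 1) (1, 0) ** weyl 3"
  "weyl 2 ** H1_mat w = uu 0 (- w) 0 ** weyl 2" "weyl 2 ** s1_mat = weyl (Suc 0)"
  "weyl (Suc 0) ** s1_mat = weyl 2"
  by (simp_all add: weyl_eq weyl_M4 levi_def uu_def M4_mult)

lemma weyl_H3:
  "weyl (Suc 0) ** H3_mat w = uu (- w) 0 0 ** weyl (Suc 0)"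
  "weyl (Suc 0) ** s2_mat = weyl 0 ** (s2_mat ** s2_mat)" "weyl 0 ** s2_mat = weyl (Suc 0)"
  "weyl 3 ** H3_mat w = uu 0 0 (- w) ** weyl 3"
  "weyl 3 ** s2_mat = weyl 2 ** (s2_mat ** s2_mat)" "weyl 2 ** s2_mat = weyl 3"
  by (simp_all add: weyl_eq weyl_M4 levi_def uu_def M4_mult)

text \<open>The first and last cells are exchanged; the middle ones are preserved, with the edge
  \<open>x, y\<close> replaced by its reverse \<open>y, sm \<pi> x\<close>.\<close>

lemma weyl_eta0:
  "weyl 0 ** eta0_mat \<pi> = levi (- \<pi>) (1, 0) (0, 1) ** weyl 3"
  "weyl 3 ** eta0_mat \<pi> = levi (- 1 / \<pi>) (\<pi>, 0) (0, \<pi>) ** weyl 0"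
  "weyl (Suc 0) ** eta0_mat \<pi> = levi 1 (0, 1) (\<pi>, 0) ** weyl (Suc 0)"
  "weyl 2 ** eta0_mat \<pi> = levi 1 (0, 1) (\<pi>, 0) ** weyl 2"
  by (simp_all add: weyl_eq weyl_M4 levi_def uu_def M4_mult)

text \<open>Conjugation reverses the order of rows and columns; the entries that get divided by
  \<pi> are all in \<pp>.\<close>

lemma eta0_normalizes:
  assumes "iw k" obtains k' where "iw k'" "k ** eta0_mat \<pi> = eta0_mat \<pi> ** k'"
proof -
  obtain a11 a12 a13 a14 a21 a22 a23 a24 a31 a32 a33 a34 a41 a42 a43 a44
    where k: "k = M4 a11 a12 a13 a14 a21 a22 a23 a24 a31 a32 a33 a34 a41 a42 a43 a44"
    by (rule M4_cases)
  have mem: "a11 \<in> \<O>" "a13 \<in> \<O>" "a14 \<in> \<O>" "a21 \<in> \<O>" "a22 \<in> \<O>" "a23 \<in> \<O>" "a24 \<in> \<O>"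
    "a33 \<in> \<O>" "a34 \<in> \<O>" "a44 \<in> \<O>" "a12 \<in> \<P>" "a31 \<in> \<P>" "a32 \<in> \<P>" "a41 \<in> \<P>" "a42 \<in> \<P>" "a43 \<in> \<P>"
    using assms by (auto simp: iw_def k forall_4)
  obtain \<mu> where \<mu>: "unit \<mu>" "symp \<mu> k" using assms by (auto simp: iw_def sim_unit_def)
  define k' where "k' = M4 a44 a43 (a42 / \<pi>) (a41 / \<pi>) a34 a33 (a32 / \<pi>) (a31 / \<pi>)
     (\<pi> * a24) (\<pi> * a23) a22 a21 (\<pi> * a14) (\<pi> * a13) a12 a11"
  have div: "w / \<pi> \<in> \<O>" if "w \<in> \<P>" for w
    using that by (cases "w = 0") (auto simp: prime_power_iff val_divide)
  have eq: "k ** eta0_mat \<pi> = eta0_mat \<pi> ** k'"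
    by (simp add: k k'_def weyl_M4 M4_mult M4_eq_iff mult.commute)
  have eta: "symp (- \<pi>) (eta0_mat \<pi>)" "- \<pi> \<noteq> 0" by (simp_all add: symp_basic(6))
  have "k' = sinv (- \<pi>) (eta0_mat \<pi>) ** (k ** eta0_mat \<pi>)"
    by (simp add: eq matrix_mul_assoc sinv_mult(1)[OF eta])
  then have "symp (1 / - \<pi> * (\<mu> * - \<pi>)) k'"
    using symp_mult[OF symp_sinv[OF eta] symp_mult[OF \<mu>(2) eta(1)]] by simp
  then have "sim_unit k'" using \<mu>(1) by (auto simp: sim_unit_def)
  then have "iw k'"
    using mem div by (simp add: iw_def k'_def forall_4 P_in_O pp_prod O_mult)
  then show ?thesis using that eq by blast
qed

lemma iw_near_one:
  assumes g: "g \<in> GSp4" and near: "\<And>i j. g$i$j - (mat 1 :: 'f^4^4)$i$j \<in> \<P>" shows "iw g"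
proof -
  obtain a11 a12 a13 a14 a21 a22 a23 a24 a31 a32 a33 a34 a41 a42 a43 a44
    where k: "g = M4 a11 a12 a13 a14 a21 a22 a23 a24 a31 a32 a33 a34 a41 a42 a43 a44"
    by (rule M4_cases)
  obtain \<mu> where \<mu>: "\<mu> \<noteq> 0" "symp \<mu> g" using g unfolding GSp4_iff by blast
  have "a11 - 1 \<in> \<P>" "a22 - 1 \<in> \<P>" "a33 - 1 \<in> \<P>" "a44 - 1 \<in> \<P>"
    using near[of 1 1] near[of 2 2] near[of 3 3] near[of 4 4] by (simp_all add: k mat_def)
  then have u: "unit a11" "unit a22" "unit a33" "unit a44"
    using unit_add[OF unit_1, of "a11 - 1"] unit_add[OF unit_1, of "a22 - 1"]
      unit_add[OF unit_1, of "a33 - 1"] unit_add[OF unit_1, of "a44 - 1"] by simp_all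
  have P: "a12 \<in> \<P>" "a13 \<in> \<P>" "a14 \<in> \<P>" "a21 \<in> \<P>" "a23 \<in> \<P>" "a24 \<in> \<P>" "a31 \<in> \<P>" "a32 \<in> \<P>" "a34 \<in> \<P>"
    "a41 \<in> \<P>" "a42 \<in> \<P>" "a43 \<in> \<P>"
    using near[of 1 2] near[of 1 3] near[of 1 4] near[of 2 1] near[of 2 3] near[of 2 4]
      near[of 3 1] near[of 3 2] near[of 3 4] near[of 4 1] near[of 4 2] near[of 4 3]
    by (simp_all add: k mat_def)
  have "\<mu> = a11 * a33 + (a21 * a43 - a31 * a13 - a41 * a23)"
    using \<mu>(2) unfolding k symp_M4 by (auto simp: algebra_simps)
  also have "unit \<dots>"
    by (rule unit_add[OF unit_mult[OF u(1,3)]]) (intro pp_diff pp_prod, use P P_in_O in auto)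
  finally have "sim_unit g" using \<mu>(2) by (auto simp: sim_unit_def)
  then show ?thesis using u P unit_in_O P_in_O by (simp add: iw_def k forall_4)
qed

text \<open>\<open>I\<close> contains all similitudes congruent to 1 modulo \<pp>, and
  \<open>n\<close> bounds the denominators of the inverse of \<open>h\<close>.\<close>

lemma smooth_if_invariant:
  assumes inv: "\<And>h k. h \<in> GSp4 \<Longrightarrow> iw k \<Longrightarrow> B (h ** k) = B h"
  shows "smooth_on_GSp4 v B"
  unfolding smooth_on_GSp4_def
proof
  fix h :: "'f^4^4" assume h: "h \<in> GSp4"
  obtain \<mu> where \<mu>: "\<mu> \<noteq> 0" "symp \<mu> h" using h unfolding GSp4_iff by blast
  define h' where "h' = sinv \<mu> h"
  have h': "h' ** h = mat 1" "h ** h' = mat 1" "h' \<in> GSp4"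
    using sinv_mult[OF \<mu>(2,1)] GSp4I[OF symp_sinv[OF \<mu>(2,1)]] \<mu>(1) by (auto simp: h'_def)
  have "finite {h' $ i $ j | i j. True}"
    by (rule finite_subset[of _ "(\<lambda>(i, j). h' $ i $ j) ` UNIV"]) auto
  from pp_bounded_multiplier[OF this] obtain n
    where n: "\<forall>c\<in>{h' $ i $ j | i j. True}. \<forall>u\<in>prime_power v (int n). u * c \<in> \<P>" by blast
  have "B g = B h" if g: "g \<in> GSp4" and near: "\<forall>i j. g$i$j - h$i$j \<in> prime_power v (int n)" for g
  proof -
    have "(h' ** g)$i$j - (mat 1 :: 'f^4^4)$i$j \<in> \<P>" for i j
    proof -
      have "(h' ** g)$i$j - (h' ** h)$i$j = (g$1$j - h$1$j) * h'$i$1 + (g$2$j - h$2$j) * h'$i$2 +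
          (g$3$j - h$3$j) * h'$i$3 + (g$4$j - h$4$j) * h'$i$4"
        by (simp add: entry_mult algebra_simps)
      also have "\<dots> \<in> \<P>" by (intro pp_add) (use n near in blast)+
      finally show ?thesis by (simp add: h')
    qed
    then have "iw (h' ** g)" by (rule iw_near_one[OF GSp4_mult[OF h'(3) g]])
    from inv[OF h this] show ?thesis by (simp add: matrix_mul_assoc h')
  qed
  then show "\<exists>n. \<forall>g\<in>GSp4. (\<forall>i j. g $ i $ j - h $ i $ j \<in> prime_power v n) \<longrightarrow> B g = B h" by blast
qed

lemma bessel_space_iff:
  "B \<in> bessel_space v \<pi> a b c \<psi> \<Omega> \<Lambda> \<longleftrightarrow>
    (\<forall>g. g \<notin> GSp4 \<longrightarrow> B g = 0) \<and>
    (\<forall>h\<in>GSp4. \<forall>k. iw k \<longrightarrow> B (h ** k) = B h) \<and>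
    (\<forall>z X Y Z. \<forall>h\<in>GSp4. nm z \<noteq> 0 \<longrightarrow>
      B (tor z ** uu X Y Z ** h) = \<Lambda> z * \<psi> (a * X + b * Y + c * Z) * B h) \<and>
    (\<forall>h\<in>GSp4. panel1 B h = 0) \<and> (\<forall>h\<in>GSp4. B (h ** eta0_mat \<pi>) = - \<Omega> \<pi> * B h) \<and>
    (\<forall>h\<in>GSp4. panel2 B h = 0)" (is "_ \<longleftrightarrow> ?R")
proof -
  have equi: "(\<forall>t\<in>T_group a b c. \<forall>X. transpose X = X \<longrightarrow> (\<forall>h\<in>GSp4.
        B (T_embed t ** U_elt X ** h) = \<Lambda> (T_to_L a b c t) * \<psi> (trace (S_mat a b c ** X)) * B h)) \<longleftrightarrow>
    (\<forall>z X Y Z. \<forall>h\<in>GSp4. nm z \<noteq> 0 \<longrightarrow>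
      B (tor z ** uu X Y Z ** h) = \<Lambda> z * \<psi> (a * X + b * Y + c * Z) * B h)" (is "?L \<longleftrightarrow> ?R")
  proof
    assume L: ?L
    show ?R
    proof (intro allI ballI impI)
      fix z X Y Z and h :: "'f^4^4" assume h: "h \<in> GSp4" and "nm z \<noteq> 0"
      then obtain t where t: "t \<in> T_group a b c" "T_to_L a b c t = z" using T_to_L_surj by blast
      define M :: "'f^2^2" where "M = vector [vector [X, Y], vector [Y, Z]]"
      have M: "transpose M = M" by (simp add: M_def vec_eq_iff forall_2 transpose_def)
      show "B (tor z ** uu X Y Z ** h) = \<Lambda> z * \<psi> (a * X + b * Y + c * Z) * B h"
        using L[rule_format, OF t(1) M h] T_embed_tor[OF t(1)] t(2)
        by (simp add: U_elt_eq[OF M] trace_S_mat[OF M]) (simp add: M_def)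
    qed
  next
    assume R: ?R
    show ?L
    proof (intro allI ballI impI)
      fix t X :: "'f^2^2" and h :: "'f^4^4" assume t: "t \<in> T_group a b c" and X: "transpose X = X" and h: "h \<in> GSp4"
      show "B (T_embed t ** U_elt X ** h) = \<Lambda> (T_to_L a b c t) * \<psi> (trace (S_mat a b c ** X)) * B h"
        using R[rule_format, OF h T_embed_tor(2)[OF t]]
        by (simp add: U_elt_eq[OF X] trace_S_mat[OF X] T_embed_tor(1)[OF t])
    qed
  qed
  have iwa: "(\<forall>h\<in>GSp4. \<forall>k\<in>iwahori v. B (h ** k) = B h) \<longleftrightarrow> (\<forall>h\<in>GSp4. \<forall>k. iw k \<longrightarrow> B (h ** k) = B h)"
    using iwahori_iff by blast
  have smooth: "(\<forall>h\<in>GSp4. \<forall>k. iw k \<longrightarrow> B (h ** k) = B h) \<Longrightarrow> smooth_on_GSp4 v B"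
    by (rule smooth_if_invariant) blast
  show ?thesis
    unfolding bessel_space_def mem_Collect_eq
    unfolding equi residue_sum_eq panel1_def[symmetric] panel2_def[symmetric] iwa
    using smooth by blast
qed

section \<open>From harmonic functions to Bessel functions\<close>

text \<open>The factor \<open>q\<^bsup>3 v(e)\<^esup>\<close> is forced by (H2): \<open>\<eta>\<^sub>0\<close> interchanges the first and the last cell,
  whose values differ by \<open>(-q)\<^sup>3\<close>.\<close>

definition open_cell_value :: "('f \<times> 'f \<Rightarrow> 'f \<times> 'f \<Rightarrow> complex) \<Rightarrow> 'f \<Rightarrow> 'f \<times> 'f \<Rightarrow> 'f \<times> 'f \<Rightarrow> complex" where
  "open_cell_value \<gamma> e x y = of_nat q powi (3 * v e) * \<Omega> (e * det2 x y) * \<gamma> (iota x) (iota y)"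

text \<open>\<open>s\<close> is the argument of \<psi> contributed by the unipotent factor, and 3 -
  i counts the steps from the last cell, each of which costs a factor -q.\<close>

definition cell_formula :: "('f \<times> 'f \<Rightarrow> 'f \<times> 'f \<Rightarrow> complex) \<Rightarrow> nat \<Rightarrow> 'f \<Rightarrow> 'f \<Rightarrow> 'f \<times> 'f \<Rightarrow> 'f \<times> 'f \<Rightarrow> complex" where
  "cell_formula \<gamma> i s e x y = \<psi> s * (- of_nat q) ^ (3 - i) * (if ind i e x y then open_cell_value \<gamma> e x y else 0)"

lemma q_nonzero: "(of_nat q :: complex) \<noteq> 0"
  using card_reps_ge_2 by auto

lemma open_cell_value_iwahori:
  assumes harm: "harmonic \<gamma>" and nz: "e \<noteq> 0" "det2 x y \<noteq> 0"
    and e0: "unit e0" and u: "unit \<alpha>" "\<beta> \<in> \<O>" "z \<in> \<P>" "unit \<delta>"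
  shows "open_cell_value \<gamma> (e * e0) (sm \<alpha> x + sm \<beta> y) (sm z x + sm \<delta> y) = open_cell_value \<gamma> e x y"
proof -
  have w: "unit (\<alpha> * \<delta> - \<beta> * z)"
    by (rule unit_diff[OF unit_mult[OF u(1,4)] pp_mult_O(2)[OF u(2,3)]])
  have e0': "e0 \<noteq> 0" "v e0 = 0" using e0 by (auto simp: int_units_iff)
  have 1: "e * e0 * det2 (sm \<alpha> x + sm \<beta> y) (sm z x + sm \<delta> y) = (e0 * (\<alpha> * \<delta> - \<beta> * z)) * (e * det2 x y)"
    by (simp add: det2_lin)
  have 2: "\<Omega> ((e0 * (\<alpha> * \<delta> - \<beta> * z)) * (e * det2 x y)) = \<Omega> (e * det2 x y)"
    using Omega_mult[of "e0 * (\<alpha> * \<delta> - \<beta> * z)" "e * det2 x y"] Omega_unit[OF unit_mult[OF e0 w]]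
      unit_nonzero[OF unit_mult[OF e0 w]] nz by simp
  have "det2 (iota x) (iota y) \<noteq> 0" using nz det2_iota_iff by blast
  from harmonic_iwahori[OF harm this u]
  have 3: "\<gamma> (iota (sm \<alpha> x + sm \<beta> y)) (iota (sm z x + sm \<delta> y)) = \<gamma> (iota x) (iota y)"
    by (simp add: iota_add iota_sm)
  have 4: "v (e * e0) = v e" using nz e0' by (simp add: val_mult)
  show ?thesis unfolding open_cell_value_def 1 2 3 4 ..
qed

lemma open_cell_value_star:
  assumes harm: "harmonic \<gamma>" and nz: "e \<noteq> 0" "det2 x y \<noteq> 0"
  shows "(\<Sum>w\<in>reps. open_cell_value \<gamma> e x (y + sm w x)) + open_cell_value \<gamma> (- e) y x = 0"
proof -
  have "open_cell_value \<gamma> e x (y + sm w x) = of_nat q powi (3 * v e) * \<Omega> (e * det2 x y) * \<gamma> (iota x) (iota y + sm w (iota x))" for w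
    by (simp add: open_cell_value_def det2_simps iota_add iota_sm)
  moreover have "open_cell_value \<gamma> (- e) y x = of_nat q powi (3 * v e) * \<Omega> (e * det2 x y) * \<gamma> (iota y) (iota x)"
    by (simp add: open_cell_value_def det2_swap[of y x])
  ultimately have "(\<Sum>w\<in>reps. open_cell_value \<gamma> e x (y + sm w x)) + open_cell_value \<gamma> (- e) y x =
    of_nat q powi (3 * v e) * \<Omega> (e * det2 x y) *
      ((\<Sum>w\<in>reps. \<gamma> (iota x) (iota y + sm w (iota x))) + \<gamma> (iota y) (iota x))"
    by (simp add: sum_distrib_left distrib_left)
  also have "\<dots> = 0" using harmonic_star[OF harm] nz det2_iota_iff by simp
  finally show ?thesis .
qed

lemma Omega_minus_pi: "\<Omega> (- \<pi>) = \<Omega> \<pi>"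
  using Omega_mult[of "-1" \<pi>] Omega_unit[of "-1"] by (simp add: int_units_iff)

lemma open_cell_value_flip:
  assumes harm: "harmonic \<gamma>" and nz: "e \<noteq> 0" "det2 x y \<noteq> 0"
  shows "open_cell_value \<gamma> e y (sm \<pi> x) = - \<Omega> \<pi> * open_cell_value \<gamma> e x y"
proof -
  have "e * det2 y (sm \<pi> x) = (- \<pi>) * (e * det2 x y)" by (simp add: det2_simps det2_swap[of y x])
  moreover have "\<Omega> ((- \<pi>) * (e * det2 x y)) = \<Omega> \<pi> * \<Omega> (e * det2 x y)"
    using Omega_mult[of "- \<pi>"] nz by (simp add: Omega_minus_pi)
  moreover have "\<gamma> (iota y) (iota (sm \<pi> x)) = - \<gamma> (iota x) (iota y)"
    unfolding iota_sm by (rule harmonic_flip[OF harm]) (use nz det2_iota_iff in blast)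
  ultimately show ?thesis by (simp add: open_cell_value_def)
qed

lemma open_cell_value_scale:
  assumes nz: "e \<noteq> 0" "det2 x y \<noteq> 0"
  shows "open_cell_value \<gamma> (- \<pi> * e) x y = of_nat q ^ 3 * \<Omega> \<pi> * open_cell_value \<gamma> e x y"
proof -
  have "v (- \<pi> * e) = 1 + v e" using nz val_mult[of "- \<pi>" e] by simp
  then have "of_nat q powi (3 * v (- \<pi> * e)) = of_nat q ^ 3 * (of_nat q powi (3 * v e) :: complex)"
    using q_nonzero by (simp add: distrib_left power_int_add)
  moreover have "\<Omega> (- \<pi> * e * det2 x y) = \<Omega> \<pi> * \<Omega> (e * det2 x y)"
    using Omega_mult[of "- \<pi>" "e * det2 x y"] nz by (simp add: Omega_minus_pi mult.assoc)
  ultimately show ?thesis by (simp add: open_cell_value_def)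
qed

text \<open>The twist by \<Omega> of the similitude factor turns \<xi> back into \<Lambda>, because
  \<Omega> squares to 1.\<close>

lemma open_cell_value_torus:
  assumes equi: "equivariant \<xi> \<gamma>" and nz: "e \<noteq> 0" "det2 x y \<noteq> 0" "nm z \<noteq> 0"
  shows "open_cell_value \<gamma> e (act z x) (act z y) = \<Lambda> z * open_cell_value \<gamma> e x y"
proof -
  have 1: "\<Omega> (e * det2 (act z x) (act z y)) = \<Omega> (nm z) * \<Omega> (e * det2 x y)"
    using Omega_mult[of "nm z" "e * det2 x y"] nz by (simp add: det2_act mult.left_commute)
  have "det2 (iota x) (iota y) \<noteq> 0" using nz det2_iota_iff by blast
  then have 2: "\<gamma> (iota (act z x)) (iota (act z y)) = \<xi> z * \<gamma> (iota x) (iota y)"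
    unfolding iota_act by (rule equivariantD[OF equi nz(3)])
  have 3: "\<Omega> (nm z) * \<xi> z = \<Lambda> z" using Omega_self[OF nz(3)] by (simp add: \<xi>_def mult.left_commute)
  have "open_cell_value \<gamma> e (act z x) (act z y) = (\<Omega> (nm z) * \<xi> z) * open_cell_value \<gamma> e x y"
    unfolding open_cell_value_def 1 2 by (simp only: mult_ac)
  then show ?thesis unfolding 3 .
qed

lemma ind_torus: "nm z \<noteq> 0 \<Longrightarrow> ind i e (act z x) (act z y) \<longleftrightarrow> ind i e x y"
  by (simp add: ind_def fA_def fB_def fC_def fm_act bm_act det2_act)

lemma pp_div_pi: "w / \<pi> \<in> prime_power v n \<longleftrightarrow> w \<in> prime_power v (n + 1)"
  by (cases "w = 0") (auto simp: prime_power_iff val_divide)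

lemma form_scale:
  "fA (- \<pi> * e) x y = - (fA e x y / \<pi>)" "fB (- \<pi> * e) x y = - (fB e x y / \<pi>)"
  "fC (- \<pi> * e) x y = - (fC e x y / \<pi>)"
  by (simp_all add: fA_def fB_def fC_def mult_ac)

text \<open>The scaling divides all three forms by \<pi>, which turns the common bound 0 into
  -1.\<close>

lemma ind_scale: "ind 3 (- \<pi> * e) x y \<longleftrightarrow> ind 0 e x y"
  unfolding ind_def form_scale by (simp add: pp_div_pi)

lemma form_flip:
  "fA e y (sm \<pi> x) = - (fC e x y / \<pi>)" "fB e y (sm \<pi> x) = - fB e x y"
  "fC e y (sm \<pi> x) = - (\<pi> * fA e x y)"
proof -
  have D: "e * det2 y (sm \<pi> x) = - (e * det2 x y * \<pi>)"
    by (simp add: det2_simps det2_swap[of y x])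
  have bm: "bm y (sm \<pi> x) = \<pi> * bm x y" and fm: "fm (sm \<pi> x) = \<pi> * \<pi> * fm x"
    by (simp_all add: bm_def fm_def sm_def algebra_simps)
  show "fA e y (sm \<pi> x) = - (fC e x y / \<pi>)" "fB e y (sm \<pi> x) = - fB e x y"
    "fC e y (sm \<pi> x) = - (\<pi> * fA e x y)"
    unfolding fA_def fB_def fC_def D bm fm by simp_all
qed

text \<open>Reversal exchanges \<open>fA\<close> and \<open>fC\<close> with a shift by one power of
  \<pi>, exactly the difference of their bounds on the middle cells.\<close>

lemma ind_flip: "i = Suc 0 \<or> i = 2 \<Longrightarrow> ind i e y (sm \<pi> x) \<longleftrightarrow> ind i e x y"
  unfolding ind_def form_flip by (auto simp: pp_div_pi pp_pi_mult_iff)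

text \<open>Each step towards the first cell asks for the integrality of one more form, the one on
  which the corresponding Hecke sum tests \<psi>.\<close>

lemma ind_pred: 
  "ind 0 e x y \<longleftrightarrow> ind (Suc 0) e x y \<and> fA e x y \<in> \<O>"
  "ind (Suc 0) e x y \<longleftrightarrow> ind 2 e x y \<and> fB e x y \<in> \<O>"
  "ind 2 e x y \<longleftrightarrow> ind 3 e x y \<and> fC e x y \<in> \<O>"
  by (auto simp: ind_def elim: pp_mono)

text \<open>The sum over \<psi> is q where the condition for the next cell holds and 0 elsewhere on
  the support, so it both cuts down the support and produces the factor -q.\<close>

lemma cell_formula_panel:
  assumes i: "(i = Suc 0 \<and> F = fA e x y) \<or> (i = 2 \<and> F = fB e x y) \<or> (i = 3 \<and> F = fC e x y)"
  shows "(\<Sum>w\<in>reps. cell_formula \<gamma> i (s + F * (- w)) e x y) + cell_formula \<gamma> (i - 1) s e x y = 0"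
proof -
  define C where "C = \<psi> s * (- of_nat q) ^ (3 - i) * (if ind i e x y then open_cell_value \<gamma> e x y else 0)"
  have "cell_formula \<gamma> i (s + F * (- w)) e x y = C * \<psi> (- w * F)" for w
    unfolding cell_formula_def psi_add C_def by (simp add: mult_ac)
  then have sum: "(\<Sum>w\<in>reps. cell_formula \<gamma> i (s + F * (- w)) e x y) = C * (\<Sum>w\<in>reps. \<psi> (- w * F))"
    by (simp only: sum_distrib_left)
  have F: "F \<in> prime_power v (- 1)" if "ind i e x y" using that i by (auto simp: ind_def)
  have pred: "ind (i - 1) e x y \<longleftrightarrow> ind i e x y \<and> F \<in> \<O>"
    using i ind_pred[of e x y] by auto
  have pow: "(- of_nat q :: complex) ^ (3 - (i - 1)) = (- of_nat q) * (- of_nat q) ^ (3 - i)"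
    using i by (auto simp: numeral_eq_Suc)
  show ?thesis
  proof (cases "ind i e x y")
    case True
    then show ?thesis
      unfolding sum psi_sum[OF F[OF True]] unfolding cell_formula_def pred pow C_def by simp
  next
    case False
    then show ?thesis unfolding sum unfolding cell_formula_def pred C_def by simp
  qed
qed

text \<open>The unipotent ambiguity, moved to the left, contributes \<psi> of an integer on the
  support, since the exponents in \<open>ind i\<close> and \<open>pat i\<close> are opposite. The
  Levi ambiguity is an Iwahori change of basis.\<close>

lemma cell_formula_pat:
  assumes harm: "harmonic \<gamma>" and nz: "e \<noteq> 0" "det2 x y \<noteq> 0" and Y: "pat i Y1 Y2 Y3" and e0: "unit e0"
    and u: "unit (fst x0)" "snd x0 \<in> \<O>" "fst y0 \<in> \<P>" "unit (snd y0)"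
    and eq: "uu b1 b2 b3 ** levi e' x' y' = uu a1 a2 a3 ** levi e x y ** (uu Y1 Y2 Y3 ** levi e0 x0 y0)"
  shows "cell_formula \<gamma> i (a * b1 + b * b2 + c * b3) e' x' y' = cell_formula \<gamma> i (a * a1 + b * a2 + c * a3) e x y"
proof -
  obtain Z1 Z2 Z3 where Z: "levi e x y ** uu Y1 Y2 Y3 = uu Z1 Z2 Z3 ** levi e x y"
    "a * Z1 + b * Z2 + c * Z3 = fA e x y * Y1 + fB e x y * Y2 + fC e x y * Y3"
    using levi_uu_theta[OF nz] .
  let ?x = "sm (fst x0) x + sm (snd x0) y" and ?y = "sm (fst y0) x + sm (snd y0) y"
  have "uu a1 a2 a3 ** levi e x y ** (uu Y1 Y2 Y3 ** levi e0 x0 y0) =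
      uu a1 a2 a3 ** (levi e x y ** uu Y1 Y2 Y3) ** levi e0 x0 y0" by (simp only: matrix_mul_assoc)
  also have "\<dots> = (uu a1 a2 a3 ** uu Z1 Z2 Z3) ** (levi e x y ** levi e0 x0 y0)"
    unfolding Z(1) by (simp only: matrix_mul_assoc)
  finally have eq': "uu (a1 + Z1) (a2 + Z2) (a3 + Z3) ** levi (e * e0) ?x ?y = uu b1 b2 b3 ** levi e' x' y'"
    by (simp only: eq uu_mult levi_mult)
  have "fst x0 * snd y0 - snd x0 * fst y0 \<noteq> 0"
    by (rule unit_nonzero[OF unit_diff[OF unit_mult[OF u(1,4)] pp_mult_O(2)[OF u(2,3)]]])
  then have d: "det2 ?x ?y \<noteq> 0" unfolding det2_lin using nz by simp
  have ee: "e * e0 \<noteq> 0" using nz unit_nonzero[OF e0] by simp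
  note inj = uu_levi_inject[OF eq' ee d]
  have s: "a * b1 + b * b2 + c * b3 = (a * a1 + b * a2 + c * a3) + (fA e x y * Y1 + fB e x y * Y2 + fC e x y * Y3)"
    unfolding inj(1-3)[symmetric] Z(2)[symmetric] by (simp add: algebra_simps)
  have psi1: "\<psi> (fA e x y * Y1 + fB e x y * Y2 + fC e x y * Y3) = 1" if "ind i e x y"
  proof (rule psi_trivial)
    have "fA e x y * Y1 \<in> prime_power v (- of_bool (i > 0) + of_bool (i > 0))"
      "fB e x y * Y2 \<in> prime_power v (- of_bool (i > 1) + of_bool (i > 1))"
      "fC e x y * Y3 \<in> prime_power v (- of_bool (i > 2) + of_bool (i > 2))"
      using that Y by (auto simp only: ind_def pat_def intro!: pp_mult)
    then show "fA e x y * Y1 + fB e x y * Y2 + fC e x y * Y3 \<in> \<O>" by (intro pp_add) simp_all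
  qed
  have ind: "ind i e' x' y' \<longleftrightarrow> ind i e x y"
    unfolding inj(4-6)[symmetric] by (rule ind_iwahori[OF e0 u])
  have open_cell_value: "open_cell_value \<gamma> e' x' y' = open_cell_value \<gamma> e x y"
    unfolding inj(4-6)[symmetric] by (rule open_cell_value_iwahori[OF harm nz e0 u])
  show ?thesis
    unfolding cell_formula_def s psi_add[of "a * a1 + b * a2 + c * a3"] ind open_cell_value
    using psi1 by (cases "ind i e x y") simp_all
qed

text \<open>The decomposition is not unique, but \<open>cell_representatives\<close> and
  \<open>cell_formula_pat\<close> show that all decompositions give the same value.\<close>

definition bessel_of :: "('f \<times> 'f \<Rightarrow> 'f \<times> 'f \<Rightarrow> complex) \<Rightarrow> 'f^4^4 \<Rightarrow> complex" where
  "bessel_of \<gamma> h = (if h \<in> GSp4 then (THE w. \<exists>i a1 a2 a3 e x y k. i < 4 \<and> e \<noteq> 0 \<and> det2 x y \<noteq> 0 \<and> iw k \<and>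
     h = uu a1 a2 a3 ** levi e x y ** weyl i ** k \<and> w = cell_formula \<gamma> i (a * a1 + b * a2 + c * a3) e x y) else 0)"

lemma cell_GSp4:
  "e \<noteq> 0 \<Longrightarrow> det2 x y \<noteq> 0 \<Longrightarrow> uu a1 a2 a3 ** levi e x y ** weyl i \<in> GSp4"
  by (intro GSp4_mult GSp4_basic GSp4_levi)

lemma bessel_of_cell_iw:
  assumes harm: "harmonic \<gamma>" and nz: "e \<noteq> 0" "det2 x y \<noteq> 0" and k: "iw k" and i: "i < 4"
  shows "bessel_of \<gamma> (uu a1 a2 a3 ** levi e x y ** weyl i ** k) = cell_formula \<gamma> i (a * a1 + b * a2 + c * a3) e x y"
proof -
  let ?h = "uu a1 a2 a3 ** levi e x y ** weyl i ** k"
  have "?h \<in> GSp4" by (rule GSp4_mult[OF cell_GSp4[OF nz] iw_GSp4[OF k]])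
  moreover have "(THE w. \<exists>i a1 a2 a3 e x y k. i < 4 \<and> e \<noteq> 0 \<and> det2 x y \<noteq> 0 \<and> iw k \<and>
     ?h = uu a1 a2 a3 ** levi e x y ** weyl i ** k \<and> w = cell_formula \<gamma> i (a * a1 + b * a2 + c * a3) e x y) =
     cell_formula \<gamma> i (a * a1 + b * a2 + c * a3) e x y" (is "The ?P = _")
  proof (rule the_equality)
    show "?P (cell_formula \<gamma> i (a * a1 + b * a2 + c * a3) e x y)" using i nz k by blast
  next
    fix w assume "?P w"
    then obtain j b1 b2 b3 e' x' y' k' where j: "j < 4" "e' \<noteq> 0" "det2 x' y' \<noteq> 0" "iw k'"
      "?h = uu b1 b2 b3 ** levi e' x' y' ** weyl j ** k'"
      "w = cell_formula \<gamma> j (a * b1 + b * b2 + c * b3) e' x' y'" by blast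
    note rep = cell_representatives[OF nz j(2,3) k j(4) i j(1,5)]
    from rep(2) obtain Y1 Y2 Y3 e0 x0 y0 where "pat i Y1 Y2 Y3" "unit e0" "unit (fst x0)" "snd x0 \<in> \<O>"
      "fst y0 \<in> \<P>" "unit (snd y0)"
      "uu b1 b2 b3 ** levi e' x' y' = uu a1 a2 a3 ** levi e x y ** (uu Y1 Y2 Y3 ** levi e0 x0 y0)" by blast
    from cell_formula_pat[OF harm nz this] show "w = cell_formula \<gamma> i (a * a1 + b * a2 + c * a3) e x y"
      unfolding j(6) rep(1)[symmetric] .
  qed
  ultimately show ?thesis by (simp add: bessel_of_def)
qed

lemma bessel_of_cell:
  assumes "harmonic \<gamma>" "e \<noteq> 0" "det2 x y \<noteq> 0" "i < 4"
  shows "bessel_of \<gamma> (uu a1 a2 a3 ** levi e x y ** weyl i) = cell_formula \<gamma> i (a * a1 + b * a2 + c * a3) e x y"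
  using bessel_of_cell_iw[OF assms(1-3) iw_one assms(4)] by simp

lemma GSp4_cases:
  assumes "h \<in> GSp4"
  obtains i a1 a2 a3 e x y k where "i < 4" "e \<noteq> 0" "det2 x y \<noteq> 0" "iw k"
    "h = uu a1 a2 a3 ** levi e x y ** weyl i ** k"
  using bruhat_cover[OF assms] unfolding in_cell_def by blast

lemma bessel_of_invariant:
  assumes harm: "harmonic \<gamma>" and h: "h \<in> GSp4" and k: "iw k"
  shows "bessel_of \<gamma> (h ** k) = bessel_of \<gamma> h"
proof -
  obtain i a1 a2 a3 e x y k' where *: "i < 4" "e \<noteq> 0" "det2 x y \<noteq> 0" "iw k'"
    "h = uu a1 a2 a3 ** levi e x y ** weyl i ** k'" using GSp4_cases[OF h] .
  have "h ** k = uu a1 a2 a3 ** levi e x y ** weyl i ** (k' ** k)"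
    unfolding *(5) by (simp only: matrix_mul_assoc)
  then show ?thesis
    using bessel_of_cell_iw[OF harm *(2,3) iw_mult[OF *(4) k] *(1)] bessel_of_cell_iw[OF harm *(2,3,4,1)] *(5) by simp
qed

lemma shift_levi: "W ** M = N ** W' \<Longrightarrow> U ** L ** W ** M = U ** (L ** N) ** (W' :: 'f^4^4)"
  by (metis matrix_mul_assoc)

lemma shift_uu: "W ** M = N ** W' \<Longrightarrow> L ** N = N' ** L \<Longrightarrow> U ** L ** W ** M = (U ** N') ** L ** (W' :: 'f^4^4)"
  by (metis matrix_mul_assoc)

lemma bessel_of_unipotent:
  assumes harm: "harmonic \<gamma>" and nz: "e \<noteq> 0" "det2 x y \<noteq> 0" and i: "i < 4"
    and M: "weyl i ** M = uu Y1 Y2 Y3 ** weyl i"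
  shows "bessel_of \<gamma> (uu a1 a2 a3 ** levi e x y ** weyl i ** M) =
    cell_formula \<gamma> i (a * a1 + b * a2 + c * a3 + (fA e x y * Y1 + fB e x y * Y2 + fC e x y * Y3)) e x y"
proof -
  obtain Z1 Z2 Z3 where Z: "levi e x y ** uu Y1 Y2 Y3 = uu Z1 Z2 Z3 ** levi e x y"
    "a * Z1 + b * Z2 + c * Z3 = fA e x y * Y1 + fB e x y * Y2 + fC e x y * Y3"
    using levi_uu_theta[OF nz] .
  have "a * (a1 + Z1) + b * (a2 + Z2) + c * (a3 + Z3) = a * a1 + b * a2 + c * a3 + (a * Z1 + b * Z2 + c * Z3)"
    by (simp add: algebra_simps)
  then show ?thesis
    unfolding shift_uu[OF M Z(1)] uu_mult bessel_of_cell[OF harm nz i] Z(2) by simp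
qed

text \<open>Only one base point per parahoric coset matters. On the cells 0 and 3 the relation is
  harmonicity at a vertex; on cell 2 it is the step to cell 1, and cell 1 belongs to the same cosets
  as cell 2.\<close>

lemma bessel_of_panel1:
  assumes harm: "harmonic \<gamma>" and h: "h \<in> GSp4"
  shows "panel1 (bessel_of \<gamma>) h = 0"
proof -
  obtain i a1 a2 a3 e x y k where *: "i < 4" and nz: "e \<noteq> 0" "det2 x y \<noteq> 0" and k: "iw k"
    and h: "h = uu a1 a2 a3 ** levi e x y ** weyl i ** k" using GSp4_cases[OF h] .
  define p where "p j = uu a1 a2 a3 ** levi e x y ** weyl j" for j
  define s where "s = a * a1 + b * a2 + c * a3"
  have p: "p j \<in> GSp4" for j unfolding p_def by (rule cell_GSp4[OF nz])
  have inv: "panel1 (bessel_of \<gamma>) (g ** l) = panel1 (bessel_of \<gamma>) g" if "g \<in> GSp4" "siegel l" for g l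
    using that bessel_of_invariant[OF harm] by (intro panel1_invariant)
  \<comment> \<open>\<open>\<epsilon>\<close> is the sign with which w passes the Weyl element: 1
    for the first cell and -1 for the last.\<close>
  have ends: "panel1 (bessel_of \<gamma>) (p j) = 0"
    if j: "j = 0 \<or> j = 3" and H: "\<And>w. weyl j ** H1_mat w = levi 1 (1, 0) (\<epsilon> * w, 1) ** weyl j"
      and S: "weyl j ** s1_mat = levi (- 1) (0, 1) (1, 0) ** (weyl j :: 'f^4^4)" and \<epsilon>: "\<epsilon> = 1 \<or> \<epsilon> = - 1" for j and \<epsilon> :: 'f
  proof -
    have j4: "j < 4" using j by auto
    have D: "det2 y x \<noteq> 0" using nz by (simp add: det2_swap[of y x])
    have 1: "bessel_of \<gamma> (p j ** H1_mat w) = cell_formula \<gamma> j s e x (y + sm (\<epsilon> * w) x)" for w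
    proof -
      have "levi e x y ** levi 1 (1, 0) (\<epsilon> * w, 1) = levi e x (y + sm (\<epsilon> * w) x)"
        by (simp add: levi_mult sm_simps add.commute)
      then show ?thesis
        unfolding p_def shift_levi[OF H] s_def
        by (simp only:) (rule bessel_of_cell[OF harm nz(1) _ j4], use nz in \<open>simp add: det2_simps\<close>)
    qed
    have "levi e x y ** levi (- 1) (0, 1) (1, 0) = levi (- e) y x"
      by (simp add: levi_mult sm_simps)
    then have 2: "bessel_of \<gamma> (p j ** s1_mat) = cell_formula \<gamma> j s (- e) y x"
      unfolding p_def shift_levi[OF S] s_def
      by (simp only:) (rule bessel_of_cell[OF harm _ D j4], use nz in simp)
    define C where "C = \<psi> s * (- of_nat q) ^ (3 - j)"
    have 3: "cell_formula \<gamma> j s e x (y + sm (\<epsilon> * w) x) = C * (if ind j e x y then open_cell_value \<gamma> e x (y + sm (\<epsilon> * w) x) else 0)"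
      if "w \<in> reps" for w
    proof -
      have "\<epsilon> * w \<in> \<O>" using reps_in_O[OF that] \<epsilon> by auto
      from ind_shear[OF this j] show ?thesis by (simp add: cell_formula_def C_def)
    qed
    have 4: "(\<Sum>w\<in>reps. open_cell_value \<gamma> e x (y + sm (\<epsilon> * w) x)) = (\<Sum>w\<in>reps. open_cell_value \<gamma> e x (y + sm w x))"
    proof (rule sum_reps_reindex)
      fix w w' :: 'f assume ww: "w - w' \<in> \<P>"
      have "det2 x (y + sm w' x) \<noteq> 0" using nz by (simp add: det2_simps)
      note inv = open_cell_value_iwahori[OF harm nz(1) this unit_1 unit_1 pp_0 ww unit_1]
      have s: "sm 1 x + sm 0 (y + sm w' x) = x" "sm (w - w') x + sm 1 (y + sm w' x) = y + sm w x"
        by (simp_all add: sm_def prod_eq_iff algebra_simps)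
      show "open_cell_value \<gamma> e x (y + sm w x) = open_cell_value \<gamma> e x (y + sm w' x)" using inv[unfolded s] by simp
    next
      fix w w' :: 'f assume "\<epsilon> * w - \<epsilon> * w' \<in> \<P>"
      then have "\<epsilon> * (w - w') \<in> \<P>" by (simp add: algebra_simps)
      then show "w - w' \<in> \<P>" using \<epsilon> pp_minus[of "w - w'" 1] by (auto simp del: minus_diff_eq)
    qed (use \<epsilon> in auto)
    have 5: "cell_formula \<gamma> j s (- e) y x = C * (if ind j e x y then open_cell_value \<gamma> (- e) y x else 0)"
      by (simp add: cell_formula_def C_def ind_swap[OF j])
    have 6: "(\<Sum>w\<in>reps. cell_formula \<gamma> j s e x (y + sm (\<epsilon> * w) x)) =
        (\<Sum>w\<in>reps. C * (if ind j e x y then open_cell_value \<gamma> e x (y + sm (\<epsilon> * w) x) else 0))"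
      by (rule sum.cong[OF refl 3])
    have "panel1 (bessel_of \<gamma>) (p j) = (\<Sum>w\<in>reps. C * (if ind j e x y then open_cell_value \<gamma> e x (y + sm (\<epsilon> * w) x) else 0)) +
        C * (if ind j e x y then open_cell_value \<gamma> (- e) y x else 0)"
      unfolding panel1_def 1 2 5 6 ..
    also have "\<dots> = C * (if ind j e x y then (\<Sum>w\<in>reps. open_cell_value \<gamma> e x (y + sm (\<epsilon> * w) x)) + open_cell_value \<gamma> (- e) y x else 0)"
      by (simp add: sum_distrib_left distrib_left)
    also have "\<dots> = 0" unfolding 4 open_cell_value_star[OF harm nz] by simp
    finally show ?thesis .
  qed
  have two: "panel1 (bessel_of \<gamma>) (p 2) = 0"
  proof -
    have "bessel_of \<gamma> (p 2 ** H1_mat w) = cell_formula \<gamma> 2 (s + fB e x y * (- w)) e x y" for w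
      unfolding p_def s_def using bessel_of_unipotent[OF harm nz _ weyl_H1(5)] by simp
    moreover have "p 2 ** s1_mat = p (Suc 0)" unfolding p_def by (simp add: weyl_H1 flip: matrix_mul_assoc)
    then have "bessel_of \<gamma> (p 2 ** s1_mat) = cell_formula \<gamma> (2 - 1) s e x y"
      unfolding s_def using bessel_of_cell[OF harm nz, of "Suc 0"] by (simp add: p_def)
    ultimately show ?thesis
      unfolding panel1_def using cell_formula_panel[of 2 "fB e x y" e x y \<gamma> s] by simp
  qed
  have "panel1 (bessel_of \<gamma>) (p i) = 0"
  proof -
    consider "i = 0" | "i = Suc 0" | "i = 2" | "i = 3" using * by linarith
    then show ?thesis
    proof cases
      case 1
      then show ?thesis using ends[of 0 1] by (simp add: weyl_H1)
    next
      case 2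
      have "p (Suc 0) ** s1_mat = p 2" unfolding p_def by (simp add: weyl_H1 flip: matrix_mul_assoc)
      then show ?thesis using inv[OF p panel_siegel(1), of "Suc 0"] two 2 by simp
    next
      case 4
      then show ?thesis using ends[of 3 "-1"] by (simp add: weyl_H1)
    qed (use two in simp)
  qed
  then show ?thesis unfolding h using inv[OF p iw_siegel[OF k], of i] by (simp add: p_def)
qed

text \<open>Here the cells are paired as 0 with 1 and 2 with 3, and the relation is evaluated at the
  longer element of each pair.\<close>

lemma bessel_of_panel2:
  assumes harm: "harmonic \<gamma>" and h: "h \<in> GSp4"
  shows "panel2 (bessel_of \<gamma>) h = 0"
proof -
  obtain i a1 a2 a3 e x y k where *: "i < 4" and nz: "e \<noteq> 0" "det2 x y \<noteq> 0" and k: "iw k"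
    and h: "h = uu a1 a2 a3 ** levi e x y ** weyl i ** k" using GSp4_cases[OF h] .
  define p where "p j = uu a1 a2 a3 ** levi e x y ** weyl j" for j
  define s where "s = a * a1 + b * a2 + c * a3"
  have p: "p j \<in> GSp4" for j unfolding p_def by (rule cell_GSp4[OF nz])
  have inv: "panel2 (bessel_of \<gamma>) (g ** l) = panel2 (bessel_of \<gamma>) g" if "g \<in> GSp4" "klingen l" for g l
    using that bessel_of_invariant[OF harm] by (intro panel2_invariant)
  have one: "panel2 (bessel_of \<gamma>) (p (Suc 0)) = 0"
  proof -
    have "bessel_of \<gamma> (p (Suc 0) ** H3_mat w) = cell_formula \<gamma> (Suc 0) (s + fA e x y * (- w)) e x y" for w
      unfolding p_def s_def using bessel_of_unipotent[OF harm nz _ weyl_H3(1)] by simp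
    moreover have "p (Suc 0) ** s2_mat = p 0 ** (s2_mat ** s2_mat)"
      unfolding p_def by (simp only: weyl_H3(2) flip: matrix_mul_assoc)
    then have "bessel_of \<gamma> (p (Suc 0) ** s2_mat) = cell_formula \<gamma> (Suc 0 - 1) s e x y"
      unfolding s_def using bessel_of_cell_iw[OF harm nz iw_s2_sq, of 0] by (simp add: p_def)
    ultimately show ?thesis
      unfolding panel2_def using cell_formula_panel[of "Suc 0" "fA e x y" e x y \<gamma> s] by simp
  qed
  have three: "panel2 (bessel_of \<gamma>) (p 3) = 0"
  proof -
    have "bessel_of \<gamma> (p 3 ** H3_mat w) = cell_formula \<gamma> 3 (s + fC e x y * (- w)) e x y" for w
      unfolding p_def s_def using bessel_of_unipotent[OF harm nz _ weyl_H3(4)] by simp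
    moreover have "p 3 ** s2_mat = p 2 ** (s2_mat ** s2_mat)"
      unfolding p_def by (simp only: weyl_H3(5) flip: matrix_mul_assoc)
    then have "bessel_of \<gamma> (p 3 ** s2_mat) = cell_formula \<gamma> (3 - 1) s e x y"
      unfolding s_def using bessel_of_cell_iw[OF harm nz iw_s2_sq, of 2] by (simp add: p_def)
    ultimately show ?thesis
      unfolding panel2_def using cell_formula_panel[of 3 "fC e x y" e x y \<gamma> s] by simp
  qed
  have "panel2 (bessel_of \<gamma>) (p i) = 0"
  proof -
    consider "i = 0" | "i = Suc 0" | "i = 2" | "i = 3" using * by linarith
    then show ?thesis
    proof cases
      case 1
      have "p 0 ** s2_mat = p (Suc 0)" unfolding p_def by (simp add: weyl_H3(3) flip: matrix_mul_assoc)
      then show ?thesis using inv[OF p panel_klingen(1), of 0] one 1 by simp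
    next
      case 3
      have "p 2 ** s2_mat = p 3" unfolding p_def by (simp add: weyl_H3(6) flip: matrix_mul_assoc)
      then show ?thesis using inv[OF p panel_klingen(1), of 2] three 3 by simp
    qed (use one three in simp_all)
  qed
  then show ?thesis unfolding h using inv[OF p iw_klingen[OF k], of i] by (simp add: p_def)
qed

text \<open>On the middle cells the sign comes from reversing an edge. On the extreme ones it is
  (-q)^3 against the q^3 gained by scaling \<open>e\<close> with -\<pi>.\<close>

lemma bessel_of_eta0:
  assumes harm: "harmonic \<gamma>" and h: "h \<in> GSp4"
  shows "bessel_of \<gamma> (h ** eta0_mat \<pi>) = - \<Omega> \<pi> * bessel_of \<gamma> h"
proof -
  obtain i a1 a2 a3 e x y k where i: "i < 4" and nz: "e \<noteq> 0" "det2 x y \<noteq> 0" and k: "iw k"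
    and h: "h = uu a1 a2 a3 ** levi e x y ** weyl i ** k" using GSp4_cases[OF h] .
  obtain k' where k': "iw k'" "k ** eta0_mat \<pi> = eta0_mat \<pi> ** k'" using eta0_normalizes[OF k] .
  define s where "s = a * a1 + b * a2 + c * a3"
  have O2: "\<Omega> \<pi> * \<Omega> \<pi> = 1" by (rule Omega_self) simp
  have key: "bessel_of \<gamma> (uu a1 a2 a3 ** levi e x y ** weyl i ** eta0_mat \<pi>) = - \<Omega> \<pi> * cell_formula \<gamma> i s e x y"
  proof -
    consider "i = 0" | "i = 3" | "i = Suc 0 \<or> i = 2" using i by linarith
    then show ?thesis
    proof cases
      case 1
      have "levi e x y ** levi (- \<pi>) (1, 0) (0, 1) = levi (- \<pi> * e) x y"
        by (simp add: levi_mult sm_simps mult.commute)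
      then have "bessel_of \<gamma> (uu a1 a2 a3 ** levi e x y ** weyl i ** eta0_mat \<pi>) = cell_formula \<gamma> 3 s (- \<pi> * e) x y"
        unfolding 1 shift_levi[OF weyl_eta0(1)] s_def
        by (simp only:) (rule bessel_of_cell[OF harm _ nz(2)], use nz in simp_all)
      also have "\<dots> = - \<Omega> \<pi> * cell_formula \<gamma> i s e x y"
        unfolding cell_formula_def ind_scale open_cell_value_scale[OF nz] 1
        by (simp add: power3_eq_cube)
      finally show ?thesis .
    next
      case 2
      define e' where "e' = e * (- 1 / \<pi>)"
      have e': "e' \<noteq> 0" "e = - \<pi> * e'" using nz by (simp_all add: e'_def)
      have D: "det2 (sm \<pi> x) (sm \<pi> y) \<noteq> 0" using nz by (simp add: det2_simps)
      have "levi e x y ** levi (- 1 / \<pi>) (\<pi>, 0) (0, \<pi>) = levi e' (sm \<pi> x) (sm \<pi> y)"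
        by (simp add: levi_mult sm_simps e'_def)
      then have "bessel_of \<gamma> (uu a1 a2 a3 ** levi e x y ** weyl i ** eta0_mat \<pi>) = cell_formula \<gamma> 0 s e' (sm \<pi> x) (sm \<pi> y)"
        unfolding 2 shift_levi[OF weyl_eta0(2)] s_def
        by (simp only:) (rule bessel_of_cell[OF harm e'(1) D], simp)
      \<comment> \<open>Two reversals amount to the homothety by \<pi>, so homothetic edges have the
        same value.\<close>
      moreover have "open_cell_value \<gamma> e' (sm \<pi> x) (sm \<pi> y) = open_cell_value \<gamma> e' x y"
      proof -
        have D': "det2 y (sm \<pi> x) \<noteq> 0" using nz by (simp add: det2_simps det2_swap[of y x])
        have "open_cell_value \<gamma> e' (sm \<pi> x) (sm \<pi> y) = (\<Omega> \<pi> * \<Omega> \<pi>) * open_cell_value \<gamma> e' x y"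
          unfolding open_cell_value_flip[OF harm e'(1) D'] open_cell_value_flip[OF harm e'(1) nz(2)] by simp
        then show ?thesis by (simp add: O2)
      qed
      moreover have "ind 0 e' (sm \<pi> x) (sm \<pi> y) \<longleftrightarrow> ind 0 e' x y"
        by (simp add: ind_def form_flip)
      moreover have "ind 3 e x y \<longleftrightarrow> ind 0 e' x y" unfolding e'(2) by (rule ind_scale)
      moreover have "open_cell_value \<gamma> e x y = of_nat q ^ 3 * \<Omega> \<pi> * open_cell_value \<gamma> e' x y"
        unfolding e'(2) by (rule open_cell_value_scale[OF e'(1) nz(2)])
      ultimately show ?thesis
        using O2 by (simp add: cell_formula_def 2 power3_eq_cube) 
    next
      case 3
      have D: "det2 y (sm \<pi> x) \<noteq> 0" using nz by (simp add: det2_simps det2_swap[of y x])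
      have W: "weyl i ** eta0_mat \<pi> = levi 1 (0, 1) (\<pi>, 0) ** weyl i"
        using 3 weyl_eta0(3,4) by auto
      have "levi e x y ** levi 1 (0, 1) (\<pi>, 0) = levi e y (sm \<pi> x)"
        by (simp add: levi_mult sm_simps)
      then have "bessel_of \<gamma> (uu a1 a2 a3 ** levi e x y ** weyl i ** eta0_mat \<pi>) = cell_formula \<gamma> i s e y (sm \<pi> x)"
        unfolding shift_levi[OF W] s_def
        by (simp only:) (rule bessel_of_cell[OF harm nz(1) D i])
      then show ?thesis unfolding cell_formula_def ind_flip[OF 3] open_cell_value_flip[OF harm nz] by simp
    qed
  qed
  have g: "uu a1 a2 a3 ** levi e x y ** weyl i ** eta0_mat \<pi> \<in> GSp4"
    by (intro GSp4_mult cell_GSp4[OF nz] GSp4_eta0) simp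
  have "h ** eta0_mat \<pi> = uu a1 a2 a3 ** levi e x y ** weyl i ** eta0_mat \<pi> ** k'"
    unfolding h using k'(2) by (metis matrix_mul_assoc)
  then have "bessel_of \<gamma> (h ** eta0_mat \<pi>) = - \<Omega> \<pi> * cell_formula \<gamma> i s e x y"
    using bessel_of_invariant[OF harm g k'(1)] key by simp
  moreover have "bessel_of \<gamma> h = cell_formula \<gamma> i s e x y" unfolding h s_def by (rule bessel_of_cell_iw[OF harm nz k i])
  ultimately show ?thesis by simp
qed

lemma bessel_of_equivariant:
  assumes harm: "harmonic \<gamma>" and equi: "equivariant \<xi> \<gamma>" and h: "h \<in> GSp4" and z: "nm z \<noteq> 0"
  shows "bessel_of \<gamma> (tor z ** uu X Y Z ** h) = \<Lambda> z * \<psi> (a * X + b * Y + c * Z) * bessel_of \<gamma> h"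
proof -
  obtain i a1 a2 a3 e x y k where i: "i < 4" and nz: "e \<noteq> 0" "det2 x y \<noteq> 0" and k: "iw k"
    and h: "h = uu a1 a2 a3 ** levi e x y ** weyl i ** k" using GSp4_cases[OF h] .
  have dz: "det2 (act z (1, 0)) (act z (0, 1)) \<noteq> 0" unfolding det2_act using z by (simp add: det2_def)
  obtain Z1 Z2 Z3 where Z: "tor z ** uu (X + a1) (Y + a2) (Z + a3) = uu Z1 Z2 Z3 ** tor z"
    "a * Z1 + b * Z2 + c * Z3 = fA 1 (act z (1, 0)) (act z (0, 1)) * (X + a1) +
      fB 1 (act z (1, 0)) (act z (0, 1)) * (Y + a2) + fC 1 (act z (1, 0)) (act z (0, 1)) * (Z + a3)"
    unfolding tor_def using levi_uu_theta[OF one_neq_zero dz] by metis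
  \<comment> \<open>The torus preserves \<open>S\<close> up to its similitude factor and hence fixes
    the character of \<open>U(F)\<close>.\<close>
  have F: "fA 1 (act z (1, 0)) (act z (0, 1)) = a" "fB 1 (act z (1, 0)) (act z (0, 1)) = b"
    "fC 1 (act z (1, 0)) (act z (0, 1)) = c"
    unfolding fA_def fB_def fC_def fm_act bm_act det2_act using z by (simp_all add: fm_def bm_def det2_def)
  have D: "det2 (act z x) (act z y) \<noteq> 0" using nz z by (simp add: det2_act)
  have "tor z ** uu X Y Z ** h = (tor z ** (uu X Y Z ** uu a1 a2 a3)) ** levi e x y ** weyl i ** k"
    unfolding h by (simp only: matrix_mul_assoc)
  also have "\<dots> = uu Z1 Z2 Z3 ** (tor z ** levi e x y) ** weyl i ** k"
    unfolding uu_mult Z(1) by (simp only: matrix_mul_assoc)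
  finally have "bessel_of \<gamma> (tor z ** uu X Y Z ** h) = cell_formula \<gamma> i (a * Z1 + b * Z2 + c * Z3) e (act z x) (act z y)"
    unfolding tor_levi using bessel_of_cell_iw[OF harm nz(1) D k i] by simp
  moreover have "a * Z1 + b * Z2 + c * Z3 = (a * X + b * Y + c * Z) + (a * a1 + b * a2 + c * a3)"
    unfolding Z(2) F by (simp add: algebra_simps)
  moreover have "bessel_of \<gamma> h = cell_formula \<gamma> i (a * a1 + b * a2 + c * a3) e x y"
    unfolding h by (rule bessel_of_cell_iw[OF harm nz k i])
  ultimately show ?thesis
    by (simp add: cell_formula_def psi_add ind_torus[OF z] open_cell_value_torus[OF equi nz z])
qed

lemma bessel_exists:
  assumes harm: "harmonic \<gamma>" and equi: "equivariant \<xi> \<gamma>" and xy: "det2 x y \<noteq> 0" "\<gamma> x y \<noteq> 0"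
  shows "\<exists>B\<in>bessel_space v \<pi> a b c \<psi> \<Omega> \<Lambda>. B \<noteq> 0"
proof
  show "bessel_of \<gamma> \<in> bessel_space v \<pi> a b c \<psi> \<Omega> \<Lambda>"
    unfolding bessel_space_iff
    using bessel_of_invariant[OF harm] bessel_of_equivariant[OF harm equi] bessel_of_panel1[OF harm] bessel_of_eta0[OF harm]
      bessel_of_panel2[OF harm] by (simp add: bessel_of_def del: split_paired_All)
  obtain e where e: "e \<noteq> 0" "ind 3 e (jota x) (jota y)" using ind_exists by blast
  have D: "det2 (jota x) (jota y) \<noteq> 0" using xy det2_iota_iff[of "jota x" "jota y"] by (simp add: iota_jota)
  have "bessel_of \<gamma> (uu 0 0 0 ** levi e (jota x) (jota y) ** weyl 3) = open_cell_value \<gamma> e (jota x) (jota y)"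
    using bessel_of_cell[OF harm e(1) D, of 3 0 0 0] e(2) by (simp add: cell_formula_def psi_0)
  also have "\<dots> \<noteq> 0"
    using xy e(1) D q_nonzero Omega_nonzero by (simp add: open_cell_value_def iota_jota)
  finally show "bessel_of \<gamma> \<noteq> 0" by (auto simp: fun_eq_iff)
qed

text \<open>Lowering v(e) multiplies the forms by at least the same power of \<pi>; a strict
  decrease gains the one power between the bounds -1 and 0.\<close>

lemma ind_mono:
  assumes "ind 3 e x y" "e \<noteq> 0" "e' \<noteq> 0"
  shows "v e' \<le> v e \<Longrightarrow> ind 3 e' x y" "v e' < v e \<Longrightarrow> ind 0 e' x y"
proof -
  have scale: "w / (e' * D) \<in> prime_power v (n + m)"
    if "w / (e * D) \<in> prime_power v n" "v e' + m \<le> v e" for w D n m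
  proof (cases "w = 0 \<or> D = 0")
    case False
    then show ?thesis using that assms(2,3) by (auto simp: prime_power_iff val_divide val_mult)
  qed auto
  show "ind 3 e' x y" if "v e' \<le> v e"
    using assms(1) scale[where m = 0] that by (simp add: ind_def fA_def fB_def fC_def)
  show "ind 0 e' x y" if "v e' < v e"
    using assms(1) scale[where m = 1 and n = "-1"] that by (simp add: ind_def fA_def fB_def fC_def)
qed

lemma tor_one: "tor one = mat 1"
  by (simp add: tor_def act_def L_mult_laws(3) jota_iota levi_def mat_M4 M4_eq_iff)

lemma uu_zero: "uu 0 0 0 = (mat 1 :: 'f^4^4)"
  by (simp add: uu_def mat_M4)

lemma levi_weyl_GSp4: "e \<noteq> 0 \<Longrightarrow> det2 x y \<noteq> 0 \<Longrightarrow> levi e x y ** weyl i \<in> GSp4"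
  by (intro GSp4_mult GSp4_basic GSp4_levi)

section \<open>From Bessel functions to harmonic functions\<close>

definition cell_value :: "('f^4^4 \<Rightarrow> complex) \<Rightarrow> nat \<Rightarrow> 'f \<Rightarrow> 'f \<times> 'f \<Rightarrow> 'f \<times> 'f \<Rightarrow> complex" where
  "cell_value B i e x y = B (levi e x y ** weyl i)"

text \<open>Undoes the normalisation in \<open>open_cell_value\<close>; \<Omega> is its own
  inverse.\<close>

definition normalized_value :: "('f^4^4 \<Rightarrow> complex) \<Rightarrow> 'f \<Rightarrow> 'f \<times> 'f \<Rightarrow> 'f \<times> 'f \<Rightarrow> complex" where
  "normalized_value B e x y = of_nat q powi (- 3 * v e) * \<Omega> (e * det2 x y) * cell_value B 3 e x y"

text \<open>All \<open>e\<close> satisfying the support condition give the same value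
  (\<open>normalized_value_unique\<close>), so an arbitrary one is taken.\<close>

definition edge_function :: "('f^4^4 \<Rightarrow> complex) \<Rightarrow> 'f \<times> 'f \<Rightarrow> 'f \<times> 'f \<Rightarrow> complex" where
  "edge_function B x y = normalized_value B (SOME e. e \<noteq> 0 \<and> ind 3 e (jota x) (jota y)) (jota x) (jota y)"

context
  fixes B assumes B: "B \<in> bessel_space v \<pi> a b c \<psi> \<Omega> \<Lambda>"
begin

lemma B_outside: "h \<notin> GSp4 \<Longrightarrow> B h = 0"
  and B_iw: "h \<in> GSp4 \<Longrightarrow> iw k \<Longrightarrow> B (h ** k) = B h"
  and B_equi: "nm z \<noteq> 0 \<Longrightarrow> h \<in> GSp4 \<Longrightarrow>
    B (tor z ** uu X Y Z ** h) = \<Lambda> z * \<psi> (a * X + b * Y + c * Z) * B h"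
  and B_panel1: "h \<in> GSp4 \<Longrightarrow> panel1 B h = 0"
  and B_eta0: "h \<in> GSp4 \<Longrightarrow> B (h ** eta0_mat \<pi>) = - \<Omega> \<pi> * B h"
  and B_panel2: "h \<in> GSp4 \<Longrightarrow> panel2 B h = 0"
proof -
  note * = B[unfolded bessel_space_iff]
  show "h \<notin> GSp4 \<Longrightarrow> B h = 0" using * by blast
  show "h \<in> GSp4 \<Longrightarrow> iw k \<Longrightarrow> B (h ** k) = B h" using * by blast
  show "nm z \<noteq> 0 \<Longrightarrow> h \<in> GSp4 \<Longrightarrow>
    B (tor z ** uu X Y Z ** h) = \<Lambda> z * \<psi> (a * X + b * Y + c * Z) * B h" using * by blast
  show "h \<in> GSp4 \<Longrightarrow> panel1 B h = 0" using * by blast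
  show "h \<in> GSp4 \<Longrightarrow> B (h ** eta0_mat \<pi>) = - \<Omega> \<pi> * B h" using * by blast
  show "h \<in> GSp4 \<Longrightarrow> panel2 B h = 0" using * by blast
qed

lemma B_uu: "h \<in> GSp4 \<Longrightarrow> B (uu X Y Z ** h) = \<psi> (a * X + b * Y + c * Z) * B h"
  using B_equi[of one h X Y Z] Lambda_F[of 1] by (simp add: tor_one)

lemma B_tor: "nm z \<noteq> 0 \<Longrightarrow> h \<in> GSp4 \<Longrightarrow> B (tor z ** h) = \<Lambda> z * B h"
  using B_equi[of z h 0 0 0] by (simp add: uu_zero psi_0)

lemma cell_value_unipotent:
  assumes nz: "e \<noteq> 0" "det2 x y \<noteq> 0" and M: "weyl i ** M = uu Y1 Y2 Y3 ** weyl i"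
  shows "B (levi e x y ** weyl i ** M) = \<psi> (fA e x y * Y1 + fB e x y * Y2 + fC e x y * Y3) * cell_value B i e x y"
proof -
  obtain Z1 Z2 Z3 where Z: "levi e x y ** uu Y1 Y2 Y3 = uu Z1 Z2 Z3 ** levi e x y"
    "a * Z1 + b * Z2 + c * Z3 = fA e x y * Y1 + fB e x y * Y2 + fC e x y * Y3"
    using levi_uu_theta[OF nz] .
  have "levi e x y ** weyl i ** M = (levi e x y ** uu Y1 Y2 Y3) ** weyl i"
    using M by (metis matrix_mul_assoc)
  also have "\<dots> = uu Z1 Z2 Z3 ** (levi e x y ** weyl i)" unfolding Z(1) by (simp only: matrix_mul_assoc)
  finally show ?thesis
    using B_uu[OF levi_weyl_GSp4[OF nz]] by (simp add: cell_value_def Z(2))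
qed

text \<open>The last Weyl element carries lower unipotent elements of \<open>I\<close> into
  \<open>U(F)\<close>, so at a nonzero value \<psi> must be trivial on the resulting multiples of
  the three forms.\<close>

lemma cell_value_support:
  assumes nz: "e \<noteq> 0" "det2 x y \<noteq> 0" and n0: "cell_value B 3 e x y \<noteq> 0" shows "ind 3 e x y"
proof -
  have W: "weyl 3 ** lower (- Y3) (- Y2) (- Y1) = uu Y1 Y2 Y3 ** weyl 3" for Y1 Y2 Y3 :: 'f
    by (simp add: weyl_eq lower_def uu_def M4_mult M4_eq_iff)
  have "\<psi> (fA e x y * Y1 + fB e x y * Y2 + fC e x y * Y3) = 1"
    if "Y1 \<in> \<P>" "Y2 \<in> \<P>" "Y3 \<in> \<P>" for Y1 Y2 Y3
  proof -
    have "iw (lower (- Y3) (- Y2) (- Y1))" using that by (intro iw_lower) auto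
    from B_iw[OF levi_weyl_GSp4[OF nz] this, of 3] cell_value_unipotent[OF nz W]
    show ?thesis using n0 by (simp add: cell_value_def)
  qed
  then have "\<psi> (y' * fA e x y) = 1" "\<psi> (y' * fB e x y) = 1" "\<psi> (y' * fC e x y) = 1" if "y' \<in> \<P>" for y'
    using that \<open>\<And>Y1 Y2 Y3. Y1 \<in> \<P> \<Longrightarrow> Y2 \<in> \<P> \<Longrightarrow> Y3 \<in> \<P> \<Longrightarrow> _\<close>[of y' 0 0]
      \<open>\<And>Y1 Y2 Y3. Y1 \<in> \<P> \<Longrightarrow> Y2 \<in> \<P> \<Longrightarrow> Y3 \<in> \<P> \<Longrightarrow> _\<close>[of 0 y' 0]
      \<open>\<And>Y1 Y2 Y3. Y1 \<in> \<P> \<Longrightarrow> Y2 \<in> \<P> \<Longrightarrow> Y3 \<in> \<P> \<Longrightarrow> _\<close>[of 0 0 y']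
    by (simp_all add: mult.commute)
  then show ?thesis unfolding ind_def using psi_support[of 1] by simp
qed

text \<open>(H3), (H1) and (H3) at the base points of the cells 3, 2 and 1: the last cell determines
  all others.\<close>

lemma cell_value_step:
  assumes nz: "e \<noteq> 0" "det2 x y \<noteq> 0"
  shows "(\<Sum>w\<in>reps. \<psi> (- w * fC e x y)) * cell_value B 3 e x y + cell_value B 2 e x y = 0"
    "(\<Sum>w\<in>reps. \<psi> (- w * fB e x y)) * cell_value B 2 e x y + cell_value B (Suc 0) e x y = 0"
    "(\<Sum>w\<in>reps. \<psi> (- w * fA e x y)) * cell_value B (Suc 0) e x y + cell_value B 0 e x y = 0"
proof -
  let ?p = "\<lambda>i. levi e x y ** weyl i"
  have g: "?p i \<in> GSp4" for i by (rule levi_weyl_GSp4[OF nz])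
  have "?p 3 ** s2_mat = ?p 2 ** (s2_mat ** s2_mat)" by (simp only: weyl_H3(5) flip: matrix_mul_assoc)
  then have "B (?p 3 ** s2_mat) = cell_value B 2 e x y" using B_iw[OF g iw_s2_sq] by (simp add: cell_value_def)
  moreover have "B (?p 3 ** H3_mat w) = \<psi> (- w * fC e x y) * cell_value B 3 e x y" for w
    using cell_value_unipotent[OF nz weyl_H3(4)[of w]] by (simp add: mult.commute)
  ultimately show "(\<Sum>w\<in>reps. \<psi> (- w * fC e x y)) * cell_value B 3 e x y + cell_value B 2 e x y = 0"
    using B_panel2[OF g, of 3] unfolding panel2_def by (simp add: sum_distrib_right)
  have "?p 2 ** s1_mat = ?p (Suc 0)" by (simp only: weyl_H1(6) flip: matrix_mul_assoc)
  then have "B (?p 2 ** s1_mat) = cell_value B (Suc 0) e x y" by (simp add: cell_value_def)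
  moreover have "B (?p 2 ** H1_mat w) = \<psi> (- w * fB e x y) * cell_value B 2 e x y" for w
    using cell_value_unipotent[OF nz weyl_H1(5)[of w]] by (simp add: mult.commute)
  ultimately show "(\<Sum>w\<in>reps. \<psi> (- w * fB e x y)) * cell_value B 2 e x y + cell_value B (Suc 0) e x y = 0"
    using B_panel1[OF g, of 2] unfolding panel1_def by (simp add: sum_distrib_right)
  have "?p (Suc 0) ** s2_mat = ?p 0 ** (s2_mat ** s2_mat)" by (simp only: weyl_H3(2) flip: matrix_mul_assoc)
  then have "B (?p (Suc 0) ** s2_mat) = cell_value B 0 e x y" using B_iw[OF g iw_s2_sq] by (simp add: cell_value_def)
  moreover have "B (?p (Suc 0) ** H3_mat w) = \<psi> (- w * fA e x y) * cell_value B (Suc 0) e x y" for w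
    using cell_value_unipotent[OF nz weyl_H3(1)[of w]] by (simp add: mult.commute)
  ultimately show "(\<Sum>w\<in>reps. \<psi> (- w * fA e x y)) * cell_value B (Suc 0) e x y + cell_value B 0 e x y = 0"
    using B_panel2[OF g, of "Suc 0"] unfolding panel2_def by (simp add: sum_distrib_right)
qed

lemma cell_value_2:
  assumes nz: "e \<noteq> 0" "det2 x y \<noteq> 0" and "ind 2 e x y"
  shows "cell_value B 2 e x y = - of_nat q * cell_value B 3 e x y"
proof -
  have "fC e x y \<in> \<O>" "fC e x y \<in> prime_power v (- 1)"
    using assms(3) by (auto simp: ind_def elim: pp_mono)
  then show ?thesis using cell_value_step(1)[OF nz] psi_sum by (simp add: add_eq_0_iff)
qed

lemma cell_value_0:
  assumes nz: "e \<noteq> 0" "det2 x y \<noteq> 0" and "ind 0 e x y"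
  shows "cell_value B 0 e x y = - (of_nat q ^ 3) * cell_value B 3 e x y"
proof -
  have O: "fA e x y \<in> \<O>" "fB e x y \<in> \<O>" "ind 2 e x y"
    using assms(3) by (auto simp: ind_def elim: pp_mono)
  then have "fA e x y \<in> prime_power v (- 1)" "fB e x y \<in> prime_power v (- 1)" by (auto elim: pp_mono)
  then show ?thesis using O cell_value_step(2,3)[OF nz] psi_sum cell_value_2[OF nz O(3)]
    by (simp add: add_eq_0_iff power3_eq_cube)
qed

lemma cell_value_iwahori:
  assumes nz: "e \<noteq> 0" "det2 x y \<noteq> 0" and e0: "unit e0" and u: "unit \<alpha>" "\<beta> \<in> \<O>" "z \<in> \<P>" "unit \<delta>"
  shows "cell_value B 3 (e * e0) (sm \<alpha> x + sm \<beta> y) (sm z x + sm \<delta> y) = cell_value B 3 e x y"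
proof -
  \<comment> \<open>The Levi element conjugated by the last Weyl element, which lies in the Iwahori
    subgroup again.\<close>
  define k where "k = levi (1 / e0) (e0 * \<alpha>, - e0 * \<beta>) (- e0 * z, e0 * \<delta>)"
  have e0': "e0 \<noteq> 0" using e0 by (rule unit_nonzero)
  have "iw k" unfolding k_def
    by (rule iw_levi) (use e0 u unit_divide[OF unit_1 e0] unit_in_O in
      \<open>simp_all add: unit_mult O_mult pp_mult_O\<close>)
  moreover have "levi e0 (\<alpha>, \<beta>) (z, \<delta>) ** weyl 3 = weyl 3 ** k"
    using e0' by (simp add: k_def weyl_eq levi_def M4_mult M4_eq_iff)
  then have "levi e x y ** (levi e0 (\<alpha>, \<beta>) (z, \<delta>) ** weyl 3) = levi e x y ** weyl 3 ** k"
    by (metis matrix_mul_assoc)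
  then have "levi (e * e0) (sm \<alpha> x + sm \<beta> y) (sm z x + sm \<delta> y) ** weyl 3 = levi e x y ** weyl 3 ** k"
    by (simp add: matrix_mul_assoc levi_mult)
  ultimately show ?thesis using B_iw[OF levi_weyl_GSp4[OF nz]] by (simp add: cell_value_def)
qed

text \<open>(H2) leads from the first cell back to the last, where \<open>e\<close> has been
  multiplied by -\<pi>; the cubic factor is the one from \<open>cell_value_0\<close>.\<close>

lemma cell_value_scale:
  assumes nz: "e \<noteq> 0" "det2 x y \<noteq> 0" and "ind 0 e x y"
  shows "cell_value B 3 (- \<pi> * e) x y = of_nat q ^ 3 * \<Omega> \<pi> * cell_value B 3 e x y"
proof -
  have "levi e x y ** weyl 0 ** eta0_mat \<pi> = (levi e x y ** levi (- \<pi>) (1, 0) (0, 1)) ** weyl 3"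
    using weyl_eta0(1) by (metis matrix_mul_assoc)
  also have "levi e x y ** levi (- \<pi>) (1, 0) (0, 1) = levi (- \<pi> * e) x y"
    by (simp add: levi_mult sm_simps mult.commute)
  finally show ?thesis
    using B_eta0[OF levi_weyl_GSp4[OF nz, of 0]] cell_value_0[OF assms] by (simp add: cell_value_def)
qed

text \<open>(H2) reverses edges on cell 2, so both sides are compared there. Under
  \<open>ind 2\<close>, which is stable under reversal, the passage between the cells 3 and 2 is
  multiplication by -q.\<close>

lemma cell_value_flip:
  assumes nz: "e \<noteq> 0" "det2 x y \<noteq> 0" and i: "ind 2 e x y"
  shows "cell_value B 3 e y (sm \<pi> x) = - \<Omega> \<pi> * cell_value B 3 e x y"
proof -
  have D: "det2 y (sm \<pi> x) \<noteq> 0" using nz by (simp add: det2_simps det2_swap[of y x])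
  have "levi e x y ** weyl 2 ** eta0_mat \<pi> = (levi e x y ** levi 1 (0, 1) (\<pi>, 0)) ** weyl 2"
    using weyl_eta0(4) by (metis matrix_mul_assoc)
  also have "levi e x y ** levi 1 (0, 1) (\<pi>, 0) = levi e y (sm \<pi> x)"
    by (simp add: levi_mult sm_simps)
  finally have F: "cell_value B 2 e y (sm \<pi> x) = - \<Omega> \<pi> * cell_value B 2 e x y"
    using B_eta0[OF levi_weyl_GSp4[OF nz, of 2]] by (simp add: cell_value_def)
  have "ind 2 e y (sm \<pi> x)" using ind_flip i by blast
  from cell_value_2[OF nz(1) D this] have "of_nat q * cell_value B 3 e y (sm \<pi> x) = - cell_value B 2 e y (sm \<pi> x)" by simp
  also have "\<dots> = of_nat q * (- \<Omega> \<pi> * cell_value B 3 e x y)"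
    unfolding F cell_value_2[OF nz i] by (simp add: mult_ac)
  finally show ?thesis using mult_left_cancel[OF q_nonzero] by blast
qed

lemma cell_value_star:
  assumes nz: "e \<noteq> 0" "det2 x y \<noteq> 0"
  shows "(\<Sum>w\<in>reps. cell_value B 3 e x (y + sm w x)) + cell_value B 3 (- e) y x = 0"
proof -
  have 1: "B (levi e x y ** weyl 3 ** H1_mat w) = cell_value B 3 e x (y + sm (- w) x)" for w
  proof -
    have "levi e x y ** weyl 3 ** H1_mat w = (levi e x y ** levi 1 (1, 0) (- w, 1)) ** weyl 3"
      using weyl_H1(2) by (metis matrix_mul_assoc)
    also have "levi e x y ** levi 1 (1, 0) (- w, 1) = levi e x (y + sm (- w) x)"
      by (simp add: levi_mult sm_simps(1,2) add.commute)
    finally show ?thesis by (simp add: cell_value_def)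
  qed
  have "levi e x y ** weyl 3 ** s1_mat = (levi e x y ** levi (- 1) (0, 1) (1, 0)) ** weyl 3"
    using weyl_H1(4) by (metis matrix_mul_assoc)
  also have "levi e x y ** levi (- 1) (0, 1) (1, 0) = levi (- e) y x"
    by (simp add: levi_mult sm_simps)
  finally have 2: "B (levi e x y ** weyl 3 ** s1_mat) = cell_value B 3 (- e) y x" by (simp add: cell_value_def)
  have "(\<Sum>w\<in>reps. cell_value B 3 e x (y + sm (- w) x)) = (\<Sum>w\<in>reps. cell_value B 3 e x (y + sm w x))"
  proof (rule sum_reps_reindex)
    fix w w' :: 'f assume ww: "w - w' \<in> \<P>"
    have "det2 x (y + sm w' x) \<noteq> 0" using nz by (simp add: det2_simps)
    note inv = cell_value_iwahori[OF nz(1) this unit_1 unit_1 pp_0 ww unit_1]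
    have s: "sm 1 x + sm 0 (y + sm w' x) = x" "sm (w - w') x + sm 1 (y + sm w' x) = y + sm w x"
      by (simp_all add: sm_def prod_eq_iff algebra_simps)
    show "cell_value B 3 e x (y + sm w x) = cell_value B 3 e x (y + sm w' x)" using inv[unfolded s] by simp
  next
    fix w w' :: 'f assume "- w - - w' \<in> \<P>"
    then show "w - w' \<in> \<P>" using pp_minus[of "w - w'" 1] by simp
  qed simp
  then show ?thesis using B_panel1[OF levi_weyl_GSp4[OF nz], of 3] by (simp add: panel1_def 1 2)
qed

lemma cell_value_torus:
  assumes nz: "e \<noteq> 0" "det2 x y \<noteq> 0" "nm z \<noteq> 0"
  shows "cell_value B 3 e (act z x) (act z y) = \<Lambda> z * cell_value B 3 e x y"
  using B_tor[OF nz(3) levi_weyl_GSp4[OF nz(1,2)], of 3]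
  by (simp add: cell_value_def matrix_mul_assoc tor_levi)

lemma normalized_value_scale:
  assumes nz: "e \<noteq> 0" "det2 x y \<noteq> 0" and i: "ind 0 e x y"
  shows "normalized_value B (- \<pi> * e) x y = normalized_value B e x y"
proof -
  have "v (- \<pi> * e) = 1 + v e" using nz val_mult[of "- \<pi>" e] by simp
  then have 1: "(of_nat q :: complex) powi (- 3 * v (- \<pi> * e)) = of_nat q powi (- 3 * v e) * inverse (of_nat q ^ 3)"
  proof -
    have "- 3 * v (- \<pi> * e) = - 3 * v e + - 3" using \<open>v (- \<pi> * e) = 1 + v e\<close> by simp
    then show ?thesis
      by (simp only: power_int_add[OF disjI1[OF q_nonzero]] power_int_minus) simp
  qed
  have 2: "\<Omega> (- \<pi> * e * det2 x y) = \<Omega> \<pi> * \<Omega> (e * det2 x y)"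
    using Omega_mult[of "- \<pi>" "e * det2 x y"] nz by (simp add: Omega_minus_pi mult.assoc)
  have O2: "\<Omega> \<pi> * \<Omega> \<pi> = 1" by (rule Omega_self) simp
  have "normalized_value B (- \<pi> * e) x y = (inverse (of_nat q ^ 3) * of_nat q ^ 3) * (\<Omega> \<pi> * \<Omega> \<pi>) * normalized_value B e x y"
    unfolding normalized_value_def 1 2 cell_value_scale[OF assms] by (simp only: mult_ac)
  then show ?thesis using q_nonzero O2 by simp
qed

text \<open>Valuations are reached one at a time by passing from \<open>e'\<close> to -\<pi>
  \<open>e'\<close>. As v(e') is strictly below v(e), the stronger condition \<open>ind 0\<close>
  holds at \<open>e'\<close>, as the scaling requires.\<close>

lemma normalized_value_const:
  assumes nz: "e \<noteq> 0" "det2 x y \<noteq> 0" and i: "ind 3 e x y"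
  shows "e' \<noteq> 0 \<Longrightarrow> v e = v e' + int n \<Longrightarrow> normalized_value B e' x y = normalized_value B e x y"
proof (induction n arbitrary: e')
  case 0
  define u where "u = e' / e"
  have u: "unit u" "e' = e * u" using 0 nz by (simp_all add: u_def int_units_iff val_divide)
  have "cell_value B 3 (e * u) (sm 1 x + sm 0 y) (sm 0 x + sm 1 y) = cell_value B 3 e x y"
    by (rule cell_value_iwahori[OF nz u(1) unit_1 pp_0 pp_0 unit_1])
  moreover have "\<Omega> (e * u * det2 x y) = \<Omega> (e * det2 x y)"
    using Omega_mult[of u "e * det2 x y"] Omega_unit[OF u(1)] unit_nonzero[OF u(1)] nz by (simp add: mult_ac)
  ultimately show ?case using 0 unfolding normalized_value_def u(2) by (simp add: sm_simps flip: u(2))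
next
  case (Suc n)
  have "v (- \<pi> * e') = 1 + v e'" using Suc.prems val_mult[of "- \<pi>" e'] by simp
  then have "normalized_value B (- \<pi> * e') x y = normalized_value B e x y" using Suc by simp
  moreover have "ind 0 e' x y" using ind_mono(2)[OF i nz(1) Suc.prems(1)] Suc.prems(2) by simp
  ultimately show ?case using normalized_value_scale[OF Suc.prems(1) nz(2)] by simp
qed

lemma normalized_value_unique:
  assumes "e \<noteq> 0" "e' \<noteq> 0" "det2 x y \<noteq> 0" "ind 3 e x y" "ind 3 e' x y"
  shows "normalized_value B e' x y = normalized_value B e x y"
proof (cases "v e' \<le> v e")
  case True
  then show ?thesis using normalized_value_const[OF assms(1,3,4,2), of "nat (v e - v e')"] by simp
next
  case False
  then show ?thesis using normalized_value_const[OF assms(2,3,5,1), of "nat (v e' - v e)"] by simp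
qed

lemma edge_function_eq:
  assumes "e \<noteq> 0" "det2 x y \<noteq> 0" "ind 3 e x y" shows "edge_function B (iota x) (iota y) = normalized_value B e x y"
proof -
  define e' where "e' = (SOME e. e \<noteq> 0 \<and> ind 3 e x y)"
  have "e' \<noteq> 0 \<and> ind 3 e' x y" unfolding e'_def by (rule someI[of _ e]) (use assms in blast)
  then have "normalized_value B e' x y = normalized_value B e x y" using normalized_value_unique assms by blast
  then show ?thesis by (simp add: edge_function_def jota_iota e'_def)
qed

lemma edge_function_harmonic: "harmonic (edge_function B)"
  unfolding harmonic_def
proof (intro conjI allI impI)
  fix X Y \<alpha> \<beta> z \<delta>
  assume XY: "det2 X Y \<noteq> (0::'f)" and u: "unit \<alpha>" "\<beta> \<in> \<O>" "z \<in> \<P>" "unit \<delta>"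
  define x y where "x = jota X" and "y = jota Y"
  have X: "X = iota x" "Y = iota y" by (simp_all add: x_def y_def iota_jota)
  have xy: "det2 x y \<noteq> 0" using XY det2_iota_iff by (simp add: X)
  obtain e where e: "e \<noteq> 0" "ind 3 e x y" using ind_exists by blast
  let ?x = "sm \<alpha> x + sm \<beta> y" and ?y = "sm z x + sm \<delta> y"
  have w: "unit (\<alpha> * \<delta> - \<beta> * z)"
    by (rule unit_diff[OF unit_mult[OF u(1,4)] pp_mult_O(2)[OF u(2,3)]])
  have "\<alpha> * \<delta> - \<beta> * z \<noteq> 0" by (rule unit_nonzero[OF w])
  then have D: "det2 ?x ?y \<noteq> 0" unfolding det2_lin using xy by simp
  have i: "ind 3 e ?x ?y" using ind_iwahori[OF unit_1 u, of 3 e x y] e(2) by simp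
  have "\<Omega> (e * det2 ?x ?y) = \<Omega> (e * det2 x y)"
    using Omega_mult[OF unit_nonzero[OF w], of "e * det2 x y"] Omega_unit[OF w] e(1) xy
    by (simp add: det2_lin mult.left_commute)
  moreover have "cell_value B 3 e ?x ?y = cell_value B 3 e x y" using cell_value_iwahori[OF e(1) xy unit_1 u] by simp
  ultimately have "normalized_value B e ?x ?y = normalized_value B e x y" by (simp add: normalized_value_def)
  then show "edge_function B (sm \<alpha> X + sm \<beta> Y) (sm z X + sm \<delta> Y) = edge_function B X Y"
    using edge_function_eq[OF e(1) D i] edge_function_eq[OF e(1) xy e(2)] by (simp add: X iota_add iota_sm)
next
  fix X Y :: "'f \<times> 'f" assume XY: "det2 X Y \<noteq> 0"
  define x y where "x = jota X" and "y = jota Y"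
  have X: "X = iota x" "Y = iota y" by (simp_all add: x_def y_def iota_jota)
  have xy: "det2 x y \<noteq> 0" using XY det2_iota_iff by (simp add: X)
  have yx: "det2 y x \<noteq> 0" using xy by (simp add: det2_swap[of y x])
  obtain e where e: "e \<noteq> 0" "ind 3 e x y" using ind_exists by blast
  define C where "C = of_nat q powi (- 3 * v e) * \<Omega> (e * det2 x y)"
  have 1: "edge_function B X (Y + sm w X) = C * cell_value B 3 e x (y + sm w x)" if "w \<in> reps" for w
  proof -
    have "det2 x (y + sm w x) \<noteq> 0" using xy by (simp add: det2_simps)
    moreover have "ind 3 e x (y + sm w x)" using ind_shear[OF reps_in_O[OF that]] e(2) by simp
    ultimately have "edge_function B (iota x) (iota (y + sm w x)) = normalized_value B e x (y + sm w x)" by (rule edge_function_eq[OF e(1)])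
    then show ?thesis by (simp add: X iota_add iota_sm normalized_value_def C_def det2_simps)
  qed
  have "ind 3 (- e) y x" using ind_swap e(2) by blast
  then have "edge_function B Y X = normalized_value B (- e) y x" unfolding X by (intro edge_function_eq) (use e yx in auto)
  then have 2: "edge_function B Y X = C * cell_value B 3 (- e) y x" by (simp add: normalized_value_def C_def det2_swap[of y x])
  have "(\<Sum>w\<in>reps. edge_function B X (Y + sm w X)) + edge_function B Y X =
      C * ((\<Sum>w\<in>reps. cell_value B 3 e x (y + sm w x)) + cell_value B 3 (- e) y x)"
    using 1 by (simp add: 2 sum_distrib_left distrib_left)
  then show "(\<Sum>w\<in>reps. edge_function B X (Y + sm w X)) + edge_function B Y X = 0" by (simp add: cell_value_star[OF e(1) xy])
next
  fix X Y :: "'f \<times> 'f" assume XY: "det2 X Y \<noteq> 0"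
  define x y where "x = jota X" and "y = jota Y"
  have X: "X = iota x" "Y = iota y" by (simp_all add: x_def y_def iota_jota)
  have xy: "det2 x y \<noteq> 0" using XY det2_iota_iff by (simp add: X)
  have D: "det2 y (sm \<pi> x) \<noteq> 0" using xy by (simp add: det2_simps det2_swap[of y x])
  \<comment> \<open>The strongest condition is chosen, since the reversal needs \<open>ind 2\<close>
    and not only \<open>ind 3\<close>.\<close>
  obtain e where e: "e \<noteq> 0" "ind 0 e x y" using ind_exists by blast
  have i: "ind 3 e x y" "ind 2 e x y" using e(2) by (auto simp: ind_def elim: pp_mono)
  have "ind 2 e y (sm \<pi> x)" using ind_flip i(2) by blast
  then have "ind 3 e y (sm \<pi> x)" by (auto simp: ind_def elim: pp_mono)
  from edge_function_eq[OF e(1) D this] have "edge_function B Y (sm \<pi> X) = normalized_value B e y (sm \<pi> x)" by (simp add: X iota_sm)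
  also have "\<dots> = - normalized_value B e x y"
  proof -
    have "e * det2 y (sm \<pi> x) = - \<pi> * (e * det2 x y)" by (simp add: det2_simps det2_swap[of y x])
    then have 1: "\<Omega> (e * det2 y (sm \<pi> x)) = \<Omega> \<pi> * \<Omega> (e * det2 x y)"
      using Omega_mult[of "- \<pi>" "e * det2 x y"] e(1) xy by (simp add: Omega_minus_pi)
    have "normalized_value B e y (sm \<pi> x) = - (\<Omega> \<pi> * \<Omega> \<pi>) * normalized_value B e x y"
      unfolding normalized_value_def 1 cell_value_flip[OF e(1) xy i(2)] by (simp add: mult_ac)
    then show ?thesis using Omega_self[of \<pi>] by simp
  qed
  also have "normalized_value B e x y = edge_function B X Y" using edge_function_eq[OF e(1) xy i(1)] by (simp add: X)
  finally show "edge_function B Y (sm \<pi> X) = - edge_function B X Y" .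
qed

lemma edge_function_equivariant: "equivariant \<xi> (edge_function B)"
  unfolding equivariant_def
proof (intro allI impI)
  fix z X Y :: "'f \<times> 'f" assume z: "nm z \<noteq> 0" and XY: "det2 X Y \<noteq> 0"
  define x y where "x = jota X" and "y = jota Y"
  have X: "X = iota x" "Y = iota y" by (simp_all add: x_def y_def iota_jota)
  have xy: "det2 x y \<noteq> 0" using XY det2_iota_iff by (simp add: X)
  obtain e where e: "e \<noteq> 0" "ind 3 e x y" using ind_exists by blast
  have D: "det2 (act z x) (act z y) \<noteq> 0" using xy z by (simp add: det2_act)
  have i: "ind 3 e (act z x) (act z y)" using ind_torus[OF z] e(2) by blast
  have 1: "\<Omega> (e * det2 (act z x) (act z y)) = \<Omega> (nm z) * \<Omega> (e * det2 x y)"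
    using Omega_mult[of "nm z" "e * det2 x y"] z e(1) xy by (simp add: det2_act mult.left_commute)
  have "normalized_value B e (act z x) (act z y) = \<xi> z * normalized_value B e x y"
    unfolding normalized_value_def 1 cell_value_torus[OF e(1) xy z] \<xi>_def by (simp only: mult_ac)
  then show "edge_function B (z \<odot> X) (z \<odot> Y) = \<xi> z * edge_function B X Y"
    using edge_function_eq[OF e(1) D i] edge_function_eq[OF e(1) xy e(2)] by (simp add: X iota_act)
qed

text \<open>A nonzero value on the last cell satisfies the support condition and is therefore seen
  by \<open>edge_function\<close>; the other cells follow from the last.\<close>

lemma edge_function_vanishes_imp:
  assumes 0: "\<And>x y. det2 x y \<noteq> 0 \<Longrightarrow> edge_function B x y = 0" shows "B = 0"
proof -
  have B3: "cell_value B 3 e x y = 0" if nz: "e \<noteq> 0" "det2 x y \<noteq> 0" for e x y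
  proof (rule ccontr)
    assume n: "cell_value B 3 e x y \<noteq> 0"
    have "edge_function B (iota x) (iota y) = normalized_value B e x y" by (rule edge_function_eq[OF nz cell_value_support[OF nz n]])
    moreover have "det2 (iota x) (iota y) \<noteq> 0" using nz det2_iota_iff by blast
    ultimately have "normalized_value B e x y = 0" using 0 by simp
    then show False using n nz q_nonzero Omega_nonzero by (simp add: normalized_value_def)
  qed
  have Bi: "cell_value B i e x y = 0" if nz: "e \<noteq> 0" "det2 x y \<noteq> 0" and i: "i < 4" for i e x y
  proof -
    have "cell_value B 2 e x y = 0" using cell_value_step(1)[OF nz] B3[OF nz] by simp
    moreover from this have "cell_value B (Suc 0) e x y = 0" using cell_value_step(2)[OF nz] by simp
    moreover from this have "cell_value B 0 e x y = 0" using cell_value_step(3)[OF nz] by simp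
    moreover have "i = 0 \<or> i = Suc 0 \<or> i = 2 \<or> i = 3" using i by linarith
    ultimately show ?thesis using B3[OF nz] by auto
  qed
  have "B h = 0" for h
  proof (cases "h \<in> GSp4")
    case True
    then obtain i a1 a2 a3 e x y k where *: "i < 4" "e \<noteq> 0" "det2 x y \<noteq> 0" "iw k"
      "h = uu a1 a2 a3 ** levi e x y ** weyl i ** k" by (rule GSp4_cases)
    have "B h = B (uu a1 a2 a3 ** (levi e x y ** weyl i))"
      unfolding *(5) using B_iw[OF cell_GSp4[OF *(2,3)] *(4)] by (simp add: matrix_mul_assoc)
    also have "\<dots> = 0" using B_uu[OF levi_weyl_GSp4[OF *(2,3)], of a1 a2 a3 i] Bi[OF *(2,3,1)] by (simp add: cell_value_def)
    finally show ?thesis .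
  qed (rule B_outside)
  then show ?thesis by (simp add: fun_eq_iff)
qed

end

section \<open>The dimension\<close>

lemma bessel_lincomb:
  assumes "B \<in> bessel_space v \<pi> a b c \<psi> \<Omega> \<Lambda>" "B' \<in> bessel_space v \<pi> a b c \<psi> \<Omega> \<Lambda>"
  shows "(\<lambda>h. r * B h + s * B' h) \<in> bessel_space v \<pi> a b c \<psi> \<Omega> \<Lambda>"
proof -
  have panel: "panel1 (\<lambda>h. r * B h + s * B' h) h = r * panel1 B h + s * panel1 B' h"
    "panel2 (\<lambda>h. r * B h + s * B' h) h = r * panel2 B h + s * panel2 B' h" for h
    by (simp_all add: panel1_def panel2_def sum.distrib sum_distrib_left algebra_simps)
  show ?thesis
    unfolding bessel_space_iff panel
    using B_outside[OF assms(1)] B_outside[OF assms(2)] B_iw[OF assms(1)] B_iw[OF assms(2)]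
      B_equi[OF assms(1)] B_equi[OF assms(2)] B_panel1[OF assms(1)] B_panel1[OF assms(2)]
      B_eta0[OF assms(1)] B_eta0[OF assms(2)] B_panel2[OF assms(1)] B_panel2[OF assms(2)]
    by (simp add: algebra_simps del: split_paired_All)
qed

lemma bessel_zero: "0 \<in> bessel_space v \<pi> a b c \<psi> \<Omega> \<Lambda>"
  unfolding bessel_space_iff by (simp add: panel1_def panel2_def)

text \<open>Turns a test edge for harmonic functions into a single group element at which evaluation
  is injective on the Bessel space, so the dimension is at most 1.\<close>

lemma bessel_evaluation:
  assumes "det2 x0 y0 \<noteq> 0"
    "\<And>\<gamma> x y. harmonic \<gamma> \<Longrightarrow> equivariant \<xi> \<gamma> \<Longrightarrow> \<gamma> x0 y0 = 0 \<Longrightarrow> det2 x y \<noteq> 0 \<Longrightarrow> \<gamma> x y = 0"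
  shows "\<exists>h. \<forall>B\<in>bessel_space v \<pi> a b c \<psi> \<Omega> \<Lambda>. B h = 0 \<longrightarrow> B = 0"
proof -
  define x y where "x = jota x0" and "y = jota y0"
  have X: "x0 = iota x" "y0 = iota y" by (simp_all add: x_def y_def iota_jota)
  have xy: "det2 x y \<noteq> 0" using assms(1) det2_iota_iff by (simp add: X)
  obtain e where e: "e \<noteq> 0" "ind 3 e x y" using ind_exists by blast
  have "B = 0" if B: "B \<in> bessel_space v \<pi> a b c \<psi> \<Omega> \<Lambda>" and 0: "B (levi e x y ** weyl 3) = 0" for B
  proof (rule edge_function_vanishes_imp[OF B])
    have "edge_function B x0 y0 = normalized_value B e x y" unfolding X by (rule edge_function_eq[OF B e(1) xy e(2)])
    then have "edge_function B x0 y0 = 0" using 0 by (simp add: normalized_value_def cell_value_def)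
    then show "edge_function B x' y' = 0" if "det2 x' y' \<noteq> 0" for x' y'
      using assms(2) edge_function_harmonic[OF B] edge_function_equivariant[OF B] that by blast
  qed
  then show ?thesis by blast
qed

lemma dimension_one:
  assumes B0: "B0 \<in> bessel_space v \<pi> a b c \<psi> \<Omega> \<Lambda>" "B0 \<noteq> 0"
    and h: "\<forall>B\<in>bessel_space v \<pi> a b c \<psi> \<Omega> \<Lambda>. B h = 0 \<longrightarrow> B = 0"
  shows "has_dimension (bessel_space v \<pi> a b c \<psi> \<Omega> \<Lambda>) 1"
proof -
  interpret fs: vector_space "fun_scale :: complex \<Rightarrow> ('f^4^4 \<Rightarrow> complex) \<Rightarrow> 'f^4^4 \<Rightarrow> complex"
    by (rule vector_space_fun_scale)
  let ?V = "bessel_space v \<pi> a b c \<psi> \<Omega> \<Lambda>"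
  have "B0 h \<noteq> 0" using h B0 by blast
  have "fs.span {B0} = ?V"
  proof
    have "fun_scale r B0 \<in> ?V" for r
      using bessel_lincomb[OF B0(1) B0(1), of r 0] by (simp add: fun_scale_def)
    then show "fs.span {B0} \<subseteq> ?V" unfolding fs.span_singleton by blast
    show "?V \<subseteq> fs.span {B0}"
    proof
      fix B assume B: "B \<in> ?V"
      define r where "r = B h / B0 h"
      have "(\<lambda>g. 1 * B g + - r * B0 g) \<in> ?V" by (rule bessel_lincomb[OF B B0(1)])
      from bspec[OF h this] have "(\<lambda>g. 1 * B g + - r * B0 g) = 0"
        using \<open>B0 h \<noteq> 0\<close> by (simp add: r_def)
      then have "B = fun_scale r B0" by (simp add: fun_eq_iff fun_scale_def)
      then show "B \<in> fs.span {B0}" unfolding fs.span_singleton by blast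
    qed
  qed
  moreover from this have "fs.dim ?V = 1"
    using B0(2) fs.dim_eq_card[of "{B0}" ?V] fs.span_eq_iff fs.subspace_span[of "{B0}"]
    by (metis card_1_singleton_iff fs.dependent_single fs.span_span One_nat_def)
  ultimately show ?thesis unfolding has_dimension_def by (meson finite.emptyI finite_insert)
qed

lemma dimension_zero:
  assumes "\<And>B. B \<in> bessel_space v \<pi> a b c \<psi> \<Omega> \<Lambda> \<Longrightarrow> B = 0"
  shows "has_dimension (bessel_space v \<pi> a b c \<psi> \<Omega> \<Lambda>) 0"
proof -
  interpret fs: vector_space "fun_scale :: complex \<Rightarrow> ('f^4^4 \<Rightarrow> complex) \<Rightarrow> 'f^4^4 \<Rightarrow> complex"
    by (rule vector_space_fun_scale)
  have V: "bessel_space v \<pi> a b c \<psi> \<Omega> \<Lambda> = {0}" using assms bessel_zero by blast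
  have "fs.span {} = {0}" by simp
  moreover have "fs.dim {0} = 0"
    using fs.dim_eq_card[of "{}" "{0}"] fs.independent_empty by simp
  ultimately show ?thesis unfolding has_dimension_def V by blast
qed

theorem bessel_dimension:
  "has_dimension (bessel_space v \<pi> a b c \<psi> \<Omega> \<Lambda>)
    (if (\<forall>z\<in>L_units d. \<Lambda> z = \<Omega> (nm z)) \<and> L_symbol v d \<in> {- 1, 0} then 0 else 1)"
proof -
  obtain cond where "quadratic_character v \<pi> d \<xi> cond" using character by blast
  then interpret quadratic_character v \<pi> d \<xi> cond .
  \<comment> \<open>As \<Omega> squares to 1, multiplying by it is the same as dividing by
    it.\<close>
  have triv: "(\<forall>z\<in>L_units d. \<Lambda> z = \<Omega> (nm z)) \<longleftrightarrow> (\<forall>z. nm z \<noteq> 0 \<longrightarrow> \<xi> z = 1)"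
  proof -
    have "\<Lambda> z = \<Omega> (nm z) \<longleftrightarrow> \<xi> z = 1" if "nm z \<noteq> 0" for z
    proof
      assume "\<xi> z = 1"
      then have "\<Lambda> z * \<Omega> (nm z) * \<Omega> (nm z) = \<Omega> (nm z)" by (simp add: \<xi>_def)
      then show "\<Lambda> z = \<Omega> (nm z)" using Omega_self[OF that] by (simp add: mult.assoc)
    qed (simp add: \<xi>_def Omega_self[OF that])
    then show ?thesis by (simp add: L_units_iff Ball_def del: split_paired_All)
  qed
  have sym: "L_symbol v d \<in> {- 1, 0} \<longleftrightarrow> \<not> is_sq d" by (simp add: L_symbol_def)
  show ?thesis
  proof (cases "(\<forall>z. nm z \<noteq> 0 \<longrightarrow> \<xi> z = 1) \<and> \<not> is_sq d")
    case True
    have "B = 0" if B: "B \<in> bessel_space v \<pi> a b c \<psi> \<Omega> \<Lambda>" for B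
    proof (rule edge_function_vanishes_imp[OF B])
      fix x y :: "'f \<times> 'f" assume "det2 x y \<noteq> 0"
      then show "edge_function B x y = 0"
        using vanishing_field_trivial[OF edge_function_harmonic[OF B] edge_function_equivariant[OF B] xi_small_theta] True
        by blast
    qed
    from dimension_zero[OF this] show ?thesis unfolding triv sym using True by simp
  next
    case False
    obtain x0 y0 where xy: "det2 x0 y0 \<noteq> 0"
      "\<And>\<gamma> x y. harmonic \<gamma> \<Longrightarrow> equivariant \<xi> \<gamma> \<Longrightarrow> \<gamma> x0 y0 = 0 \<Longrightarrow> det2 x y \<noteq> 0 \<Longrightarrow> \<gamma> x y = 0"
    proof (cases "is_sq d")
      case True
      show ?thesis by (rule uniqueness_split[OF True]) (rule that)
    next
      case False
      show ?thesis by (rule uniqueness_field[OF False]) (rule that)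
    qed
    have "\<exists>h. \<forall>B\<in>bessel_space v \<pi> a b c \<psi> \<Omega> \<Lambda>. B h = 0 \<longrightarrow> B = 0"
      by (rule bessel_evaluation[OF xy(1)]) (rule xy(2))
    then obtain h where h: "\<forall>B\<in>bessel_space v \<pi> a b c \<psi> \<Omega> \<Lambda>. B h = 0 \<longrightarrow> B = 0" by blast
    have "\<exists>\<gamma>. harmonic \<gamma> \<and> equivariant \<xi> \<gamma> \<and> (\<exists>x y. det2 x y \<noteq> 0 \<and> \<gamma> x y \<noteq> 0)"
    proof (cases "\<forall>z. nm z \<noteq> 0 \<longrightarrow> \<xi> z = 1")
      case True
      then show ?thesis using False existence_split_trivial by blast
    qed (use existence_nontrivial in blast)
    then obtain B0 where "B0 \<in> bessel_space v \<pi> a b c \<psi> \<Omega> \<Lambda>" "B0 \<noteq> 0"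
      using bessel_exists by blast
    from dimension_one[OF this h] show ?thesis unfolding triv sym using False by auto
  qed
qed

end

theorem theorem3p1:
  fixes v :: "'f::field_char_0 \<Rightarrow> int"
    and \<pi> a b c d :: 'f
    and \<psi> \<Omega> :: "'f \<Rightarrow> complex"
    and \<Lambda> :: "'f \<times> 'f \<Rightarrow> complex"
  assumes "nonarch_local_field v"
    and "uniformizer v \<pi>"
    and "a \<in> integers v" and "b \<in> integers v" and "c \<in> int_units v"
    and "d = b\<^sup>2 - 4 * a * c" and "d \<noteq> 0"
    and "\<not> is_sq d \<Longrightarrow> discriminant v d = {d * x | x. x \<in> integers v}"
    and "is_sq d \<Longrightarrow> d \<in> int_units v"
    and "add_char v \<psi>" and "conductor_integers v \<psi>"
    and "mult_char v \<Omega>" and "unramified v \<Omega>" and "\<And>x. x \<noteq> 0 \<Longrightarrow> (\<Omega> x)\<^sup>2 = 1"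
    and "L_char v d \<Lambda>" and "\<And>x. x \<noteq> 0 \<Longrightarrow> \<Lambda> (L_of d x) = 1"
  shows "has_dimension (bessel_space v \<pi> a b c \<psi> \<Omega> \<Lambda>)
    (if (\<forall>z\<in>L_units d. \<Lambda> z = \<Omega> (L_norm d z)) \<and> L_symbol v d \<in> {- 1, 0} then 0 else 1)"
proof -
  interpret uniformized_field v \<pi>
    using assms(1,2) by (simp add: uniformized_field_def uniformized_field_axioms_def)
  have "4 * a * c \<in> \<O>"
  proof -
    have "4 \<in> \<O>" using pp_add[of 2 0 2] pp_add[of 1 0 1] by simp
    then show ?thesis using assms(3,5) unit_in_O by (simp add: O_mult)
  qed
  then have "d \<in> \<O>" using assms(4,6) by (simp add: power2_eq_square pp_diff O_mult)
  then interpret bessel_data v \<pi> d a b c \<psi> \<Omega> \<Lambda>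
    using assms by unfold_locales auto
  show ?thesis by (rule bessel_dimension)
qed

end
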